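(* Let $K$ and $H$ be Hopf algebras with bijective antipodes over a field $k$ and let $\tau : K\otimes H\longrightarrow k$ be a linear form which satisfies (A.1)–(A.4). Suppose $W\in{}_K^K\mathcal{YD}$, $V\in{}_H^H\mathcal{YD}$, $\beta : W\otimes V\longrightarrow k$ is a linear form, and $\tau$ and $\beta$ satisfy (C.1)–(C.2). Then: (a) $(K, H, \tau, \mathfrak{B}(W), \mathfrak{B}(V), \mathfrak{B}(\beta))$ is a two-cocycle twist datum. (b) The linear form $\mathfrak{B}(\beta)\#\tau : (\mathfrak{B}(W)\# K)\otimes(\mathfrak{B}(V)\# H)\longrightarrow k$ satisfies (A.1)–(A.4).
   Context: Everything is over a field $k$. For an ordinary coalgebra write $\Delta(c) = c_{(1)}\otimes c_{(2)}$; for a left comodule write $\delta(m) = m_{(-1)}\otimes m_{(0)}$. For a linear form $\beta : U\otimes V\to k$ write $\beta(u,v) = \beta(u\otimes v)$; $\beta_\ell : U\to V^*$ and $\beta_r : V\to U^*$ are given by $\beta_\ell(u)(v) = \beta(u,v) = \beta_r(v)(u)$. Yetter–Drinfel'd modules. For a Hopf algebra $H$, ${}_H^H\mathcal{YD}$ is the category whose objects are left $H$-modules and left $H$-comodules $M$ with $h_{(1)}m_{(-1)}\otimes h_{(2)}\cdot m_{(0)} = (h_{(1)}\cdot m)_{(-1)}h_{(2)}\otimes (h_{(1)}\cdot m)_{(0)}$, and whose morphisms are module and comodule maps. It is monoidal with diagonal action and codiagonal coaction, with braiding $m\otimes n \mapsto m_{(-1)}\cdot n\otimes m_{(0)}$.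 The coproduct of a coalgebra in the category is written $\Delta(c) = c^{(1)}\otimes c^{(2)}$. A bialgebra in the category is an algebra and coalgebra $R$ in the category such that $\epsilon$ and $\Delta: R\to R\otimes R$ are algebra maps, where $(a\otimes b)(a'\otimes b') = a(b_{(-1)}\cdot a')\otimes b_{(0)}b'$. Bi-product. For a bialgebra $R$ in ${}_H^H\mathcal{YD}$, $R\# H$ is the $k$-bialgebra $R\otimes H$ (with $r\# h = r\otimes h$) with product $(r\# h)(r'\# h') = r(h_{(1)}\cdot r')\# h_{(2)}h'$, coproduct $\Delta(r\# h) = (r^{(1)}\# r^{(2)}_{\ (-1)}h_{(1)})\otimes(r^{(2)}_{\ (0)}\# h_{(2)})$, unit $1\#1$, counit $\epsilon\otimes\epsilon$. Nichols algebra. For $M\in{}_H^H\mathcal{YD}$ the tensor algebra $T(M)$ is a graded bialgebra in ${}_H^H\mathcal{YD}$ with $M$ primitive. Let $I$ be the unique maximal graded subobject of $T(M)$ which is a coideal and satisfies $I\cap M = (0)$; it is an ideal, and $\mathfrak{B}(M) = T(M)/I$, a connected graded bialgebra in ${}_H^H\mathcal{YD}$, with $M = \mathfrak{B}(M)(1)$. Conditions. For bialgebras $U,A$ over $k$ and a form $\tau : U\otimes A\to k$: (A.1) $\tau(u,aa') = \tau(u_{(2)},a)\tau(u_{(1)},a')$; (A.2) $\tau(1,a) = \epsilon(a)$; (A.3) $\tau(uu',a) = \tau(u,a_{(1)})\tau(u',a_{(2)})$; (A.4) $\tau(u,1) = \epsilon(u)$. For bialgebras $T$ in ${}_K^K\mathcal{YD}$,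 $R$ in ${}_H^H\mathcal{YD}$ and a form $\beta : T\otimes R\to k$ ($S$ the antipode of $H$): (B.1) $\beta(tt',r) = \beta(t, S^{-1}(r^{(2)}_{\ (-1)})\cdot r^{(1)})\,\beta(t', r^{(2)}_{\ (0)})$; (B.2) $\beta(1,r) = \epsilon(r)$; (B.3) $\beta(t,rr') = \beta(t^{(2)},r)\beta(t^{(1)},r')$; (B.4) $\beta(t,1) = \epsilon(t)$. For forms $\tau : K\otimes H\to k$ and $\beta : W\otimes V\to k$, $W\in{}_K^K\mathcal{YD}$, $V\in{}_H^H\mathcal{YD}$: (C.1) $\beta(k\cdot w, v) = \beta(w, v\leftharpoonup\tau_\ell(k))$, where $v\leftharpoonup p = p(v_{(-1)})v_{(0)}$ for $p\in H^*$; (C.2) $\beta(w\leftharpoonup\tau_r(h), v) = \beta(w, S^{-1}(h)\cdot v)$, where $w\leftharpoonup p = p(w_{(-1)})w_{(0)}$ for $p\in K^*$. All identities are required for all elements. A two-cocycle twist datum is a tuple $(K,H,\tau,T,R,\beta)$ where $K,H$ are Hopf algebras with bijective antipodes over $k$, $T$ and $R$ are bialgebras in ${}_K^K\mathcal{YD}$ and ${}_H^H\mathcal{YD}$, $\tau : K\otimes H\to k$ satisfies (A.1)–(A.4), $\beta : T\otimes R\to k$ satisfies (B.1)–(B.4), and $\tau,\beta$ satisfy (C.1)–(C.2). For such a datum, $\beta\#\tau : (T\# K)\otimes(R\# H)\to k$ is the form $(\beta\#\tau)(t\# k,r\# h) = \beta(t,S^{-1}(h_{(1)})\cdot r)\,\tau(k,h_{(2)})$.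 The form $\mathfrak{B}(\beta) : \mathfrak{B}(W)\otimes\mathfrak{B}(V)\to k$ is the unique linear form which satisfies (B.1)–(B.4) and restricts to $\beta$ on $W\otimes V$ (it exists under the hypotheses of the claim). *)

theory Defs
  imports
    "HOL-Library.Poly_Mapping"
    "HOL-Algebra.Module"
    "HOL-Algebra.QuotRing"
begin

section \<open>Vector spaces\<close>

text \<open>
  The base field is a type \<open>'k\<close> of class \<^class>\<open>field\<close>; the record \<open>scalars\<close> is this field,
  both as a ring and as a vector space over itself.  A vector space is a module over \<open>scalars\<close>.
  The fields \<^const>\<open>mult\<close> and \<^const>\<open>one\<close> of the record \<open>module\<close> only carry meaning for
  algebras.
\<close>

definition scalars :: "('k::field, 'k) module" where
  "scalars = \<lparr>carrier = UNIV, mult = (*), one = 1, zero = 0, add = (+), smult = (*)\<rparr>"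

definition linear_maps ::
  "('k::field, 'a, 'm) module_scheme \<Rightarrow> ('k, 'b, 'n) module_scheme \<Rightarrow> ('a \<Rightarrow> 'b) set" where
  "linear_maps M N = {f \<in> carrier M \<rightarrow> carrier N.
     (\<forall>x\<in>carrier M. \<forall>y\<in>carrier M. f (x \<oplus>\<^bsub>M\<^esub> y) = f x \<oplus>\<^bsub>N\<^esub> f y) \<and>
     (\<forall>c. \<forall>x\<in>carrier M. f (c \<odot>\<^bsub>M\<^esub> x) = c \<odot>\<^bsub>N\<^esub> f x)}"

definition vspan :: "('k::field, 'a, 'm) module_scheme \<Rightarrow> 'a set \<Rightarrow> 'a set" where
  "vspan M S = \<Inter>{N. submodule N scalars M \<and> S \<subseteq> N}"

text \<open>
  The quotient by a subspace (and, when \<open>N\<close> is an ideal of an algebra, the quotient algebra),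
  in the style of \<^const>\<open>FactRing\<close>.
\<close>
definition factor_space :: "('k::field, 'a, 'm) module_scheme \<Rightarrow> 'a set \<Rightarrow> ('k, 'a set) module" where
  "factor_space M N =
     \<lparr>carrier = a_rcosets\<^bsub>M\<^esub> N, mult = rcoset_mult M N, one = N +>\<^bsub>M\<^esub> \<one>\<^bsub>M\<^esub>,
      zero = N, add = set_add M, smult = (\<lambda>c X. \<Union>x\<in>X. N +>\<^bsub>M\<^esub> (c \<odot>\<^bsub>M\<^esub> x))\<rparr>"

definition free_space :: "'x set \<Rightarrow> ('k::field, 'x \<Rightarrow>\<^sub>0 'k) module" where
  "free_space X =
     \<lparr>carrier = {f. Poly_Mapping.keys f \<subseteq> X}, mult = undefined, one = undefined,
      zero = 0, add = (+), smult = (\<lambda>c. Poly_Mapping.map ((*) c))\<rparr>"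

text \<open>
  The linear extension of a map \<open>f\<close> on basis elements to a class \<open>X\<close> in a quotient of a free
  vector space.  \<^const>\<open>the_elem\<close> is meaningful because it is used only where the value does not
  depend on the representative.
\<close>
definition class_sum ::
  "('k::field, 'n, 'z) module_scheme \<Rightarrow> ('x \<Rightarrow>\<^sub>0 'k) set \<Rightarrow> ('x \<Rightarrow> 'n) \<Rightarrow> 'n" where
  "class_sum N X f = the_elem
     ((\<lambda>g. \<Oplus>\<^bsub>N\<^esub>x\<in>Poly_Mapping.keys g. Poly_Mapping.lookup g x \<odot>\<^bsub>N\<^esub> f x) ` X)"


section \<open>Tensor products\<close>

definition tensor_relations ::
  "('k::field, 'u, 'm) module_scheme \<Rightarrow> ('k, 'v, 'n) module_scheme \<Rightarrow> ('u \<times> 'v \<Rightarrow>\<^sub>0 'k) set" where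
  "tensor_relations U V = vspan (free_space (carrier U \<times> carrier V))
     ({Poly_Mapping.single (u \<oplus>\<^bsub>U\<^esub> u', v) 1 - Poly_Mapping.single (u, v) 1
         - Poly_Mapping.single (u', v) 1 | u u' v.
         u \<in> carrier U \<and> u' \<in> carrier U \<and> v \<in> carrier V}
    \<union> {Poly_Mapping.single (u, v \<oplus>\<^bsub>V\<^esub> v') 1 - Poly_Mapping.single (u, v) 1
         - Poly_Mapping.single (u, v') 1 | u v v'.
         u \<in> carrier U \<and> v \<in> carrier V \<and> v' \<in> carrier V}
    \<union> {Poly_Mapping.single (c \<odot>\<^bsub>U\<^esub> u, v) 1 - Poly_Mapping.single (u, v) c | c u v.
         u \<in> carrier U \<and> v \<in> carrier V}
    \<union> {Poly_Mapping.single (u, c \<odot>\<^bsub>V\<^esub> v) 1 - Poly_Mapping.single (u, v) c | c u v.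
         u \<in> carrier U \<and> v \<in> carrier V})"

definition tensor ::
  "('k::field, 'u, 'm) module_scheme \<Rightarrow> ('k, 'v, 'n) module_scheme
     \<Rightarrow> ('k, ('u \<times> 'v \<Rightarrow>\<^sub>0 'k) set) module" where
  "tensor U V = factor_space (free_space (carrier U \<times> carrier V)) (tensor_relations U V)"

definition pure_tensor ::
  "('k::field, 'u, 'm) module_scheme \<Rightarrow> ('k, 'v, 'n) module_scheme
     \<Rightarrow> 'u \<Rightarrow> 'v \<Rightarrow> ('u \<times> 'v \<Rightarrow>\<^sub>0 'k) set" where
  "pure_tensor U V u v =
     tensor_relations U V +>\<^bsub>free_space (carrier U \<times> carrier V)\<^esub> Poly_Mapping.single (u, v) 1"

text \<open>
  Sweedler sums: if \<open>X = u\<^sub>1 \<otimes> v\<^sub>1 + \<dots> + u\<^sub>n \<otimes> v\<^sub>n\<close> and \<open>f\<close> is bilinear into \<open>N\<close>, then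
  \<open>tensor_sum N X f = f u\<^sub>1 v\<^sub>1 + \<dots> + f u\<^sub>n v\<^sub>n\<close>.
\<close>
definition tensor_sum ::
  "('k::field, 'n, 'z) module_scheme \<Rightarrow> ('u \<times> 'v \<Rightarrow>\<^sub>0 'k) set \<Rightarrow> ('u \<Rightarrow> 'v \<Rightarrow> 'n) \<Rightarrow> 'n" where
  "tensor_sum N X f = class_sum N X (\<lambda>(u, v). f u v)"

text \<open>The image in \<open>U \<otimes> V\<close> of \<open>A \<otimes> B\<close>, for subspaces \<open>A\<close>, \<open>B\<close>.\<close>
definition tensor_span ::
  "('k::field, 'u, 'm) module_scheme \<Rightarrow> ('k, 'v, 'n) module_scheme
     \<Rightarrow> 'u set \<Rightarrow> 'v set \<Rightarrow> ('u \<times> 'v \<Rightarrow>\<^sub>0 'k) set set" where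
  "tensor_span U V A B = vspan (tensor U V) {pure_tensor U V u v | u v. u \<in> A \<and> v \<in> B}"

definition linear_forms ::
  "('k::field, 'u, 'm) module_scheme \<Rightarrow> ('k, 'v, 'n) module_scheme
     \<Rightarrow> (('u \<times> 'v \<Rightarrow>\<^sub>0 'k) set \<Rightarrow> 'k) set" where
  "linear_forms U V = linear_maps (tensor U V) scalars"


section \<open>Bialgebras and Hopf algebras\<close>

record (overloaded) ('k::field, 'a) bialg = "('k, 'a) module" +
  comult :: "'a \<Rightarrow> ('a \<times> 'a \<Rightarrow>\<^sub>0 'k) set"
  counit :: "'a \<Rightarrow> 'k"

record (overloaded) ('k::field, 'a) hopf = "('k, 'a) bialg" +
  antipode :: "'a \<Rightarrow> 'a"

locale k_algebra =
  Module.module scalars A + ring A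
  for A :: "('k::field, 'a, 'm) module_scheme" (structure) +
  assumes smult_mult_left:
      "x \<in> carrier A \<Longrightarrow> y \<in> carrier A \<Longrightarrow> (c \<odot> x) \<otimes> y = c \<odot> (x \<otimes> y)"
    and smult_mult_right:
      "x \<in> carrier A \<Longrightarrow> y \<in> carrier A \<Longrightarrow> x \<otimes> (c \<odot> y) = c \<odot> (x \<otimes> y)"

text \<open>
  The coproduct and counit are separate parameters, so that ordinary coalgebras and coalgebras
  in a Yetter--Drinfel'd category share this definition.
\<close>
locale k_coalgebra =
  Module.module scalars C
  for C :: "('k::field, 'a, 'm) module_scheme" (structure)
    and D :: "'a \<Rightarrow> ('a \<times> 'a \<Rightarrow>\<^sub>0 'k) set" and e :: "'a \<Rightarrow> 'k" +
  assumes comult_linear: "D \<in> linear_maps C (tensor C C)"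
    and counit_linear: "e \<in> linear_maps C scalars"
    and coassoc: "x \<in> carrier C \<Longrightarrow>
      tensor_sum (tensor C (tensor C C)) (D x) (\<lambda>a b.
        tensor_sum (tensor C (tensor C C)) (D a) (\<lambda>a1 a2.
          pure_tensor C (tensor C C) a1 (pure_tensor C C a2 b))) =
      tensor_sum (tensor C (tensor C C)) (D x) (\<lambda>a b.
        tensor_sum (tensor C (tensor C C)) (D b) (\<lambda>b1 b2.
          pure_tensor C (tensor C C) a (pure_tensor C C b1 b2)))"
    and counit_left: "x \<in> carrier C \<Longrightarrow> tensor_sum C (D x) (\<lambda>a b. e a \<odot> b) = x"
    and counit_right: "x \<in> carrier C \<Longrightarrow> tensor_sum C (D x) (\<lambda>a b. e b \<odot> a) = x"

locale bialgebra =
  k_algebra B + k_coalgebra B "comult B" "counit B"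
  for B :: "('k::field, 'a, 'm) bialg_scheme" (structure) +
  assumes comult_mult: "x \<in> carrier B \<Longrightarrow> y \<in> carrier B \<Longrightarrow>
      comult B (x \<otimes> y) =
      tensor_sum (tensor B B) (comult B x) (\<lambda>x1 x2.
        tensor_sum (tensor B B) (comult B y) (\<lambda>y1 y2.
          pure_tensor B B (x1 \<otimes> y1) (x2 \<otimes> y2)))"
    and comult_one: "comult B \<one> = pure_tensor B B \<one> \<one>"
    and counit_mult: "x \<in> carrier B \<Longrightarrow> y \<in> carrier B \<Longrightarrow>
      counit B (x \<otimes> y) = counit B x * counit B y"
    and counit_one: "counit B \<one> = 1"

locale hopf_algebra =
  bialgebra H for H :: "('k::field, 'h, 'm) hopf_scheme" (structure) +
  assumes antipode_linear: "antipode H \<in> linear_maps H H"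
    and antipode_left: "x \<in> carrier H \<Longrightarrow>
      tensor_sum H (comult H x) (\<lambda>a b. antipode H a \<otimes> b) = counit H x \<odot> \<one>"
    and antipode_right: "x \<in> carrier H \<Longrightarrow>
      tensor_sum H (comult H x) (\<lambda>a b. a \<otimes> antipode H b) = counit H x \<odot> \<one>"

definition bijective_antipode :: "('k::field, 'h, 'm) hopf_scheme \<Rightarrow> bool" where
  "bijective_antipode H \<longleftrightarrow> bij_betw (antipode H) (carrier H) (carrier H)"

definition inv_antipode :: "('k::field, 'h, 'm) hopf_scheme \<Rightarrow> 'h \<Rightarrow> 'h" where
  "inv_antipode H = inv_into (carrier H) (antipode H)"


section \<open>Yetter--Drinfel'd modules\<close>

record (overloaded) ('k::field, 'a, 'h) yd = "('k, 'a) module" +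
  act :: "'h \<Rightarrow> 'a \<Rightarrow> 'a"
  coact :: "'a \<Rightarrow> ('h \<times> 'a \<Rightarrow>\<^sub>0 'k) set"

locale yd_module =
  H: hopf_algebra H + Module.module scalars M
  for H :: "('k::field, 'h, 'm) hopf_scheme" and M :: "('k, 'a, 'h, 'n) yd_scheme" +
  assumes act_linear_left: "x \<in> carrier M \<Longrightarrow> (\<lambda>h. act M h x) \<in> linear_maps H M"
    and act_linear_right: "h \<in> carrier H \<Longrightarrow> act M h \<in> linear_maps M M"
    and act_one: "x \<in> carrier M \<Longrightarrow> act M \<one>\<^bsub>H\<^esub> x = x"
    and act_mult: "g \<in> carrier H \<Longrightarrow> h \<in> carrier H \<Longrightarrow> x \<in> carrier M \<Longrightarrow>
      act M (g \<otimes>\<^bsub>H\<^esub> h) x = act M g (act M h x)"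
    and coact_linear: "coact M \<in> linear_maps M (tensor H M)"
    and coact_coassoc: "x \<in> carrier M \<Longrightarrow>
      tensor_sum (tensor H (tensor H M)) (coact M x) (\<lambda>g y.
        tensor_sum (tensor H (tensor H M)) (comult H g) (\<lambda>g1 g2.
          pure_tensor H (tensor H M) g1 (pure_tensor H M g2 y))) =
      tensor_sum (tensor H (tensor H M)) (coact M x) (\<lambda>g y.
        tensor_sum (tensor H (tensor H M)) (coact M y) (\<lambda>g' z.
          pure_tensor H (tensor H M) g (pure_tensor H M g' z)))"
    and coact_counit: "x \<in> carrier M \<Longrightarrow>
      tensor_sum M (coact M x) (\<lambda>g y. counit H g \<odot>\<^bsub>M\<^esub> y) = x"
    and yd_compat: "h \<in> carrier H \<Longrightarrow> x \<in> carrier M \<Longrightarrow>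
      tensor_sum (tensor H M) (comult H h) (\<lambda>h1 h2.
        tensor_sum (tensor H M) (coact M x) (\<lambda>g y.
          pure_tensor H M (h1 \<otimes>\<^bsub>H\<^esub> g) (act M h2 y))) =
      tensor_sum (tensor H M) (comult H h) (\<lambda>h1 h2.
        tensor_sum (tensor H M) (coact M (act M h1 x)) (\<lambda>g y.
          pure_tensor H M (g \<otimes>\<^bsub>H\<^esub> h2) y))"

definition yd_hom ::
  "('k::field, 'h, 'm) hopf_scheme \<Rightarrow> ('k, 'a, 'h, 'n) yd_scheme \<Rightarrow> ('k, 'b, 'h, 'p) yd_scheme
     \<Rightarrow> ('a \<Rightarrow> 'b) set" where
  "yd_hom H M N = {f \<in> linear_maps M N.
     (\<forall>h\<in>carrier H. \<forall>x\<in>carrier M. f (act M h x) = act N h (f x)) \<and>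
     (\<forall>x\<in>carrier M. coact N (f x) =
        tensor_sum (tensor H N) (coact M x) (\<lambda>g y. pure_tensor H N g (f y)))}"

definition yd_tensor ::
  "('k::field, 'h, 'm) hopf_scheme \<Rightarrow> ('k, 'a, 'h, 'n) yd_scheme \<Rightarrow> ('k, 'b, 'h, 'p) yd_scheme
     \<Rightarrow> ('k, ('a \<times> 'b \<Rightarrow>\<^sub>0 'k) set, 'h) yd" where
  "yd_tensor H M N = module.extend (tensor M N) (yd.fields
     (\<lambda>h X. tensor_sum (tensor M N) (comult H h) (\<lambda>h1 h2.
        tensor_sum (tensor M N) X (\<lambda>x y. pure_tensor M N (act M h1 x) (act N h2 y))))
     (\<lambda>X. tensor_sum (tensor H (tensor M N)) X (\<lambda>x y.
        tensor_sum (tensor H (tensor M N)) (coact M x) (\<lambda>g x0.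
          tensor_sum (tensor H (tensor M N)) (coact N y) (\<lambda>g' y0.
            pure_tensor H (tensor M N) (g \<otimes>\<^bsub>H\<^esub> g') (pure_tensor M N x0 y0))))))"

definition yd_unit :: "('k::field, 'h, 'm) hopf_scheme \<Rightarrow> ('k, 'k, 'h) yd" where
  "yd_unit H = module.extend scalars (yd.fields
     (\<lambda>h c. counit H h * c)
     (\<lambda>c. pure_tensor H (scalars :: ('k, 'k) module) \<one>\<^bsub>H\<^esub> c))"

text \<open>The product \<open>(a \<otimes> b)(a' \<otimes> b') = a(b\<^sub>(\<^sub>-\<^sub>1\<^sub>) \<cdot> a') \<otimes> b\<^sub>(\<^sub>0\<^sub>) b'\<close> on \<open>R \<otimes> R\<close>.\<close>
definition braided_mult ::
  "('k::field, 'a, 'h, 'n) yd_scheme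
     \<Rightarrow> ('a \<times> 'a \<Rightarrow>\<^sub>0 'k) set \<Rightarrow> ('a \<times> 'a \<Rightarrow>\<^sub>0 'k) set \<Rightarrow> ('a \<times> 'a \<Rightarrow>\<^sub>0 'k) set" where
  "braided_mult R X Y =
     tensor_sum (tensor R R) X (\<lambda>a b. tensor_sum (tensor R R) Y (\<lambda>a' b'.
       tensor_sum (tensor R R) (coact R b) (\<lambda>g b0.
         pure_tensor R R (a \<otimes>\<^bsub>R\<^esub> act R g a') (b0 \<otimes>\<^bsub>R\<^esub> b'))))"

record (overloaded) ('k::field, 'a, 'h) yd_bialg = "('k, 'a, 'h) yd" +
  br_comult :: "'a \<Rightarrow> ('a \<times> 'a \<Rightarrow>\<^sub>0 'k) set"
  br_counit :: "'a \<Rightarrow> 'k"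

locale yd_bialgebra =
  yd_module H R + R: k_algebra R + R: k_coalgebra R "br_comult R" "br_counit R"
  for H :: "('k::field, 'h, 'm) hopf_scheme" and R :: "('k, 'a, 'h, 'n) yd_bialg_scheme" +
  assumes mult_hom: "(\<lambda>X. tensor_sum R X (\<lambda>x y. x \<otimes>\<^bsub>R\<^esub> y)) \<in> yd_hom H (yd_tensor H R R) R"
    and unit_hom: "(\<lambda>c. c \<odot>\<^bsub>R\<^esub> \<one>\<^bsub>R\<^esub>) \<in> yd_hom H (yd_unit H) R"
    and br_comult_hom: "br_comult R \<in> yd_hom H R (yd_tensor H R R)"
    and br_counit_hom: "br_counit R \<in> yd_hom H R (yd_unit H)"
    and br_comult_mult: "x \<in> carrier R \<Longrightarrow> y \<in> carrier R \<Longrightarrow>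
      br_comult R (x \<otimes>\<^bsub>R\<^esub> y) = braided_mult R (br_comult R x) (br_comult R y)"
    and br_comult_one: "br_comult R \<one>\<^bsub>R\<^esub> = pure_tensor R R \<one>\<^bsub>R\<^esub> \<one>\<^bsub>R\<^esub>"
    and br_counit_mult: "x \<in> carrier R \<Longrightarrow> y \<in> carrier R \<Longrightarrow>
      br_counit R (x \<otimes>\<^bsub>R\<^esub> y) = br_counit R x * br_counit R y"
    and br_counit_one: "br_counit R \<one>\<^bsub>R\<^esub> = 1"

definition biproduct ::
  "('k::field, 'a, 'h, 'n) yd_bialg_scheme \<Rightarrow> ('k, 'h, 'm) hopf_scheme
     \<Rightarrow> ('k, ('a \<times> 'h \<Rightarrow>\<^sub>0 'k) set) bialg" where
  "biproduct R H = (let B = tensor R H in module.extend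
     (B\<lparr>mult := (\<lambda>X Y. tensor_sum B X (\<lambda>r h. tensor_sum B Y (\<lambda>r' h'.
           tensor_sum B (comult H h) (\<lambda>h1 h2.
             pure_tensor R H (r \<otimes>\<^bsub>R\<^esub> act R h1 r') (h2 \<otimes>\<^bsub>H\<^esub> h'))))),
        one := pure_tensor R H \<one>\<^bsub>R\<^esub> \<one>\<^bsub>H\<^esub>\<rparr>)
     (bialg.fields
       (\<lambda>X. tensor_sum (tensor B B) X (\<lambda>r h.
          tensor_sum (tensor B B) (br_comult R r) (\<lambda>r1 r2.
            tensor_sum (tensor B B) (coact R r2) (\<lambda>g r20.
              tensor_sum (tensor B B) (comult H h) (\<lambda>h1 h2.
                pure_tensor B B (pure_tensor R H r1 (g \<otimes>\<^bsub>H\<^esub> h1)) (pure_tensor R H r20 h2))))))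
       (\<lambda>X. tensor_sum scalars X (\<lambda>r h. br_counit R r * counit H h))))"


section \<open>The tensor algebra\<close>

text \<open>
  \<open>T(M)\<close> is the free vector space on the words over \<open>M\<close>, modulo multilinearity in the letters;
  the class of a word \<open>[m\<^sub>1, \<dots>, m\<^sub>n]\<close> is \<open>m\<^sub>1 \<otimes> \<dots> \<otimes> m\<^sub>n\<close>, and the product is concatenation.
\<close>

definition word_algebra ::
  "('k::field, 'a, 'n) module_scheme \<Rightarrow> ('k, 'a list \<Rightarrow>\<^sub>0 'k) module" where
  "word_algebra M = (free_space (lists (carrier M)))
     \<lparr>mult := (\<lambda>f g. \<Sum>u\<in>Poly_Mapping.keys f. \<Sum>v\<in>Poly_Mapping.keys g.
        Poly_Mapping.single (u @ v) (Poly_Mapping.lookup f u * Poly_Mapping.lookup g v)),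
      one := Poly_Mapping.single [] 1\<rparr>"

definition word_relations :: "('k::field, 'a, 'n) module_scheme \<Rightarrow> ('a list \<Rightarrow>\<^sub>0 'k) set" where
  "word_relations M = vspan (word_algebra M)
     ({Poly_Mapping.single (u @ (x \<oplus>\<^bsub>M\<^esub> y) # v) 1 - Poly_Mapping.single (u @ x # v) 1
         - Poly_Mapping.single (u @ y # v) 1 | u x y v.
         u \<in> lists (carrier M) \<and> v \<in> lists (carrier M) \<and> x \<in> carrier M \<and> y \<in> carrier M}
    \<union> {Poly_Mapping.single (u @ (c \<odot>\<^bsub>M\<^esub> x) # v) 1 - Poly_Mapping.single (u @ x # v) c | c u x v.
         u \<in> lists (carrier M) \<and> v \<in> lists (carrier M) \<and> x \<in> carrier M})"

definition tensor_alg ::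
  "('k::field, 'a, 'n) module_scheme \<Rightarrow> ('k, ('a list \<Rightarrow>\<^sub>0 'k) set) module" where
  "tensor_alg M = factor_space (word_algebra M) (word_relations M)"

definition word_class ::
  "('k::field, 'a, 'n) module_scheme \<Rightarrow> 'a list \<Rightarrow> ('a list \<Rightarrow>\<^sub>0 'k) set" where
  "word_class M w = word_relations M +>\<^bsub>word_algebra M\<^esub> Poly_Mapping.single w 1"

definition tensor_alg_degree ::
  "('k::field, 'a, 'n) module_scheme \<Rightarrow> nat \<Rightarrow> ('a list \<Rightarrow>\<^sub>0 'k) set set" where
  "tensor_alg_degree M n =
     {X \<in> carrier (tensor_alg M). \<exists>f\<in>X. \<forall>w\<in>Poly_Mapping.keys f. length w = n}"

primrec word_act ::
  "('k::field, 'h, 'm) hopf_scheme \<Rightarrow> ('k, 'a, 'h, 'n) yd_scheme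
     \<Rightarrow> 'a list \<Rightarrow> 'h \<Rightarrow> ('a list \<Rightarrow>\<^sub>0 'k) set" where
  "word_act H M [] = (\<lambda>h. counit H h \<odot>\<^bsub>tensor_alg M\<^esub> \<one>\<^bsub>tensor_alg M\<^esub>)"
| "word_act H M (x # w) = (\<lambda>h. tensor_sum (tensor_alg M) (comult H h) (\<lambda>h1 h2.
     word_class M [act M h1 x] \<otimes>\<^bsub>tensor_alg M\<^esub> word_act H M w h2))"

primrec word_coact ::
  "('k::field, 'h, 'm) hopf_scheme \<Rightarrow> ('k, 'a, 'h, 'n) yd_scheme
     \<Rightarrow> 'a list \<Rightarrow> ('h \<times> ('a list \<Rightarrow>\<^sub>0 'k) set \<Rightarrow>\<^sub>0 'k) set" where
  "word_coact H M [] = pure_tensor H (tensor_alg M) \<one>\<^bsub>H\<^esub> \<one>\<^bsub>tensor_alg M\<^esub>"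
| "word_coact H M (x # w) =
     tensor_sum (tensor H (tensor_alg M)) (coact M x) (\<lambda>g x0.
       tensor_sum (tensor H (tensor_alg M)) (word_coact H M w) (\<lambda>g' Y.
         pure_tensor H (tensor_alg M) (g \<otimes>\<^bsub>H\<^esub> g') (word_class M [x0] \<otimes>\<^bsub>tensor_alg M\<^esub> Y)))"

definition tensor_alg_yd ::
  "('k::field, 'h, 'm) hopf_scheme \<Rightarrow> ('k, 'a, 'h, 'n) yd_scheme
     \<Rightarrow> ('k, ('a list \<Rightarrow>\<^sub>0 'k) set, 'h) yd" where
  "tensor_alg_yd H M = module.extend (tensor_alg M) (yd.fields
     (\<lambda>h X. class_sum (tensor_alg M) X (\<lambda>w. word_act H M w h))
     (\<lambda>X. class_sum (tensor H (tensor_alg M)) X (word_coact H M)))"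

text \<open>\<open>word_comult\<close> is the multiplicative extension, for the braided product on \<open>T(M) \<otimes> T(M)\<close>, of
  \<open>x \<mapsto> x \<otimes> 1 + 1 \<otimes> x\<close>.\<close>
primrec word_comult ::
  "('k::field, 'h, 'm) hopf_scheme \<Rightarrow> ('k, 'a, 'h, 'n) yd_scheme
     \<Rightarrow> 'a list \<Rightarrow> (('a list \<Rightarrow>\<^sub>0 'k) set \<times> ('a list \<Rightarrow>\<^sub>0 'k) set \<Rightarrow>\<^sub>0 'k) set" where
  "word_comult H M [] =
     pure_tensor (tensor_alg M) (tensor_alg M) \<one>\<^bsub>tensor_alg M\<^esub> \<one>\<^bsub>tensor_alg M\<^esub>"
| "word_comult H M (x # w) = braided_mult (tensor_alg_yd H M)
     (pure_tensor (tensor_alg M) (tensor_alg M) (word_class M [x]) \<one>\<^bsub>tensor_alg M\<^esub>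
        \<oplus>\<^bsub>tensor (tensor_alg M) (tensor_alg M)\<^esub>
      pure_tensor (tensor_alg M) (tensor_alg M) \<one>\<^bsub>tensor_alg M\<^esub> (word_class M [x]))
     (word_comult H M w)"

definition tensor_algebra ::
  "('k::field, 'h, 'm) hopf_scheme \<Rightarrow> ('k, 'a, 'h, 'n) yd_scheme
     \<Rightarrow> ('k, ('a list \<Rightarrow>\<^sub>0 'k) set, 'h) yd_bialg" where
  "tensor_algebra H M = yd.extend (tensor_alg_yd H M) (yd_bialg.fields
     (\<lambda>X. class_sum (tensor (tensor_alg M) (tensor_alg M)) X (word_comult H M))
     (\<lambda>X. class_sum scalars X (\<lambda>w. if w = [] then 1 else 0)))"


section \<open>Nichols algebras\<close>

definition yd_subobject ::
  "('k::field, 'h, 'm) hopf_scheme \<Rightarrow> ('k, 'a, 'h, 'n) yd_scheme \<Rightarrow> 'a set \<Rightarrow> bool" where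
  "yd_subobject H M N \<longleftrightarrow> submodule N scalars M \<and>
     (\<forall>h\<in>carrier H. \<forall>x\<in>N. act M h x \<in> N) \<and>
     (\<forall>x\<in>N. coact M x \<in> tensor_span H M (carrier H) N)"

definition yd_coideal :: "('k::field, 'a, 'h, 'n) yd_bialg_scheme \<Rightarrow> 'a set \<Rightarrow> bool" where
  "yd_coideal R I \<longleftrightarrow>
     (\<forall>x\<in>I. br_comult R x \<in>
        tensor_span R R I (carrier R) <+>\<^bsub>tensor R R\<^esub> tensor_span R R (carrier R) I) \<and>
     (\<forall>x\<in>I. br_counit R x = 0)"

definition nichols_candidate ::
  "('k::field, 'h, 'm) hopf_scheme \<Rightarrow> ('k, 'a, 'h, 'n) yd_scheme
     \<Rightarrow> ('a list \<Rightarrow>\<^sub>0 'k) set set \<Rightarrow> bool" where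
  "nichols_candidate H M I \<longleftrightarrow>
     yd_subobject H (tensor_algebra H M) I \<and>
     I = vspan (tensor_algebra H M) (\<Union>n. I \<inter> tensor_alg_degree M n) \<and>
     yd_coideal (tensor_algebra H M) I \<and>
     I \<inter> (\<lambda>x. word_class M [x]) ` carrier M = {\<zero>\<^bsub>tensor_algebra H M\<^esub>}"

text \<open>The candidates are closed under sums, so there is exactly one maximal candidate.\<close>
definition nichols_ideal ::
  "('k::field, 'h, 'm) hopf_scheme \<Rightarrow> ('k, 'a, 'h, 'n) yd_scheme
     \<Rightarrow> ('a list \<Rightarrow>\<^sub>0 'k) set set" where
  "nichols_ideal H M = (THE I. nichols_candidate H M I \<and>
     (\<forall>J. nichols_candidate H M J \<and> I \<subseteq> J \<longrightarrow> J = I))"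

definition yd_quotient ::
  "('k::field, 'h, 'm) hopf_scheme \<Rightarrow> ('k, 'a, 'h, 'n) yd_bialg_scheme \<Rightarrow> 'a set
     \<Rightarrow> ('k, 'a set, 'h) yd_bialg" where
  "yd_quotient H R I = (let Q = factor_space R I in
     yd.extend
       (module.extend Q (yd.fields
         (\<lambda>h X. \<Union>x\<in>X. I +>\<^bsub>R\<^esub> act R h x)
         (\<lambda>X. the_elem ((\<lambda>x. tensor_sum (tensor H Q) (coact R x)
            (\<lambda>g y. pure_tensor H Q g (I +>\<^bsub>R\<^esub> y))) ` X))))
       (yd_bialg.fields
         (\<lambda>X. the_elem ((\<lambda>x. tensor_sum (tensor Q Q) (br_comult R x)
            (\<lambda>y z. pure_tensor Q Q (I +>\<^bsub>R\<^esub> y) (I +>\<^bsub>R\<^esub> z))) ` X))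
         (\<lambda>X. the_elem (br_counit R ` X))))"

definition nichols_algebra ::
  "('k::field, 'h, 'm) hopf_scheme \<Rightarrow> ('k, 'a, 'h, 'n) yd_scheme
     \<Rightarrow> ('k, ('a list \<Rightarrow>\<^sub>0 'k) set set, 'h) yd_bialg" where
  "nichols_algebra H M = yd_quotient H (tensor_algebra H M) (nichols_ideal H M)"

text \<open>The identification of \<open>M\<close> with the component of degree one.\<close>
definition nichols_incl ::
  "('k::field, 'h, 'm) hopf_scheme \<Rightarrow> ('k, 'a, 'h, 'n) yd_scheme
     \<Rightarrow> 'a \<Rightarrow> ('a list \<Rightarrow>\<^sub>0 'k) set set" where
  "nichols_incl H M x = nichols_ideal H M +>\<^bsub>tensor_algebra H M\<^esub> word_class M [x]"


section \<open>Conditions on linear forms\<close>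

definition conditions_A ::
  "('k::field, 'u, 'm) bialg_scheme \<Rightarrow> ('k, 'a, 'n) bialg_scheme
     \<Rightarrow> (('u \<times> 'a \<Rightarrow>\<^sub>0 'k) set \<Rightarrow> 'k) \<Rightarrow> bool" where
  "conditions_A U A \<tau> \<longleftrightarrow> (let t = (\<lambda>u a. \<tau> (pure_tensor U A u a)) in
     (\<forall>u\<in>carrier U. \<forall>a\<in>carrier A. \<forall>a'\<in>carrier A.
        t u (a \<otimes>\<^bsub>A\<^esub> a') = tensor_sum scalars (comult U u) (\<lambda>u1 u2. t u2 a * t u1 a')) \<and>
     (\<forall>a\<in>carrier A. t \<one>\<^bsub>U\<^esub> a = counit A a) \<and>
     (\<forall>u\<in>carrier U. \<forall>u'\<in>carrier U. \<forall>a\<in>carrier A.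
        t (u \<otimes>\<^bsub>U\<^esub> u') a = tensor_sum scalars (comult A a) (\<lambda>a1 a2. t u a1 * t u' a2)) \<and>
     (\<forall>u\<in>carrier U. t u \<one>\<^bsub>A\<^esub> = counit U u))"

definition conditions_B ::
  "('k::field, 'h, 'm) hopf_scheme \<Rightarrow> ('k, 't, 'g, 'n) yd_bialg_scheme
     \<Rightarrow> ('k, 'r, 'h, 'p) yd_bialg_scheme \<Rightarrow> (('t \<times> 'r \<Rightarrow>\<^sub>0 'k) set \<Rightarrow> 'k) \<Rightarrow> bool" where
  "conditions_B H T R \<beta> \<longleftrightarrow> (let b = (\<lambda>t r. \<beta> (pure_tensor T R t r)) in
     (\<forall>t\<in>carrier T. \<forall>t'\<in>carrier T. \<forall>r\<in>carrier R.
        b (t \<otimes>\<^bsub>T\<^esub> t') r =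
          tensor_sum scalars (br_comult R r) (\<lambda>r1 r2.
            tensor_sum scalars (coact R r2) (\<lambda>g r20.
              b t (act R (inv_antipode H g) r1) * b t' r20))) \<and>
     (\<forall>r\<in>carrier R. b \<one>\<^bsub>T\<^esub> r = br_counit R r) \<and>
     (\<forall>t\<in>carrier T. \<forall>r\<in>carrier R. \<forall>r'\<in>carrier R.
        b t (r \<otimes>\<^bsub>R\<^esub> r') =
          tensor_sum scalars (br_comult T t) (\<lambda>t1 t2. b t2 r * b t1 r')) \<and>
     (\<forall>t\<in>carrier T. b t \<one>\<^bsub>R\<^esub> = br_counit T t))"

text \<open>\<open>x \<leftharpoonup> p = p(x\<^sub>(\<^sub>-\<^sub>1\<^sub>)) x\<^sub>(\<^sub>0\<^sub>)\<close>\<close>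
definition coact_apply :: "('k::field, 'a, 'h, 'n) yd_scheme \<Rightarrow> 'a \<Rightarrow> ('h \<Rightarrow> 'k) \<Rightarrow> 'a" where
  "coact_apply M x p = tensor_sum M (coact M x) (\<lambda>g y. p g \<odot>\<^bsub>M\<^esub> y)"

definition conditions_C ::
  "('k::field, 'g, 'l) hopf_scheme \<Rightarrow> ('k, 'h, 'm) hopf_scheme
     \<Rightarrow> ('k, 'w, 'g, 'n) yd_scheme \<Rightarrow> ('k, 'v, 'h, 'p) yd_scheme
     \<Rightarrow> (('g \<times> 'h \<Rightarrow>\<^sub>0 'k) set \<Rightarrow> 'k) \<Rightarrow> (('w \<times> 'v \<Rightarrow>\<^sub>0 'k) set \<Rightarrow> 'k) \<Rightarrow> bool" where
  "conditions_C K H W V \<tau> \<beta> \<longleftrightarrow>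
     (\<forall>k\<in>carrier K. \<forall>w\<in>carrier W. \<forall>v\<in>carrier V.
        \<beta> (pure_tensor W V (act W k w) v) =
        \<beta> (pure_tensor W V w (coact_apply V v (\<lambda>h. \<tau> (pure_tensor K H k h))))) \<and>
     (\<forall>h\<in>carrier H. \<forall>w\<in>carrier W. \<forall>v\<in>carrier V.
        \<beta> (pure_tensor W V (coact_apply W w (\<lambda>k. \<tau> (pure_tensor K H k h))) v) =
        \<beta> (pure_tensor W V w (act V (inv_antipode H h) v)))"

definition twist_datum ::
  "('k::field, 'g, 'l) hopf_scheme \<Rightarrow> ('k, 'h, 'm) hopf_scheme
     \<Rightarrow> (('g \<times> 'h \<Rightarrow>\<^sub>0 'k) set \<Rightarrow> 'k)
     \<Rightarrow> ('k, 't, 'g, 'n) yd_bialg_scheme \<Rightarrow> ('k, 'r, 'h, 'p) yd_bialg_scheme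
     \<Rightarrow> (('t \<times> 'r \<Rightarrow>\<^sub>0 'k) set \<Rightarrow> 'k) \<Rightarrow> bool" where
  "twist_datum K H \<tau> T R \<beta> \<longleftrightarrow>
     hopf_algebra K \<and> bijective_antipode K \<and> hopf_algebra H \<and> bijective_antipode H \<and>
     yd_bialgebra K T \<and> yd_bialgebra H R \<and>
     \<tau> \<in> linear_forms K H \<and> conditions_A K H \<tau> \<and>
     \<beta> \<in> linear_forms T R \<and> conditions_B H T R \<beta> \<and>
     conditions_C K H T R \<tau> \<beta>"

text \<open>
  \<open>(\<beta> # \<tau>)(t # k, r # h) = \<beta>(t, S\<^sup>-\<^sup>1(h\<^sub>1) \<cdot> r) \<tau>(k, h\<^sub>2)\<close>, extended linearly to
  \<open>(T # K) \<otimes> (R # H)\<close>.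
\<close>
definition twist_form ::
  "('k::field, 'g, 'l) hopf_scheme \<Rightarrow> ('k, 'h, 'm) hopf_scheme
     \<Rightarrow> (('g \<times> 'h \<Rightarrow>\<^sub>0 'k) set \<Rightarrow> 'k)
     \<Rightarrow> ('k, 't, 'g, 'n) yd_bialg_scheme \<Rightarrow> ('k, 'r, 'h, 'p) yd_bialg_scheme
     \<Rightarrow> (('t \<times> 'r \<Rightarrow>\<^sub>0 'k) set \<Rightarrow> 'k)
     \<Rightarrow> (('t \<times> 'g \<Rightarrow>\<^sub>0 'k) set \<times> ('r \<times> 'h \<Rightarrow>\<^sub>0 'k) set \<Rightarrow>\<^sub>0 'k) set \<Rightarrow> 'k" where
  "twist_form K H \<tau> T R \<beta> Z =
     tensor_sum scalars Z (\<lambda>X Y.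
       tensor_sum scalars X (\<lambda>t k. tensor_sum scalars Y (\<lambda>r h.
         tensor_sum scalars (comult H h) (\<lambda>h1 h2.
           \<beta> (pure_tensor T R t (act R (inv_antipode H h1) r)) * \<tau> (pure_tensor K H k h2)))))"

text \<open>
  The defining property of \<open>\<BB>(\<beta>)\<close>.  Extensionality fixes the values of the HOL function outside
  the carrier of the tensor product, so that the form can be unique.
\<close>
definition is_nichols_form ::
  "('k::field, 'g, 'l) hopf_scheme \<Rightarrow> ('k, 'h, 'm) hopf_scheme
     \<Rightarrow> ('k, 'w, 'g, 'n) yd_scheme \<Rightarrow> ('k, 'v, 'h, 'p) yd_scheme
     \<Rightarrow> (('w \<times> 'v \<Rightarrow>\<^sub>0 'k) set \<Rightarrow> 'k)
     \<Rightarrow> ((('w list \<Rightarrow>\<^sub>0 'k) set set \<times> ('v list \<Rightarrow>\<^sub>0 'k) set set \<Rightarrow>\<^sub>0 'k) set \<Rightarrow> 'k) \<Rightarrow> bool" where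
  "is_nichols_form K H W V \<beta> \<gamma> \<longleftrightarrow>
     \<gamma> \<in> linear_forms (nichols_algebra K W) (nichols_algebra H V) \<and>
     \<gamma> \<in> extensional (carrier (tensor (nichols_algebra K W) (nichols_algebra H V))) \<and>
     conditions_B H (nichols_algebra K W) (nichols_algebra H V) \<gamma> \<and>
     (\<forall>w\<in>carrier W. \<forall>v\<in>carrier V.
        \<gamma> (pure_tensor (nichols_algebra K W) (nichols_algebra H V)
             (nichols_incl K W w) (nichols_incl H V v)) = \<beta> (pure_tensor W V w v))"

definition nichols_form ::
  "('k::field, 'g, 'l) hopf_scheme \<Rightarrow> ('k, 'h, 'm) hopf_scheme
     \<Rightarrow> ('k, 'w, 'g, 'n) yd_scheme \<Rightarrow> ('k, 'v, 'h, 'p) yd_scheme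
     \<Rightarrow> (('w \<times> 'v \<Rightarrow>\<^sub>0 'k) set \<Rightarrow> 'k)
     \<Rightarrow> (('w list \<Rightarrow>\<^sub>0 'k) set set \<times> ('v list \<Rightarrow>\<^sub>0 'k) set set \<Rightarrow>\<^sub>0 'k) set \<Rightarrow> 'k" where
  "nichols_form K H W V \<beta> = (THE \<gamma>. is_nichols_form K H W V \<beta> \<gamma>)"

end

theory Submission
 imports Defs Complex_Main
begin

text \<open>
 The form is first built on \<open>T(W) \<otimes> T(V)\<close>: (B.1) and (B.3) force its values on words, and (C.1), (C.2)
 make the recursion respect the braidings.  By (B.1) and (B.3) the maximal graded coideals pair to zero
 with the other tensor algebra, so the form descends to the Nichols algebras, and (A.1)--(A.4)
 for \<open>B(\<beta>) # \<tau>\<close> follow from those for \<open>\<tau>\<close> together with (B.1)--(B.4) and (C.1), (C.2).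
\<close>

section \<open>Linear combinations and integration against them\<close>

text \<open>Sweedler sums in \<open>tensor\<close> are meaningful only for multilinear integrands,
  and checking multilinearity at every step would swamp the computations. Bases are therefore
  chosen, structure maps are recorded as finite formal combinations, and the Hopf-algebraic
  identities are proved for iterated finite sums of arbitrary functions. For T(M) the basis consists
  of the words in basis letters, so that the product is concatenation. The Nichols algebra gets no
  basis: like T(M) it is treated as a space spanned by images of words on which the structure maps
  follow the word formulas, and identities that are linear in each argument pass down from words.
  (B.1) as a recursion uses the coproduct twisted by the inverse braiding; its laws come from the
  Yetter-Drinfel'd condition rewritten for the inverse antipode. The condition that a coideal meets
  M trivially is not visibly stable under sums or products. It is replaced by vanishing of the
  projection to degree one, a derivation relative to the counit; this shows both that a largest
  candidate exists and that it is an ideal.\<close>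

abbreviation "tsum \<equiv> tensor_sum"
abbreviation "Sinv \<equiv> inv_antipode"
abbreviation "lin \<equiv> linear_maps"
abbreviation "pt \<equiv> pure_tensor"
abbreviation "car \<equiv> carrier"
abbreviation "lk \<equiv> Poly_Mapping.lookup"
abbreviation "ks \<equiv> Poly_Mapping.keys"
abbreviation "sg \<equiv> Poly_Mapping.single"
abbreviation cmul :: "'k::field => ('x \<Rightarrow>\<^sub>0 'k) => ('x \<Rightarrow>\<^sub>0 'k)"
 where "cmul c \<equiv> Poly_Mapping.map ((*) c)"

text \<open>The integral of \<open>f\<close> against the formal combination \<open>m\<close>. A
  combination is used only through these integrals, which determine it by \<open>ev_eqI\<close>; no
  linearity is ever asked of \<open>f\<close>.\<close>

definition ev :: "('x \<Rightarrow>\<^sub>0 'k::field) => ('x => 'k) => 'k" where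
 "ev m f = (\<Sum>x\<in>ks m. lk m x * f x)"

definition ev2 :: "('x \<times> 'y \<Rightarrow>\<^sub>0 'k::field) => ('x => 'y => 'k) => 'k" where
 "ev2 m f = ev m (%(a, b). f a b)"

lemma lookup_cmul [simp]: "lk (cmul c m) x = c * lk m x"
 by (simp add: map.rep_eq when_def)

lemma ev_superset: "finite A ==> ks m <= A ==> ev m f = (\<Sum>x\<in>A. lk m x * f x)"
 unfolding ev_def by (rule sum.mono_neutral_left) (auto simp: in_keys_iff)

lemma ev_zero [simp]: "ev 0 f = 0"
 by (simp add: ev_def)

lemma ev_plus [simp]: "ev (m + n) f = ev m f + ev n f"
proof -
 have "ks (m + n) <= ks m \<union> ks n" by (rule Poly_Mapping.keys_add)
 thus ?thesis
 by (simp add: ev_superset[of "ks m \<union> ks n"] lookup_add algebra_simps sum.distrib)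
qed

lemma ev_cmul [simp]: "ev (cmul c m) f = c * ev m f"
proof -
 have "ks (cmul c m) <= ks m" by (auto simp: in_keys_iff)
 thus ?thesis
 by (simp add: ev_superset[of "ks m"] sum_distrib_left mult.assoc)
qed

lemma ev_uminus [simp]: "ev (- m) f = - ev m f"
 by (simp add: ev_def sum_negf keys_def)

lemma ev_diff [simp]: "ev (m - n) f = ev m f - ev n f"
 by (metis add_uminus_conv_diff ev_plus ev_uminus)

lemma ev_single [simp]: "ev (sg x c) f = c * f x"
 by (cases "c = 0") (simp_all add: ev_def)

lemma ev_sum [simp]: "ev (\<Sum>i\<in>A. m i) f = (\<Sum>i\<in>A. ev (m i) f)"
 by (induction A rule: infinite_finite_induct) simp_all

lemma ev_fun_zero [simp]: "ev m (%x. 0) = 0"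
 by (simp add: ev_def)

lemma ev_fun_plus: "ev m (%x. f x + g x) = ev m f + ev m g"
 by (simp add: ev_def algebra_simps sum.distrib)

lemma ev_fun_mult_left: "ev m (%x. c * f x) = c * ev m f"
 by (simp add: ev_def sum_distrib_left mult.left_commute)

lemma ev_fun_mult_right: "ev m (%x. f x * c) = ev m f * c"
 by (simp add: ev_def sum_distrib_right mult.assoc)

lemma ev_cong: "(!!x. x : ks m ==> f x = g x) ==> ev m f = ev m g"
 by (simp add: ev_def)

lemma ev_indicator: "ev m (%x. if x = y then 1 else 0) = lk m y"
 by (simp add: ev_def sum.delta' in_keys_iff if_distrib cong: if_cong)

text \<open>Integrating the indicator of a point reads off the coefficient there.\<close>

lemma ev_eqI: "(!!f. ev m f = ev n f) ==> m = n"
 by (metis ev_indicator poly_mapping_eqI)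

text \<open>Fubini for finite sums. Permuting independent Sweedler legs is an instance of this rule
  or of its variants for pairs; later uses mostly fix the two combinations that are exchanged, which
  orients the rule.\<close>

lemma ev_swap: "ev m (%x. ev n (%y. f x y)) = ev n (%y. ev m (%x. f x y))"
 by (simp add: ev_def sum_distrib_left sum.swap[of _ "ks n"] mult.left_commute)

lemma ev2_zero [simp]: "ev2 0 f = 0"
 and ev2_plus [simp]: "ev2 (p + q) f = ev2 p f + ev2 q f"
 and ev2_diff [simp]: "ev2 (p - q) f = ev2 p f - ev2 q f"
 and ev2_uminus [simp]: "ev2 (- p) f = - ev2 p f"
 and ev2_cmul [simp]: "ev2 (cmul c p) f = c * ev2 p f"
 and ev2_single [simp]: "ev2 (sg (x, y) c) f = c * f x y"
 and ev2_fun_zero [simp]: "ev2 p (%x y. 0) = 0"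
 by (simp_all add: ev2_def split_def)

lemma ev2_fun_plus: "ev2 m (%x y. f x y + g x y) = ev2 m f + ev2 m g"
 by (simp add: ev2_def split_def ev_fun_plus)

lemma ev2_fun_mult_left: "ev2 m (%x y. c * f x y) = c * ev2 m f"
 by (simp add: ev2_def split_def ev_fun_mult_left)

lemma ev2_fun_mult_right: "ev2 m (%x y. f x y * c) = ev2 m f * c"
 by (simp add: ev2_def split_def ev_fun_mult_right)

lemma ev2_cong: "(!!x y. (x, y) : ks m ==> f x y = g x y) ==> ev2 m f = ev2 m g"
 unfolding ev2_def by (rule ev_cong) auto

lemma ev2_eqI: "(!!f. ev2 m f = ev2 n f) ==> m = n"
proof (rule ev_eqI)
 fix f assume "!!f. ev2 m f = ev2 n f"
 from this[of "%x y. f (x, y)"] show "ev m f = ev n f" by (simp add: ev2_def split_def)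
qed

lemma ev_ev2_swap: "ev m (%x. ev2 n (%y z. f x y z)) = ev2 n (%y z. ev m (%x. f x y z))"
 using ev_swap[of m n "%x p. f x (fst p) (snd p)"] by (simp add: ev2_def split_def)

lemma ev2_swap:
 "ev2 m (%x x'. ev2 n (%y z. f x x' y z)) = ev2 n (%y z. ev2 m (%x x'. f x x' y z))"
 using ev_swap[of m n "%q p. f (fst q) (snd q) (fst p) (snd p)"] by (simp add: ev2_def split_def)

text \<open>Composition of linear maps that are recorded by their values on basis elements: the
  linear extension of \<open>f\<close> applied to \<open>m\<close>. It is characterised by
  \<open>ev_bind\<close>.\<close>

definition bind :: "('x \<Rightarrow>\<^sub>0 'k::field) => ('x => ('y \<Rightarrow>\<^sub>0 'k)) => ('y \<Rightarrow>\<^sub>0 'k)" where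
 "bind m f = (\<Sum>x\<in>ks m. cmul (lk m x) (f x))"

definition bind2 ::
 "('x \<times> 'z \<Rightarrow>\<^sub>0 'k::field) => ('x => 'z => ('y \<Rightarrow>\<^sub>0 'k)) => ('y \<Rightarrow>\<^sub>0 'k)" where
 "bind2 m f = bind m (%(a, b). f a b)"

lemma ev_bind [simp]: "ev (bind m f) g = ev m (%x. ev (f x) g)"
 by (simp add: bind_def ev_def[of m])

lemma ev2_bind [simp]: "ev2 (bind m f) g = ev m (%x. ev2 (f x) g)"
 by (simp add: ev2_def)

lemma ev_bind2 [simp]: "ev (bind2 m f) g = ev2 m (%x y. ev (f x y) g)"
 by (simp add: ev2_def bind2_def split_def)

lemma ev2_bind2 [simp]: "ev2 (bind2 m f) g = ev2 m (%x y. ev2 (f x y) g)"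
 by (simp add: ev2_def bind2_def split_def)

lemma keys_cmul: "ks (cmul c m) <= ks m"
 by (auto simp: in_keys_iff)

lemma keys_sum_subset: "(!!i. i : A ==> ks (m i) <= S) ==> ks (\<Sum>i\<in>A. m i) <= S"
proof (induction A rule: infinite_finite_induct)
 case (insert x F)
 thus ?case
 using Poly_Mapping.keys_add[of "m x" "sum m F"] by fastforce
qed simp_all

lemma keys_bind: "(!!x. x : ks m ==> ks (f x) <= S) ==> ks (bind m f) <= S"
 unfolding bind_def by (rule keys_sum_subset) (rule order_trans[OF keys_cmul], simp)

lemma keys_bind2: "(!!x y. (x, y) : ks m ==> ks (f x y) <= S) ==> ks (bind2 m f) <= S"
 unfolding bind2_def by (rule keys_bind) (simp add: split_def)

section \<open>Vector spaces and linear maps\<close>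

abbreviation vs :: "('k::field, 'a, 'm) module_scheme => bool" where
 "vs M \<equiv> Module.module scalars M"

lemma scalars_simps [simp]:
 "car scalars = UNIV" "mult scalars = (*)" "one scalars = 1" "zero scalars = 0"
 "add scalars = (+)" "smult scalars = (*)"
 by (simp_all add: scalars_def)

lemma cring_scalars: "cring (scalars :: ('k::field, 'k) module)"
proof -
 have "\<exists>y. y + x = 0" for x :: 'k by (metis add.left_inverse)
 thus ?thesis
 by (intro cringI abelian_groupI comm_monoidI) (auto simp: algebra_simps)
qed

lemma vsk: "vs (scalars :: ('k::field, 'k) module)"
 using cring_scalars
 by (intro moduleI) (auto simp: algebra_simps cring_def ring_def)

lemma finsum_scalars: "finsum (scalars :: ('k::field, 'k) module) f A = sum f A"
proof -
 interpret Module.module "scalars :: ('k, 'k) module" "scalars :: ('k, 'k) module"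
 by (rule vsk)
 show ?thesis
 by (induction A rule: infinite_finite_induct) (auto simp: finsum_infinite)
qed

locale vspace = Module.module scalars M
 for M :: "('k::field, 'a, 'm) module_scheme" (structure)

lemma vspaceI: "vs M ==> vspace M"
 by (simp add: vspace_def)

lemma linI:
 assumes "!!x. x : car M ==> f x : car N"
 and "!!x y. x : car M ==> y : car M ==> f (x \<oplus>\<^bsub>M\<^esub> y) = f x \<oplus>\<^bsub>N\<^esub> f y"
 and "!!c x. x : car M ==> f (c \<odot>\<^bsub>M\<^esub> x) = c \<odot>\<^bsub>N\<^esub> f x"
 shows "f : lin M N"
 using assms by (auto simp: linear_maps_def)

lemma lin_closed: "f : lin M N ==> x : car M ==> f x : car N"
 and lin_add: "f : lin M N ==> x : car M ==> y : car M ==>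
 f (x \<oplus>\<^bsub>M\<^esub> y) = f x \<oplus>\<^bsub>N\<^esub> f y"
 and lin_smult: "f : lin M N ==> x : car M ==> f (c \<odot>\<^bsub>M\<^esub> x) = c \<odot>\<^bsub>N\<^esub> f x"
 by (auto simp: linear_maps_def)

lemma lin_zero:
 assumes "vs M" "vs N" "f : lin M N"
 shows "f (zero M) = (zero N)"
proof -
 interpret M: vspace M using assms by (simp add: vspace_def)
 interpret N: vspace N using assms by (simp add: vspace_def)
 have "f (0 \<odot>\<^bsub>M\<^esub> (zero M)) = 0 \<odot>\<^bsub>N\<^esub> f (zero M)"
 using assms by (intro lin_smult) auto
 thus ?thesis
 using M.smult_l_null[of "(zero M)"] N.smult_l_null[of "f (zero M)"] assms(3)
 by (simp add: lin_closed)
qed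

lemma vs_minus:
 assumes "vs M" "x : car M"
 shows "\<ominus>\<^bsub>M\<^esub> x = (-1) \<odot>\<^bsub>M\<^esub> x"
proof -
 interpret M: vspace M using assms by (simp add: vspace_def)
 have "x \<oplus>\<^bsub>M\<^esub> (-1) \<odot>\<^bsub>M\<^esub> x = (1 + -1) \<odot>\<^bsub>M\<^esub> x"
 using M.smult_l_distr[of 1 "-1" x] M.smult_one[of x] assms by simp
 also have "... = (zero M)" using M.smult_l_null[of x] assms by simp
 finally show ?thesis
 using assms by (intro M.M.minus_equality) (auto simp: M.M.a_comm)
qed

lemma lin_minus:
 assumes "vs M" "vs N" "f : lin M N" "x : car M"
 shows "f (\<ominus>\<^bsub>M\<^esub> x) = \<ominus>\<^bsub>N\<^esub> f x"
 using assms by (simp add: vs_minus lin_smult lin_closed)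

lemma lin_diff:
 assumes "vs M" "vs N" "f : lin M N" "x : car M" "y : car M"
 shows "f (x \<ominus>\<^bsub>M\<^esub> y) = f x \<ominus>\<^bsub>N\<^esub> f y"
proof -
 interpret M: vspace M using assms by (simp add: vspace_def)
 show ?thesis using assms by (simp add: a_minus_def lin_add lin_minus)
qed

lemma lin_comp:
 "f : lin M N ==> g : lin N P ==> (%x. g (f x)) : lin M P"
 by (auto simp: linear_maps_def Pi_iff)

lemma lin_finsum:
 assumes "vs M" "vs N" "f : lin M N" "g : A \<rightarrow> car M"
 shows "f (finsum M g A) = finsum N (%i. f (g i)) A"
proof -
 interpret M: vspace M using assms by (simp add: vspace_def)
 interpret N: vspace N using assms by (simp add: vspace_def)
 show ?thesis using assms(4)
 proof (induction A rule: infinite_finite_induct)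
 case (insert i A)
 thus ?case using assms(3) by (simp add: lin_add lin_closed Pi_iff M.M.finsum_closed)
 qed (use assms in \<open>simp_all add: lin_zero M.M.finsum_infinite N.M.finsum_infinite\<close>)
qed

lemma vs_subspace_iff:
 assumes "vs M"
 shows "submodule N scalars M \<longleftrightarrow> N <= car M & (zero M) : N &
 (ALL x:N. ALL y:N. x \<oplus>\<^bsub>M\<^esub> y : N) & (\<forall>c. ALL x:N. c \<odot>\<^bsub>M\<^esub> x : N)" (is "?l \<longleftrightarrow> ?r")
proof
 interpret vspace M using assms by (simp add: vspace_def)
 show "?l ==> ?r"
 using submoduleE[of N] subgroup.one_closed[of N "add_monoid M"]
 by (auto simp: submodule_def)
 assume r: ?r
 show ?l
 proof (rule submoduleI)
 fix a assume "a : N"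
 thus "\<ominus>\<^bsub>M\<^esub> a : N" using r vs_minus[OF assms, of a] by auto
 qed (use r in auto)
qed

lemma vspan_submodule:
 assumes "vs M" "S <= car M"
 shows "submodule (vspan M S) scalars M" "S <= vspan M S"
proof -
 interpret vspace M using assms by (simp add: vspace_def)
 have "submodule (car M) scalars M" using assms by (subst vs_subspace_iff) auto
 thus "submodule (vspan M S) scalars M"
 using assms unfolding vspan_def
 by (subst vs_subspace_iff) (auto simp: vs_subspace_iff)
 show "S <= vspan M S" by (auto simp: vspan_def)
qed

lemma vspan_minimal: "submodule N scalars M ==> S <= N ==> vspan M S <= N"
 by (auto simp: vspan_def)

lemma vspan_mono: "S <= S' ==> vspan M S <= vspan M S'"
 by (auto simp: vspan_def)

lemma submodule_vimage:
 assumes "vs M" "vs N" "f : lin M N" "submodule N' scalars N"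
 shows "submodule {x : car M. f x : N'} scalars M"
proof -
 interpret M: vspace M using assms by (simp add: vspace_def)
 show ?thesis
 using assms lin_zero[OF assms(1-3)] by (auto simp: vs_subspace_iff lin_add lin_smult)
qed

lemma vspan_image:
 assumes "vs M" "vs N" "f : lin M N" "submodule N' scalars N" "S <= car M"
 and "!!x. x : S ==> f x : N'" and "x : vspan M S"
 shows "f x : N'"
 using vspan_minimal[OF submodule_vimage[OF assms(1-4)], of S] assms(5-7) by blast

lemma submodule_zero: "vs M ==> submodule {(zero M)} scalars M"
proof -
 assume "vs M"
 then interpret vspace M by (simp add: vspace_def)
 show ?thesis using \<open>vs M\<close> by (auto simp: vs_subspace_iff smult_r_null)
qed

lemma submodule_equalizer:
 assumes "vs M" "vs N" "f : lin M N" "g : lin M N"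
 shows "submodule {x : car M. f x = g x} scalars M"
proof -
 interpret M: vspace M using assms by (simp add: vspace_def)
 show ?thesis
 using assms lin_zero[OF assms(1-3)] lin_zero[OF assms(1,2,4)]
 by (auto simp: vs_subspace_iff lin_add lin_smult)
qed

lemma vspan_ext:
 assumes "vs M" "vs N" "f : lin M N" "g : lin M N" "S <= car M"
 and "!!x. x : S ==> f x = g x" and "x : vspan M S"
 shows "f x = g x"
 using vspan_minimal[OF submodule_equalizer[OF assms(1-4)], of S] assms(5-7) by blast

section \<open>Free spaces\<close>

lemma free_space_simps [simp]:
 "car (free_space X) = {f. ks f <= X}" "zero (free_space X) = 0" "add (free_space X) = (+)"
 "smult (free_space X) = cmul"
 by (simp_all add: free_space_def)

lemma cmul_simps [simp]:
 "cmul c (m + n) = cmul c m + cmul c n" "cmul (c + d) m = cmul c m + cmul d m"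
 "cmul c (cmul d m) = cmul (c * d) m" "cmul 1 m = m" "cmul c (sg x d) = sg x (c * d)"
 "cmul 0 m = 0" "cmul c 0 = 0" "cmul c (m - n) = cmul c m - cmul c n"
 by (auto intro!: ev_eqI simp: algebra_simps)

lemma vs_free_space: "vs (free_space X :: ('k::field, 'x \<Rightarrow>\<^sub>0 'k) module)"
proof (rule moduleI)
 show "cring (scalars :: ('k, 'k) module)" by (rule cring_scalars)
 have "ks (f + g) <= X" if "ks f <= X" "ks g <= X" for f g :: "'x \<Rightarrow>\<^sub>0 'k"
 using Poly_Mapping.keys_add[of f g] that by blast
 moreover have "\<exists>y. ks y <= X & y + x = 0" if "ks x <= X" for x :: "'x \<Rightarrow>\<^sub>0 'k"
 using that by (intro exI[of _ "- x"]) (simp add: keys_def)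
 ultimately show "abelian_group (free_space X :: ('k, 'x \<Rightarrow>\<^sub>0 'k) module)"
 by (intro abelian_groupI) (auto simp: add.assoc add.commute)
next
 fix a and x :: "'x \<Rightarrow>\<^sub>0 'k" assume "x : car (free_space X)"
 thus "a \<odot>\<^bsub>free_space X\<^esub> x : car (free_space X)" using keys_cmul by fastforce
qed auto

text \<open>The analogue of \<open>ev\<close> with values in a vector space, that is, the linear
  extension of \<open>f\<close> to the free space. \<open>class_sum\<close> is the common value of
  this extension on a class, by \<open>class_sum_lift\<close>.\<close>

definition lift :: "('k::field, 'n, 'z) module_scheme => ('x => 'n) => ('x \<Rightarrow>\<^sub>0 'k) => 'n" where
 "lift N f g = (\<Oplus>\<^bsub>N\<^esub>x\<in>ks g. lk g x \<odot>\<^bsub>N\<^esub> f x)"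

lemma class_sum_lift: "class_sum N X f = the_elem (lift N f ` X)"
 by (simp add: class_sum_def lift_def)

lemma lift_superset:
 assumes "vs N" "f : X \<rightarrow> car N" "finite A" "ks g <= A" "A <= X"
 shows "lift N f g = (\<Oplus>\<^bsub>N\<^esub>x\<in>A. lk g x \<odot>\<^bsub>N\<^esub> f x)"
proof -
 interpret vspace N using assms by (simp add: vspace_def)
 have "f x : car N" if "x : A" for x using assms that by auto
 thus ?thesis unfolding lift_def
 by (intro M.add.finprod_mono_neutral_cong_left)
 (use assms smult_l_null in \<open>auto simp: in_keys_iff\<close>)
qed

lemma lift_linear:
 fixes N :: "('k::field, 'n, 'z) module_scheme" and f :: "'x => 'n"
 assumes "vs N" "f : X \<rightarrow> car N"
 shows "lift N f : lin (free_space X) N"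
proof -
 interpret vspace N using assms by (simp add: vspace_def)
 have fx: "f x : car N" if "x : X" for x using assms that by auto
 show ?thesis
 proof (rule linI)
 fix g :: "'x \<Rightarrow>\<^sub>0 'k" assume "g : car (free_space X)"
 thus "lift N f g : car N"
 unfolding lift_def by (intro M.finsum_closed) (use fx in auto)
 next
 fix g h :: "'x \<Rightarrow>\<^sub>0 'k" assume "g : car (free_space X)" "h : car (free_space X)"
 hence X: "ks g <= X" "ks h <= X" by auto
 let ?A = "ks g \<union> ks h"
 have A: "finite ?A" "?A <= X" "ks (g + h) <= ?A" using X Poly_Mapping.keys_add[of g h] by auto
 have "lift N f (g + h) = (\<Oplus>\<^bsub>N\<^esub>x\<in>?A. lk g x \<odot>\<^bsub>N\<^esub> f x \<oplus>\<^bsub>N\<^esub> lk h x \<odot>\<^bsub>N\<^esub> f x)"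
 unfolding lift_superset[OF assms A(1,3,2)]
 using fx A(2) smult_l_distr by (intro M.finsum_cong') (auto simp: lookup_add)
 also have "... = (\<Oplus>\<^bsub>N\<^esub>x\<in>?A. lk g x \<odot>\<^bsub>N\<^esub> f x) \<oplus>\<^bsub>N\<^esub> (\<Oplus>\<^bsub>N\<^esub>x\<in>?A. lk h x \<odot>\<^bsub>N\<^esub> f x)"
 using fx A(2) by (intro M.finsum_addf) auto
 also have "... = lift N f g \<oplus>\<^bsub>N\<^esub> lift N f h"
 using A by (simp add: lift_superset[OF assms, of ?A])
 finally show "lift N f (g \<oplus>\<^bsub>free_space X\<^esub> h) = lift N f g \<oplus>\<^bsub>N\<^esub> lift N f h" by simp
 next
 fix c and g :: "'x \<Rightarrow>\<^sub>0 'k" assume "g : car (free_space X)"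
 hence X: "ks g <= X" by auto
 have "lift N f (cmul c g) = (\<Oplus>\<^bsub>N\<^esub>x\<in>ks g. c \<odot>\<^bsub>N\<^esub> (lk g x \<odot>\<^bsub>N\<^esub> f x))"
 unfolding lift_superset[OF assms finite_keys keys_cmul X]
 using fx X smult_assoc1 by (intro M.finsum_cong') auto
 also have "... = c \<odot>\<^bsub>N\<^esub> lift N f g"
 unfolding lift_def using fx X by (intro finsum_smult_ldistr[symmetric]) auto
 finally show "lift N f (c \<odot>\<^bsub>free_space X\<^esub> g) = c \<odot>\<^bsub>N\<^esub> lift N f g" by simp
 qed
qed

lemma lift_single: "vs N ==> f x : car N ==> lift N f (sg x c) = c \<odot>\<^bsub>N\<^esub> f x"
proof -
 assume "vs N" and fx: "f x : car N"
 then interpret vspace N by (simp add: vspace_def)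
 show ?thesis using fx smult_l_null[OF fx] smult_closed[OF _ fx, of c]
 by (simp add: lift_def)
qed

lemma lift_scalars: "lift scalars f g = ev g f"
 by (simp add: lift_def ev_def finsum_scalars)

lemma lin_lift:
 assumes "vs M" "vs N" "ph : lin M N" "f : ks g \<rightarrow> car M"
 shows "ph (lift M f g) = lift N (%x. ph (f x)) g"
proof -
 interpret M: vspace M using assms by (simp add: vspace_def)
 interpret N: vspace N using assms by (simp add: vspace_def)
 have fx: "f x : car M" if "x : ks g" for x using assms that by auto
 have "ph (lift M f g) = (\<Oplus>\<^bsub>N\<^esub>x\<in>ks g. ph (lk g x \<odot>\<^bsub>M\<^esub> f x))"
 unfolding lift_def using fx by (intro lin_finsum assms) auto
 also have "... = lift N (%x. ph (f x)) g"
 unfolding lift_def using fx assms(3)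
 by (intro N.M.finsum_cong') (auto simp: lin_smult lin_closed)
 finally show ?thesis .
qed

lemma lin_lift_scalars:
 "vs M ==> ph : lin M scalars ==> f : ks g \<rightarrow> car M ==>
 ph (lift M f g) = ev g (%x. ph (f x))"
 using lin_lift[OF _ vsk] by (simp add: lift_scalars)

lemma free_space_span:
 fixes g :: "'x \<Rightarrow>\<^sub>0 'k::field"
 assumes "g : car (free_space X)"
 shows "g : vspan (free_space X) ((%x. sg x 1) ` X)"
proof -
 let ?V = "vspan (free_space X) ((%x. sg x (1::'k)) ` X)"
 note assms
 hence g: "ks g <= X" by simp
 have s: "submodule ?V scalars (free_space X)" "(%x. sg x 1) ` X <= ?V"
 by (rule vspan_submodule[OF vs_free_space]; force)+
 have *: "sg x c : ?V" if "x : X" for x c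
 proof -
 have "c \<odot>\<^bsub>free_space X\<^esub> sg x 1 : ?V"
 using s that unfolding vs_subspace_iff[OF vs_free_space] by blast
 thus ?thesis by simp
 qed
 have "(\<Sum>x\<in>A. sg x (lk g x)) : ?V" if "finite A" "A <= X" for A
 using that
 proof (induction A)
 case empty thus ?case using s(1) unfolding vs_subspace_iff[OF vs_free_space] by simp
 next
 case (insert x A)
 thus ?case using s(1) *[of x] unfolding vs_subspace_iff[OF vs_free_space] by simp
 qed
 moreover have "g = (\<Sum>x\<in>ks g. sg x (lk g x))"
 by (rule ev_eqI) (simp add: ev_def[of g])
 ultimately show ?thesis using g by (metis finite_keys)
qed

lemma keys_add_subset: "ks f <= X ==> ks g <= X ==> ks (f + g) <= X"
 using Poly_Mapping.keys_add[of f g] by blast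

lemma keys_cmul_subset: "ks f <= X ==> ks (cmul c f) <= X"
 by (rule order_trans[OF keys_cmul])

section \<open>Quotient spaces\<close>

lemma vs_abelian_subgroup:
 assumes "vs M" "submodule N scalars M"
 shows "abelian_subgroup N M"
proof -
 interpret vspace M using assms by (simp add: vspace_def)
 show ?thesis
 using assms by (intro abelian_subgroupI3 additive_subgroup.intro M.abelian_group_axioms)
 (simp add: submodule_def)
qed

lemma coset_mem_iff:
 assumes "vs M" "submodule N scalars M" "x : car M"
 shows "y : N +>\<^bsub>M\<^esub> x \<longleftrightarrow> y : car M & N +>\<^bsub>M\<^esub> y = N +>\<^bsub>M\<^esub> x"
proof -
 interpret abelian_subgroup N M by (rule vs_abelian_subgroup) fact+
 show ?thesis
 using a_elemrcos_carrier[OF assms(3)] a_repr_independence[OF _ assms(3) a_subgroup, of y]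
 a_rcos_self[of y] by auto
qed

lemma coset_eq_iff:
 assumes "vs M" "submodule N scalars M" "x : car M" "y : car M"
 shows "N +>\<^bsub>M\<^esub> x = N +>\<^bsub>M\<^esub> y \<longleftrightarrow> x \<ominus>\<^bsub>M\<^esub> y : N"
proof -
 interpret abelian_subgroup N M by (rule vs_abelian_subgroup) fact+
 show ?thesis
 using a_rcos_module[OF assms(4,3)] coset_mem_iff[OF assms(1,2,4), of x] assms(3)
 by (simp add: a_minus_def)
qed

lemma vs_diff_eq_zero:
 assumes "vs M" "x : car M" "y : car M" "x \<ominus>\<^bsub>M\<^esub> y = (zero M)"
 shows "x = y"
proof -
 interpret vspace M using assms by (simp add: vspace_def)
 have "x \<ominus>\<^bsub>M\<^esub> y \<oplus>\<^bsub>M\<^esub> y = x" using assms(2,3) by (simp add: a_minus_def M.a_assoc M.l_neg)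
 thus ?thesis unfolding assms(4) using assms by simp
qed

lemma factor_space_simps [simp]:
 "zero (factor_space M N) = N" "one (factor_space M N) = N +>\<^bsub>M\<^esub> (one M)"
 "mult (factor_space M N) = rcoset_mult M N"
 by (simp_all add: factor_space_def)

lemma carrier_factor_space: "car (factor_space M N) = (%x. N +>\<^bsub>M\<^esub> x) ` car M"
 by (auto simp: factor_space_def A_RCOSETS_def RCOSETS_def a_r_coset_def)

text \<open>This is the form in which \<open>factor_space\<close> defines scalar multiplication and
  \<open>yd_quotient\<close> the action: a union of cosets over all representatives. All of them
  coincide because \<open>f\<close> maps \<open>N\<close> into \<open>N'\<close>, so the union is a
  single coset.\<close>

lemma coset_UN:
 assumes "vs M" "submodule N scalars M" "vs M'" "submodule N' scalars M'"
 and "f : lin M M'" "!!z. z : N ==> f z : N'" "x : car M"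
 shows "(\<Union>z\<in>N +>\<^bsub>M\<^esub> x. N' +>\<^bsub>M'\<^esub> f z) = N' +>\<^bsub>M'\<^esub> f x"
proof -
 interpret abelian_subgroup N M by (rule vs_abelian_subgroup) fact+
 have "N' +>\<^bsub>M'\<^esub> f z = N' +>\<^bsub>M'\<^esub> f x" if "z : N +>\<^bsub>M\<^esub> x" for z
 proof -
 have z: "z : car M" "N +>\<^bsub>M\<^esub> z = N +>\<^bsub>M\<^esub> x" using that coset_mem_iff[OF assms(1,2,7)] by auto
 hence "z \<ominus>\<^bsub>M\<^esub> x : N" using assms(7) coset_eq_iff[OF assms(1,2)] by simp
 hence "f (z \<ominus>\<^bsub>M\<^esub> x) : N'" by (rule assms(6))
 hence "f z \<ominus>\<^bsub>M'\<^esub> f x : N'"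
 using lin_diff[OF assms(1,3,5) z(1) assms(7)] by simp
 thus ?thesis using coset_eq_iff[OF assms(3,4)] z(1) assms(5,7) by (simp add: lin_closed)
 qed
 hence "(\<Union>z\<in>N +>\<^bsub>M\<^esub> x. N' +>\<^bsub>M'\<^esub> f z) = (\<Union>z\<in>N +>\<^bsub>M\<^esub> x. N' +>\<^bsub>M'\<^esub> f x)"
 by (rule SUP_cong[OF refl])
 moreover have "N +>\<^bsub>M\<^esub> x ~= {}" using a_rcos_self[OF assms(7)] by blast
 ultimately show ?thesis by (simp only: UN_constant if_False)
qed

text \<open>The counterpart of \<open>coset_UN\<close> for maps defined by \<open>the_elem\<close>:
  since \<open>f\<close> kills \<open>N\<close>, its image of a coset is a singleton. Sweedler sums,
  and the coaction, coproduct and counit of a quotient, all have this form.\<close>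

lemma coset_the_elem:
 assumes "vs M" "submodule N scalars M" "vs M'"
 and "f : lin M M'" "!!z. z : N ==> f z = (zero M')" "x : car M"
 shows "the_elem (f ` (N +>\<^bsub>M\<^esub> x)) = f x"
proof -
 interpret abelian_subgroup N M by (rule vs_abelian_subgroup) fact+
 interpret M': vspace M' using assms by (simp add: vspace_def)
 have "f z = f x" if "z : N +>\<^bsub>M\<^esub> x" for z
 proof -
 have z: "z : car M" "N +>\<^bsub>M\<^esub> z = N +>\<^bsub>M\<^esub> x" using that coset_mem_iff[OF assms(1,2,6)] by auto
 hence "z \<ominus>\<^bsub>M\<^esub> x : N" using assms(6) coset_eq_iff[OF assms(1,2)] by simp
 hence "f (z \<ominus>\<^bsub>M\<^esub> x) = (zero M')" by (rule assms(5))
 hence "f z \<ominus>\<^bsub>M'\<^esub> f x = (zero M')"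
 using lin_diff[OF assms(1,3,4) z(1) assms(6)] by simp
 thus ?thesis
 by (rule vs_diff_eq_zero[OF assms(3) lin_closed[OF assms(4) z(1)] lin_closed[OF assms(4,6)]])
 qed
 hence "f ` (N +>\<^bsub>M\<^esub> x) = (%_. f x) ` (N +>\<^bsub>M\<^esub> x)" by (rule image_cong[OF refl])
 moreover have "N +>\<^bsub>M\<^esub> x ~= {}" using a_rcos_self[OF assms(6)] by blast
 ultimately show ?thesis by (simp add: image_constant_conv)
qed

lemma
 assumes "vs M" "submodule N scalars M"
 shows vs_factor_space: "vs (factor_space M N)"
 and proj_linear: "(%x. N +>\<^bsub>M\<^esub> x) : lin M (factor_space M N)"
proof -
 interpret M: vspace M using assms by (simp add: vspace_def)
 interpret abelian_subgroup N M by (rule vs_abelian_subgroup) fact+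
 let ?Q = "factor_space M N"
 have add: "(N +>\<^bsub>M\<^esub> x) \<oplus>\<^bsub>?Q\<^esub> (N +>\<^bsub>M\<^esub> y) = N +>\<^bsub>M\<^esub> (x \<oplus>\<^bsub>M\<^esub> y)"
 if "x : car M" "y : car M" for x y
 using that by (simp add: factor_space_def a_rcos_sum)
 have smult: "c \<odot>\<^bsub>?Q\<^esub> (N +>\<^bsub>M\<^esub> x) = N +>\<^bsub>M\<^esub> (c \<odot>\<^bsub>M\<^esub> x)" if "x : car M" for c x
 proof -
 have l: "(%x. c \<odot>\<^bsub>M\<^esub> x) : lin M M"
 by (rule linI) (auto simp: M.smult_r_distr M.smult_assoc1[symmetric] mult.commute)
 show ?thesis
 using coset_UN[OF assms assms l, of x] that assms(2)
 by (simp add: factor_space_def vs_subspace_iff[OF assms(1)])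
 qed
 have zero: "N = N +>\<^bsub>M\<^esub> (zero M)"
 by (simp add: M.M.a_coset_add_zero a_subset)
 have c: "car ?Q = (%x. N +>\<^bsub>M\<^esub> x) ` car M" by (rule carrier_factor_space)
 have ag: "abelian_group ?Q"
 proof (rule abelian_groupI)
 show "(zero (?Q)) : car ?Q" unfolding c using zero by auto
 fix X assume X: "X : car ?Q"
 then obtain x where x: "x : car M" "X = N +>\<^bsub>M\<^esub> x" by (auto simp: c)
 show "(zero (?Q)) \<oplus>\<^bsub>?Q\<^esub> X = X" using x zero add[of "(zero M)" x] by simp
 show "EX y:car ?Q. y \<oplus>\<^bsub>?Q\<^esub> X = (zero (?Q))"
 using x zero add[of "\<ominus>\<^bsub>M\<^esub> x" x] by (intro bexI[of _ "N +>\<^bsub>M\<^esub> \<ominus>\<^bsub>M\<^esub> x"]) (auto simp: c M.M.l_neg)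
 qed (auto simp add: c add M.M.a_ac)
 show "vs ?Q"
 by (rule moduleI[OF cring_scalars ag])
 (auto simp: c add smult M.smult_l_distr[simplified] M.smult_r_distr M.smult_assoc1[simplified]
 M.smult_one[simplified])
 show "(%x. N +>\<^bsub>M\<^esub> x) : lin M (factor_space M N)"
 by (rule linI) (auto simp: c add smult)
qed

lemma factor_lift_linear:
 assumes "vs M" "submodule N scalars M" "vs M'"
 and "f : lin M M'" "!!z. z : N ==> f z = (zero M')"
 shows "(%X. the_elem (f ` X)) : lin (factor_space M N) M'"
proof -
 interpret M: vspace M using assms by (simp add: vspace_def)
 note te = coset_the_elem[OF assms]
 note p = proj_linear[OF assms(1,2)]
 show ?thesis
 proof (rule linI)
 fix X assume X: "X : car (factor_space M N)"
 then obtain x where x: "x : car M" "X = N +>\<^bsub>M\<^esub> x" by (auto simp: carrier_factor_space)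
 show "the_elem (f ` X) : car M'" using x assms(4) by (simp add: te lin_closed)
 show "the_elem (f ` (c \<odot>\<^bsub>factor_space M N\<^esub> X)) = c \<odot>\<^bsub>M'\<^esub> the_elem (f ` X)" for c
 using x te lin_smult[OF p, of x c, symmetric] lin_smult[OF assms(4), of x c] by simp
 fix Y assume "Y : car (factor_space M N)"
 then obtain y where y: "y : car M" "Y = N +>\<^bsub>M\<^esub> y" by (auto simp: carrier_factor_space)
 show "the_elem (f ` (X \<oplus>\<^bsub>factor_space M N\<^esub> Y)) = the_elem (f ` X) \<oplus>\<^bsub>M'\<^esub> the_elem (f ` Y)"
 using x y te lin_add[OF p, of x y, symmetric] lin_add[OF assms(4), of x y] by simp
 qed
qed

section \<open>Coordinates with respect to a basis\<close>

text \<open>Formal combinations form a vector space on a whole type, where bases and linear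
  extensions exist; \<open>ex_coords\<close> extracts from this a basis of a space that is given by
  its carrier.\<close>

global_interpretation pm: vector_space "cmul :: 'k::field => ('x \<Rightarrow>\<^sub>0 'k) => ('x \<Rightarrow>\<^sub>0 'k)"
 by standard simp_all

text \<open>A basis is encoded by a linear section \<open>c\<close> of the evaluation of formal
  combinations. That every \<open>b\<close> occurring in some \<open>c x\<close> satisfies
  \<open>c b = sg b 1\<close> makes these vectors linearly independent, so no index set has to be
  carried along.\<close>

definition is_coords :: "('k::field, 'a, 'm) module_scheme => ('a => ('a \<Rightarrow>\<^sub>0 'k)) => bool" where
 "is_coords M c \<longleftrightarrow> c : lin M (free_space (car M)) &
 (ALL x:car M. lift M (%x. x) (c x) = x & (ALL b:ks (c x). c b = sg b 1))"

text \<open>The kernel \<open>N\<close> of evaluation has a basis \<open>C\<close>, which is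
  extended by single elements of \<open>M\<close> to a basis \<open>B\<close>. The projection
  \<open>p\<close> that kills \<open>C\<close> and fixes the rest of \<open>B\<close> turns each
  formal element into a combination of basis vectors of the same value, because
  \<open>g - p g\<close> lies in \<open>N\<close>.\<close>

lemma ex_coords:
 fixes M :: "('k::field, 'a, 'm) module_scheme"
 assumes "vs M"
 shows "\<exists>c. is_coords M c"
proof -
 interpret M: vspace M using assms by (simp add: vspace_def)
 let ?l = "lift M (%x. x)"
 let ?F = "free_space (car M) :: ('k, 'a \<Rightarrow>\<^sub>0 'k) module"
 have l: "?l : lin ?F M" by (rule lift_linear[OF assms]) simp
 have ladd: "?l (f + g) = ?l f \<oplus>\<^bsub>M\<^esub> ?l g" if "ks f <= car M" "ks g <= car M" for f g
 using lin_add[OF l, of f g] that by simp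
 have lsm: "?l (cmul c f) = c \<odot>\<^bsub>M\<^esub> ?l f" if "ks f <= car M" for c f
 using lin_smult[OF l, of f c] that by simp
 have lsg: "?l (sg x c) = c \<odot>\<^bsub>M\<^esub> x" if "x : car M" for c x
 using that by (rule lift_single[OF assms])
 have lc: "?l f : car M" if "ks f <= car M" for f
 using lin_closed[OF l, of f] that by simp
 have l0: "?l 0 = (zero M)"
 using lin_zero[OF vs_free_space assms l] by simp
 define N where "N = {g. ks g <= car M & ?l g = (zero M)}"
 define S where "S = (%x. sg x (1::'k)) ` car M"
 have N: "pm.subspace N"
 by (rule pm.subspaceI)
 (simp_all add: N_def ladd lsm l0 keys_add_subset keys_cmul_subset M.smult_r_null[simplified])
 obtain C where C: "C <= N" "pm.independent C" "N <= pm.span C"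
 using pm.maximal_independent_subset[of N] by metis
 have CN: "pm.span C <= N" by (rule pm.span_minimal[OF C(1) N])
 obtain B where B: "C <= B" "B <= C \<union> S" "pm.independent B" "C \<union> S <= pm.span B"
 using pm.maximal_independent_subset_extend[of C "C \<union> S"] C by (metis sup_ge1)
 interpret pp: vector_space_pair "cmul :: 'k => ('a \<Rightarrow>\<^sub>0 'k) => _" "cmul :: 'k => ('a \<Rightarrow>\<^sub>0 'k) => _" ..
 obtain p where p: "Vector_Spaces.linear cmul cmul p" "ALL b:B. p b = (if b : C then 0 else b)"
 using pp.linear_independent_extend[OF B(3), of "%b. if b : C then 0 else b"] by metis
 interpret p: Vector_Spaces.linear cmul cmul p by (rule p(1))
 have pmod: "module_hom cmul cmul p" by (rule p.module_hom_axioms)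
 \<comment> \<open>Elements of \<open>B\<close> outside \<open>C\<close> are singles by the choice
   of \<open>B\<close>; \<open>B'\<close> collects the vectors for which they stand, and these will
   be the basis of \<open>M\<close>.\<close>
 define B' where "B' = {x : car M. sg x (1::'k) : B - C}"
 have F: "pm.subspace {g. ks g <= car M}" "pm.subspace {g. ks g <= B'}"
 by (rule pm.subspaceI; simp add: keys_add_subset keys_cmul_subset)+
 have pB: "p g : {g. ks g <= B'}" if "g : pm.span B" for g
 using that
 proof (induction rule: pm.span_induct_alt)
 case base thus ?case by (simp add: p.zero)
 next
 case (step c x y)
 have "p x : {g. ks g <= B'}"
 using step(1) p(2) B(2) by (auto simp: B'_def S_def)
 thus ?case using step(2) by (simp add: p.add p.scale keys_add_subset keys_cmul_subset)
 qed
 have diff: "g - p g : N" if "g : pm.span B" for g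
 using that
 proof (induction rule: pm.span_induct_alt)
 case base thus ?case using N by (simp add: p.zero pm.subspace_def)
 next
 case (step c x y)
 have "x - p x : N"
 using step(1) p(2) C(1) N by (auto simp: pm.subspace_def)
 moreover have "cmul c x + y - p (cmul c x + y) = cmul c (x - p x) + (y - p y)"
 by (simp add: p.add p.scale)
 ultimately show ?case using step(2) N unfolding pm.subspace_def by metis
 qed
 have pN: "p g = 0" if "g : N" for g
 proof -
 have "g : pm.span C" using that C by auto
 thus ?thesis
 by (induction rule: pm.span_induct_alt) (use p(2) B(1) in \<open>auto simp: p.zero p.add p.scale\<close>)
 qed
 define c where "c x = p (sg x 1)" for x
 have sB: "sg x 1 : pm.span B" if "x : car M" for x using that B(4) by (auto simp: S_def)
 have kc: "ks (c x) <= B'" if "x : car M" for x using pB[OF sB[OF that]] by (simp add: c_def)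
 have cB: "c b = sg b 1" if "b : B'" for b using that p(2) by (auto simp: c_def B'_def)
 have "lift M (%x. x) (c x) = x" if x: "x : car M" for x
 proof -
 have "sg x 1 - c x : N" using diff[OF sB[OF x]] by (simp add: c_def)
 hence "?l (sg x 1 - c x) = (zero M)" "ks (sg x 1 - c x) <= car M" by (auto simp: N_def)
 moreover have k: "ks (c x) <= car M" using kc[OF x] by (auto simp: B'_def)
 ultimately have "?l (sg x 1 - c x + c x) = (zero M) \<oplus>\<^bsub>M\<^esub> ?l (c x)" using ladd by metis
 thus ?thesis using x lc[OF k] by (simp add: lsg M.smult_one[simplified])
 qed
 moreover have "c : lin M ?F"
 proof (rule linI)
 fix x assume x: "x : car M"
 show "c x : car ?F" using kc[OF x] by (auto simp: B'_def)
 fix y assume y: "y : car M"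
 \<comment> \<open>The formal expression of additivity evaluates to zero, hence lies in
   \<open>N\<close> and is killed by \<open>p\<close>; scalar multiples are treated in the same way
   below.\<close>
 let ?d = "sg (x \<oplus>\<^bsub>M\<^esub> y) 1 + (cmul (-1) (sg x 1) + cmul (-1) (sg y 1))"
 have "x \<oplus>\<^bsub>M\<^esub> y \<oplus>\<^bsub>M\<^esub> (\<ominus>\<^bsub>M\<^esub> x \<oplus>\<^bsub>M\<^esub> \<ominus>\<^bsub>M\<^esub> y) = (zero M)"
 using x y M.M.r_neg[of "x \<oplus>\<^bsub>M\<^esub> y"] by (simp add: M.M.minus_add)
 hence "?l ?d = (zero M)"
 using x y by (simp add: ladd lsg keys_add_subset M.smult_one[simplified]
 vs_minus[OF assms, symmetric])
 moreover have "ks ?d <= car M"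
 using x y by (simp add: keys_add_subset)
 ultimately have "p ?d = 0" by (intro pN) (simp add: N_def)
 thus "c (x \<oplus>\<^bsub>M\<^esub> y) = c x \<oplus>\<^bsub>?F\<^esub> c y"
 unfolding p.add p.scale by (simp add: c_def pm.scale_minus_left algebra_simps del: cmul_simps(5))
 next
 fix r x assume x: "x : car M"
 let ?d = "sg (r \<odot>\<^bsub>M\<^esub> x) 1 + cmul (- r) (sg x 1)"
 have "?l ?d = (zero M)"
 using x M.smult_l_distr[of r "- r" x] by (simp add: ladd lsg keys_add_subset M.smult_one[simplified] M.smult_l_null[simplified])
 moreover have "ks ?d <= car M"
 using x by (simp add: keys_add_subset)
 ultimately have "p ?d = 0" by (intro pN) (simp add: N_def)
 thus "c (r \<odot>\<^bsub>M\<^esub> x) = r \<odot>\<^bsub>?F\<^esub> c x"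
 unfolding p.add p.scale by (simp add: c_def pm.scale_minus_left algebra_simps del: cmul_simps(5))
 qed
 ultimately show ?thesis
 unfolding is_coords_def using kc cB by (intro exI[of _ c]) blast
qed

definition coords :: "('k::field, 'a, 'm) module_scheme => 'a => ('a \<Rightarrow>\<^sub>0 'k)" where
 "coords M = (SOME c. is_coords M c)"

definition basis :: "('k::field, 'a, 'm) module_scheme => 'a set" where
 "basis M = {b : car M. coords M b = sg b 1}"

lemma
 assumes "vs M"
 shows coords_linear: "coords M : lin M (free_space (car M))"
 and lift_coords: "x : car M ==> lift M (%x. x) (coords M x) = x"
 and keys_coords: "x : car M ==> ks (coords M x) <= basis M"
 and coords_basis: "b : basis M ==> coords M b = sg b 1"
 and basis_carrier: "b : basis M ==> b : car M"
proof -
 have *: "is_coords M (coords M)"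
 unfolding coords_def using ex_coords[OF assms] by (rule someI_ex)
 thus l: "coords M : lin M (free_space (car M))"
 unfolding is_coords_def by blast
 have "ks (coords M x) <= car M" if "x : car M" for x
 using lin_closed[OF l that] by simp
 thus "x : car M ==> lift M (%x. x) (coords M x) = x"
 "x : car M ==> ks (coords M x) <= basis M"
 using * unfolding is_coords_def basis_def by blast+
qed (auto simp: basis_def)

lemma ev_linear:
 assumes "vs M" "c : lin M (free_space X)"
 shows "(%x. ev (c x) f) : lin M scalars"
 by (rule linI) (simp_all add: lin_add[OF assms(2)] lin_smult[OF assms(2)])

lemma ev_coords:
 assumes "vs M" "ph : lin M scalars" "x : car M"
 shows "ev (coords M x) ph = ph x"
proof -
 have "ph (lift M (%x. x) (coords M x)) = ev (coords M x) ph"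
 using keys_coords[OF assms(1,3)] basis_carrier[OF assms(1)]
 by (subst lin_lift_scalars[OF assms(1,2)]) auto
 thus ?thesis using lift_coords[OF assms(1,3)] by simp
qed

text \<open>Each coordinate is a linear functional, so functionals separate points. Equations
  between vectors, tensors in particular, are reduced by this to scalar equations, to which
  \<open>ev\<close> applies.\<close>

lemma functional_eqI:
 assumes "vs M" "x : car M" "y : car M"
 and "!!ph. ph : lin M scalars ==> ph x = ph y"
 shows "x = y"
proof -
 have c: "coords M x = coords M y"
 by (rule ev_eqI) (rule assms(4)[OF ev_linear[OF assms(1) coords_linear[OF assms(1)]]])
 have "x = lift M (%x. x) (coords M x)" by (rule lift_coords[OF assms(1,2), symmetric])
 also have "... = y" unfolding c by (rule lift_coords[OF assms(1,3)])
 finally show ?thesis .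
qed

lemma basis_ext:
 assumes "vs M" "vs N" "f : lin M N" "g : lin M N"
 and "!!b. b : basis M ==> f b = g b" "x : car M"
 shows "f x = g x"
proof (rule functional_eqI[OF assms(2)])
 fix ph assume ph: "ph : lin N scalars"
 have "ev (coords M x) (%x. ph (f x)) = ev (coords M x) (%x. ph (g x))"
 by (rule ev_cong) (simp only: assms(5)[OF subsetD[OF keys_coords[OF assms(1,6)]]])
 thus "ph (f x) = ph (g x)"
 using ev_coords[OF assms(1) lin_comp[OF assms(3) ph] assms(6)]
 ev_coords[OF assms(1) lin_comp[OF assms(4) ph] assms(6)] by simp
qed (use lin_closed[OF assms(3,6)] lin_closed[OF assms(4,6)] in simp_all)

section \<open>Tensor products and Sweedler sums\<close>

lemma
 assumes "vs M" "submodule N scalars M"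
 shows submodule_subset: "N <= car M"
 and submodule_zero_mem: "(zero M) : N"
 and submodule_add: "x : N ==> y : N ==> x \<oplus>\<^bsub>M\<^esub> y : N"
 and submodule_smult: "x : N ==> c \<odot>\<^bsub>M\<^esub> x : N"
 using assms(2) unfolding vs_subspace_iff[OF assms(1)] by blast+

lemma lin_ev: "(%g. ev g F) : lin (free_space X) scalars"
 by (rule linI) simp_all

lemma lin_id: "(%x. x) : lin M M"
 by (rule linI) simp_all

lemma lin_plus:
 assumes "vs N" "f : lin M N" "g : lin M N"
 shows "(%x. f x \<oplus>\<^bsub>N\<^esub> g x) : lin M N"
proof -
 interpret N: vspace N using assms by (simp add: vspace_def)
 show ?thesis using assms(2,3)
 by (intro linI) (simp_all add: lin_closed lin_add lin_smult N.M.a_ac N.smult_r_distr)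
qed

lemma lin_smult_right:
 assumes "vs N" "f : lin M N"
 shows "(%x. c \<odot>\<^bsub>N\<^esub> f x) : lin M N"
proof -
 interpret N: vspace N using assms by (simp add: vspace_def)
 show ?thesis using assms(2)
 by (intro linI)
 (simp_all add: lin_closed lin_add lin_smult N.smult_r_distr N.smult_assoc1[simplified, symmetric] mult.commute)
qed

lemma lin_smult_left:
 assumes "vs N" "f : lin M scalars" "x : car N"
 shows "(%z. f z \<odot>\<^bsub>N\<^esub> x) : lin M N"
proof -
 interpret N: vspace N using assms by (simp add: vspace_def)
 show ?thesis using assms(2,3)
 by (intro linI)
 (simp_all add: lin_closed lin_add lin_smult N.smult_l_distr[simplified] N.smult_assoc1[simplified])
qed

lemma lin_cong:
 assumes "vs M" "f : lin M N" "!!x. x : car M ==> f x = g x"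
 shows "g : lin M N"
proof -
 interpret vspace M using assms by (simp add: vspace_def)
 show ?thesis using assms(2,3)
 by (intro linI) (metis lin_closed, metis lin_add M.a_closed,
 metis lin_smult smult_closed UNIV_I scalars_simps(1))
qed

definition bil :: "('k::field, 'u, 'm) module_scheme => ('k, 'v, 'n) module_scheme =>
 ('k, 'w, 'p) module_scheme => ('u => 'v => 'w) => bool" where
 "bil U V N f \<longleftrightarrow> (ALL v:car V. (%u. f u v) : lin U N) &
 (ALL u:car U. f u : lin V N)"

lemma bil_closed: "bil U V N f ==> u : car U ==> v : car V ==> f u v : car N"
 by (auto simp: bil_def lin_closed)

lemma bil_comp: "bil U V N f ==> ph : lin N P ==> bil U V P (%u v. ph (f u v))"
 unfolding bil_def by (auto intro: lin_comp)

lemma bil_cong: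
 assumes "vs U" "vs V" "bil U V N f"
 and "!!u v. u : car U ==> v : car V ==> f u v = g u v"
 shows "bil U V N g"
 using assms(3,4) unfolding bil_def
 by (auto intro: lin_cong[OF assms(1)] lin_cong[OF assms(2)])

lemma keys_sg_subset: "x : X ==> ks (sg x c) <= X"
 by simp

lemma keys_diff_subset: "ks f <= X ==> ks g <= X ==> ks (f - g) <= X"
 using Poly_Mapping.keys_diff[of f g] by blast

section \<open>The tensor product and its universal property\<close>

definition tensor_gens ::
 "('k::field, 'u, 'm) module_scheme => ('k, 'v, 'n) module_scheme => ('u \<times> 'v \<Rightarrow>\<^sub>0 'k) set" where
 "tensor_gens U V = ({Poly_Mapping.single (u \<oplus>\<^bsub>U\<^esub> u', v) 1 - Poly_Mapping.single (u, v) 1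
 - Poly_Mapping.single (u', v) 1 | u u' v.
 u : car U & u' : car U & v : car V}
 \<union> {Poly_Mapping.single (u, v \<oplus>\<^bsub>V\<^esub> v') 1 - Poly_Mapping.single (u, v) 1
 - Poly_Mapping.single (u, v') 1 | u v v'.
 u : car U & v : car V & v' : car V}
 \<union> {Poly_Mapping.single (c \<odot>\<^bsub>U\<^esub> u, v) 1 - Poly_Mapping.single (u, v) c | c u v.
 u : car U & v : car V}
 \<union> {Poly_Mapping.single (u, c \<odot>\<^bsub>V\<^esub> v) 1 - Poly_Mapping.single (u, v) c | c u v.
 u : car U & v : car V})"

lemma tensor_relations_gens:
 "tensor_relations U V = vspan (free_space (car U \<times> car V)) (tensor_gens U V)"
 unfolding tensor_relations_def tensor_gens_def by (rule refl)

lemma tensor_gens_carrier: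
 assumes "vs U" "vs V"
 shows "tensor_gens U V <= car (free_space (car U \<times> car V))"
proof
 interpret U: vspace U using assms by (simp add: vspace_def)
 interpret V: vspace V using assms by (simp add: vspace_def)
 fix g assume "g : tensor_gens U V"
 hence "ks g <= car U \<times> car V"
 unfolding tensor_gens_def
 by (elim UnE CollectE exE conjE; simp only:; intro keys_diff_subset keys_sg_subset SigmaI)
 (simp_all add: U.smult_closed[simplified] V.smult_closed[simplified])
 thus "g : car (free_space (car U \<times> car V))" by simp
qed

lemma tensor_relations_submodule:
 assumes "vs U" "vs V"
 shows "submodule (tensor_relations U V) scalars (free_space (car U \<times> car V))"
 unfolding tensor_relations_gens
 by (rule vspan_submodule(1)[OF vs_free_space tensor_gens_carrier[OF assms]])

lemma tensor_relations_kill: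
 assumes "vs U" "vs V" "bil U V scalars F" "g : tensor_relations U V"
 shows "ev g (%(u, v). F u v) = 0"
proof -
 have l: "F (u \<oplus>\<^bsub>U\<^esub> u') v = F u v + F u' v" "F (c \<odot>\<^bsub>U\<^esub> u) v = c * F u v"
 if "u : car U" "u' : car U" "v : car V" for u u' v c
 using assms(3) that unfolding bil_def linear_maps_def by auto
 have r: "F u (v \<oplus>\<^bsub>V\<^esub> v') = F u v + F u v'" "F u (c \<odot>\<^bsub>V\<^esub> v) = c * F u v"
 if "u : car U" "v : car V" "v' : car V" for u v v' c
 using assms(3) that unfolding bil_def linear_maps_def by auto
 have "ev g (%(u, v). F u v) : {0}"
 proof (rule vspan_image[OF vs_free_space vsk lin_ev _ tensor_gens_carrier[OF assms(1,2)] _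
 assms(4)[unfolded tensor_relations_gens]])
 show "submodule {0} scalars scalars" using submodule_zero[OF vsk] by simp
 fix g assume "g : tensor_gens U V"
 thus "ev g (%(u, v). F u v) : {0}"
 unfolding tensor_gens_def by (elim UnE CollectE exE conjE) (simp_all add: l r)
 qed
 thus ?thesis by simp
qed

definition pair :: "('x \<Rightarrow>\<^sub>0 'k::field) => ('y \<Rightarrow>\<^sub>0 'k) => ('x \<times> 'y \<Rightarrow>\<^sub>0 'k)" where
 "pair m n = bind m (%a. bind n (%b. sg (a, b) 1))"

lemma ev2_pair [simp]: "ev2 (pair m n) f = ev m (%a. ev n (%b. f a b))"
 by (simp add: pair_def)

locale vs2 =
 fixes U :: "('k::field, 'u, 'm) module_scheme" and V :: "('k, 'v, 'n) module_scheme"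
 assumes vsU: "vs U" and vsV: "vs V"
begin

abbreviation "FS \<equiv> free_space (car U \<times> car V) :: ('k, 'u \<times> 'v \<Rightarrow>\<^sub>0 'k) module"
abbreviation "prj g \<equiv> tensor_relations U V +>\<^bsub>FS\<^esub> g"

lemma vs_tensor: "vs (tensor U V)"
 unfolding tensor_def
 by (rule vs_factor_space[OF vs_free_space tensor_relations_submodule[OF vsU vsV]])

lemma prj_linear: "(%g. prj g) : lin FS (tensor U V)"
 unfolding tensor_def
 by (rule proj_linear[OF vs_free_space tensor_relations_submodule[OF vsU vsV]])

lemma carrier_tensor: "car (tensor U V) = (%g. prj g) ` car FS"
 unfolding tensor_def by (rule carrier_factor_space)

lemma pure_closed: "u : car U ==> v : car V ==> pt U V u v : car (tensor U V)"
 unfolding carrier_tensor pure_tensor_def by auto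

lemma tensor_ext:
 assumes "vs N" "f : lin (tensor U V) N" "g : lin (tensor U V) N"
 and "!!u v. u : car U ==> v : car V ==> f (pt U V u v) = g (pt U V u v)"
 and "X : car (tensor U V)"
 shows "f X = g X"
proof -
 obtain h where h: "h : car FS" "X = prj h" using assms(5) by (auto simp: carrier_tensor)
 have "f (prj h) = g (prj h)"
 using free_space_span[OF h(1)]
 by (rule vspan_ext[OF vs_free_space assms(1) lin_comp[OF prj_linear assms(2)]
 lin_comp[OF prj_linear assms(3)], rotated 2]) (use assms(4) in \<open>auto simp: pure_tensor_def\<close>)
 thus ?thesis using h by simp
qed

lemma tensor_span_pure:
 assumes "X : car (tensor U V)"
 shows "X : vspan (tensor U V) {pt U V u v |u v. u : car U & v : car V}"
 (is "_ : vspan _ ?S")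
proof -
 obtain h where h: "h : car FS" "X = prj h" using assms by (auto simp: carrier_tensor)
 have S: "?S <= car (tensor U V)" using pure_closed by auto
 show ?thesis unfolding h(2)
 by (rule vspan_image[OF vs_free_space vs_tensor prj_linear vspan_submodule(1)[OF vs_tensor S] _ _
 free_space_span[OF h(1)]])
 (use vspan_submodule(2)[OF vs_tensor S] in \<open>auto simp: pure_tensor_def\<close>)
qed

text \<open>Well-definedness is reduced to scalar-valued bilinear maps: composing with a functional
  leaves \<open>tensor_relations_kill\<close>, and functionals separate the points of
  \<open>N\<close>.\<close>

lemma tensor_sum_prj:
 assumes "vs N" "bil U V N f" "g : car FS"
 shows "tsum N (prj g) f = lift N (%(u, v). f u v) g"
proof -
 have fN: "(%(u, v). f u v) : car U \<times> car V \<rightarrow> car N"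
 using bil_closed[OF assms(2)] by auto
 have l: "lift N (%(u, v). f u v) : lin FS N" by (rule lift_linear[OF assms(1) fN])
 interpret N: vspace N using assms by (simp add: vspace_def)
 have kill: "lift N (%(u, v). f u v) z = (zero N)" if z: "z : tensor_relations U V" for z
 proof (rule functional_eqI[OF assms(1)])
 have zc: "z : car FS"
 by (rule subsetD[OF submodule_subset[OF vs_free_space tensor_relations_submodule[OF vsU vsV]] z])
 thus "lift N (%(u, v). f u v) z : car N" by (rule lin_closed[OF l])
 fix ph assume ph: "ph : lin N scalars"
 have "ph (lift N (%(u, v). f u v) z) = ev z (%(u, v). ph (f u v))"
 using fN zc by (subst lin_lift_scalars[OF assms(1) ph]) (auto simp: split_def)
 also have "... = 0"
 by (rule tensor_relations_kill[OF vsU vsV bil_comp[OF assms(2) ph] z])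
 finally show "ph (lift N (%(u, v). f u v) z) = ph (zero N)"
 using lin_zero[OF assms(1) vsk ph] by simp
 qed simp
 show ?thesis unfolding tensor_sum_def class_sum_lift
 by (rule coset_the_elem[OF vs_free_space tensor_relations_submodule[OF vsU vsV] assms(1) l kill assms(3)])
qed

lemma tensor_sum_linear:
 assumes "vs N" "bil U V N f"
 shows "(%X. tsum N X f) : lin (tensor U V) N"
proof -
 have fN: "(%(u, v). f u v) : car U \<times> car V \<rightarrow> car N"
 using bil_closed[OF assms(2)] by auto
 have l: "lift N (%(u, v). f u v) : lin FS N" by (rule lift_linear[OF assms(1) fN])
 interpret FS: vspace FS using vs_free_space by (simp add: vspace_def)
 show ?thesis
 proof (rule linI)
 fix X assume "X : car (tensor U V)"
 then obtain g where g: "g : car FS" "X = prj g" by (auto simp: carrier_tensor)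
 show "tsum N X f : car N" using g lin_closed[OF l g(1)] by (simp add: tensor_sum_prj[OF assms])
 show "tsum N (c \<odot>\<^bsub>tensor U V\<^esub> X) f = c \<odot>\<^bsub>N\<^esub> tsum N X f" for c
 proof -
 have "c \<odot>\<^bsub>FS\<^esub> g : car FS" using g(1) by (intro FS.smult_closed) auto
 thus ?thesis
 using g lin_smult[OF prj_linear g(1), of c] lin_smult[OF l g(1), of c]
 by (metis tensor_sum_prj[OF assms])
 qed
 fix Y assume "Y : car (tensor U V)"
 then obtain h where h: "h : car FS" "Y = prj h" by (auto simp: carrier_tensor)
 have "g \<oplus>\<^bsub>FS\<^esub> h : car FS" using g(1) h(1) by (intro FS.M.a_closed)
 thus "tsum N (X \<oplus>\<^bsub>tensor U V\<^esub> Y) f = tsum N X f \<oplus>\<^bsub>N\<^esub> tsum N Y f"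
 using g h lin_add[OF prj_linear g(1) h(1)] lin_add[OF l g(1) h(1)]
 by (metis tensor_sum_prj[OF assms])
 qed
qed

lemma tensor_sum_pure:
 assumes "vs N" "bil U V N f" "u : car U" "v : car V"
 shows "tsum N (pt U V u v) f = f u v"
proof -
 interpret N: vspace N using assms by (simp add: vspace_def)
 have "f u v : car N" using assms by (auto intro: bil_closed)
 thus ?thesis
 unfolding pure_tensor_def using assms N.smult_one
 by (subst tensor_sum_prj) (auto simp: lift_single)
qed

lemma bil_pure: "bil U V (tensor U V) (pt U V)"
proof -
 interpret U: vspace U using vsU by (simp add: vspace_def)
 interpret V: vspace V using vsV by (simp add: vspace_def)
 interpret T: vspace "tensor U V" using vs_tensor by (simp add: vspace_def)
 let ?R = "tensor_relations U V"
 have S: "S <= vspan FS S" for S by (auto simp: vspan_def)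
 have eq: "prj a = prj b" if "a - b : ?R" "ks a <= car U \<times> car V" "ks b <= car U \<times> car V"
 for a b :: "'u \<times> 'v \<Rightarrow>\<^sub>0 'k"
 proof -
 have "\<ominus>\<^bsub>FS\<^esub> b = - b"
 using that by (subst vs_minus[OF vs_free_space]) (auto intro: ev_eqI)
 hence "a \<ominus>\<^bsub>FS\<^esub> b = a - b" by (simp add: a_minus_def)
 thus ?thesis
 using coset_eq_iff[OF vs_free_space tensor_relations_submodule[OF vsU vsV], of a b] that by simp
 qed
 have sgc: "c \<odot>\<^bsub>tensor U V\<^esub> pt U V u v = prj (sg (u, v) c)" if "u : car U" "v : car V" for c u v
 using lin_smult[OF prj_linear, of "sg (u, v) 1" c] that by (simp add: pure_tensor_def)
 have adc: "pt U V u v \<oplus>\<^bsub>tensor U V\<^esub> pt U V u' v' = prj (sg (u, v) 1 + sg (u', v') 1)"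
 if "u : car U" "v : car V" "u' : car U" "v' : car V" for u v u' v'
 using lin_add[OF prj_linear, of "sg (u, v) 1" "sg (u', v') 1"] that by (simp add: pure_tensor_def)
 show ?thesis unfolding bil_def
 proof (intro conjI ballI linI)
 fix v u u' assume *: "v : car V" "u : car U" "u' : car U"
 show "pt U V (u \<oplus>\<^bsub>U\<^esub> u') v = pt U V u v \<oplus>\<^bsub>tensor U V\<^esub> pt U V u' v"
 unfolding adc[OF *(2,1,3,1)] unfolding pure_tensor_def
 proof (rule eq)
 show "sg (u \<oplus>\<^bsub>U\<^esub> u', v) 1 - (sg (u, v) 1 + sg (u', v) 1) : ?R"
 unfolding tensor_relations_gens diff_diff_add[symmetric]
 by (rule subsetD[OF S]) (use * in \<open>unfold tensor_gens_def, blast\<close>)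
 qed (use * in \<open>simp_all add: keys_add_subset\<close>)
 next
 fix u v v' assume *: "u : car U" "v : car V" "v' : car V"
 show "pt U V u (v \<oplus>\<^bsub>V\<^esub> v') = pt U V u v \<oplus>\<^bsub>tensor U V\<^esub> pt U V u v'"
 unfolding adc[OF *(1,2,1,3)] unfolding pure_tensor_def
 proof (rule eq)
 show "sg (u, v \<oplus>\<^bsub>V\<^esub> v') 1 - (sg (u, v) 1 + sg (u, v') 1) : ?R"
 unfolding tensor_relations_gens diff_diff_add[symmetric]
 by (rule subsetD[OF S]) (use * in \<open>unfold tensor_gens_def, blast\<close>)
 qed (use * in \<open>simp_all add: keys_add_subset\<close>)
 next
 fix v c u assume *: "v : car V" "u : car U"
 show "pt U V (c \<odot>\<^bsub>U\<^esub> u) v = c \<odot>\<^bsub>tensor U V\<^esub> pt U V u v"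
 unfolding sgc[OF *(2,1)] unfolding pure_tensor_def
 proof (rule eq)
 show "sg (c \<odot>\<^bsub>U\<^esub> u, v) 1 - sg (u, v) c : ?R"
 unfolding tensor_relations_gens
 by (rule subsetD[OF S]) (use * in \<open>unfold tensor_gens_def, blast\<close>)
 qed (use * U.smult_closed[of c u] in auto)
 next
 fix u c v assume *: "u : car U" "v : car V"
 show "pt U V u (c \<odot>\<^bsub>V\<^esub> v) = c \<odot>\<^bsub>tensor U V\<^esub> pt U V u v"
 unfolding sgc[OF *] unfolding pure_tensor_def
 proof (rule eq)
 show "sg (u, c \<odot>\<^bsub>V\<^esub> v) 1 - sg (u, v) c : ?R"
 unfolding tensor_relations_gens
 by (rule subsetD[OF S]) (use * in \<open>unfold tensor_gens_def, blast\<close>)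
 qed (use * V.smult_closed[of c v] in auto)
 qed (use pure_closed in auto)
qed

lemma tensor_sum_cong:
 assumes "vs N" "bil U V N f" "X : car (tensor U V)"
 and "!!u v. u : car U ==> v : car V ==> f u v = g u v"
 shows "tsum N X f = tsum N X g"
proof -
 have g: "bil U V N g" by (rule bil_cong[OF vsU vsV assms(2,4)])
 show ?thesis
 by (rule tensor_ext[OF assms(1) tensor_sum_linear[OF assms(1,2)] tensor_sum_linear[OF assms(1) g] _ assms(3)])
 (simp add: tensor_sum_pure assms g)
qed

lemma tensor_sum_closed:
 "vs N ==> bil U V N f ==> X : car (tensor U V) ==> tsum N X f : car N"
 by (rule lin_closed[OF tensor_sum_linear])

lemma lin_tensor_sum:
 assumes "vs N" "vs N'" "bil U V N f" "ph : lin N N'" "X : car (tensor U V)"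
 shows "ph (tsum N X f) = tsum N' X (%u v. ph (f u v))"
 by (rule tensor_ext[OF assms(2) lin_comp[OF tensor_sum_linear[OF assms(1,3)] assms(4)]
 tensor_sum_linear[OF assms(2) bil_comp[OF assms(3,4)]] _ assms(5)])
 (simp add: tensor_sum_pure assms(1,2,3) bil_comp[OF assms(3,4)])

lemma lin_tensor_sum_arg:
 "vs N ==> bil U V N f ==> h : lin M (tensor U V) ==>
 (%x. tsum N (h x) f) : lin M N"
 by (rule lin_comp[OF _ tensor_sum_linear])

lemma lin_tensor_sum_fun:
 assumes "vs M" "vs N" "X : car (tensor U V)"
 and "!!x. x : car M ==> bil U V N (f x)"
 and "!!u v. u : car U ==> v : car V ==> (%x. f x u v) : lin M N"
 shows "(%x. tsum N X (f x)) : lin M N"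
proof -
 interpret M: vspace M using assms by (simp add: vspace_def)
 note l = tensor_sum_linear[OF assms(2)]
 show ?thesis
 proof (rule linI)
 fix x assume x: "x : car M"
 show "tsum N X (f x) : car N" by (rule tensor_sum_closed) (use x assms in auto)
 show "tsum N X (f (c \<odot>\<^bsub>M\<^esub> x)) = c \<odot>\<^bsub>N\<^esub> tsum N X (f x)" for c
 proof (rule tensor_ext[OF assms(2) l lin_smult_right[OF assms(2) l] _ assms(3)])
 show cx: "bil U V N (f (c \<odot>\<^bsub>M\<^esub> x))" "bil U V N (f x)" using x assms(4) by auto
 show "tsum N (pt U V u v) (f (c \<odot>\<^bsub>M\<^esub> x)) = c \<odot>\<^bsub>N\<^esub> tsum N (pt U V u v) (f x)"
 if "u : car U" "v : car V" for u v
 using that cx x lin_smult[OF assms(5)] by (simp add: tensor_sum_pure assms(2))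
 qed
 fix y assume y: "y : car M"
 show "tsum N X (f (x \<oplus>\<^bsub>M\<^esub> y)) = tsum N X (f x) \<oplus>\<^bsub>N\<^esub> tsum N X (f y)"
 proof (rule tensor_ext[OF assms(2) l lin_plus[OF assms(2) l l] _ assms(3)])
 show cx: "bil U V N (f (x \<oplus>\<^bsub>M\<^esub> y))" "bil U V N (f x)" "bil U V N (f y)" using x y assms(4) by auto
 show "tsum N (pt U V u v) (f (x \<oplus>\<^bsub>M\<^esub> y)) =
 tsum N (pt U V u v) (f x) \<oplus>\<^bsub>N\<^esub> tsum N (pt U V u v) (f y)"
 if "u : car U" "v : car V" for u v
 using that cx x y lin_add[OF assms(5)] by (simp add: tensor_sum_pure assms(2))
 qed
 qed
qed

text \<open>Sums over the image of A tensor B are controlled by their values on pure tensors. This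
  is how coactions and coproducts are shown to stay inside a subspace.\<close>

lemma tensor_sum_mem:
 assumes "vs N" "submodule S scalars N" "bil U V N f" "X : tensor_span U V A B"
 and "A <= car U" "B <= car V" "!!u v. u : A ==> v : B ==> f u v : S"
 shows "tsum N X f : S"
proof (rule vspan_image[OF vs_tensor assms(1) tensor_sum_linear[OF assms(1,3)] assms(2)])
 show "X : vspan (tensor U V) {pt U V u v |u v. u : A & v : B}"
 using assms(4) by (simp add: tensor_span_def)
 show "{pt U V u v |u v. u : A & v : B} <= car (tensor U V)"
 using pure_closed assms(5,6) by auto
 fix x assume "x : {pt U V u v |u v. u : A & v : B}"
 then obtain u v where "u : A" "v : B" "x = pt U V u v" by auto
 thus "tsum N x f : S" using assms by (simp add: tensor_sum_pure subsetD)
qed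

lemma tensor_span_carrier: "tensor_span U V (car U) (car V) = car (tensor U V)"
proof
 have S: "{pt U V u v |u v. u : car U & v : car V} <= car (tensor U V)"
 using pure_closed by auto
 show "tensor_span U V (car U) (car V) <= car (tensor U V)"
 unfolding tensor_span_def by (rule submodule_subset[OF vs_tensor vspan_submodule(1)[OF vs_tensor S]])
qed (auto simp: tensor_span_def intro: tensor_span_pure)

text \<open>Coordinates with respect to pairs of basis vectors. The map
  \<open>coords (tensor U V)\<close> would refer to some chosen basis of the tensor product that has
  no relation to pure tensors.\<close>

definition coords2 :: "('u \<times> 'v \<Rightarrow>\<^sub>0 'k) set => ('u \<times> 'v \<Rightarrow>\<^sub>0 'k)" where
 "coords2 X = tsum (free_space (basis U \<times> basis V)) X (%u v. pair (coords U u) (coords V v))"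

lemma bil_pair: "bil U V (free_space (basis U \<times> basis V)) (%u v. pair (coords U u) (coords V v))"
proof -
 have k: "ks (pair (coords U u) (coords V v)) <= basis U \<times> basis V"
 if "u : car U" "v : car V" for u v
 unfolding pair_def using keys_coords[OF vsU that(1)] keys_coords[OF vsV that(2)]
 by (intro keys_bind) auto
 show ?thesis unfolding bil_def
 using k by (auto intro!: linI ev2_eqI simp: lin_add[OF coords_linear[OF vsU]] lin_smult[OF coords_linear[OF vsU]]
 lin_add[OF coords_linear[OF vsV]] lin_smult[OF coords_linear[OF vsV]] ev_fun_plus ev_fun_mult_left)
qed

lemma coords2_linear: "coords2 : lin (tensor U V) (free_space (basis U \<times> basis V))"
 unfolding coords2_def[abs_def] by (rule tensor_sum_linear[OF vs_free_space bil_pair])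

lemma keys_coords2: "X : car (tensor U V) ==> ks (coords2 X) <= basis U \<times> basis V"
 using lin_closed[OF coords2_linear] by simp

lemma lin_ev2: "(%g. ev2 g F) : lin (free_space X) scalars"
 by (rule linI) simp_all

lemma ev2_coords2:
 "X : car (tensor U V) ==> ev2 (coords2 X) F =
 tsum scalars X (%u v. ev (coords U u) (%a. ev (coords V v) (%b. F a b)))"
 unfolding coords2_def
 by (subst lin_tensor_sum[OF vs_free_space vsk bil_pair lin_ev2]) simp_all

lemma bil_expand:
 assumes "bil U V scalars F" "u : car U" "v : car V"
 shows "ev (coords U u) (%a. ev (coords V v) (%b. F a b)) = F u v"
proof -
 have "ev (coords U u) (%a. ev (coords V v) (%b. F a b)) = ev (coords U u) (%a. F a v)"
 using assms keys_coords[OF vsU assms(2)] basis_carrier[OF vsU]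
 by (intro ev_cong ev_coords[OF vsV]) (auto simp: bil_def)
 also have "... = F u v"
 using assms by (intro ev_coords[OF vsU]) (auto simp: bil_def)
 finally show ?thesis .
qed

text \<open>The bridge from coordinates to Sweedler sums. It holds for bilinear integrands; for
  others the left side still makes sense, while the right side may depend on the
  representative.\<close>

lemma ev2_coords2_bil:
 assumes "bil U V scalars F" "X : car (tensor U V)"
 shows "ev2 (coords2 X) F = tsum scalars X F"
 unfolding ev2_coords2[OF assms(2)]
 by (rule tensor_sum_cong[symmetric, OF vsk assms]) (simp add: bil_expand[OF assms(1)])

lemma tensor_functional_eqI:
 assumes "X : car (tensor U V)" "Y : car (tensor U V)"
 and "!!F. bil U V scalars F ==> tsum scalars X F = tsum scalars Y F"
 shows "X = Y"
proof (rule functional_eqI[OF vs_tensor assms(1,2)])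
 fix ph assume ph: "ph : lin (tensor U V) scalars"
 have b: "bil U V scalars (%u v. ph (pt U V u v))" by (rule bil_comp[OF bil_pure ph])
 have "ph Z = tsum scalars Z (%u v. ph (pt U V u v))" if "Z : car (tensor U V)" for Z
 by (rule tensor_ext[OF vsk ph tensor_sum_linear[OF vsk b] _ that])
 (simp add: tensor_sum_pure[OF vsk b])
 thus "ph X = ph Y" using assms b by metis
qed

end

lemma vs2I: "vs U ==> vs V ==> vs2 U V"
 by (simp add: vs2_def)

section \<open>Structure maps in coordinates\<close>

text \<open>
 A linear map into a space with basis \<open>B\<close> is recorded by the linear combinations to which it
 sends the basis elements of its source.  Identities between structure maps then become
 identities between iterated sums \<open>ev\<close>, \<open>ev2\<close> of an arbitrary function, with
 no multilinearity condition on that function.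
\<close>

locale bialg_coord =
 fixes B :: "'h set" and mu :: "'h => 'h => 'h \<Rightarrow>\<^sub>0 'k::field" and un :: "'h \<Rightarrow>\<^sub>0 'k"
 and D :: "'h => 'h \<times> 'h \<Rightarrow>\<^sub>0 'k" and e :: "'h => 'k"
 assumes mu_keys: "ks (mu a b) <= B" and un_keys: "ks un <= B" and D_keys: "ks (D a) <= B \<times> B"
 and D_out: "a \<notin> B ==> D a = 0" and e_out: "a \<notin> B ==> e a = 0"
 and mu_assoc: "ev (mu a b) (%x. ev (mu x c) f) = ev (mu b c) (%x. ev (mu a x) f)"
 and un_l: "a : B ==> ev un (%u. ev (mu u a) f) = f a"
 and un_r: "a : B ==> ev un (%u. ev (mu a u) f) = f a"
 and D_coassoc: "ev2 (D h) (%a b. ev2 (D a) (%c d. F c d b)) =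
 ev2 (D h) (%a b. ev2 (D b) (%c d. F a c d))"
 and counit_l: "h : B ==> ev2 (D h) (%a b. e a * f b) = f h"
 and counit_r: "h : B ==> ev2 (D h) (%a b. e b * f a) = f h"
 and D_mu: "ev (mu a b) (%x. ev2 (D x) g) = ev2 (D a) (%a1 a2. ev2 (D b) (%b1 b2.
 ev (mu a1 b1) (%x. ev (mu a2 b2) (%y. g x y))))"
 and D_un: "ev un (%u. ev2 (D u) g) = ev un (%u. ev un (%v. g u v))"
 and e_mu: "ev (mu a b) e = e a * e b"
 and e_un: "ev un e = 1"
begin

lemma D_cong: "(!!a b. a : B ==> b : B ==> F a b = G a b) ==> ev2 (D h) F = ev2 (D h) G"
 using D_keys[of h] by (intro ev2_cong) blast

text \<open>Rebrackets a fourfold coproduct so that the two middle legs are the legs of one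
  coproduct and can be treated together.\<close>

lemma D4: "ev2 (D h) (%a b. ev2 (D b) (%h3 h4. ev2 (D a) (%l1 l2. F l1 l2 h3 h4))) =
 ev2 (D h) (%l1 x. ev2 (D x) (%y h4. ev2 (D y) (%l2 h3. F l1 l2 h3 h4)))"
proof -
 have "ev2 (D h) (%a b. ev2 (D b) (%h3 h4. ev2 (D a) (%l1 l2. F l1 l2 h3 h4))) =
 ev2 (D h) (%a b. ev2 (D a) (%l1 l2. ev2 (D b) (%h3 h4. F l1 l2 h3 h4)))"
 by (rule ev2_cong) (rule ev2_swap)
 thus ?thesis by (simp only: D_coassoc)
qed

lemma un_cong: "(!!a. a : B ==> f a = g a) ==> ev un f = ev un g"
 using un_keys by (intro ev_cong) blast

lemma mu_cong: "(!!a. a : B ==> f a = g a) ==> ev (mu x y) f = ev (mu x y) g"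
 using mu_keys[of x y] by (intro ev_cong) blast

end

text \<open>Only the inverse antipode \<open>Si\<close> is kept, as it is the one that occurs in
  (B.1), (C.2) and the twisted form. \<open>Si_l\<close> and \<open>Si_r\<close> say that it is an
  antipode for the opposite product.\<close>

locale hopf_coord = bialg_coord B mu un D e
 for B :: "'h set" and mu :: "'h => 'h => 'h \<Rightarrow>\<^sub>0 'k::field" and un D e +
 fixes Si :: "'h => 'h \<Rightarrow>\<^sub>0 'k"
 assumes Si_keys: "ks (Si a) <= B"
 and Si_l: "ev2 (D h) (%a b. ev (Si b) (%s. ev (mu s a) f)) = e h * ev un f"
 and Si_r: "ev2 (D h) (%a b. ev (Si a) (%s. ev (mu b s) f)) = e h * ev un f"
 and Si_mu: "ev (mu a b) (%x. ev (Si x) f) = ev (Si a) (%s. ev (Si b) (%t. ev (mu t s) f))"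
 and Si_D: "ev (Si h) (%s. ev2 (D s) g) =
 ev2 (D h) (%a b. ev (Si a) (%s. ev (Si b) (%t. g t s)))"
 and Si_un: "ev un (%u. ev (Si u) f) = ev un f"
 and e_Si: "ev (Si h) e = e h"
begin

lemma Si_cong: "(!!a. a : B ==> f a = g a) ==> ev (Si x) f = ev (Si x) g"
 using Si_keys[of x] by (intro ev_cong) blast

end

text \<open>The raw axioms of a Hopf algebra with bijective antipode, from which the laws of
  \<open>hopf_coord\<close> are derived. Vanishing off the basis lets the derived laws hold for all
  arguments.\<close>

locale antipode_coord = bialg_coord B mu un D e
 for B :: "'h set" and mu :: "'h => 'h => 'h \<Rightarrow>\<^sub>0 'k::field" and un D e +
 fixes S Si :: "'h => 'h \<Rightarrow>\<^sub>0 'k"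
 assumes S_keys: "ks (S a) <= B" and Si_keys: "ks (Si a) <= B"
 and S_out: "a \<notin> B ==> S a = 0" and Si_out: "a \<notin> B ==> Si a = 0"
 and mu_out: "a \<notin> B \<or> b \<notin> B ==> mu a b = 0"
 and S_l: "ev2 (D h) (%a b. ev (S a) (%s. ev (mu s b) f)) = e h * ev un f"
 and S_r: "ev2 (D h) (%a b. ev (S b) (%s. ev (mu a s) f)) = e h * ev un f"
 and Si_S: "a : B ==> ev (S a) (%s. ev (Si s) f) = f a"
 and S_Si: "a : B ==> ev (Si a) (%s. ev (S s) f) = f a"
begin

lemma S_cong: "(!!a. a : B ==> f a = g a) ==> ev (S x) f = ev (S x) g"
 using S_keys[of x] by (intro ev_cong) blast

lemma Si_cong: "(!!a. a : B ==> f a = g a) ==> ev (Si x) f = ev (Si x) g"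
 using Si_keys[of x] by (intro ev_cong) blast

lemma S_un: "ev un (%u. ev (S u) f) = ev un f"
proof -
 have "ev un (%u. ev2 (D u) (%a b. ev (S a) (%s. ev (mu s b) f))) = ev un f"
 by (simp add: S_l ev_fun_mult_right e_un)
 moreover have "ev un (%u. ev2 (D u) (%a b. ev (S a) (%s. ev (mu s b) f))) =
 ev un (%u. ev (S u) (%s. ev un (%v. ev (mu s v) f)))"
 by (simp add: D_un ev_swap[of un "S u" for u])
 moreover have "... = ev un (%u. ev (S u) f)"
 by (rule ev_cong, rule S_cong, rule un_r)
 ultimately show ?thesis by simp
qed

text \<open>Uniqueness of convolution inverses for maps from H tensor H to H: the product
  \<open>ab\<close> has S(ab) as a left inverse and S(b)S(a) as a right inverse. \<open>W\<close> is
  the convolution of all three, evaluated in both bracketings.\<close>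

lemma S_mu: "ev (mu a b) (%x. ev (S x) f) = ev (S b) (%s. ev (S a) (%t. ev (mu s t) f))"
proof (cases "a : B & b : B")
 case False
 thus ?thesis using mu_out[of a b] S_out by auto
next
 case True
 hence a: "a : B" and b: "b : B" by auto
 define W where "W = ev2 (D a) (%a1 a'. ev2 (D b) (%b1 b'. ev2 (D a') (%a2 a3. ev2 (D b') (%b2 b3.
 ev (mu a1 b1) (%x. ev (S x) (%x'. ev (mu a2 b2) (%y. ev (S b3) (%s. ev (S a3) (%t.
 ev (mu s t) (%z. ev (mu y z) (%w. ev (mu x' w) f)))))))))))"
 have "W = ev2 (D a) (%a' a3. ev2 (D b) (%b' b3. ev (S b3) (%s. ev (S a3) (%t. ev (mu s t) (%z.
 ev2 (D a') (%a1 a2. ev2 (D b') (%b1 b2. ev (mu a1 b1) (%x. ev (mu a2 b2) (%y. ev (S x) (%x'.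
 ev (mu x' y) (%v. ev (mu v z) f)))))))))))"
 proof -
 have "W = ev2 (D a) (%a1 a'. ev2 (D a') (%a2 a3. ev2 (D b) (%b1 b'. ev2 (D b') (%b2 b3.
 ev (S b3) (%s. ev (S a3) (%t. ev (mu s t) (%z.
 ev (mu a1 b1) (%x. ev (mu a2 b2) (%y. ev (S x) (%x'. ev (mu x' y) (%v. ev (mu v z) f)))))))))))"
 proof -
 have "ev (mu a1 b1) (%x. ev (S x) (%x'. ev (mu a2 b2) (%y. ev (S b3) (%s. ev (S a3) (%t.
 ev (mu s t) (%z. ev (mu y z) (%w. ev (mu x' w) f))))))) =
 ev (S b3) (%s. ev (S a3) (%t. ev (mu s t) (%z.
 ev (mu a1 b1) (%x. ev (mu a2 b2) (%y. ev (S x) (%x'. ev (mu x' y) (%v. ev (mu v z) f)))))))" (is "?l = ?r") for a1 b1 a2 b2 a3 b3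
 proof -
 define Z where "Z = bind (S b3) (%s. bind (S a3) (%t. mu s t))"
 have Z: "ev (S b3) (%s. ev (S a3) (%t. ev (mu s t) h)) = ev Z h" for h
 by (simp add: Z_def)
 have "?r = ev (mu a1 b1) (%x. ev (mu a2 b2) (%y. ev (S x) (%x'. ev Z (%z. ev (mu x' y) (%v. ev (mu v z) f)))))"
 unfolding Z by (simp only: ev_swap[of Z "mu a1 b1"] ev_swap[of Z "mu a2 b2"] ev_swap[of Z "S x" for x])
 also have "... = ev (mu a1 b1) (%x. ev (S x) (%x'. ev (mu a2 b2) (%y. ev Z (%z. ev (mu x' y) (%v. ev (mu v z) f)))))"
 by (rule ev_cong, rule ev_swap)
 also have "... = ?l" unfolding Z by (simp only: mu_assoc)
 finally show ?thesis by (rule sym)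
 qed
 thus ?thesis unfolding W_def by (simp only: ev2_swap[of "D b" "D a'" for a'])
 qed
 also have "... = ev2 (D a) (%a' a3. ev2 (D a') (%a1 a2. ev2 (D b) (%b' b3. ev2 (D b') (%b1 b2.
 ev (S b3) (%s. ev (S a3) (%t. ev (mu s t) (%z.
 ev (mu a1 b1) (%x. ev (mu a2 b2) (%y. ev (S x) (%x'. ev (mu x' y) (%v. ev (mu v z) f)))))))))))"
 by (simp only: D_coassoc)
 finally show ?thesis by (simp add: ev_ev2_swap ev2_swap[of "D b" "D a'" for a'])
 qed
 also have "... = ev2 (D a) (%a' a3. ev2 (D b) (%b' b3. e a' * (e b' * ev (S b3) (%s. ev (S a3) (%t. ev (mu s t) (%z.
 ev un (%v. ev (mu v z) f)))))))"
 proof -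
 have "ev2 (D a') (%a1 a2. ev2 (D b') (%b1 b2. ev (mu a1 b1) (%x. ev (mu a2 b2) (%y. ev (S x) (%x'.
 ev (mu x' y) h))))) = e a' * (e b' * ev un h)" for a' b' h
 unfolding D_mu[symmetric] S_l by (simp add: ev_fun_mult_right e_mu)
 thus ?thesis by (simp add: ev_fun_mult_left)
 qed
 also have "... = ev2 (D a) (%a' a3. e a' * ev2 (D b) (%b' b3. e b' * ev (S b3) (%s. ev (S a3) (%t. ev (mu s t) (%z.
 ev un (%v. ev (mu v z) f))))))"
 by (simp add: ev2_fun_mult_left)
 also have "... = ev (S b) (%s. ev (S a) (%t. ev (mu s t) (%z. ev un (%v. ev (mu v z) f))))"
 unfolding counit_l[OF b] by (rule counit_l[OF a])
 also have "... = ev (S b) (%s. ev (S a) (%t. ev (mu s t) f))"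
 by (rule ev_cong, rule ev_cong, rule mu_cong, rule un_l)
 finally have 1: "W = ev (S b) (%s. ev (S a) (%t. ev (mu s t) f))" .
 \<comment> \<open>The other bracketing: b_2 S(b_3) collapses first, then a_2 S(a_3), and S(ab)
   remains.\<close>
 have "W = ev2 (D a) (%a1 a'. ev2 (D b) (%b1 b'. ev (mu a1 b1) (%x. ev (S x) (%x'.
 ev2 (D a') (%a2 a3. ev (S a3) (%t. ev2 (D b') (%b2 b3. ev (S b3) (%s. ev (mu b2 s) (%v. ev (mu v t) (%z.
 ev (mu a2 z) (%w. ev (mu x' w) f)))))))))))"
 proof -
 have "ev (mu a2 b2) (%y. ev (S b3) (%s. ev (S a3) (%t. ev (mu s t) (%z. ev (mu y z) h)))) =
 ev (S a3) (%t. ev (S b3) (%s. ev (mu b2 s) (%v. ev (mu v t) (%z. ev (mu a2 z) h))))" (is "?l = ?r") for a2 b2 a3 b3 h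
 proof -
 have "?l = ev (S b3) (%s. ev (S a3) (%t. ev (mu s t) (%z. ev (mu a2 b2) (%y. ev (mu y z) h))))"
 by (simp only: ev_swap[of "mu a2 b2" "S x" for x] ev_swap[of "mu a2 b2" "mu s t" for s t])
 also have "... = ev (S b3) (%s. ev (S a3) (%t. ev (mu b2 s) (%v. ev (mu v t) (%z. ev (mu a2 z) h))))"
 by (simp only: mu_assoc)
 also have "... = ?r" by (rule ev_swap)
 finally show ?thesis .
 qed
 thus ?thesis unfolding W_def by (simp add: ev_ev2_swap ev2_swap[of "D b" "D a'" for a'])
 qed
 also have "... = ev2 (D a) (%a1 a'. ev2 (D b) (%b1 b'. ev (mu a1 b1) (%x. ev (S x) (%x'.
 ev2 (D a') (%a2 a3. ev (S a3) (%t. e b' * ev (mu a2 t) (%w. ev (mu x' w) f)))))))"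
 unfolding S_r by (intro ev2_cong ev_cong S_cong) (simp add: un_l)
 also have "... = ev2 (D a) (%a1 a'. ev2 (D b) (%b1 b'. e b' * ev (mu a1 b1) (%x. ev (S x) (%x'.
 e a' * ev un (%w. ev (mu x' w) f)))))"
 by (simp add: ev_fun_mult_left ev2_fun_mult_left S_r)
 also have "... = ev2 (D a) (%a1 a'. e a' * ev (mu a1 b) (%x. ev (S x) (%x'. ev un (%w. ev (mu x' w) f))))"
 unfolding counit_r[OF b] by (simp add: ev_fun_mult_left)
 also have "... = ev (mu a b) (%x. ev (S x) (%x'. ev un (%w. ev (mu x' w) f)))"
 by (rule counit_r[OF a])
 also have "... = ev (mu a b) (%x. ev (S x) f)"
 by (rule ev_cong, rule S_cong, rule un_r)
 finally show ?thesis using 1 by simp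
qed

text \<open>The dual argument, for maps from H to H tensor H: the coproduct has the convolution
  inverse Delta(S(h)) on the left and S(h_2) tensor S(h_1) on the right, and \<open>W\<close> is the
  convolution of the three.\<close>

lemma S_D: "ev (S h) (%s. ev2 (D s) g) = ev2 (D h) (%a b. ev (S b) (%t. ev (S a) (%s. g t s)))"
proof (cases "h : B")
 case False
 thus ?thesis by (simp add: S_out D_out)
next
 case h: True
 define W where "W = ev2 (D h) (%a k. ev2 (D k) (%b l. ev2 (D b) (%b1 b2. ev2 (D l) (%c d.
 ev (S a) (%s. ev2 (D s) (%s1 s2. ev (S d) (%x. ev (S c) (%y.
 ev (mu s1 b1) (%p. ev (mu s2 b2) (%q. ev (mu p x) (%p'. ev (mu q y) (%q'. g p' q'))))))))))))"
 have "W = ev2 (D h) (%k l. ev2 (D l) (%c d. ev2 (D k) (%a b. ev (S a) (%s. ev (mu s b) (%m. ev2 (D m) (%p q.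
 ev (S d) (%x. ev (S c) (%y. ev (mu p x) (%p'. ev (mu q y) (%q'. g p' q'))))))))))"
 proof -
 have "ev (S d) (%x. ev (S c) (%y. ev (mu s1 b1) (%p. ev (mu s2 b2) (%q. ev (mu p x) (%p'. ev (mu q y) (%q'. g p' q')))))) =
 ev (mu s1 b1) (%p. ev (mu s2 b2) (%q. ev (S d) (%x. ev (S c) (%y. ev (mu p x) (%p'. ev (mu q y) (%q'. g p' q'))))))" for s1 s2 b1 b2 c d
 by (simp only: ev_swap[of "S x" "mu s1 b1" for x] ev_swap[of "S x" "mu s2 b2" for x])
 hence "W = ev2 (D h) (%a k. ev2 (D k) (%b l. ev2 (D l) (%c d. ev (S a) (%s. ev (mu s b) (%m. ev2 (D m) (%p q.
 ev (S d) (%x. ev (S c) (%y. ev (mu p x) (%p'. ev (mu q y) (%q'. g p' q'))))))))))"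
 proof -
 assume *: "!!d c s1 b1 s2 b2. ev (S d) (%x. ev (S c) (%y. ev (mu s1 b1) (%p. ev (mu s2 b2) (%q. ev (mu p x) (%p'. ev (mu q y) (%q'. g p' q')))))) =
 ev (mu s1 b1) (%p. ev (mu s2 b2) (%q. ev (S d) (%x. ev (S c) (%y. ev (mu p x) (%p'. ev (mu q y) (%q'. g p' q'))))))"
 have "W = ev2 (D h) (%a k. ev2 (D k) (%b l. ev2 (D b) (%b1 b2. ev2 (D l) (%c d.
 ev (S a) (%s. ev2 (D s) (%s1 s2. ev (mu s1 b1) (%p. ev (mu s2 b2) (%q. ev (S d) (%x. ev (S c) (%y.
 ev (mu p x) (%p'. ev (mu q y) (%q'. g p' q'))))))))))))"
 unfolding W_def * ..
 also have "... = ev2 (D h) (%a k. ev2 (D k) (%b l. ev2 (D l) (%c d. ev2 (D b) (%b1 b2.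
 ev (S a) (%s. ev2 (D s) (%s1 s2. ev (mu s1 b1) (%p. ev (mu s2 b2) (%q. ev (S d) (%x. ev (S c) (%y.
 ev (mu p x) (%p'. ev (mu q y) (%q'. g p' q'))))))))))))"
 by (rule ev2_cong, rule ev2_cong, rule ev2_swap)
 also have "... = ev2 (D h) (%a k. ev2 (D k) (%b l. ev2 (D l) (%c d.
 ev (S a) (%s. ev2 (D s) (%s1 s2. ev2 (D b) (%b1 b2. ev (mu s1 b1) (%p. ev (mu s2 b2) (%q. ev (S d) (%x. ev (S c) (%y.
 ev (mu p x) (%p'. ev (mu q y) (%q'. g p' q'))))))))))))"
 by ((rule ev2_cong)+, subst ev_ev2_swap[symmetric], rule ev_cong, rule ev2_swap)
 finally show ?thesis by (simp only: D_mu)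
 qed
 also have "... = ev2 (D h) (%k l. ev2 (D k) (%a b. ev2 (D l) (%c d. ev (S a) (%s. ev (mu s b) (%m. ev2 (D m) (%p q.
 ev (S d) (%x. ev (S c) (%y. ev (mu p x) (%p'. ev (mu q y) (%q'. g p' q'))))))))))"
 by (simp only: D_coassoc)
 finally show ?thesis by (simp only:) (rule ev2_cong, rule ev2_swap)
 qed
 also have "... = ev2 (D h) (%k l. e k * ev2 (D l) (%c d.
 ev un (%p. ev un (%q. ev (S d) (%x. ev (S c) (%y. ev (mu p x) (%p'. ev (mu q y) (%q'. g p' q'))))))))"
 unfolding S_l D_un by (simp add: ev2_fun_mult_left)
 also have "... = ev2 (D h) (%c d. ev (S d) (%x. ev (S c) (%y. ev un (%p. ev (mu p x) (%p'. ev un (%q. ev (mu q y) (%q'. g p' q')))))))"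
 unfolding counit_l[OF h]
 by (simp only: ev_swap[of un "S x" for x] ev_swap[of un "mu p x" for p x])
 also have "... = ev2 (D h) (%c d. ev (S d) (%x. ev (S c) (%y. g x y)))"
 proof (rule ev2_cong, rule S_cong, rule S_cong)
 fix x y assume "x : B" "y : B"
 thus "ev un (%p. ev (mu p x) (%p'. ev un (%q. ev (mu q y) (%q'. g p' q')))) = g x y"
 by (simp add: un_l)
 qed
 finally have 1: "W = ev2 (D h) (%a b. ev (S b) (%t. ev (S a) (%s. g t s)))" .
 have "W = ev2 (D h) (%a k. ev2 (D k) (%b1 l. ev2 (D l) (%m d. ev (S a) (%s. ev2 (D s) (%s1 s2.
 ev (S d) (%x. ev (mu b1 x) (%v. ev (mu s1 v) (%p'. ev2 (D m) (%b2 c. ev (S c) (%y. ev (mu b2 y) (%w. ev (mu s2 w) (%q'. g p' q'))))))))))))"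
 proof -
 have "ev (S d) (%x. ev (S c) (%y. ev (mu s1 b1) (%p. ev (mu s2 b2) (%q. ev (mu p x) (%p'. ev (mu q y) (%q'. g p' q')))))) =
 ev (S d) (%x. ev (mu b1 x) (%v. ev (mu s1 v) (%p'. ev (S c) (%y. ev (mu b2 y) (%w. ev (mu s2 w) (%q'. g p' q'))))))" (is "?l = ?r") for s1 s2 b1 b2 c d
 proof -
 have "?l = ev (S d) (%x. ev (S c) (%y. ev (mu s1 b1) (%p. ev (mu p x) (%p'. ev (mu s2 b2) (%q. ev (mu q y) (%q'. g p' q'))))))"
 by (simp only: ev_swap[of "mu s2 b2" "mu p x" for p x])
 also have "... = ev (S d) (%x. ev (S c) (%y. ev (mu b1 x) (%v. ev (mu s1 v) (%p'. ev (mu b2 y) (%w. ev (mu s2 w) (%q'. g p' q'))))))"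
 by (simp only: mu_assoc)
 also have "... = ?r"
 by (simp only: ev_swap[of "S c" "mu a x" for a x])
 finally show ?thesis .
 qed
 hence "W = ev2 (D h) (%a k. ev2 (D k) (%b1 l. ev2 (D l) (%b2 m. ev2 (D m) (%c d. ev (S a) (%s. ev2 (D s) (%s1 s2.
 ev (S d) (%x. ev (mu b1 x) (%v. ev (mu s1 v) (%p'. ev (S c) (%y. ev (mu b2 y) (%w. ev (mu s2 w) (%q'. g p' q'))))))))))))"
 unfolding W_def by (simp only: D_coassoc)
 also have "... = ev2 (D h) (%a k. ev2 (D k) (%b1 l. ev2 (D l) (%m d. ev2 (D m) (%b2 c. ev (S a) (%s. ev2 (D s) (%s1 s2.
 ev (S d) (%x. ev (mu b1 x) (%v. ev (mu s1 v) (%p'. ev (S c) (%y. ev (mu b2 y) (%w. ev (mu s2 w) (%q'. g p' q'))))))))))))"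
 by (simp only: D_coassoc)
 also have "... = ev2 (D h) (%a k. ev2 (D k) (%b1 l. ev2 (D l) (%m d. ev (S a) (%s. ev2 (D m) (%b2 c. ev2 (D s) (%s1 s2.
 ev (S d) (%x. ev (mu b1 x) (%v. ev (mu s1 v) (%p'. ev (S c) (%y. ev (mu b2 y) (%w. ev (mu s2 w) (%q'. g p' q'))))))))))))"
 by ((rule ev2_cong)+, rule ev_ev2_swap[symmetric])
 also have "... = ev2 (D h) (%a k. ev2 (D k) (%b1 l. ev2 (D l) (%m d. ev (S a) (%s. ev2 (D s) (%s1 s2. ev2 (D m) (%b2 c.
 ev (S d) (%x. ev (mu b1 x) (%v. ev (mu s1 v) (%p'. ev (S c) (%y. ev (mu b2 y) (%w. ev (mu s2 w) (%q'. g p' q'))))))))))))"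
 by ((rule ev2_cong)+, rule ev_cong, rule ev2_swap)
 also have "... = ev2 (D h) (%a k. ev2 (D k) (%b1 l. ev2 (D l) (%m d. ev (S a) (%s. ev2 (D s) (%s1 s2.
 ev (S d) (%x. ev (mu b1 x) (%v. ev (mu s1 v) (%p'. ev2 (D m) (%b2 c. ev (S c) (%y. ev (mu b2 y) (%w. ev (mu s2 w) (%q'. g p' q'))))))))))))"
 by ((rule ev2_cong)+, rule ev_cong, rule ev2_cong) (simp only: ev_ev2_swap)
 finally show ?thesis .
 qed
 also have "... = ev2 (D h) (%a k. ev2 (D k) (%b1 l. ev2 (D l) (%m d. e m * ev (S a) (%s. ev2 (D s) (%s1 s2.
 ev (S d) (%x. ev (mu b1 x) (%v. ev (mu s1 v) (%p'. g p' s2))))))))"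
 proof -
 have "ev2 (D s) (%s1 s2. ev (S d) (%x. ev (mu b1 x) (%v. ev (mu s1 v) (%p'. ev un (%w. ev (mu s2 w) (%q'. g p' q')))))) =
 ev2 (D s) (%s1 s2. ev (S d) (%x. ev (mu b1 x) (%v. ev (mu s1 v) (%p'. g p' s2))))" for s d b1
 by (rule D_cong) (simp add: un_r)
 thus ?thesis unfolding S_r by (simp add: ev_fun_mult_left ev2_fun_mult_left)
 qed
 also have "... = ev2 (D h) (%a k. ev2 (D k) (%b1 l. ev (S a) (%s. ev2 (D s) (%s1 s2.
 ev (S l) (%x. ev (mu b1 x) (%v. ev (mu s1 v) (%p'. g p' s2)))))))"
 by (rule ev2_cong, rule D_cong, rule counit_l)
 also have "... = ev2 (D h) (%a k. ev (S a) (%s. ev2 (D s) (%s1 s2. ev2 (D k) (%b1 l.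
 ev (S l) (%x. ev (mu b1 x) (%v. ev (mu s1 v) (%p'. g p' s2)))))))"
 by (rule ev2_cong, subst ev_ev2_swap[symmetric], rule ev_cong, rule ev2_swap)
 also have "... = ev2 (D h) (%a k. e k * ev (S a) (%s. ev2 (D s) (%s1 s2. g s1 s2)))"
 proof -
 have "ev2 (D s) (%s1 s2. ev un (%v. ev (mu s1 v) (%p'. g p' s2))) = ev2 (D s) (%s1 s2. g s1 s2)" for s
 by (rule D_cong) (simp add: un_r)
 thus ?thesis unfolding S_r by (simp add: ev_fun_mult_left ev2_fun_mult_left)
 qed
 also have "... = ev (S h) (%s. ev2 (D s) g)" by (rule counit_r[OF h])
 finally show ?thesis using 1 by simp
qed

lemma e_S: "ev (S h) e = e h"
proof (cases "h : B")
 case h: True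
 have "ev2 (D h) (%a b. ev (S a) (%s. ev (mu s b) e)) = e h"
 by (simp only: S_l e_un) simp
 hence "ev2 (D h) (%a b. e b * ev (S a) e) = e h"
 by (simp add: e_mu ev_fun_mult_left mult.commute)
 thus ?thesis by (simp add: counit_r[OF h])
qed (simp add: S_out e_out)

lemma Si_un: "ev un (%u. ev (Si u) f) = ev un f"
proof -
 have "ev un (%u. ev (Si u) f) = ev un (%u. ev (S u) (%s. ev (Si s) f))"
 by (rule S_un[symmetric])
 also have "... = ev un f" by (rule un_cong) (rule Si_S)
 finally show ?thesis .
qed

text \<open>Inserting \<open>S\<close> followed by its inverse lets the laws of \<open>S\<close> be
  used inside a product; this is how they are carried over to \<open>Si\<close>.\<close>

lemma mu_Si_S: "ev (mu a b) f = ev (mu a b) (%x. ev (S x) (%s. ev (Si s) f))"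
 by (rule mu_cong) (simp add: Si_S)

lemma hopf_coord: "hopf_coord B mu un D e Si"
proof unfold_locales
 fix a b h :: 'h and f :: "'h => 'k" and g :: "'h => 'h => 'k"
 show "ks (Si a) <= B" by (rule Si_keys)
 show "ev un (%u. ev (Si u) f) = ev un f" by (rule Si_un)
 have "ev2 (D h) (%a b. ev (Si b) (%s. ev (mu s a) f)) =
 ev2 (D h) (%a b. ev (S a) (%x. ev (Si b) (%s. ev (S s) (%y. ev (mu x y) (%z. ev (Si z) f)))))"
 by (subst mu_Si_S) (simp add: S_mu ev_swap[of "Si b" "S a" for a b])
 also have "... = ev2 (D h) (%a b. ev (S a) (%x. ev (mu x b) (%z. ev (Si z) f)))"
 by (rule D_cong) (simp add: S_Si)
 finally show "ev2 (D h) (%a b. ev (Si b) (%s. ev (mu s a) f)) = e h * ev un f"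
 by (simp add: S_l Si_un)
 have "ev2 (D h) (%a b. ev (Si a) (%s. ev (mu b s) f)) =
 ev2 (D h) (%a b. ev (Si a) (%s. ev (S s) (%x. ev (S b) (%y. ev (mu x y) (%z. ev (Si z) f)))))"
 by (subst mu_Si_S) (simp add: S_mu)
 also have "... = ev2 (D h) (%a b. ev (S b) (%y. ev (mu a y) (%z. ev (Si z) f)))"
 by (rule D_cong) (simp add: S_Si)
 finally show "ev2 (D h) (%a b. ev (Si a) (%s. ev (mu b s) f)) = e h * ev un f"
 by (simp add: S_r Si_un)
 show "ev (mu a b) (%x. ev (Si x) f) = ev (Si a) (%s. ev (Si b) (%t. ev (mu t s) f))"
 proof (cases "a : B & b : B")
 case True
 have "ev (Si a) (%s. ev (Si b) (%t. ev (mu t s) f)) =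
 ev (Si a) (%s. ev (Si b) (%t. ev (S s) (%x. ev (S t) (%y. ev (mu x y) (%z. ev (Si z) f)))))"
 by (subst mu_Si_S) (simp only: S_mu)
 also have "... = ev (Si a) (%s. ev (S s) (%x. ev (Si b) (%t. ev (S t) (%y. ev (mu x y) (%z. ev (Si z) f)))))"
 by (simp only: ev_swap[of "Si b" "S s" for s])
 finally show ?thesis using True by (simp add: S_Si)
 next
 case False
 thus ?thesis using mu_out[of a b] Si_out by auto
 qed
 show "ev (Si h) e = e h"
 proof (cases "h : B")
 case True
 hence "e h = ev (Si h) (%s. ev (S s) e)" by (simp add: S_Si)
 thus ?thesis by (simp only: e_S)
 qed (simp add: Si_out e_out)
 show "ev (Si h) (%s. ev2 (D s) g) = ev2 (D h) (%a b. ev (Si a) (%s. ev (Si b) (%t. g t s)))"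
 proof (cases "h : B")
 case True
 hence "ev2 (D h) (%a b. ev (Si a) (%s. ev (Si b) (%t. g t s))) =
 ev (Si h) (%x. ev (S x) (%h. ev2 (D h) (%a b. ev (Si a) (%s. ev (Si b) (%t. g t s)))))"
 by (simp add: S_Si)
 also have "... = ev (Si h) (%x. ev2 (D x) (%c d. ev (S d) (%a. ev (Si a) (%s. ev (S c) (%b. ev (Si b) (%t. g t s))))))"
 by (simp add: S_D ev_swap[of "S c" "Si a" for c a])
 also have "... = ev (Si h) (%s. ev2 (D s) g)"
 by (rule ev_cong, rule D_cong) (simp add: Si_S)
 finally show ?thesis by (rule sym)
 qed (simp add: Si_out D_out)
qed

end

locale yd_coord = hopf_coord B mu un D e Si
 for B :: "'h set" and mu :: "'h => 'h => 'h \<Rightarrow>\<^sub>0 'k::field" and un D e Si +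
 fixes BM :: "'m set" and A :: "'h => 'm => 'm \<Rightarrow>\<^sub>0 'k" and C :: "'m => 'h \<times> 'm \<Rightarrow>\<^sub>0 'k"
 assumes A_keys: "ks (A h x) <= BM" and C_keys: "ks (C x) <= B \<times> BM"
 and A_out: "h \<notin> B ==> A h x = 0"
 and A_un: "x : BM ==> ev un (%u. ev (A u x) f) = f x"
 and A_mu: "ev (mu g h) (%p. ev (A p x) f) = ev (A h x) (%y. ev (A g y) f)"
 and C_coassoc: "ev2 (C x) (%g y. ev2 (D g) (%a b. F a b y)) =
 ev2 (C x) (%g y. ev2 (C y) (%g' z. F g g' z))"
 and C_counit: "x : BM ==> ev2 (C x) (%g y. e g * f y) = f x"
 and compat: "ev2 (D h) (%h1 h2. ev2 (C x) (%g y. ev (mu h1 g) (%p. ev (A h2 y) (%z. G p z)))) =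
 ev2 (D h) (%h1 h2. ev (A h1 x) (%y. ev2 (C y) (%g z. ev (mu g h2) (%p. G p z))))"
begin

lemma A_cong: "(!!a. a : BM ==> f a = g a) ==> ev (A h x) f = ev (A h x) g"
 using A_keys[of h x] by (intro ev_cong) blast

lemma C_cong: "(!!a b. a : B ==> b : BM ==> F a b = G a b) ==> ev2 (C x) F = ev2 (C x) G"
 using C_keys[of x] by (intro ev2_cong) blast

end

text \<open>The basis is closed under the product, as the words in T(M) are, so \<open>rm\<close>
  yields basis elements rather than combinations. A Nichols algebra need not have such a basis; it
  inherits the identities through the quotient map.\<close>

locale ybi_coord = yd_coord B mu un D e Si BM A C
 for B :: "'h set" and mu :: "'h => 'h => 'h \<Rightarrow>\<^sub>0 'k::field" and un D e Si
 and BM :: "'r set" and A :: "'h => 'r => 'r \<Rightarrow>\<^sub>0 'k" and C +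
 fixes rm :: "'r => 'r => 'r" and r1 :: 'r and Dr :: "'r => 'r \<times> 'r \<Rightarrow>\<^sub>0 'k" and er :: "'r => 'k"
 assumes r1_BM: "r1 : BM" and rm_BM: "x : BM ==> y : BM ==> rm x y : BM"
 and Dr_keys: "x : BM ==> ks (Dr x) <= BM \<times> BM"
 and rm_assoc: "rm (rm x y) z = rm x (rm y z)" and rm_l: "rm r1 x = x" and rm_r: "rm x r1 = x"
 and A_rm: "ev (A h (rm x y)) f =
 ev2 (D h) (%h1 h2. ev (A h1 x) (%x'. ev (A h2 y) (%y'. f (rm x' y'))))"
 and A_r1: "ev (A h r1) f = e h * f r1"
 and C_rm: "ev2 (C (rm x y)) F =
 ev2 (C x) (%g x0. ev2 (C y) (%g' y0. ev (mu g g') (%p. F p (rm x0 y0))))"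
 and C_r1: "ev2 (C r1) F = ev un (%u. F u r1)"
 and Dr_coassoc: "ev2 (Dr x) (%a b. ev2 (Dr a) (%c d. G c d b)) =
 ev2 (Dr x) (%a b. ev2 (Dr b) (%c d. G a c d))"
 and Dr_counit_l: "x : BM ==> ev2 (Dr x) (%a b. er a * f b) = f x"
 and Dr_counit_r: "x : BM ==> ev2 (Dr x) (%a b. er b * f a) = f x"
 and Dr_A: "ev (A h x) (%y. ev2 (Dr y) g) =
 ev2 (D h) (%h1 h2. ev2 (Dr x) (%x1 x2. ev (A h1 x1) (%a. ev (A h2 x2) (%b. g a b))))"
 and Dr_C: "ev2 (C x) (%h y. ev2 (Dr y) (%a b. K h a b)) =
 ev2 (Dr x) (%x1 x2. ev2 (C x1) (%h a. ev2 (C x2) (%h' b. ev (mu h h') (%p. K p a b))))"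
 and er_A: "ev (A h x) er = e h * er x"
 and er_C: "ev2 (C x) (%h y. er y * k h) = er x * ev un k"
 and Dr_rm: "y : BM ==> ev2 (Dr (rm x y)) g = ev2 (Dr x) (%a b. ev2 (Dr y) (%c d.
 ev2 (C b) (%h b0. ev (A h c) (%c'. g (rm a c') (rm b0 d)))))"
 and Dr_r1: "ev2 (Dr r1) g = g r1 r1"
 and er_rm: "er (rm x y) = er x * er y" and er_r1: "er r1 = 1"
begin

lemma Dr_cong: "x : BM ==> (!!a b. a : BM ==> b : BM ==> F a b = G a b) ==>
 ev2 (Dr x) F = ev2 (Dr x) G"
 using Dr_keys[of x] by (intro ev2_cong) blast

end

section \<open>The tensor algebra in coordinates\<close>

context yd_coord
begin

primrec aT :: "'m list => 'h => 'm list \<Rightarrow>\<^sub>0 'k" where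
 "aT [] = (%h. sg [] (e h))"
| "aT (x # w) = (%h. bind2 (D h) (%h1 h2.
 bind (A h1 x) (%y. bind (aT w h2) (%v. sg (y # v) 1))))"

primrec cT :: "'m list => 'h \<times> 'm list \<Rightarrow>\<^sub>0 'k" where
 "cT [] = bind un (%u. sg (u, []) 1)"
| "cT (x # w) = bind2 (C x) (%g y. bind2 (cT w) (%g' v.
 bind (mu g g') (%p. sg (p, y # v) 1)))"

text \<open>The two summands are x tensor 1 and 1 tensor x multiplied into the coproduct of
  \<open>w\<close>. In the second one the letter is braided past the left factor \<open>u\<close>,
  which gives x_(-1) . u in the left factor and x_(0) in front of \<open>v\<close>.\<close>

primrec dT :: "'m list => 'm list \<times> 'm list \<Rightarrow>\<^sub>0 'k" where
 "dT [] = sg ([], []) 1"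
| "dT (x # w) = bind2 (dT w) (%u v.
 sg (x # u, v) 1 + bind2 (C x) (%g y. bind (aT u g) (%u'. sg (u', y # v) 1)))"

lemma ev_actT [simp]:
 "ev (aT [] h) f = e h * f []"
 "ev (aT (x # w) h) f =
 ev2 (D h) (%h1 h2. ev (A h1 x) (%y. ev (aT w h2) (%v. f (y # v))))"
 by simp_all

lemma ev2_coactT [simp]:
 "ev2 (cT []) F = ev un (%u. F u [])"
 "ev2 (cT (x # w)) F =
 ev2 (C x) (%g y. ev2 (cT w) (%g' v. ev (mu g g') (%p. F p (y # v))))"
 by simp_all

lemma ev2_comultT [simp]:
 "ev2 (dT []) g = g [] []"
 "ev2 (dT (x # w)) g = ev2 (dT w) (%u v. g (x # u) v) +
 ev2 (dT w) (%u v. ev2 (C x) (%h y. ev (aT u h) (%u'. g u' (y # v))))"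
 by (simp_all add: ev2_fun_plus)

declare aT.simps [simp del] cT.simps [simp del] dT.simps [simp del]

lemma actT_out: "h \<notin> B ==> aT w h = 0"
 by (cases w) (auto intro: ev_eqI simp: e_out D_out)

lemma actT_mu: "ev (mu g h) (%p. ev (aT w p) f) = ev (aT w h) (%y. ev (aT y g) f)"
proof (induction w arbitrary: g h f)
 case Nil
 thus ?case by (simp add: ev_fun_mult_right e_mu mult.commute)
next
 case (Cons x w)
 have "ev (mu g h) (%p. ev (aT (x # w) p) f) = ev2 (D g) (%g1 g2. ev2 (D h) (%h1 h2.
 ev (mu g1 h1) (%p. ev (A p x) (%y. ev (mu g2 h2) (%q. ev (aT w q) (%v. f (y # v)))))))"
 by (simp add: D_mu ev_swap[of "mu a b" "A c x" for a b c x])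
 also have "... = ev2 (D g) (%g1 g2. ev2 (D h) (%h1 h2. ev (A h1 x) (%y. ev (A g1 y) (%y'.
 ev (aT w h2) (%v. ev (aT v g2) (%v'. f (y' # v')))))))"
 by (simp add: Cons.IH A_mu)
 also have "... = ev (aT (x # w) h) (%y. ev (aT y g) f)"
 by (simp add: ev_ev2_swap ev_swap[of "aT w a" "A c x" for a c x] ev2_swap[of "D h" "D g"])
 finally show ?case .
qed

lemma actT_un: "w : lists BM ==> ev un (%u. ev (aT w u) f) = f w"
proof (induction w arbitrary: f)
 case (Cons x w)
 thus ?case by (simp add: D_un A_un ev_swap[of un "A c x" for c x])
qed (simp add: ev_fun_mult_right e_un)

lemma actT_keys: "ks (aT w h) <= lists BM"
proof (induction w arbitrary: h)
 case (Cons x w)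
 have "!!h v. v : ks (aT w h) ==> v : lists BM" "!!h x y. y : ks (A h x) ==> y : BM"
 using Cons A_keys by blast+
 thus ?case unfolding aT.simps
 by (intro keys_bind2 keys_bind keys_sg_subset) simp
qed (simp add: aT.simps)

lemma coactT_keys: "ks (cT w) <= B \<times> lists BM"
proof (induction w)
 case Nil
 have "!!u. u : ks un ==> u : B" using un_keys by blast
 thus ?case unfolding cT.simps by (intro keys_bind keys_sg_subset) simp
next
 case (Cons x w)
 have "!!g v. (g, v) : ks (cT w) ==> v : lists BM" "!!g y. (g, y) : ks (C x) ==> y : BM"
 "!!p a b. p : ks (mu a b) ==> p : B"
 using Cons C_keys mu_keys by blast+
 thus ?case unfolding cT.simps by (intro keys_bind2 keys_bind keys_sg_subset) simp
qed

lemma comultT_keys: "w : lists BM ==> ks (dT w) <= lists BM \<times> lists BM"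
proof (induction w)
 case (Cons x w)
 hence "x : BM" "ks (dT w) <= lists BM \<times> lists BM" by simp_all
 moreover from this have "!!u v. (u, v) : ks (dT w) ==> u : lists BM & v : lists BM"
 "!!g y. (g, y) : ks (C x) ==> y : BM"
 "!!u h v. v : ks (aT u h) ==> v : lists BM"
 using C_keys actT_keys by blast+
 ultimately show ?case unfolding dT.simps
 by (intro keys_bind2 keys_bind keys_add_subset keys_sg_subset) simp_all
qed (simp add: dT.simps)

lemma coactT_cong:
 "(!!a b. a : B ==> b : lists BM ==> F a b = G a b) ==> ev2 (cT x) F = ev2 (cT x) G"
 using coactT_keys[of x] by (intro ev2_cong) blast

lemma comultT_cong:
 "x : lists BM ==> (!!a b. a : lists BM ==> b : lists BM ==> F a b = G a b) ==>
 ev2 (dT x) F = ev2 (dT x) G"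
 using comultT_keys[of x] by (intro ev2_cong) blast

lemma coactT_coassoc: "ev2 (cT w) (%g y. ev2 (D g) (%a b. F a b y)) =
 ev2 (cT w) (%g y. ev2 (cT y) (%g' z. F g g' z))"
proof (induction w arbitrary: F)
 case (Cons x w)
 have "ev2 (cT (x # w)) (%g y. ev2 (D g) (%a b. F a b y)) =
 ev2 (C x) (%g y. ev2 (C y) (%h z. ev2 (cT w) (%g' v. ev2 (cT v) (%h' v'.
 ev (mu g g') (%a. ev (mu h h') (%b. F a b (z # v')))))))"
 by (simp add: D_mu ev2_swap[of "cT w" "D g" for g] C_coassoc Cons.IH)
 also have "... = ev2 (cT (x # w)) (%g y. ev2 (cT y) (%g' z. F g g' z))"
 by (simp add: ev_ev2_swap ev2_swap[of "cT w" "C y" for y])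
 finally show ?case .
qed (simp add: D_un)

lemma coactT_counit: "w : lists BM ==> ev2 (cT w) (%g y. e g * f y) = f w"
proof (induction w arbitrary: f)
 case (Cons x w)
 thus ?case
 by (simp add: ev_fun_mult_right e_mu mult.assoc ev2_fun_mult_left C_counit)
qed (simp add: ev_fun_mult_right e_un)

text \<open>Yetter-Drinfel'd modules are closed under tensor products. After h has been spread over
  three legs, \<open>compat\<close> exchanges the first two around the letter \<open>x\<close>, and
  the induction hypothesis exchanges the last two around \<open>w\<close>.\<close>

lemma compatT: "ev2 (D h) (%h1 h2. ev2 (cT w) (%g y. ev (mu h1 g) (%p. ev (aT y h2) (%z. G p z)))) =
 ev2 (D h) (%h1 h2. ev (aT w h1) (%y. ev2 (cT y) (%g z. ev (mu g h2) (%p. G p z))))"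
proof (induction w arbitrary: h G)
 case Nil
 have "ev2 (D h) (%h1 h2. ev2 (cT []) (%g y. ev (mu h1 g) (%p. ev (aT y h2) (%z. G p z)))) =
 ev2 (D h) (%h1 h2. e h2 * G h1 [])"
 by (rule D_cong) (simp add: ev_fun_mult_left un_r)
 also have "... = ev2 (D h) (%h1 h2. e h1 * G h2 [])"
 by (cases "h : B") (simp_all add: counit_l counit_r D_out)
 also have "... = ev2 (D h) (%h1 h2. ev (aT [] h1) (%y. ev2 (cT y) (%g z. ev (mu g h2) (%p. G p z))))"
 by (rule D_cong) (simp add: un_l)
 finally show ?case .
next
 case (Cons x w)
 have "ev2 (D h) (%h1 h2. ev2 (cT (x # w)) (%g y. ev (mu h1 g) (%p. ev (aT y h2) (%z. G p z)))) =
 ev2 (D h) (%h1 h2. ev2 (D h2) (%h3 h4. ev2 (cT w) (%g' v. ev2 (C x) (%g y.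
 ev (mu h1 g) (%q. ev (A h3 y) (%z. ev (mu q g') (%p. ev (aT v h4) (%z'. G p (z # z')))))))))"
 by (simp add: ev_ev2_swap mu_assoc[symmetric] ev_swap[of "mu a b" "A c y" for a b c y]
 ev2_swap[of "C x" "cT w"] ev2_swap[of "C x" "D k" for k] ev2_swap[of "cT w" "D k" for k])
 also have "... = ev2 (D h) (%k h4. ev2 (cT w) (%g' v. ev2 (D k) (%h1 h3. ev2 (C x) (%g y.
 ev (mu h1 g) (%q. ev (A h3 y) (%z. ev (mu q g') (%p. ev (aT v h4) (%z'. G p (z # z')))))))))"
 by (simp add: D_coassoc[symmetric] ev2_swap[of "cT w" "D k" for k])
 also have "... = ev2 (D h) (%k h4. ev2 (D k) (%h1 h3. ev (A h1 x) (%y. ev2 (C y) (%g z. ev2 (cT w) (%g' v.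
 ev (mu h3 g') (%q. ev (aT v h4) (%z'. ev (mu g q) (%p. G p (z # z')))))))))"
 by (simp add: compat mu_assoc ev2_swap[of "cT w" "D k" for k] ev_ev2_swap[of _ "cT w", symmetric]
 ev2_swap[of "cT w" "C y" for y] ev_swap[of "aT v h" "mu a b" for v h a b])
 also have "... = ev2 (D h) (%h1 m. ev (A h1 x) (%y. ev2 (C y) (%g z. ev2 (D m) (%h3 h4. ev2 (cT w) (%g' v.
 ev (mu h3 g') (%q. ev (aT v h4) (%z'. ev (mu g q) (%p. G p (z # z')))))))))"
 by (simp add: D_coassoc ev_ev2_swap[of "A a b" "D c" for a b c] ev2_swap[of "C x" "D m" for x m])
 also have "... = ev2 (D h) (%h1 m. ev (A h1 x) (%y. ev2 (C y) (%g z. ev2 (D m) (%h3 h4.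
 ev (aT w h3) (%v. ev2 (cT v) (%g' z'. ev (mu g' h4) (%q. ev (mu g q) (%p. G p (z # z')))))))))"
 by (simp add: Cons.IH)
 also have "... = ev2 (D h) (%h1 h2. ev (aT (x # w) h1) (%y. ev2 (cT y) (%g z. ev (mu g h2) (%p. G p z))))"
 by (simp add: D_coassoc mu_assoc ev_ev2_swap[of "A a b" "D c" for a b c] ev2_swap[of "C x" "D m" for x m]
 ev_ev2_swap[of "aT w b" "C c" for b c])
 finally show ?case .
qed

section \<open>Concatenation and the braided coproduct of words under action and coaction\<close>

lemma actT_append: "ev (aT (u @ v) h) f =
 ev2 (D h) (%h1 h2. ev (aT u h1) (%x'. ev (aT v h2) (%y'. f (x' @ y'))))"
proof (induction u arbitrary: h f)
 case Nil
 thus ?case by (cases "h : B") (simp_all add: counit_l D_out actT_out)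
next
 case (Cons x u)
 thus ?case by (simp add: ev_ev2_swap[of "A a b" "D c" for a b c] D_coassoc)
qed

lemma coactT_append: "ev2 (cT (u @ v)) F =
 ev2 (cT u) (%g x0. ev2 (cT v) (%g' y0. ev (mu g g') (%p. F p (x0 @ y0))))"
proof (induction u arbitrary: F)
 case Nil
 have "ev2 (cT v) F = ev2 (cT v) (%g' y0. ev un (%u. ev (mu u g') (%p. F p y0)))"
 by (rule coactT_cong) (simp add: un_l)
 thus ?case by (simp add: ev_ev2_swap)
next
 case (Cons x u)
 thus ?case by (simp add: ev_ev2_swap mu_assoc)
qed

text \<open>The summand x tensor 1 is direct. In the summand 1 tensor x the action has to pass
  through the braiding of the letter with the left factor, and this is the Yetter-Drinfel'd
  condition \<open>compat\<close> for the letter.\<close>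

lemma comultT_act: "ev (aT w h) (%y. ev2 (dT y) g) =
 ev2 (D h) (%h1 h2. ev2 (dT w) (%x1 x2. ev (aT x1 h1) (%a. ev (aT x2 h2) (%b. g a b))))"
proof (induction w arbitrary: h g)
 case Nil
 have "e h * c = ev2 (D h) (%a b. e a * (e b * c))" for c
 by (cases "h : B") (simp_all add: counit_l e_out D_out)
 thus ?case by simp
next
 case (Cons x w)
 have 1: "ev2 (D h) (%h1 h2. ev2 (dT w) (%p q. ev (aT (x # p) h1) (%a. ev (aT q h2) (%b. g a b)))) =
 ev2 (D h) (%h1 h2. ev (A h1 x) (%y. ev (aT w h2) (%v. ev2 (dT v) (%p q. g (y # p) q))))"
 by (simp add: Cons.IH D_coassoc ev2_swap[of "dT w" "D k" for k]
 ev_ev2_swap[of "A a b" "D c" for a b c] ev_ev2_swap[of "A a b" "dT c" for a b c])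
 have "ev2 (D h) (%h1 h2. ev2 (dT w) (%p q. ev2 (C x) (%k y0. ev (aT p k) (%p'.
 ev (aT p' h1) (%a. ev (aT (y0 # q) h2) (%b. g a b)))))) =
 ev2 (D h) (%h1 h2. ev2 (D h2) (%c d. ev2 (dT w) (%p q. ev2 (C x) (%k y0.
 ev (mu h1 k) (%m. ev (A c y0) (%y'. ev (aT p m) (%a. ev (aT q d) (%b. g a (y' # b)))))))))"
 by (simp add: actT_mu[symmetric] ev_ev2_swap[of _ "D c" for c] ev2_swap[of "C x" "D k" for k]
 ev2_swap[of "dT w" "D k" for k] ev_swap[of "aT a b" "A c y" for a b c y]
 ev_swap[of "A c y" "mu a b" for a b c y])
 also have "... = ev2 (D h) (%k h4. ev2 (dT w) (%p q. ev2 (D k) (%h1 c. ev2 (C x) (%k y0.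
 ev (mu h1 k) (%m. ev (A c y0) (%y'. ev (aT p m) (%a. ev (aT q h4) (%b. g a (y' # b)))))))))"
 by (simp add: D_coassoc[symmetric] ev2_swap[of "dT w" "D k" for k])
 also have "... = ev2 (D h) (%h1 m. ev (A h1 x) (%y. ev2 (D m) (%c d. ev2 (dT w) (%p q. ev2 (C y) (%k y0.
 ev (mu k c) (%m. ev (aT p m) (%a. ev (aT q d) (%b. g a (y0 # b)))))))))"
 by (simp add: compat D_coassoc ev2_swap[of "dT w" "D k" for k]
 ev_ev2_swap[of "A a b" "D c" for a b c] ev_ev2_swap[of "A a b" "dT c" for a b c])
 also have "... = ev2 (D h) (%h1 m. ev (A h1 x) (%y. ev2 (D m) (%c d. ev2 (dT w) (%p q. ev2 (C y) (%k y0.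
 ev (aT p c) (%p'. ev (aT p' k) (%a. ev (aT q d) (%b. g a (y0 # b)))))))))"
 by (simp only: actT_mu)
 also have "... = ev2 (D h) (%h1 m. ev (A h1 x) (%y. ev2 (D m) (%c d. ev2 (dT w) (%p q. ev2 (C y) (%k y0.
 ev (aT p c) (%p'. ev (aT q d) (%b. ev (aT p' k) (%a. g a (y0 # b)))))))))"
 by ((rule ev2_cong ev_cong)+) (rule ev_swap)
 also have "... = ev2 (D h) (%h1 h2. ev (A h1 x) (%y. ev (aT w h2) (%v. ev2 (dT v) (%p q.
 ev2 (C y) (%k y0. ev (aT p k) (%p'. g p' (y0 # q)))))))"
 by (simp only: Cons.IH ev_ev2_swap[of _ "C c" for c])
 finally show ?case
 using 1 by (simp add: ev2_fun_plus ev_fun_plus)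
qed

text \<open>In the braided summand the coaction of x_(-1) . u appears. It is computed by
  \<open>compatT\<close> for the word \<open>u\<close>, while coassociativity of the coaction of the
  letter matches the legs.\<close>

lemma comultT_coact: "ev2 (cT w) (%h y. ev2 (dT y) (%a b. K h a b)) =
 ev2 (dT w) (%x1 x2. ev2 (cT x1) (%h a. ev2 (cT x2) (%h' b. ev (mu h h') (%p. K p a b))))"
proof (induction w arbitrary: K)
 case Nil
 have "ev un (%u. K u [] []) = ev un (%u. ev un (%v. ev (mu u v) (%p. K p [] [])))"
 by (rule un_cong) (simp add: un_r)
 thus ?case by simp
next
 case (Cons x w)
 have 1: "ev2 (C x) (%g y. ev2 (cT w) (%g' v. ev2 (dT v) (%p q. ev (mu g g') (%h. K h (y # p) q)))) =
 ev2 (dT w) (%u v. ev2 (cT (x # u)) (%h a. ev2 (cT v) (%h' b. ev (mu h h') (%p. K p a b))))"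
 by (simp add: Cons.IH mu_assoc ev_ev2_swap ev2_swap[of "C x" "dT w"])
 have "ev2 (dT w) (%u v. ev2 (C x) (%k y0. ev (aT u k) (%u'.
 ev2 (cT u') (%h a. ev2 (cT (y0 # v)) (%h' b. ev (mu h h') (%p. K p a b)))))) =
 ev2 (dT w) (%u v. ev2 (C x) (%k y0. ev2 (C y0) (%k' y00. ev2 (cT v) (%b' q.
 ev (aT u k) (%u'. ev2 (cT u') (%h a. ev (mu h k') (%m. ev (mu m b') (%r. K r a (y00 # q)))))))))"
 (is "_ = ?r")
 proof -
 have "ev2 (dT w) (%u v. ev2 (C x) (%k y0. ev (aT u k) (%u'.
 ev2 (cT u') (%h a. ev2 (cT (y0 # v)) (%h' b. ev (mu h h') (%p. K p a b)))))) =
 ev2 (dT w) (%u v. ev2 (C x) (%k y0. ev2 (C y0) (%k' y00.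
 ev (aT u k) (%u'. ev2 (cT u') (%h a. ev2 (cT v) (%b' q.
 ev (mu h k') (%m. ev (mu m b') (%r. K r a (y00 # q)))))))))"
 by (simp add: mu_assoc ev_ev2_swap[of _ "C c" for c] ev2_swap[of "cT u" "C c" for u c])
 also have "... = ?r"
 by ((rule ev2_cong)+, subst ev_ev2_swap[symmetric], rule ev_cong, rule ev2_swap)
 finally show ?thesis .
 qed
 also have "... = ev2 (dT w) (%u v. ev2 (C x) (%g y. ev2 (cT v) (%b' q. ev2 (D g) (%k k'.
 ev (aT u k) (%u'. ev2 (cT u') (%h a. ev (mu h k') (%m. ev (mu m b') (%r. K r a (y # q)))))))))"
 by (simp add: C_coassoc[symmetric] ev2_swap[of "cT v" "D c" for v c])
 also have "... = ev2 (dT w) (%u v. ev2 (C x) (%g y. ev2 (C y) (%k y0. ev2 (cT v) (%b q. ev2 (cT u) (%a p.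
 ev (mu a b) (%g'. ev (mu g g') (%h. ev (aT p k) (%p'. K h p' (y0 # q)))))))))"
 by (simp only: compatT[symmetric]) (simp add: C_coassoc ev2_swap[of "cT v" "D c" for v c] mu_assoc
 ev2_swap[of "cT v" "C c" for v c] ev_swap[of "aT a b" "mu c d" for a b c d])
 also have "... = ev2 (dT w) (%u v. ev2 (C x) (%g y. ev2 (C y) (%k y0. ev2 (cT u) (%a p. ev2 (cT v) (%b q.
 ev (mu a b) (%g'. ev (mu g g') (%h. ev (aT p k) (%p'. K h p' (y0 # q)))))))))"
 by ((rule ev2_cong)+) (rule ev2_swap)
 also have "... = ev2 (C x) (%g y. ev2 (cT w) (%g' v. ev2 (dT v) (%p q. ev2 (C y) (%k y0.
 ev (mu g g') (%h. ev (aT p k) (%p'. K h p' (y0 # q)))))))"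
 by (simp add: Cons.IH ev2_swap[of "C x" "dT w" for x] ev2_swap[of "cT v" "C c" for v c] ev_ev2_swap)
 finally show ?case using 1
 by (simp add: ev2_fun_plus ev_fun_plus ev_ev2_swap)
qed

text \<open>Each side has three summands, according to the tensor factor that receives the letter.
  When it lands in the last factor it acts on both of the others, which is the case that needs
  \<open>comultT_act\<close>; the other two follow by induction and reordering.\<close>

lemma comultT_coassoc: "ev2 (dT w) (%a b. ev2 (dT a) (%c d. G c d b)) =
 ev2 (dT w) (%a b. ev2 (dT b) (%c d. G a c d))"
proof (induction w arbitrary: G)
 case (Cons x w)
 have 1: "ev2 (dT w) (%u v. ev2 (C x) (%k y. ev (aT u k) (%u'. ev2 (dT u') (%c d. G c d (y # v))))) =
 ev2 (dT w) (%u v. ev2 (dT v) (%c d. ev2 (C x) (%k y. ev2 (C y) (%k' y'. ev (aT u k) (%u'.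
 ev (aT c k') (%c'. G u' c' (y' # d)))))))"
 by (simp add: comultT_act C_coassoc ev2_swap[of "C c" "dT v" for v c] Cons.IH)
 have 2: "ev2 (dT w) (%u v. ev2 (dT u) (%c d. ev2 (C x) (%k y. ev (aT c k) (%c'. G c' (y # d) v)))) =
 ev2 (dT w) (%u v. ev2 (C x) (%k y. ev (aT u k) (%u'. ev2 (dT v) (%c d. G u' (y # c) d))))"
 by (simp add: Cons.IH ev_ev2_swap ev2_swap[of "C c" "dT v" for v c])
 have "ev2 (dT (x # w)) (%a b. ev2 (dT a) (%c d. G c d b)) =
 ev2 (dT w) (%u v. ev2 (dT u) (%c d. G (x # c) d v)) +
 ev2 (dT w) (%u v. ev2 (dT u) (%c d. ev2 (C x) (%k y. ev (aT c k) (%c'. G c' (y # d) v)))) +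
 ev2 (dT w) (%u v. ev2 (C x) (%k y. ev (aT u k) (%u'. ev2 (dT u') (%c d. G c d (y # v)))))"
 by (simp add: ev2_fun_plus)
 also have "... = ev2 (dT (x # w)) (%a b. ev2 (dT b) (%c d. G a c d))"
 unfolding 1 2 by (simp add: Cons.IH ev2_fun_plus ev_fun_plus ev_ev2_swap ev2_swap[of "C c" "dT v" for v c])
 finally show ?case .
qed simp

definition eT :: "'m list => 'k" where
 "eT w = (if w = [] then 1 else 0)"

lemma counitT_simps [simp]: "eT [] = 1" "eT (x # w) = 0"
 by (simp_all add: eT_def)

lemma counitT_append: "eT (u @ v) = eT u * eT v"
 by (simp add: eT_def)

lemma counitT_act: "ev (aT w h) eT = e h * eT w"
 by (cases w) simp_all

lemma counitT_coact: "ev2 (cT w) (%h y. eT y * k h) = eT w * ev un k"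
 by (cases w) simp_all

lemma comultT_counit_l: "w : lists BM ==> ev2 (dT w) (%a b. eT a * f b) = f w"
proof (induction w arbitrary: f)
 case (Cons x w)
 thus ?case
 by (simp add: ev_fun_mult_right counitT_act mult.assoc C_counit ev2_fun_mult_left
 mult.left_commute[of "e h" for h])
qed simp

lemma comultT_counit_r: "w : lists BM ==> ev2 (dT w) (%a b. eT b * f a) = f w"
 by (induction w arbitrary: f) simp_all

text \<open>By definition the coproduct turns left multiplication by a letter x into left
  multiplication by x tensor 1 + 1 tensor x, so the induction step amounts to associativity of the
  braided product.\<close>

lemma comultT_append:
 assumes v: "v : lists BM"
 shows "ev2 (dT (u @ v)) g = ev2 (dT u) (%a b. ev2 (dT v) (%c d.
 ev2 (cT b) (%h b0. ev (aT c h) (%c'. g (a @ c') (b0 @ d)))))"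
proof (induction u arbitrary: g)
 case Nil
 have "ev2 (dT v) g = ev2 (dT v) (%c d. ev un (%h. ev (aT c h) (%c'. g c' d)))"
 by (rule comultT_cong[OF v]) (simp add: actT_un)
 thus ?case by simp
next
 case (Cons x u)
 have "ev2 (dT u) (%a b. ev2 (C x) (%h y. ev2 (C y) (%k z. ev2 (dT v) (%c d. ev2 (cT b) (%l b0.
 ev (aT c l) (%c1. ev (aT a h) (%x'. ev (aT c1 k) (%y'. g (x' @ y') (z # b0 @ d))))))))) =
 ev2 (dT u) (%a b. ev2 (C x) (%h y. ev2 (C y) (%k z. ev2 (dT v) (%c d. ev2 (cT b) (%l b0.
 ev (aT a h) (%x'. ev (aT c l) (%c1. ev (aT c1 k) (%y'. g (x' @ y') (z # b0 @ d)))))))))"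
 by ((rule ev2_cong)+) (rule ev_swap)
 with Cons show ?case
 by (simp add: actT_append actT_mu C_coassoc ev_ev2_swap ev2_swap[of "dT v" "C c" for c]
 ev2_swap[of "cT b" "C c" for b c] ev2_swap[of "cT b" "D c" for b c]
 ev2_swap[of "dT v" "D c" for c])
qed

lemma ybi_coord_T: "ybi_coord B mu un D e Si (lists BM) (%h w. aT w h) cT (@) [] dT eT"
proof unfold_locales
 fix x g f
 show "ev2 (dT x) (%a b. ev2 (dT a) (%c d. G c d b)) =
 ev2 (dT x) (%a b. ev2 (dT b) (%c d. G a c d))" for G
 by (rule comultT_coassoc)
qed (simp_all add: actT_keys coactT_keys actT_out actT_un actT_mu coactT_coassoc coactT_counit compatT
 comultT_keys actT_append coactT_append comultT_act comultT_coact comultT_counit_l comultT_counit_r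
 counitT_act counitT_coact comultT_append counitT_append)

end

section \<open>The Yetter-Drinfel'd condition rewritten for the inverse antipode\<close>

context yd_coord
begin

text \<open>\<open>h\<^sub>2 (S\<^sup>-\<^sup>1(h\<^sub>1) y)\<^sub>(\<^sub>-\<^sub>1\<^sub>) \<otimes> (S\<^sup>-\<^sup>1(h\<^sub>1) y)\<^sub>(\<^sub>0\<^sub>) = y\<^sub>(\<^sub>-\<^sub>1\<^sub>) h\<^sub>1 \<otimes> S\<^sup>-\<^sup>1(h\<^sub>2) y\<^sub>(\<^sub>0\<^sub>)\<close>\<close>

lemma coact_Si_aux:
 assumes h: "h : B" and y: "y : BM"
 shows "ev2 (D h) (%h1 k. ev (Si h1) (%s. ev (A s y) (%m. ev2 (D k) (%h2 h3. ev2 (C m) (%g m0.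
 ev (mu h2 g) (%p. ev (A h3 m0) (%z. F p z))))))) = ev2 (C y) (%g y0. ev (mu g h) (%p. F p y0))"
proof -
 have "ev2 (D h) (%h1 k. ev (Si h1) (%s. ev (A s y) (%m. ev2 (D k) (%h2 h3. ev2 (C m) (%g m0.
 ev (mu h2 g) (%p. ev (A h3 m0) (%z. F p z))))))) =
 ev2 (D h) (%k h3. ev2 (D k) (%h1 h2. ev (Si h1) (%s. ev (mu h2 s) (%q. ev (A q y) (%m.
 ev2 (C m) (%g m0. ev (mu g h3) (%p. F p m0)))))))"
 by (simp only: compat) (simp add: D_coassoc A_mu ev_ev2_swap[of "A a b" "D c" for a b c]
 ev_ev2_swap[of "Si a" "D c" for a c])
 also have "... = ev2 (D h) (%k h3. e k * ev un (%u. ev (A u y) (%m.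
 ev2 (C m) (%g m0. ev (mu g h3) (%p. F p m0)))))"
 by (simp only: Si_r)
 also have "... = ev2 (C y) (%g y0. ev (mu g h) (%p. F p y0))"
 by (simp add: counit_l[OF h] A_un[OF y])
 finally show ?thesis .
qed

text \<open>The right side is expanded by \<open>coact_Si_aux\<close>, which brings in further legs
  of h; then S^-1(h_4) h_3 cancels in the action and the left side remains. The identity computes
  coactions of elements on which an inverse antipode acts.\<close>

lemma coact_Si:
 assumes h: "h : B" and y: "y : BM"
 shows "ev2 (D h) (%h1 h2. ev (Si h1) (%s. ev (A s y) (%m. ev2 (C m) (%g m0. ev (mu h2 g) (%p. F p m0))))) =
 ev2 (C y) (%g y0. ev2 (D h) (%h1 h2. ev (mu g h1) (%p. ev (Si h2) (%s. ev (A s y0) (%z. F p z)))))"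
proof -
 have "ev2 (C y) (%g y0. ev2 (D h) (%h1 h2. ev (mu g h1) (%p. ev (Si h2) (%s. ev (A s y0) (%z. F p z))))) =
 ev2 (D h) (%k h4. ev2 (C y) (%g y0. ev (mu g k) (%p. ev (Si h4) (%s. ev (A s y0) (%z. F p z)))))"
 by (rule ev2_swap)
 also have "... = ev2 (D h) (%k h4. ev2 (D k) (%h1 l. ev (Si h1) (%s. ev (A s y) (%m.
 ev2 (D l) (%h2 h3. ev2 (C m) (%g m0. ev (mu h2 g) (%p. ev (A h3 m0) (%z.
 ev (Si h4) (%s. ev (A s z) (%z'. F p z'))))))))))"
 by (rule D_cong) (rule coact_Si_aux[OF _ y, symmetric])
 also have "... = ev2 (D h) (%h1 l'. ev2 (D l') (%h2 l. ev (Si h1) (%s. ev (A s y) (%m.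
 ev2 (C m) (%g m0. ev (mu h2 g) (%p. ev2 (D l) (%h3 h4.
 ev (Si h4) (%s. ev (mu s h3) (%q. ev (A q m0) (%z'. F p z'))))))))))"
 by (simp add: D_coassoc A_mu ev_ev2_swap[of _ "D c" for c] ev2_swap[of "C m" "D c" for m c]
 ev_swap[of "A a b" "Si c" for a b c])
 also have "... = ev2 (D h) (%h1 l'. ev2 (D l') (%h2 l. ev (Si h1) (%s. ev (A s y) (%m.
 ev2 (C m) (%g m0. ev (mu h2 g) (%p. e l * F p m0))))))"
 by (simp only: Si_l) (intro ev2_cong ev_cong C_cong, simp add: A_un)
 also have "... = ev2 (D h) (%h1 l'. ev (Si h1) (%s. ev (A s y) (%m.
 ev2 (C m) (%g m0. ev (mu l' g) (%p. F p m0)))))"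
 by (rule D_cong) (simp add: ev_fun_mult_left ev2_fun_mult_left counit_r)
 finally show ?thesis by (rule sym)
qed

text \<open>Inserting h_4 S^-1(h_3) on the left allows \<open>compat\<close> to be applied inside
  the inverse antipode; then S^-1(h_2) h_1 cancels. In Sweedler notation the result reads S^-1((h_2
  m)_(-1)) h_1 tensor (h_2 m)_(0) = h_2 S^-1(m_(-1)) tensor h_1 m_(0).\<close>

lemma Si_coact:
 assumes h: "h : B"
 shows "ev2 (D h) (%h1 h2. ev (A h2 m) (%b. ev2 (C b) (%g b0. ev (Si g) (%s. ev (mu s h1) (%q. F q b0))))) =
 ev2 (D h) (%h1 h2. ev2 (C m) (%g m0. ev (Si g) (%s. ev (mu h2 s) (%q. ev (A h1 m0) (%b0. F q b0)))))"
proof -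
 have "ev2 (D h) (%h1 k. ev (A k m) (%b. ev2 (C b) (%g b0. ev (Si g) (%s. ev (mu s h1) (%q. F q b0))))) =
 ev2 (D h) (%h1 k. ev2 (D k) (%h2 l. e l * ev un (%u. ev (A h2 m) (%b. ev2 (C b) (%g b0.
 ev (Si g) (%s. ev (mu u s) (%s'. ev (mu s' h1) (%q. F q b0))))))))"
 proof (rule D_cong)
 fix h1 k assume k: "k : B"
 have "ev un (%u. ev (A h2 m) (%b. ev2 (C b) (%g b0.
 ev (Si g) (%s. ev (mu u s) (%s'. ev (mu s' h1) (%q. F q b0)))))) =
 ev (A h2 m) (%b. ev2 (C b) (%g b0. ev (Si g) (%s. ev un (%u. ev (mu u s) (%s'. ev (mu s' h1) (%q. F q b0))))))" for h2
 by (simp add: ev_swap[of un "A c m" for c] ev_swap[of un "Si c" for c] ev_ev2_swap[of un])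
 also have "... h2 = ev (A h2 m) (%b. ev2 (C b) (%g b0. ev (Si g) (%s. ev (mu s h1) (%q. F q b0))))" for h2
 by (intro ev_cong ev2_cong Si_cong) (rule un_l)
 finally show "ev (A k m) (%b. ev2 (C b) (%g b0. ev (Si g) (%s. ev (mu s h1) (%q. F q b0)))) =
 ev2 (D k) (%h2 l. e l * ev un (%u. ev (A h2 m) (%b. ev2 (C b) (%g b0.
 ev (Si g) (%s. ev (mu u s) (%s'. ev (mu s' h1) (%q. F q b0)))))))"
 using counit_r[OF k] by simp
 qed
 also have "... = ev2 (D h) (%h1 k. ev2 (D k) (%h2 l. ev2 (D l) (%h3 h4. ev (A h2 m) (%b. ev2 (C b) (%g b0.
 ev (Si g) (%s. ev (Si h3) (%t. ev (mu t s) (%v. ev (mu h4 v) (%s'. ev (mu s' h1) (%q. F q b0))))))))))"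
 proof -
 have "ev2 (D l) (%h3 h4. ev (A h2 m) (%b. ev2 (C b) (%g b0.
 ev (Si g) (%s. ev (Si h3) (%t. ev (mu t s) (%v. ev (mu h4 v) (%s'. ev (mu s' h1) (%q. F q b0)))))))) =
 ev2 (D l) (%h3 h4. ev (Si h3) (%t. ev (mu h4 t) (%u. ev (A h2 m) (%b. ev2 (C b) (%g b0.
 ev (Si g) (%s. ev (mu u s) (%s'. ev (mu s' h1) (%q. F q b0))))))))" (is "?l = ?r") for l h2 h1
 proof -
 have "?l = ev2 (D l) (%h3 h4. ev (A h2 m) (%b. ev2 (C b) (%g b0.
 ev (Si h3) (%t. ev (Si g) (%s. ev (mu h4 t) (%u. ev (mu u s) (%s'. ev (mu s' h1) (%q. F q b0))))))))"
 by ((rule ev2_cong ev_cong)+, subst ev_swap, (rule ev_cong)+, rule mu_assoc[symmetric])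
 also have "... = ?r"
 by (simp add: ev_swap[of "Si a" "A c m" for a c] ev_swap[of "mu a b" "A c m" for a b c]
 ev_swap[of "mu a b" "Si c" for a b c] ev_ev2_swap[of _ "C b" for b])
 finally show ?thesis .
 qed
 thus ?thesis by (simp only: Si_r)
 qed
 also have "... = ev2 (D h) (%h1 k. ev2 (D k) (%l h4. ev2 (D l) (%h2 h3. ev (A h2 m) (%b. ev2 (C b) (%g b0.
 ev (mu g h3) (%p. ev (Si p) (%v. ev (mu h4 v) (%s'. ev (mu s' h1) (%q. F q b0)))))))))"
 by (simp only: Si_mu D_coassoc)
 also have "... = ev2 (D h) (%h1 k. ev2 (D k) (%l h4. ev2 (D l) (%h2 h3. ev2 (C m) (%g m0.
 ev (mu h2 g) (%p. ev (A h3 m0) (%b0. ev (Si p) (%v. ev (mu h4 v) (%s'. ev (mu s' h1) (%q. F q b0)))))))))"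
 by (simp only: compat)
 also have "... = ev2 (D h) (%k h'. ev2 (D k) (%h1 h2. ev2 (D h') (%h3 h4. ev2 (C m) (%g m0. ev (Si g) (%b.
 ev (mu h4 b) (%y. ev (A h3 m0) (%b0. ev (Si h2) (%a. ev (mu a h1) (%x. ev (mu y x) (%q. F q b0))))))))))"
 proof -
 have 1: "ev (mu h2 g) (%p. ev (A h3 m0) (%b0. ev (Si p) (%v. ev (mu h4 v) (%s'. ev (mu s' h1) (%q. F q b0))))) =
 ev (Si g) (%b. ev (mu h4 b) (%y. ev (A h3 m0) (%b0. ev (Si h2) (%a. ev (mu a h1) (%x. ev (mu y x) (%q. F q b0))))))"
 (is "?l = ?r") for h1 h2 h3 h4 g m0
 proof -
 have "?l = ev (Si h2) (%a. ev (Si g) (%b. ev (mu b a) (%v. ev (A h3 m0) (%b0. ev (mu h4 v) (%s'. ev (mu s' h1) (%q. F q b0))))))"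
 by (simp add: ev_swap[of "A c y" "Si a" for c y a] Si_mu)
 also have "... = ev (Si h2) (%a. ev (Si g) (%b. ev (A h3 m0) (%b0. ev (mu b a) (%v. ev (mu h4 v) (%s'. ev (mu s' h1) (%q. F q b0))))))"
 by (simp add: ev_swap[of "mu a b" "A c y" for a b c y])
 also have "... = ev (Si h2) (%a. ev (Si g) (%b. ev (A h3 m0) (%b0. ev (mu h4 b) (%y. ev (mu a h1) (%x. ev (mu y x) (%q. F q b0))))))"
 by (simp only: mu_assoc[symmetric])
 also have "... = ev (Si g) (%b. ev (Si h2) (%a. ev (A h3 m0) (%b0. ev (mu h4 b) (%y. ev (mu a h1) (%x. ev (mu y x) (%q. F q b0))))))"
 by (rule ev_swap)
 also have "... = ?r"
 by (simp add: ev_swap[of "Si a" "A c y" for a c y] ev_swap[of "mu a b" "A c y" for a b c y]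
 ev_swap[of "Si h2" "mu h4 b" for b])
 finally show ?thesis .
 qed
 have "ev2 (D h) (%h1 k. ev2 (D k) (%l h4. ev2 (D l) (%h2 h3. H h1 h2 h3 h4))) =
 ev2 (D h) (%k h'. ev2 (D k) (%h1 h2. ev2 (D h') (%h3 h4. H h1 h2 h3 h4)))" for H
 by (simp only: D_coassoc)
 thus ?thesis unfolding 1 .
 qed
 also have "... = ev2 (D h) (%k h'. e k * ev2 (D h') (%h3 h4. ev2 (C m) (%g m0. ev (Si g) (%b.
 ev (mu h4 b) (%y. ev (A h3 m0) (%b0. ev un (%x. ev (mu y x) (%q. F q b0))))))))"
 proof (rule ev2_cong)
 fix k h'
 show "ev2 (D k) (%h1 h2. ev2 (D h') (%h3 h4. ev2 (C m) (%g m0. ev (Si g) (%b.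
 ev (mu h4 b) (%y. ev (A h3 m0) (%b0. ev (Si h2) (%a. ev (mu a h1) (%x. ev (mu y x) (%q. F q b0))))))))) =
 e k * ev2 (D h') (%h3 h4. ev2 (C m) (%g m0. ev (Si g) (%b.
 ev (mu h4 b) (%y. ev (A h3 m0) (%b0. ev un (%x. ev (mu y x) (%q. F q b0)))))))"
 by (simp only: ev2_swap[of "D k" "D h'"] ev2_swap[of "D k" "C m"] ev_ev2_swap[where n = "D k", symmetric] Si_l)
 (simp add: ev_fun_mult_left ev2_fun_mult_left)
 qed
 also have "... = ev2 (D h) (%h3 h4. ev2 (C m) (%g m0. ev (Si g) (%b.
 ev (mu h4 b) (%y. ev (A h3 m0) (%b0. ev un (%x. ev (mu y x) (%q. F q b0)))))))"
 by (rule counit_l[OF h])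
 also have "... = ev2 (D h) (%h3 h4. ev2 (C m) (%g m0. ev (Si g) (%b.
 ev (mu h4 b) (%y. ev (A h3 m0) (%b0. F y b0)))))"
 by (rule ev2_cong, rule ev2_cong, rule ev_cong, rule mu_cong, rule ev_cong, rule un_r)
 finally show ?thesis .
qed

end

section \<open>The opposite coproduct\<close>

context ybi_coord
begin

definition Do :: "'r => 'r \<times> 'r \<Rightarrow>\<^sub>0 'k" where
 "Do r = bind2 (Dr r) (%r1 r2. bind2 (C r2) (%g z. bind (Si g) (%s. bind (A s r1) (%a. sg (a, z) 1))))"

text \<open>\<open>Do\<close> is \<open>r \<mapsto> S\<^sup>-\<^sup>1(r\<^sup>2\<^sub>(\<^sub>-\<^sub>1\<^sub>)) r\<^sup>1 \<otimes> r\<^sup>2\<^sub>(\<^sub>0\<^sub>)\<close>, the coproduct composed with the inverse braiding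
 and the flip, so that (B.1) says that it is dual to the product.\<close>

lemma ev2_Do: "ev2 (Do r) F =
 ev2 (Dr r) (%r1 r2. ev2 (C r2) (%g z. ev (Si g) (%s. ev (A s r1) (%a. F a z))))"
 by (simp add: Do_def)

lemma Do_cong: "r : BM ==> (!!a b. a : BM ==> b : BM ==> F a b = G a b) ==> ev2 (Do r) F = ev2 (Do r) G"
 unfolding ev2_Do by (intro Dr_cong C_cong ev_cong A_cong)

text \<open>\<open>Do\<close> involves the inverse braiding, so the legs of h act in the opposite
  order: h_2 on the first factor and h_1 on the second. \<open>Si_coact\<close> exchanges the action
  on the second factor with the inverse antipode of its coaction.\<close>

lemma Do_A:
 assumes h: "h : B" and r: "r : BM"
 shows "ev (A h r) (%y. ev2 (Do y) F) =
 ev2 (D h) (%h1 h2. ev2 (Do r) (%a b. ev (A h2 a) (%a'. ev (A h1 b) (%b'. F a' b'))))"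
proof -
 have "ev (A h r) (%y. ev2 (Do y) F) = ev2 (Dr r) (%r1 r2. ev2 (D h) (%h1 h2. ev (A h1 r1) (%a. ev (A h2 r2) (%b.
 ev2 (C b) (%g b0. ev (Si g) (%s. ev (A s a) (%a'. F a' b0)))))))"
 by (simp add: ev2_Do Dr_A ev2_swap[of "D h" "Dr r"])
 also have "... = ev2 (Dr r) (%r1 r2. ev2 (D h) (%h1 h2. ev (A h2 r2) (%b. ev (A h1 r1) (%a.
 ev2 (C b) (%g b0. ev (Si g) (%s. ev (A s a) (%a'. F a' b0)))))))"
 by ((rule ev2_cong)+) (rule ev_swap)
 also have "... = ev2 (Dr r) (%r1 r2. ev2 (D h) (%h1 h2. ev (A h2 r2) (%b.
 ev2 (C b) (%g b0. ev (Si g) (%s. ev (mu s h1) (%q. ev (A q r1) (%a'. F a' b0)))))))"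
 by (simp add: A_mu ev_ev2_swap[of "A a b" "C c" for a b c] ev_swap[of "A c y" "Si a" for c y a])
 also have "... = ev2 (Dr r) (%r1 r2. ev2 (D h) (%h1 h2. ev2 (C r2) (%g m0. ev (Si g) (%s.
 ev (mu h2 s) (%q. ev (A h1 m0) (%b0. ev (A q r1) (%a'. F a' b0)))))))"
 by (simp only: Si_coact[OF h])
 also have "... = ev2 (Dr r) (%r1 r2. ev2 (D h) (%h1 h2. ev2 (C r2) (%g m0. ev (Si g) (%s.
 ev (mu h2 s) (%q. ev (A q r1) (%a'. ev (A h1 m0) (%b0. F a' b0)))))))"
 by ((rule ev2_cong ev_cong)+) (rule ev_swap)
 also have "... = ev2 (D h) (%h1 h2. ev2 (Do r) (%a b. ev (A h2 a) (%a'. ev (A h1 b) (%b'. F a' b'))))"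
 by (simp add: ev2_Do A_mu ev2_swap[of "Dr r" "D h"])
 finally show ?thesis .
qed

text \<open>Here too the order is reversed: the coaction of the second factor is multiplied in front
  of that of the first. \<open>coact_Si\<close> computes the coaction of the first factor, on which
  an inverse antipode acts.\<close>

lemma Do_C:
 assumes r: "r : BM"
 shows "ev2 (C r) (%g r0. ev2 (Do r0) (%a b. F g a b)) =
 ev2 (Do r) (%a b. ev2 (C a) (%g a0. ev2 (C b) (%k b0. ev (mu k g) (%p. F p a0 b0))))"
proof -
 have "ev2 (Do r) (%a b. ev2 (C a) (%g a0. ev2 (C b) (%k b0. ev (mu k g) (%p. F p a0 b0)))) =
 ev2 (Do r) (%a b. ev2 (C b) (%k b0. ev2 (C a) (%g a0. ev (mu k g) (%p. F p a0 b0))))"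
 by (rule ev2_cong) (rule ev2_swap)
 also have "... = ev2 (Dr r) (%r1 r2. ev2 (C r2) (%k1 b0. ev2 (D k1) (%k1 k. ev (Si k1) (%s. ev (A s r1) (%a.
 ev2 (C a) (%g a0. ev (mu k g) (%p. F p a0 b0)))))))"
 unfolding ev2_Do C_coassoc
 by (intro ev2_cong) (simp add: ev_ev2_swap[of "Si a" "C b" for a b] ev_ev2_swap[of "A a r1" "C b" for a r1 b])
 also have "... = ev2 (Dr r) (%r1 r2. ev2 (C r2) (%k1 b0. ev2 (C r1) (%g y0. ev2 (D k1) (%h1 h2.
 ev (mu g h1) (%p. ev (Si h2) (%s. ev (A s y0) (%z. F p z b0)))))))"
 by (rule Dr_cong[OF r], rule C_cong, rule coact_Si)
 also have "... = ev2 (Dr r) (%r1 r2. ev2 (C r1) (%g y0. ev2 (C r2) (%k1 b0. ev2 (D k1) (%h1 h2.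
 ev (mu g h1) (%p. ev (Si h2) (%s. ev (A s y0) (%z. F p z b0)))))))"
 by (rule ev2_cong) (rule ev2_swap)
 also have "... = ev2 (C r) (%g r0. ev2 (Do r0) (%a b. F g a b))"
 unfolding ev2_Do Dr_C C_coassoc by (simp only: ev_ev2_swap)
 finally show ?thesis by (rule sym)
qed

lemma Do_counit_l:
 assumes r: "r : BM"
 shows "ev2 (Do r) (%a b. er a * f b) = f r"
proof -
 have "ev2 (Do r) (%a b. er a * f b) = ev2 (Dr r) (%r1 r2. er r1 * ev2 (C r2) (%g z. e g * f z))"
 by (simp add: ev2_Do ev_fun_mult_right ev_fun_mult_left er_A e_Si ev2_fun_mult_left[symmetric] mult_ac)
 also have "... = ev2 (Dr r) (%r1 r2. er r1 * f r2)"
 by (rule Dr_cong[OF r]) (simp add: C_counit)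
 also have "... = f r" by (rule Dr_counit_l[OF r])
 finally show ?thesis .
qed

text \<open>(B.1) makes a product dual to \<open>Do\<close>, so this is what reconciles (B.1) with
  associativity. \<open>Do_A\<close> opens the left side; on the way to the right side,
  antimultiplicativity of \<open>Si\<close> merges two inverse antipodes so that \<open>Dr_C\<close>
  applies.\<close>

lemma Do_coassoc:
 assumes r: "r : BM"
 shows "ev2 (Do r) (%a b. ev2 (Do a) (%c d. F c d b)) = ev2 (Do r) (%a b. ev2 (Do b) (%c d. F a c d))"
proof -
 have "ev2 (Do r) (%a b. ev2 (Do a) (%c d. F c d b)) =
 ev2 (Dr r) (%r1 r2. ev2 (C r2) (%g b. ev (Si g) (%s. ev2 (D s) (%h1 h2. ev2 (Do r1) (%a a'.
 ev (A h2 a) (%c. ev (A h1 a') (%d. F c d b)))))))"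
 unfolding ev2_Do[of r] by (rule Dr_cong[OF r], rule ev2_cong, rule Si_cong, rule Do_A)
 also have "... = ev2 (Dr r) (%r1 r2. ev2 (Do r1) (%a a'. ev2 (C r2) (%g b. ev2 (D g) (%g1 g2. ev (Si g1) (%x. ev (Si g2) (%y.
 ev (A x a) (%c. ev (A y a') (%d. F c d b))))))))"
 by (simp add: Si_D ev_ev2_swap[of _ "Do x" for x] ev2_swap[of "D g" "Do x" for g x] ev2_swap[of "C g" "Do x" for g x])
 also have "... = ev2 (Dr r) (%r1 r2. ev2 (Dr r2) (%x1 x2. ev2 (C x1) (%k a'. ev (Si k) (%t. ev (A t r1) (%a.
 ev2 (C x2) (%g1 z2. ev2 (C z2) (%g2 b. ev (Si g1) (%x. ev (Si g2) (%y. ev (A x a) (%c. ev (A y a') (%d. F c d b)))))))))))"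
 unfolding ev2_Do Dr_coassoc C_coassoc by (rule refl)
 also have "... = ev2 (Dr r) (%r1 r2. ev2 (Dr r2) (%x1 x2. ev2 (C x1) (%k a'.
 ev2 (C x2) (%g1 z2. ev2 (C z2) (%g2 b. ev (Si k) (%t. ev (A t r1) (%a. ev (Si g1) (%x. ev (A x a) (%c. ev (Si g2) (%y. ev (A y a') (%d. F c d b)))))))))))"
 by (simp add: ev_ev2_swap[of _ "C x" for x] ev_swap[of "Si g2" "A x a" for g2 x a, symmetric])
 also have "... = ev2 (Dr r) (%r1 r2. ev2 (Dr r2) (%x1 x2. ev2 (C x1) (%k a'.
 ev2 (C x2) (%g1 z2. ev2 (C z2) (%g2 b. ev (mu k g1) (%g. ev (Si g) (%s. ev (A s r1) (%c. ev (Si g2) (%y. ev (A y a') (%d. F c d b))))))))))"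
 proof -
 have "ev (mu k g1) (%g. ev (Si g) (%s. ev (A s r1) f)) =
 ev (Si k) (%t. ev (A t r1) (%a. ev (Si g1) (%x. ev (A x a) f)))" for k g1 r1 f
 by (simp add: Si_mu A_mu ev_swap[of "A t r1" "Si x" for t x])
 thus ?thesis by simp
 qed
 also have "... = ev2 (Dr r) (%r1 r2. ev2 (C r2) (%g z. ev2 (Dr z) (%z1 z2. ev2 (C z2) (%k d.
 ev (Si g) (%s. ev (A s r1) (%a. ev (Si k) (%t. ev (A t z1) (%c. F a c d))))))))"
 unfolding Dr_C by (simp add: ev_ev2_swap[of _ "C x" for x])
 also have "... = ev2 (Do r) (%a b. ev2 (Do b) (%c d. F a c d))"
 by (simp add: ev2_Do ev_ev2_swap)
 finally show ?thesis .
qed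

lemma Si_A_rm: "ev (Si g) (%p. ev (A p (rm u v)) f) =
 ev2 (D g) (%h1 h2. ev (Si h1) (%p. ev (Si h2) (%q. ev (A q u) (%u'. ev (A p v) (%v'. f (rm u' v'))))))"
 by (simp add: A_rm Si_D)

lemma Si_mu_A: "ev (mu k l) (%g. ev (Si g) (%s. ev (A s x) f)) =
 ev (Si k) (%t. ev (A t x) (%a. ev (Si l) (%s. ev (A s a) f)))"
 by (simp add: Si_mu A_mu ev_swap[of "A t x" "Si l" for t])

text \<open>On the factor \<open>c\<close> the legs meet as S^-1(k_2) k_1 and cancel, so only the
  action on \<open>x\<close> survives: S^-1(k_2) . (x (k_1 . c)) = (S^-1(k) . x) c. The same
  cancellation serves the coproduct of a product and the product of the bi-product.\<close>

lemma A_rm_Si: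
 assumes k: "k : B" and c: "c : BM"
 shows "ev2 (D k) (%g g'. ev (A g c) (%c'. ev (Si g') (%p. ev (A p (rm x c')) f))) =
 ev (Si k) (%q. ev (A q x) (%u. f (rm u c)))"
proof -
 have inner: "ev (A g c) (%c'. ev (Si g') (%p. ev (A p (rm x c')) f)) =
 ev2 (D g') (%h1 h2. ev (Si h1) (%p. ev (mu p g) (%m. ev (Si h2) (%q. ev (A q x) (%u. ev (A m c) (%v. f (rm u v)))))))" (is "?l = ?r") for g g'
 proof -
 have "?l = ev2 (D g') (%h1 h2. ev (A g c) (%c'. ev (Si h1) (%p. ev (Si h2) (%q. ev (A q x) (%u. ev (A p c') (%v. f (rm u v)))))))"
 by (simp only: Si_A_rm ev_ev2_swap)
 also have "... = ?r"
 proof (rule ev2_cong)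
 fix h1 h2
 show "ev (A g c) (%c'. ev (Si h1) (%p. ev (Si h2) (%q. ev (A q x) (%u. ev (A p c') (%v. f (rm u v)))))) =
 ev (Si h1) (%p. ev (mu p g) (%m. ev (Si h2) (%q. ev (A q x) (%u. ev (A m c) (%v. f (rm u v))))))"
 by (simp add: A_mu ev_swap[of "mu p g" "Si h2" for p] ev_swap[of "mu p g" "A q x" for p q]
 ev_swap[of "A g c" "Si h2"] ev_swap[of "A g c" "A q x" for q] ev_swap[of "A g c" "Si h1"])
 qed
 finally show ?thesis .
 qed
 have "ev2 (D k) (%g g'. ev (A g c) (%c'. ev (Si g') (%p. ev (A p (rm x c')) f))) =
 ev2 (D k) (%k' h2. e k' * ev un (%m. ev (Si h2) (%q. ev (A q x) (%u. ev (A m c) (%v. f (rm u v))))))"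
 unfolding inner D_coassoc[symmetric] Si_l by (rule refl)
 also have "... = ev un (%m. ev (Si k) (%q. ev (A q x) (%u. ev (A m c) (%v. f (rm u v)))))"
 by (rule counit_l[OF k])
 also have "... = ev (Si k) (%q. ev (A q x) (%u. ev un (%m. ev (A m c) (%v. f (rm u v)))))"
 by (simp add: ev_swap[of un "Si k"] ev_swap[of un "A q x" for q])
 also have "... = ev (Si k) (%q. ev (A q x) (%u. f (rm u c)))"
 by (simp only: A_un[OF c])
 finally show ?thesis .
qed

text \<open>A mixed formula: the first factor is split by \<open>Do\<close>, the second by the
  ordinary coproduct, and the inverse antipode acts on the product \<open>rm a c\<close>. This is
  the shape wanted when the first leg is paired with a single letter, because that pairing is a
  derivation.\<close>

lemma Do_rm:
 assumes x: "x : BM" and y: "y : BM"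
 shows "ev2 (Do (rm x y)) F = ev2 (Do x) (%a b. ev2 (Dr y) (%c d. ev2 (C d) (%g d0. ev (Si g) (%s.
 ev (A s (rm a c)) (%a'. F a' (rm b d0))))))"
proof -
 have "ev2 (Do (rm x y)) F = ev2 (Dr x) (%x1 x2. ev2 (Dr y) (%c d. ev2 (C x2) (%g z. ev (A g c) (%c'.
 ev2 (C z) (%g' z'. ev2 (C d) (%l d0. ev (Si g') (%p. ev (Si l) (%q. ev (A p (rm x1 c')) (%a1. ev (A q a1) (%a. F a (rm z' d0)))))))))))"
 by (simp add: ev2_Do Dr_rm[OF y] C_rm Si_mu A_mu)
 also have "... = ev2 (Dr x) (%x1 x2. ev2 (Dr y) (%c d. ev2 (C x2) (%g z.
 ev2 (C z) (%g' z'. ev2 (C d) (%l d0. ev (A g c) (%c'. ev (Si g') (%p. ev (A p (rm x1 c')) (%a1. ev (Si l) (%q. ev (A q a1) (%a. F a (rm z' d0)))))))))))"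
 by (simp add: ev_ev2_swap[of _ "C x" for x] ev_swap[of "A p v" "Si l" for p v l])
 also have "... = ev2 (Dr x) (%x1 x2. ev2 (Dr y) (%c d. ev2 (C x2) (%k z'. ev2 (C d) (%l d0.
 ev2 (D k) (%g g'. ev (A g c) (%c'. ev (Si g') (%p. ev (A p (rm x1 c')) (%a1. ev (Si l) (%q. ev (A q a1) (%a. F a (rm z' d0)))))))))))"
 by (simp add: C_coassoc[symmetric] ev2_swap[of "D k" "C d" for k d])
 also have "... = ev2 (Dr x) (%x1 x2. ev2 (Dr y) (%c d. ev2 (C x2) (%k z'. ev2 (C d) (%l d0.
 ev (Si k) (%q. ev (A q x1) (%u. ev (Si l) (%q. ev (A q (rm u c)) (%a. F a (rm z' d0)))))))))"
 by (rule Dr_cong[OF x], rule Dr_cong[OF y], rule C_cong, rule ev2_cong, rule A_rm_Si)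
 also have "... = ev2 (Do x) (%a b. ev2 (Dr y) (%c d. ev2 (C d) (%g d0. ev (Si g) (%s.
 ev (A s (rm a c)) (%a'. F a' (rm b d0))))))"
 by (simp add: ev2_Do ev_ev2_swap ev2_swap[of "C x" "Dr y" for x])
 finally show ?thesis .
qed

end

section \<open>Forms in coordinates\<close>

lemma ev2_reverse3:
 "ev2 l (%a b. ev2 m (%c d. ev2 n (%x y. F a b c d x y))) =
 ev2 n (%x y. ev2 m (%c d. ev2 l (%a b. F a b c d x y)))"
proof -
 have "ev2 l (%a b. ev2 m (%c d. ev2 n (%x y. F a b c d x y))) =
 ev2 l (%a b. ev2 n (%x y. ev2 m (%c d. F a b c d x y)))"
 by (rule ev2_cong) (rule ev2_swap)
 also have "... = ev2 n (%x y. ev2 l (%a b. ev2 m (%c d. F a b c d x y)))"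
 by (rule ev2_swap)
 also have "... = ev2 n (%x y. ev2 m (%c d. ev2 l (%a b. F a b c d x y)))"
 by (rule ev2_cong) (rule ev2_swap)
 finally show ?thesis .
qed

lemmas pull = ev_fun_mult_left ev_fun_mult_right ev2_fun_mult_left ev2_fun_mult_right
lemmas push2 = ev2_fun_mult_left[symmetric] ev2_fun_mult_right[symmetric]
lemmas push = ev_fun_mult_left[symmetric] ev_fun_mult_right[symmetric]
 ev2_fun_mult_left[symmetric] ev2_fun_mult_right[symmetric]

locale pairing_coord =
 K: hopf_coord BK muK unK DK eK SK + H: hopf_coord BH muH unH DH eH SH
 for BK :: "'g set" and muK :: "'g => 'g => 'g \<Rightarrow>\<^sub>0 'k::field" and unK DK eK SK
 and BH :: "'h set" and muH :: "'h => 'h => 'h \<Rightarrow>\<^sub>0 'k" and unH DH eH SH +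
 fixes t :: "'g => 'h => 'k"
 assumes A1: "ev (muH a b) (t u) = ev2 (DK u) (%u1 u2. t u2 a * t u1 b)"
 and A2: "ev unK (%u. t u a) = eH a"
 and A3: "ev (muK u u') (%x. t x a) = ev2 (DH a) (%a1 a2. t u a1 * t u' a2)"
 and A4: "ev unH (t u) = eK u"

text \<open>(C.1) and (C.2) are assumed for letters only; \<open>bT_C1\<close> and
  \<open>bT_C2\<close> extend them to words.\<close>

locale letters_coord =
 pairing_coord BK muK unK DK eK SK BH muH unH DH eH SH t +
 W: yd_coord BK muK unK DK eK SK BW AW CW + V: yd_coord BH muH unH DH eH SH BV AV CV
 for BK :: "'g set" and muK :: "'g => 'g => 'g \<Rightarrow>\<^sub>0 'k::field" and unK DK eK SK
 and BH :: "'h set" and muH :: "'h => 'h => 'h \<Rightarrow>\<^sub>0 'k" and unH DH eH SH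
 and t :: "'g => 'h => 'k"
 and BW :: "'w set" and AW CW and BV :: "'v set" and AV CV +
 fixes b0 :: "'w => 'v => 'k"
 assumes C1: "ev (AW k w) (%w'. b0 w' v) = ev2 (CV v) (%h v0. t k h * b0 w v0)"
 and C2: "ev2 (CW w) (%k w0. t k h * b0 w0 v) = ev (SH h) (%s. ev (AV s v) (b0 w))"
begin

sublocale VT: ybi_coord BH muH unH DH eH SH "lists BV" "%h w. V.aT w h" V.cT "(@)" "[]"
 V.dT V.eT
 by (rule V.ybi_coord_T)

sublocale WT: ybi_coord BK muK unK DK eK SK "lists BW" "%h w. W.aT w h" W.cT "(@)" "[]"
 W.dT W.eT
 by (rule W.ybi_coord_T)

text \<open>The pairing of a single letter with a word. A letter is primitive, so by (B.3) and (B.4)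
  the pairing has to vanish unless the word has length one.\<close>

definition b1 :: "'w => 'v list => 'k" where
 "b1 w r = (case r of [v] => b0 w v | _ => 0)"

lemma b1_simps [simp]: "b1 w [] = 0" "b1 w [v] = b0 w v" "b1 w (v # v' # r) = 0"
 by (simp_all add: b1_def)

lemma b1_Cons: "b1 w (v # r) = b0 w v * V.eT r"
 by (cases r) simp_all

text \<open>(B.1) read as a recursion on the left word, starting from (B.2). A form with
  (B.1)--(B.4) that extends \<open>b0\<close> can have no other values; (B.3), (B.4) and the
  C-conditions are now claims about the recursion.\<close>

primrec bT :: "'w list => 'v list => 'k" where
 "bT [] = V.eT"
| "bT (w # u) = (%r. ev2 (VT.Do r) (%x y. b1 w x * bT u y))"

text \<open>The coaction preserves the length of a word, so both sides vanish except on words of one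
  letter, where this is (C.1).\<close>

lemma b1_C1: "ev (AW k w) (%w'. b1 w' r) = ev2 (V.cT r) (%h x. t k h * b1 w x)"
proof (cases r)
 case (Cons v r')
 show ?thesis
 proof (cases r')
 case Nil
 have "ev2 (V.cT [v]) (%h x. t k h * b1 w x) = ev2 (CV v) (%h x. t k h * b0 w x)"
 by (simp, rule V.C_cong, rule H.un_r)
 thus ?thesis by (simp add: Cons Nil C1)
 qed (simp add: Cons)
qed simp

lemma b1_C2: "ev2 (CW w) (%k w0. t k h * b1 w0 r) = ev (SH h) (%s. ev (V.aT r s) (b1 w))"
proof (cases r)
 case (Cons v r')
 show ?thesis
 proof (cases r')
 case Nil
 have "ev (SH h) (%s. ev (V.aT [v] s) (b1 w)) = ev (SH h) (%s. ev (AV s v) (b0 w))"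
 by (rule H.Si_cong) (simp add: ev_fun_mult_left H.counit_r)
 thus ?thesis by (simp add: Cons Nil C2)
 qed (simp add: Cons b1_Cons)
qed simp

text \<open>A letter is primitive, so pairing with it is a derivation relative to the counit; this
  persists under the action because the action preserves length.\<close>

lemma b1_act_append:
 assumes s: "s : BH"
 shows "ev (V.aT (x @ y) s) (b1 w) =
 ev (V.aT x s) (b1 w) * V.eT y + V.eT x * ev (V.aT y s) (b1 w)"
proof (cases x)
 case (Cons v r)
 have "ev (V.aT (v # u) s) (b1 w) = ev (AV s v) (b0 w) * V.eT u" for u
 by (simp add: b1_Cons pull V.counitT_act mult.assoc[symmetric] H.counit_r[OF s] mult.commute[of _ "eH x" for x])
 thus ?thesis by (simp add: Cons V.counitT_append)
qed simp

text \<open>The reversals of order match: \<open>Do_C\<close> multiplies the coactions of the two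
  factors backwards, and (A.1) splits \<open>t k\<close> on a product backwards, so the legs of k
  fall on \<open>w\<close> and \<open>u\<close> in the order of the diagonal action.\<close>

lemma bT_C1: "ev (W.aT u k) (%u'. bT u' r) = ev2 (V.cT r) (%h x. t k h * bT u x)"
 if "r : lists BV" for r
 using that
proof (induction u arbitrary: k r)
 case Nil
 have "ev2 (V.cT r) (%h x. t k h * V.eT x) = V.eT r * eK k"
 using V.counitT_coact[of r "t k"] A4[of k] by (simp add: mult.commute)
 thus ?case by simp
next
 case (Cons w u)
 have "ev (W.aT (w # u) k) (%u'. bT u' r) =
 ev2 (VT.Do r) (%x y. ev2 (DK k) (%k1 k2. ev (AW k1 w) (%w'. b1 w' x) * ev (W.aT u k2) (%u'. bT u' y)))"
 by (simp add: push ev_ev2_swap[of _ "VT.Do r"] ev2_swap[of "DK k" "VT.Do r"]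
 ev_swap[of "W.aT u a" "AW c w" for a c])
 also have "... = ev2 (VT.Do r) (%x y. ev2 (V.cT x) (%h x0. ev2 (V.cT y) (%h' y0.
 ev2 (DK k) (%k1 k2. t k2 h' * t k1 h) * (b1 w x0 * bT u y0))))"
 proof (rule VT.Do_cong[OF Cons.prems])
 fix x y assume "y : lists BV"
 hence "ev2 (DK k) (%k1 k2. ev (AW k1 w) (%w'. b1 w' x) * ev (W.aT u k2) (%u'. bT u' y)) =
 ev2 (DK k) (%k1 k2. ev2 (V.cT x) (%h x0. ev2 (V.cT y) (%h' y0. t k2 h' * t k1 h * (b1 w x0 * bT u y0))))"
 by (simp add: Cons.IH b1_C1 push mult_ac) (rule ev2_cong, rule ev2_swap)
 thus "ev2 (DK k) (%k1 k2. ev (AW k1 w) (%w'. b1 w' x) * ev (W.aT u k2) (%u'. bT u' y)) =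
 ev2 (V.cT x) (%h x0. ev2 (V.cT y) (%h' y0.
 ev2 (DK k) (%k1 k2. t k2 h' * t k1 h) * (b1 w x0 * bT u y0)))"
 by (simp add: push ev2_swap[of "DK k" "V.cT z" for z])
 qed
 also have "... = ev2 (V.cT r) (%h r0. ev2 (VT.Do r0) (%x y. t k h * (b1 w x * bT u y)))"
 unfolding VT.Do_C[OF Cons.prems] A1[symmetric] by (simp only: push)
 also have "... = ev2 (V.cT r) (%h x. t k h * bT (w # u) x)"
 by (simp add: ev2_fun_mult_left)
 finally show ?case .
qed

text \<open>Two reversals cancel: the inverse antipode reverses the coproduct of h, and
  \<open>Do_A\<close> reverses the legs that act. This leaves h_1 with the letter and h_2 with the
  rest, as (A.3) requires.\<close>

lemma bT_C2: "ev2 (W.cT u) (%k u0. t k h * bT u0 r) = ev (SH h) (%s. ev (V.aT r s) (bT u))"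
 if "r : lists BV" for r
 using that
proof (induction u arbitrary: h r)
 case Nil
 thus ?case by (simp add: pull A2 V.counitT_act H.e_Si)
next
 case (Cons w u)
 have "ev2 (W.cT (w # u)) (%k u0. t k h * bT u0 r) = ev2 (CW w) (%k w0. ev2 (W.cT u) (%k' u0.
 ev2 (DH h) (%h1 h2. t k h1 * t k' h2) * ev2 (VT.Do r) (%x y. b1 w0 x * bT u0 y)))"
 by (simp add: ev_fun_mult_right A3)
 also have "... = ev2 (DH h) (%h1 h2. ev2 (VT.Do r) (%x y.
 ev2 (CW w) (%k w0. t k h1 * b1 w0 x) * ev2 (W.cT u) (%k' u0. t k' h2 * bT u0 y)))"
 by (simp add: push ev2_swap[of _ "DH h"] ev2_swap[of "W.cT u" "VT.Do r"] ev2_swap[of "CW w" "VT.Do r"]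
 ev2_swap[of "W.cT u" "CW w"] mult_ac)
 also have "... = ev2 (DH h) (%h1 h2. ev2 (VT.Do r) (%x y.
 ev (SH h1) (%s. ev (V.aT x s) (b1 w)) * ev (SH h2) (%s. ev (V.aT y s) (bT u))))"
 by (rule ev2_cong, rule VT.Do_cong[OF Cons.prems]) (simp add: b1_C2 Cons.IH)
 also have "... = ev2 (DH h) (%h1 h2. ev (SH h1) (%s. ev (SH h2) (%s'. ev2 (VT.Do r) (%x y.
 ev (V.aT x s) (%x'. ev (V.aT y s') (%y'. b1 w x' * bT u y'))))))"
 by (simp add: pull ev_ev2_swap[of _ "VT.Do r"])
 also have "... = ev (SH h) (%s. ev (V.aT r s) (bT (w # u)))"
 proof -
 have "ev (SH h) (%s. ev (V.aT r s) (bT (w # u))) = ev (SH h) (%s. ev2 (DH s) (%s1 s2. ev2 (VT.Do r) (%x y.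
 ev (V.aT x s2) (%x'. ev (V.aT y s1) (%y'. b1 w x' * bT u y')))))"
 by (rule H.Si_cong) (simp add: VT.Do_A Cons.prems)
 thus ?thesis by (simp add: H.Si_D)
 qed
 finally show ?case .
qed

lemma bT_append: "r : lists BV ==> bT (u @ u') r = ev2 (VT.Do r) (%x y. bT u x * bT u' y)"
proof (induction u arbitrary: r)
 case Nil
 thus ?case by (simp add: VT.Do_counit_l)
next
 case (Cons w u)
 have "bT ((w # u) @ u') r = ev2 (VT.Do r) (%x y. ev2 (VT.Do y) (%c d. b1 w x * (bT u c * bT u' d)))"
 by (simp add: pull, rule VT.Do_cong[OF Cons.prems]) (simp add: Cons.IH)
 also have "... = ev2 (VT.Do r) (%x y. bT (w # u) x * bT u' y)"
 unfolding VT.Do_coassoc[OF Cons.prems, symmetric] by (simp add: push mult.assoc)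
 finally show ?case .
qed

lemma bT_Nil_right: "bT u [] = W.eT u"
 by (cases u) (simp_all add: VT.ev2_Do)

text \<open>This is (B.3) on words, by induction on the left word. Since pairing with
  \<open>w\<close> is a derivation, \<open>Do_rm\<close> yields two sums: \<open>w\<close> pairs
  inside r' or inside r. The former is the summand w tensor 1 of the coproduct of
  \<open>w # u\<close>. In the latter, (C.2) turns the inverse antipode acting on a part of r into a
  coaction of \<open>w\<close>, and (C.1) turns the coaction of r' into an action of w_(-1) on u_1;
  the outcome is the braided summand.\<close>

lemma bT_append_right:
 assumes "u : lists BW" "r : lists BV" "r' : lists BV"
 shows "bT u (r @ r') = ev2 (W.dT u) (%u1 u2. bT u2 r * bT u1 r')"
 using assms
proof (induction u arbitrary: r r' rule: list.induct)
 case Nil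
 thus ?case by (simp add: V.counitT_append)
next
 case (Cons w u)
 have u: "u : lists BW" and r: "r : lists BV" and r': "r' : lists BV"
 using Cons.prems by simp_all
 have "bT (w # u) (r @ r') = ev2 (VT.Do r) (%a b. ev2 (V.dT r') (%c d. ev2 (V.cT d) (%g d0.
 ev (SH g) (%s. ev (V.aT (a @ c) s) (b1 w)) * bT u (b @ d0))))"
 by (simp add: VT.Do_rm[OF r r'] pull)
 also have "... = ev2 (VT.Do r) (%a b. ev2 (V.dT r') (%c d. ev2 (V.cT d) (%g d0.
 V.eT c * (ev (SH g) (%s. ev (V.aT a s) (b1 w)) * bT u (b @ d0)) +
 V.eT a * (ev (SH g) (%s. ev (V.aT c s) (b1 w)) * bT u (b @ d0)))))"
 proof -
 have "ev (SH g) (%s. ev (V.aT (a @ c) s) (b1 w)) =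
 V.eT c * ev (SH g) (%s. ev (V.aT a s) (b1 w)) + V.eT a * ev (SH g) (%s. ev (V.aT c s) (b1 w))" for g a c
 unfolding ev_fun_mult_left[symmetric] ev_fun_plus[symmetric]
 by (rule H.Si_cong) (simp add: b1_act_append ev_fun_mult_left mult.commute)
 thus ?thesis by (simp add: distrib_right mult.assoc)
 qed
 also have "... = ev2 (VT.Do r) (%a b. ev2 (V.cT r') (%g d0. ev (SH g) (%s. ev (V.aT a s) (b1 w)) * bT u (b @ d0))) +
 ev2 (V.dT r') (%c d. ev2 (V.cT d) (%g d0. ev (SH g) (%s. ev (V.aT c s) (b1 w)) * bT u (r @ d0)))"
 proof -
 have "ev2 (V.dT r') (%c d. ev2 (V.cT d) (%g d0. V.eT c * G g d0)) = ev2 (V.cT r') G" for G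
 using V.comultT_counit_l[OF r', of "%d. ev2 (V.cT d) G"] by (simp add: ev2_fun_mult_left)
 moreover have "ev2 (VT.Do r) (%a b. ev2 (V.dT r') (%c d. ev2 (V.cT d) (%g d0. V.eT a * G c g b d0))) =
 ev2 (V.dT r') (%c d. ev2 (V.cT d) (%g d0. G c g r d0))" for G
 using VT.Do_counit_l[OF r, of "%b. ev2 (V.dT r') (%c d. ev2 (V.cT d) (%g d0. G c g b d0))"]
 by (simp add: ev2_fun_mult_left)
 ultimately show ?thesis by (simp add: ev2_fun_plus)
 qed
 also have "... = ev2 (W.dT u) (%u1 u2. ev2 (CW w) (%k w0. ev (W.aT u1 k) (%u1'. bT (w0 # u2) r * bT u1' r'))) +
 ev2 (W.dT u) (%u1 u2. bT u2 r * bT (w # u1) r')"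
 proof (rule arg_cong2[of _ _ _ _ "(+)"])
 have "ev2 (VT.Do r) (%a b. ev2 (V.cT r') (%g d0. ev (SH g) (%s. ev (V.aT a s) (b1 w)) * bT u (b @ d0))) =
 ev2 (VT.Do r) (%a b. ev2 (V.cT r') (%g d0. ev2 (CW w) (%k w0. t k g * b1 w0 a) *
 ev2 (W.dT u) (%u1 u2. bT u2 b * bT u1 d0)))" (is "?x = _")
 unfolding b1_C2 using Cons.IH[OF u] by (intro VT.Do_cong[OF r] V.coactT_cong) simp
 also have "... = ev2 (W.dT u) (%u1 u2. ev2 (CW w) (%k w0.
 ev2 (VT.Do r) (%a b. b1 w0 a * bT u2 b) * ev2 (V.cT r') (%g d0. t k g * bT u1 d0)))"
 by (simp add: push ev2_swap[of "VT.Do r" "W.dT u"] ev2_swap[of "V.cT r'" "W.dT u"]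
 ev2_swap[of "CW w" "W.dT u"] ev2_swap[of "VT.Do r" "CW w"] ev2_swap[of "V.cT r'" "CW w"]
 ev2_swap[of "V.cT r'" "VT.Do r"] mult_ac)
 also have "... = ev2 (W.dT u) (%u1 u2. ev2 (CW w) (%k w0. ev (W.aT u1 k) (%u1'. bT (w0 # u2) r * bT u1' r')))" (is "_ = ?y")
 by (simp add: bT_C1[OF r', symmetric] pull)
 finally show "?x = ?y" .
 have "ev2 (V.dT r') (%c d. ev2 (V.cT d) (%g d0. ev (SH g) (%s. ev (V.aT c s) (b1 w)) * bT u (r @ d0))) =
 ev2 (VT.Do r') (%x y. b1 w x * bT u (r @ y))" (is "?x = _")
 by (simp add: VT.ev2_Do pull)
 also have "... = ev2 (VT.Do r') (%x y. b1 w x * ev2 (W.dT u) (%u1 u2. bT u2 r * bT u1 y))"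
 by (rule VT.Do_cong[OF r']) (simp add: Cons.IH u r)
 also have "... = ev2 (W.dT u) (%u1 u2. bT u2 r * bT (w # u1) r')" (is "_ = ?y")
 by (simp add: push ev2_swap[of _ "W.dT u"] mult_ac)
 finally show "?x = ?y" .
 qed
 finally show ?case by (simp add: add.commute)
qed

end

section \<open>The twist form in coordinates\<close>

locale twist_coord =
 pairing_coord BK muK unK DK eK SK BH muH unH DH eH SH t +
 T: ybi_coord BK muK unK DK eK SK BT AT CT rmT r1T DrT erT +
 R: ybi_coord BH muH unH DH eH SH BR AR CR rmR r1R DrR erR
 for BK :: "'g set" and muK :: "'g => 'g => 'g \<Rightarrow>\<^sub>0 'k::field" and unK DK eK SK
 and BH :: "'h set" and muH :: "'h => 'h => 'h \<Rightarrow>\<^sub>0 'k" and unH DH eH SH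
 and t :: "'g => 'h => 'k"
 and BT :: "'t set" and AT CT rmT r1T DrT erT and BR :: "'r set" and AR CR rmR r1R DrR erR +
 fixes b :: "'t => 'r => 'k"
 assumes B1: "r : BR ==> b (rmT u u') r = ev2 (R.Do r) (%x y. b u x * b u' y)"
 and B2: "b r1T r = erR r"
 and B3: "u : BT ==> r : BR ==> r' : BR ==> b u (rmR r r') = ev2 (DrT u) (%u1 u2. b u2 r * b u1 r')"
 and B4: "b u r1R = erT u"
 and C1: "r : BR ==> ev (AT k u) (%u'. b u' r) = ev2 (CR r) (%h x. t k h * b u x)"
 and C2: "r : BR ==> ev2 (CT u) (%k u0. t k h * b u0 r) = ev (SH h) (%s. ev (AR s r) (b u))"
begin

text \<open>The factor beta(u, S^-1(h) . r) of the twisted form. \<open>F\<close> is then the value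
  of beta # tau on (u # k) tensor (r # h).\<close>

definition G :: "'t => 'r => 'h => 'k" where
 "G u r h = ev (SH h) (%s. ev (AR s r) (b u))"

definition F :: "'t => 'g => 'r => 'h => 'k" where
 "F u k r h = ev2 (DH h) (%h1 h2. G u r h1 * t k h2)"

lemma F_A2: "r : BR ==> h : BH ==> ev unK (%k. F r1T k r h) = erR r * eH h"
proof -
 assume "r : BR" and h: "h : BH"
 have "G r1T r h = eH h * erR r" for h
 proof -
 have "G r1T r h = ev (SH h) (%s. ev (AR s r) erR)"
 unfolding G_def by (intro ev_cong R.A_cong) (rule B2)
 thus ?thesis by (simp add: R.er_A pull H.e_Si)
 qed
 hence "ev unK (%k. F r1T k r h) = ev2 (DH h) (%h1 h2. eH h1 * (eH h2 * erR r))"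
 by (simp add: F_def ev_ev2_swap pull A2 mult_ac)
 thus ?thesis using h by (simp add: H.counit_l mult.commute)
qed

lemma F_A4: "ev unH (%h. F u k r1R h) = erT u * eK k"
proof -
 have "G u r1R h = eH h * erT u" for h
 by (simp add: G_def R.A_r1 B4 pull H.e_Si)
 hence "ev unH (%h. F u k r1R h) = ev unH eH * erT u * ev unH (t k)"
 by (simp add: F_def H.D_un pull)
 thus ?thesis by (simp add: H.e_un A4)
qed

text \<open>(B.1) combined with \<open>Do_A\<close>. The reversal of legs in \<open>Do_A\<close>
  undoes that of the inverse antipode, so h_1 goes with \<open>u\<close> and h_2 with
  \<open>u'\<close>.\<close>

lemma G_rmT:
 assumes r: "r : BR"
 shows "G (rmT u u') r h = ev2 (DH h) (%h1 h2. ev2 (R.Do r) (%a c. G u a h1 * G u' c h2))"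
proof -
 have "G (rmT u u') r h = ev (SH h) (%s. ev (AR s r) (%x. ev2 (R.Do x) (%x1 x2. b u x1 * b u' x2)))"
 unfolding G_def by (intro ev_cong R.A_cong) (rule B1)
 also have "... = ev (SH h) (%s. ev2 (DH s) (%s1 s2. ev2 (R.Do r) (%a c. ev (AR s2 a) (%x1. ev (AR s1 c) (%x2. b u x1 * b u' x2)))))"
 by (rule H.Si_cong) (rule R.Do_A[OF _ r])
 also have "... = ev2 (DH h) (%h1 h2. ev2 (R.Do r) (%a c. G u a h1 * G u' c h2))"
 by (simp add: H.Si_D G_def pull ev_ev2_swap[of _ "R.Do r"])
 finally show ?thesis .
qed

lemma G_AT: "ev (AT k u) (%u1. G u1 c h) = ev (SH h) (%q. ev (AR q c) (%x. ev2 (CR x) (%g z. t k g * b u z)))"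
proof -
 have "ev (AT k u) (%u1. G u1 c h) = ev (SH h) (%q. ev (AR q c) (%x. ev (AT k u) (%u1. b u1 x)))"
 by (simp add: G_def ev_swap[of "AT k u" "SH h"] ev_swap[of "AT k u" "AR q c" for q])
 also have "... = ev (SH h) (%q. ev (AR q c) (%x. ev2 (CR x) (%g z. t k g * b u z)))"
 by (intro ev_cong R.A_cong) (rule C1)
 finally show ?thesis .
qed

lemma G_CT: "r : BR ==> ev2 (CT u) (%k u0. t k h * b u0 r) = G u r h"
 unfolding G_def by (rule C2)

lemma G_mu: "ev (muH g l) (G u r) = ev (SH g) (%s. ev (AR s r) (%a. G u a l))"
 unfolding G_def using R.Si_mu_A[of g l r "b u"] .

text \<open>The left side is a product in T # K. \<open>G_rmT\<close> and (A.3) spread h over four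
  legs. (C.1) turns the action of k_1 on \<open>u'\<close> into a value of \<open>t\<close>, which
  (A.1) merges with the value at k_2. The identity \<open>coact_Si\<close> on the two middle legs
  then yields the coaction that occurs in the coproduct of R # H.\<close>

lemma F_A3:
 assumes r: "r : BR" and h: "h : BH"
 shows "ev2 (DK k) (%k1 k2. ev (AT k1 u') (%u1. ev (muK k2 k') (%m. F (rmT u u1) m r h))) =
 ev2 (DrR r) (%r1 r2. ev2 (CR r2) (%g r20. ev2 (DH h) (%h1 h2. ev (muH g h1) (%p.
 F u k r1 p * F u' k' r20 h2))))"
proof -
 have "ev2 (DK k) (%k1 k2. ev (AT k1 u') (%u1. ev (muK k2 k') (%m. F (rmT u u1) m r h))) =
 ev2 (DH h) (%h1 h2. ev2 (DK k) (%k1 k2. ev (AT k1 u') (%u1. G (rmT u u1) r h1) * ev (muK k2 k') (%m. t m h2)))"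
 by (simp add: F_def pull ev_ev2_swap[of _ "DH h"] ev2_swap[of "DK k" "DH h"])
 also have "... = ev2 (DH h) (%h1 h2. ev2 (DH h2) (%h3 h4. ev2 (DH h1) (%l1 l2. ev2 (R.Do r) (%a c.
 G u a l1 * (ev2 (DK k) (%k1 k2. ev (AT k1 u') (%u1. G u1 c l2) * t k2 h3) * t k' h4)))))"
 by (simp add: G_rmT[OF r] A3 pull ev_ev2_swap[of "AT a c" "DH d" for a c d] ev_ev2_swap[of _ "R.Do r"])
 (simp add: push2 ev2_swap[of "DK k" "DH x" for x] ev2_swap[of "DK k" "R.Do r"]
 ev2_swap[of "R.Do r" "DH x" for x] mult_ac, rule ev2_cong, rule ev2_swap)
 also have "... = ev2 (DH h) (%h1 h2. ev2 (DH h2) (%h3 h4. ev2 (DH h1) (%l1 l2. ev2 (R.Do r) (%a c.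
 G u a l1 * (ev (SH l2) (%q. ev (AR q c) (%x. ev2 (CR x) (%g z. ev (muH h3 g) (%m. t k m * b u' z)))) * t k' h4)))))"
 proof -
 have "ev2 (DK k) (%k1 k2. ev (AT k1 u') (%u1. G u1 c l2) * t k2 h3) =
 ev (SH l2) (%q. ev (AR q c) (%x. ev2 (CR x) (%g z. ev2 (DK k) (%k1 k2. t k2 h3 * t k1 g) * b u' z)))" for c l2 h3
 by (simp add: G_AT push ev_ev2_swap[where n = "DK k", symmetric] ev2_swap[of "DK k" "CR x" for x] mult_ac)
 thus ?thesis by (simp only: A1[symmetric] ev_fun_mult_right)
 qed
 \<comment> \<open>Rebracketing makes l_2 and h_3 the legs of one coproduct, the shape required by
   \<open>coact_Si\<close>.\<close>
 also have "... = ev2 (DH h) (%l1 x. ev2 (DH x) (%y h4. ev2 (DH y) (%l2 h3. ev2 (R.Do r) (%a c.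
 G u a l1 * (ev (SH l2) (%q. ev (AR q c) (%x. ev2 (CR x) (%g z. ev (muH h3 g) (%m. t k m * b u' z)))) * t k' h4)))))"
 by (rule H.D4)
 also have "... = ev2 (DH h) (%l1 x. ev2 (DH x) (%y h4. ev2 (R.Do r) (%a c. G u a l1 *
 (ev2 (DH y) (%l2 h3. ev (SH l2) (%q. ev (AR q c) (%x. ev2 (CR x) (%g z. ev (muH h3 g) (%m. t k m * b u' z))))) * t k' h4))))"
 by (simp only: push2 ev2_swap[of "DH y" "R.Do r" for y])
 also have "... = ev2 (DH h) (%l1 x. ev2 (DH x) (%y h4. ev2 (R.Do r) (%a c. G u a l1 *
 (ev2 (CR c) (%g y0. ev2 (DH y) (%h1 h2. ev (muH g h1) (%p. ev (SH h2) (%s. ev (AR s y0) (%z. t k p * b u' z))))) * t k' h4))))"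
 by (rule ev2_cong, rule H.D_cong, rule R.Do_cong[OF r], subst R.coact_Si) simp_all
 also have "... = ev2 (DH h) (%l1 x. ev2 (DH x) (%y h4. ev2 (DH y) (%h1 h2. ev2 (R.Do r) (%a c.
 ev2 (CR c) (%g y0. G u a l1 * (ev (muH g h1) (t k) * G u' y0 h2 * t k' h4))))))"
 by (simp add: pull G_def[symmetric]) (simp add: push2 ev2_swap[of "CR c" "DH x" for c x] ev2_swap[of "R.Do r" "DH x" for x])
 also have "... = ev2 (DH h) (%h1 h2. ev2 (DH h2) (%h3 h4. ev2 (DH h1) (%l1 i1. ev2 (R.Do r) (%a c.
 ev2 (CR c) (%g y0. G u a l1 * (ev (muH g i1) (t k) * G u' y0 h3 * t k' h4))))))"
 by (rule H.D4[symmetric])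
 also have "... = ev2 (DH h) (%h1 h2. ev2 (DH h2) (%h3 h4. ev2 (DH h1) (%l1 i1. ev2 (DrR r) (%r1 r2. ev2 (CR r2) (%g' r20.
 ev2 (DH g') (%g0 g. ev (muH g0 l1) (G u r1) * (ev (muH g i1) (t k) * G u' r20 h3 * t k' h4)))))))"
 unfolding R.ev2_Do G_mu R.C_coassoc by (simp add: ev_ev2_swap[of _ "CR c" for c] ev_fun_mult_right)
 also have "... = ev2 (DrR r) (%r1 r2. ev2 (CR r2) (%g r20. ev2 (DH h) (%h1 h2. ev (muH g h1) (%p.
 F u k r1 p * F u' k' r20 h2))))"
 by (simp add: F_def pull H.D_mu)
 (simp add: push2 ev2_swap[of "DH x" "DrR r" for x] ev2_swap[of "DH x" "CR y" for x y] mult_ac,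
 (rule ev2_cong)+, rule ev2_reverse3)
 finally show ?thesis .
qed

text \<open>\<open>A_rm_Si\<close> cancels the action of h_1 on \<open>r'\<close> against an inverse
  antipode. After (B.3) a second inverse antipode still acts on the argument paired with u_2, and
  (C.2) trades it for a coaction of u_2. Finally (A.1) splits \<open>t k\<close> on a product and
  (A.3) collects the elements of K into g k_1, as in the coproduct of T # K.\<close>

lemma F_A1:
 assumes u: "u : BT" and r: "r : BR" and r': "r' : BR"
 shows "ev2 (DH h) (%h1 h2. ev (AR h1 r') (%x. ev (muH h2 h') (%m. F u k (rmR r x) m))) =
 ev2 (DrT u) (%u1 u2. ev2 (CT u2) (%g u20. ev2 (DK k) (%k1 k2. ev (muK g k1) (%p.
 F u20 k2 r h * F u1 p r' h'))))"
proof -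
 have "ev2 (DH h) (%h1 h2. ev (AR h1 r') (%x. ev (muH h2 h') (%m. F u k (rmR r x) m))) =
 ev2 (DH h) (%x h4. ev2 (DH h') (%d e. ev2 (DH x) (%h1 h3. ev (AR h1 r') (%x.
 ev (muH h3 d) (G u (rmR r x)))) * ev (muH h4 e) (t k)))"
 by (simp add: F_def H.D_mu pull ev_ev2_swap) (simp add: push2 H.D_coassoc ev2_swap[of "DH h'" "DH x" for x])
 also have "... = ev2 (DH h) (%x h4. ev2 (DH h') (%d e.
 ev (SH x) (%q. ev (AR q r) (%y. G u (rmR y r') d)) * ev (muH h4 e) (t k)))"
 unfolding G_mu by (rule H.D_cong, rule ev2_cong, subst R.A_rm_Si[OF _ r']) simp_all
 also have "... = ev2 (DH h) (%x h4. ev2 (DH h') (%d e. ev (SH x) (%q. ev (AR q r) (%y.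
 ev2 (DH d) (%d1 d2. ev2 (DrT u) (%u1 u2. G u2 y d2 * G u1 r' d1)))) * ev (muH h4 e) (t k)))"
 proof -
 have "G u (rmR y r') d = ev2 (DH d) (%d1 d2. ev2 (DrT u) (%u1 u2. G u2 y d2 * G u1 r' d1))" for y d
 proof -
 have "G u (rmR y r') d = ev2 (DH d) (%h1 h2. ev (SH h1) (%p. ev (SH h2) (%q. ev (AR q y) (%y'. ev (AR p r') (%v'.
 ev2 (DrT u) (%u1 u2. b u2 y' * b u1 v'))))))"
 unfolding G_def R.Si_A_rm by (intro ev2_cong ev_cong R.A_cong) (rule B3[OF u])
 thus ?thesis by (simp add: ev_ev2_swap[of _ "DrT u"] pull G_def)
 qed
 thus ?thesis by simp
 qed
 also have "... = ev2 (DH h) (%x h4. ev2 (DH h') (%d e. ev2 (DH d) (%d1 d2. ev2 (DrT u) (%u1 u2.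
 ev2 (CT u2) (%g u20. t g d2 * G u20 r x) * G u1 r' d1)) * ev (muH h4 e) (t k)))"
 proof -
 have "ev (SH x) (%q. ev (AR q r) (%y. G u2 y d2)) = ev2 (CT u2) (%g u20. t g d2 * G u20 r x)" for x u2 d2
 proof -
 have "ev (SH x) (%q. ev (AR q r) (%y. G u2 y d2)) =
 ev (SH x) (%q. ev (AR q r) (%y. ev2 (CT u2) (%g u20. t g d2 * b u20 y)))"
 by (intro ev_cong R.A_cong) (rule G_CT[symmetric])
 thus ?thesis by (simp add: ev_ev2_swap pull G_def)
 qed
 thus ?thesis by (simp add: ev_ev2_swap pull)
 qed
 also have "... = ev2 (DrT u) (%u1 u2. ev2 (CT u2) (%g u20. ev2 (DK k) (%k1 k2. ev (muK g k1) (%p.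
 F u20 k2 r h * F u1 p r' h'))))"
 by (simp add: F_def A1 pull ev_ev2_swap A3)
 (simp add: push2 ev2_swap[of "DH x" "DrT u" for x] ev2_swap[of "DH x" "CT y" for x y] ev2_swap[of "DH x" "DK k" for x]
 ev2_swap[of "DK k" "CT y" for y] ev2_swap[of "DK k" "DrT u"] ev2_swap[of "DH y" "DH h" for y] H.D_coassoc mult_ac)
 finally show ?thesis .
qed

end

section \<open>Coordinates of Hopf algebras and Yetter--Drinfel'd modules\<close>

abbreviation "sw \<equiv> tsum scalars"

lemma bilI:
 "(!!v. v : car V ==> (%u. f u v) : lin U N) ==>
 (!!u. u : car U ==> (%v. f u v) : lin V N) ==> bil U V N f"
 by (simp add: bil_def)

lemma bil_left: "bil U V N f ==> v : car V ==> (%u. f u v) : lin U N"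
 and bil_right: "bil U V N f ==> u : car U ==> f u : lin V N"
 by (simp_all add: bil_def)

lemma lin_tsum_arg:
 "vs U ==> vs V ==> vs N ==> bil U V N f ==> h : lin M (tensor U V) ==>
 (%x. tsum N (h x) f) : lin M N"
 by (rule vs2.lin_tensor_sum_arg[OF vs2I])

lemma lin_tsum_arg':
 "h : lin M (tensor U V) ==> bil U V N f ==> vs U ==> vs V ==> vs N ==>
 (%x. tsum N (h x) f) : lin M N"
 by (rule lin_tsum_arg)

lemma lin_tsum_fun:
 "vs U ==> vs V ==> vs N ==> vs M ==> X : car (tensor U V) ==>
 (!!x. x : car M ==> bil U V N (f x)) ==>
 (!!u v. u : car U ==> v : car V ==> (%x. f x u v) : lin M N) ==>
 (%x. tsum N X (f x)) : lin M N"
 by (rule vs2.lin_tensor_sum_fun[OF vs2I])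

lemma lin_tsum_fun':
 "X : car (tensor U V) ==> (!!x. x : car M ==> bil U V N (f x)) ==>
 (!!u v. u : car U ==> v : car V ==> (%x. f x u v) : lin M N) ==>
 vs U ==> vs V ==> vs N ==> vs M ==> (%x. tsum N X (f x)) : lin M N"
 by (rule lin_tsum_fun)

lemma lin_tsum:
 "X : car (tensor U V) ==> ph : lin N N' ==> bil U V N f ==> vs U ==> vs V ==> vs N ==> vs N' ==>
 ph (tsum N X f) = tsum N' X (%a b. ph (f a b))"
 by (rule vs2.lin_tensor_sum[OF vs2I])

lemma lin_pure1:
 "vs U ==> vs V ==> v : car V ==> f : lin M U ==>
 (%x. pt U V (f x) v) : lin M (tensor U V)"
 using lin_comp bil_left[OF vs2.bil_pure[OF vs2I]] by fastforce

lemma lin_pure2: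
 "vs U ==> vs V ==> u : car U ==> f : lin M V ==>
 (%x. pt U V u (f x)) : lin M (tensor U V)"
 using lin_comp bil_right[OF vs2.bil_pure[OF vs2I]] by fastforce

lemma lin_ev_coords:
 "vs N ==> g : lin M N ==> (%x. ev (coords N (g x)) f) : lin M scalars"
 using lin_comp[OF _ ev_linear[OF _ coords_linear]] by fastforce

lemma lin_ev_fun:
 assumes "!!y. y : ks m ==> (%x. f x y) : lin M scalars"
 shows "(%x. ev m (f x)) : lin M scalars"
proof (rule linI)
 fix x y assume x: "x : car M" and y: "y : car M"
 have "ev m (f (x \<oplus>\<^bsub>M\<^esub> y)) = ev m (%z. f x z + f y z)"
 by (rule ev_cong) (use lin_add[OF assms x y] in simp)
 thus "ev m (f (x \<oplus>\<^bsub>M\<^esub> y)) = ev m (f x) \<oplus>\<^bsub>scalars\<^esub> ev m (f y)"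
 by (simp add: ev_fun_plus)
next
 fix c x assume x: "x : car M"
 have "ev m (f (c \<odot>\<^bsub>M\<^esub> x)) = ev m (%z. c * f x z)"
 by (rule ev_cong) (use lin_smult[OF assms x] in simp)
 thus "ev m (f (c \<odot>\<^bsub>M\<^esub> x)) = c \<odot>\<^bsub>scalars\<^esub> ev m (f x)"
 by (simp add: ev_fun_mult_left)
qed simp

lemma lin_mult_left: "f : lin M scalars ==> (%x. c * f x) : lin M scalars"
 and lin_mult_right: "f : lin M scalars ==> (%x. f x * c) : lin M scalars"
 by (auto simp: linear_maps_def algebra_simps)

lemmas lins = bilI lin_id lin_tsum_arg lin_tsum_fun lin_pure1 lin_pure2 lin_ev_coords lin_ev_fun
 lin_mult_left lin_mult_right vsk

section \<open>Trilinear forms and coassociativity\<close>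

definition tri :: "('k::field, 'u, 'm) module_scheme => ('k, 'v, 'n) module_scheme =>
 ('k, 'w, 'p) module_scheme => ('u => 'v => 'w => 'k) => bool" where
 "tri U V W F \<longleftrightarrow> (ALL v:car V. ALL w:car W. (%u. F u v w) : lin U scalars) &
 (ALL u:car U. bil V W scalars (F u))"

lemma tri_functional:
 assumes "vs U" "vs V" "vs W" "tri U V W F"
 shows "(%Z. sw Z (%a Y. sw Y (F a))) : lin (tensor U (tensor V W)) scalars" (is "?P : _")
 and "u : car U ==> v : car V ==> w : car W ==>
 sw (pt U (tensor V W) u (pt V W v w)) (%a Y. sw Y (F a)) = F u v w"
proof -
 interpret VW: vs2 V W by (rule vs2I) fact+
 interpret UVW: vs2 U "tensor V W" by (rule vs2I) (fact, rule VW.vs_tensor)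
 have b: "bil U (tensor V W) scalars (%a Y. sw Y (F a))"
 proof (rule bilI)
 fix Y assume "Y : car (tensor V W)"
 thus "(%u. sw Y (F u)) : lin U scalars"
 by (rule lin_tsum_fun[OF assms(2,3) vsk assms(1)]) (use assms(4) in \<open>auto simp: tri_def\<close>)
 next
 fix u assume "u : car U"
 thus "(%Y. sw Y (F u)) : lin (tensor V W) scalars"
 by (intro VW.tensor_sum_linear[OF vsk]) (use assms(4) in \<open>auto simp: tri_def\<close>)
 qed
 show "?P : lin (tensor U (tensor V W)) scalars"
 by (rule UVW.tensor_sum_linear[OF vsk b])
 assume "u : car U" "v : car V" "w : car W"
 thus "sw (pt U (tensor V W) u (pt V W v w)) (%a Y. sw Y (F a)) = F u v w"
 using assms(4) by (simp add: UVW.tensor_sum_pure[OF vsk b] VW.pure_closed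
 VW.tensor_sum_pure[OF vsk] tri_def)
qed

text \<open>The bilinear function with the values of an arbitrary \<open>F\<close> on basis vectors.
  Laws of Sweedler sums need multilinear integrands, whereas coordinate identities allow any;
  replacing \<open>F\<close> by its extension changes nothing in a sum over basis vectors.\<close>

definition ext2 where "ext2 U V F u v = ev (coords U u) (%a. ev (coords V v) (%b. F a b))"

definition ext3 where
 "ext3 U V W F u v w = ev (coords U u) (%a. ev (coords V v) (%b. ev (coords W w) (%c. F a b c)))"

lemma ext2_basis: "vs U ==> vs V ==> a : basis U ==> b : basis V ==> ext2 U V F a b = F a b"
 by (simp add: ext2_def coords_basis)

lemma ext3_basis: "vs U ==> vs V ==> vs W ==> a : basis U ==> b : basis V ==> c : basis W ==>
 ext3 U V W F a b c = F a b c"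
 by (simp add: ext3_def coords_basis)

lemma bil_ext2: "vs U ==> vs V ==> bil U V scalars (ext2 U V F)"
 unfolding ext2_def[abs_def] by (intro lins)

lemma tri_ext3: "vs U ==> vs V ==> vs W ==> tri U V W (ext3 U V W F)"
 unfolding tri_def ext3_def[abs_def] by (intro conjI ballI lins)

lemma tri_bil12: "tri U V W F ==> w : car W ==> bil U V scalars (%u v. F u v w)"
 and tri_bil23: "tri U V W F ==> u : car U ==> bil V W scalars (F u)"
 and tri1: "tri U V W F ==> v : car V ==> w : car W ==> (%u. F u v w) : lin U scalars"
 and tri2: "tri U V W F ==> u : car U ==> w : car W ==> (%v. F u v w) : lin V scalars"
 and tri3: "tri U V W F ==> u : car U ==> v : car V ==> (%w. F u v w) : lin W scalars"
 by (auto simp: tri_def bil_def)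

lemma tri_sw12:
 assumes "vs C" "vs U" "D : lin C (tensor C C)" "tri C C U F"
 shows "bil C U scalars (%a b. sw (D a) (%c d. F c d b))"
proof (rule bilI)
 fix b assume b: "b : car U"
 show "(%a. sw (D a) (%c d. F c d b)) : lin C scalars"
 by (rule lin_tsum_arg[OF assms(1,1) vsk tri_bil12[OF assms(4) b]]) (use assms(3) in simp)
next
 fix a assume a: "a : car C"
 show "(%b. sw (D a) (%c d. F c d b)) : lin U scalars"
 by (rule lin_tsum_fun[OF assms(1,1) vsk assms(2) lin_closed[OF assms(3) a]])
 (use tri_bil12[OF assms(4)] tri3[OF assms(4)] in simp_all)
qed

lemma tri_sw23:
 assumes "vs C" "vs U" "E : lin U (tensor C U)" "tri C C U F"
 shows "bil C U scalars (%a b. sw (E b) (%c d. F a c d))"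
proof (rule bilI)
 fix b assume b: "b : car U"
 show "(%a. sw (E b) (%c d. F a c d)) : lin C scalars"
 by (rule lin_tsum_fun[OF assms(1,2) vsk assms(1) lin_closed[OF assms(3) b]])
 (use tri_bil23[OF assms(4)] tri1[OF assms(4)] in simp_all)
next
 fix a assume a: "a : car C"
 show "(%b. sw (E b) (%c d. F a c d)) : lin U scalars"
 by (rule lin_tsum_arg[OF assms(1,2) vsk tri_bil23[OF assms(4) a]]) (use assms(3) in simp)
qed

text \<open>Every representative of a class in the tensor product is supported on pairs from the
  carriers, so agreement there determines the image of the class. This covers integrands whose
  bilinearity has not been established.\<close>

lemma sw_cong:
 assumes "vs U" "vs V" "X : car (tensor U V)"
 and "!!u v. u : car U ==> v : car V ==> f u v = g u v"
 shows "sw X f = sw X g"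
proof -
 interpret vs2 U V by (rule vs2I) fact+
 obtain m where m: "m : car FS" "X = prj m" using assms(3) by (auto simp: carrier_tensor)
 have "ev z (%(u, v). f u v) = ev z (%(u, v). g u v)" if "z : X" for z
 proof (rule ev_cong)
 fix p assume p: "p : ks z"
 have "z : car FS"
 using that coset_mem_iff[OF vs_free_space tensor_relations_submodule[OF assms(1,2)] m(1)] m(2) by blast
 thus "(case p of (u, v) => f u v) = (case p of (u, v) => g u v)" using assms(4) p by (cases p) auto
 qed
 thus ?thesis by (simp add: tensor_sum_def class_sum_lift lift_scalars[abs_def])
qed

lemma sw_tsum:
 assumes "X : car (tensor A B)" "bil A B (tensor U V) f" "bil U V scalars F" "vs A" "vs B" "vs U" "vs V"
 shows "sw (tsum (tensor U V) X f) F = sw X (%a b. sw (f a b) F)"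
 by (rule lin_tsum[OF assms(1) vs2.tensor_sum_linear[OF vs2I vsk assms(3)] assms(2)])
 (rule assms vs2.vs_tensor[OF vs2I] vsk)+

lemma sw_pure:
 "bil U V scalars F ==> u : car U ==> v : car V ==> vs U ==> vs V ==> sw (pt U V u v) F = F u v"
 by (rule vs2.tensor_sum_pure[OF vs2I vsk])

lemma tri_functional_eqI:
 assumes "vs U" "vs V" "vs W" "X : car (tensor U (tensor V W))" "Y : car (tensor U (tensor V W))"
 and "!!F. tri U V W F ==> sw X (%a Z. sw Z (F a)) = sw Y (%a Z. sw Z (F a))"
 shows "X = Y"
proof -
 interpret VW: vs2 V W by (rule vs2I) fact+
 interpret T: vs2 U "tensor V W" by (rule vs2I) (fact, rule VW.vs_tensor)
 show ?thesis
 proof (rule functional_eqI[OF T.vs_tensor assms(4,5)])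
 fix ph assume ph: "ph : lin (tensor U (tensor V W)) scalars"
 define F where "F = (%u v w. ph (pt U (tensor V W) u (pt V W v w)))"
 have F: "tri U V W F"
 unfolding tri_def F_def
 by (intro conjI ballI bilI lin_comp[OF _ ph] lin_pure1 lin_pure2 assms(1-3) VW.vs_tensor VW.pure_closed lin_id)
 have l: "(%Z. sw Z (F a)) : lin (tensor V W) scalars" if "a : car U" for a
 by (rule VW.tensor_sum_linear[OF vsk tri_bil23[OF F that]])
 have b: "bil U (tensor V W) scalars (%a Z. sw Z (F a))"
 by (rule bilI, rule VW.lin_tensor_sum_fun[OF assms(1) vsk _ tri_bil23[OF F] tri1[OF F]], assumption+, rule l)
 have p: "ph (pt U (tensor V W) u Z) = sw Z (F u)" if u: "u : car U" and Z: "Z : car (tensor V W)" for u Z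
 by (rule VW.tensor_ext[OF vsk _ l[OF u] _ Z, of "%Z. ph (pt U (tensor V W) u Z)"],
 intro lin_comp[OF _ ph] lin_pure2 assms VW.vs_tensor u lin_id,
 subst VW.tensor_sum_pure[OF vsk tri_bil23[OF F u]]) (simp_all add: F_def)
 have "ph Z = sw Z (%a Z. sw Z (F a))" if "Z : car (tensor U (tensor V W))" for Z
 by (rule T.tensor_ext[OF vsk ph T.tensor_sum_linear[OF vsk b] _ that])
 (simp add: T.tensor_sum_pure[OF vsk b] p)
 thus "ph X = ph Y" using assms(4-6) F by simp
 qed
qed


text \<open>Coassociativity of a coproduct (\<open>U = C\<close>, \<open>E = D\<close>) and of a
  coaction have the same shape and are treated together. Applying trilinear forms turns the tensor
  equation into a scalar identity; \<open>coassoc_sw\<close> and \<open>coassoc_swI\<close> pass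
  between the two.\<close>

lemma
 assumes vs: "vs C" "vs U" and D: "D : lin C (tensor C C)"
 and E: "E : lin U (tensor C U)" and x: "x : car U"
 defines "L \<equiv> tsum (tensor C (tensor C U)) (E x) (%a b.
 tsum (tensor C (tensor C U)) (D a) (%a1 a2.
 pt C (tensor C U) a1 (pt C U a2 b)))"
 and "R \<equiv> tsum (tensor C (tensor C U)) (E x) (%a b.
 tsum (tensor C (tensor C U)) (E b) (%b1 b2.
 pt C (tensor C U) a (pt C U b1 b2)))"
 shows coassoc_sw_left: "tri C C U F ==> sw L (%a Y. sw Y (F a)) = sw (E x) (%a b. sw (D a) (%a1 a2. F a1 a2 b))" (is "_ ==> ?left")
 and coassoc_sw_right: "tri C C U F ==> sw R (%a Y. sw Y (F a)) = sw (E x) (%a b. sw (E b) (%b1 b2. F a b1 b2))" (is "_ ==> ?right")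
 and coassoc_closed: "L : car (tensor C (tensor C U))" "R : car (tensor C (tensor C U))"
proof -
 interpret CC: vs2 C C by (rule vs2I) fact+
 interpret CU: vs2 C U by (rule vs2I) fact+
 interpret T: vs2 C "tensor C U" by (rule vs2I) (fact, rule CU.vs_tensor)
 have Dl: "(%x. D x) : lin C (tensor C C)" and El: "(%x. E x) : lin U (tensor C U)"
 using D E by auto
 have cl: "E b : car (tensor C U)" if "b : car U" for b using lin_closed[OF E that] .
 have cl2: "D b : car (tensor C C)" if "b : car C" for b using lin_closed[OF D that] .
 have b1: "bil C C (tensor C (tensor C U)) (%a1 a2. pt C (tensor C U) a1 (pt C U a2 b))"
 if "b : car U" for b
 using that by (intro lins vs CU.vs_tensor CU.pure_closed)
 have b2: "bil C U (tensor C (tensor C U)) (%b1 b2. pt C (tensor C U) a (pt C U b1 b2))"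
 if "a : car C" for a
 using that by (intro lins vs CU.vs_tensor)
 have b3: "bil C U (tensor C (tensor C U)) (%a b.
 tsum (tensor C (tensor C U)) (D a) (%a1 a2.
 pt C (tensor C U) a1 (pt C U a2 b)))"
 by (rule bilI, rule lin_tsum_arg[OF vs(1) vs(1) T.vs_tensor b1 Dl], assumption,
 rule lin_tsum_fun[OF vs(1) vs(1) T.vs_tensor vs(2) cl2 b1], assumption+)
 (intro lins vs CU.vs_tensor)
 have b4: "bil C U (tensor C (tensor C U)) (%a b.
 tsum (tensor C (tensor C U)) (E b) (%b1 b2.
 pt C (tensor C U) a (pt C U b1 b2)))"
 by (rule bilI, rule lin_tsum_fun[OF vs T.vs_tensor vs(1) cl b2], assumption+,
 intro lins vs CU.vs_tensor CU.pure_closed, assumption+, rule lin_tsum_arg[OF vs T.vs_tensor b2 El])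
 show "L : car (tensor C (tensor C U))" "R : car (tensor C (tensor C U))"
 unfolding L_def R_def by (rule CU.tensor_sum_closed[OF T.vs_tensor _ cl[OF x]] b3 b4)+
 assume F: "tri C C U F"
 note Ph = tri_functional(1)[OF vs(1) vs(1) vs(2) F] and Php = tri_functional(2)[OF vs(1) vs(1) vs(2) F]
 show ?left
 unfolding L_def CU.lin_tensor_sum[OF T.vs_tensor vsk b3 Ph cl[OF x]]
 proof (rule sw_cong[OF vs cl[OF x]])
 fix a b assume a: "a : car C" and b: "b : car U"
 show "sw (tsum (tensor C (tensor C U)) (D a) (%a1 a2.
 pt C (tensor C U) a1 (pt C U a2 b))) (%a Y. sw Y (F a)) = sw (D a) (%a1 a2. F a1 a2 b)"
 unfolding CC.lin_tensor_sum[OF T.vs_tensor vsk b1[OF b] Ph cl2[OF a]]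
 by (rule sw_cong[OF vs(1) vs(1) cl2[OF a]]) (simp add: Php b)
 qed
 show ?right
 unfolding R_def CU.lin_tensor_sum[OF T.vs_tensor vsk b4 Ph cl[OF x]]
 proof (rule sw_cong[OF vs cl[OF x]])
 fix a b assume a: "a : car C" and b: "b : car U"
 show "sw (tsum (tensor C (tensor C U)) (E b) (%b1 b2.
 pt C (tensor C U) a (pt C U b1 b2))) (%a Y. sw Y (F a)) = sw (E b) (%b1 b2. F a b1 b2)"
 unfolding CU.lin_tensor_sum[OF T.vs_tensor vsk b2[OF a] Ph cl[OF b]]
 by (rule sw_cong[OF vs cl[OF b]]) (simp add: Php a)
 qed
qed

lemma coassoc_sw:
 assumes "vs C" "vs U" "D : lin C (tensor C C)" "E : lin U (tensor C U)" "tri C C U F"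
 and eq: "tsum (tensor C (tensor C U)) (E x) (%a b.
 tsum (tensor C (tensor C U)) (D a) (%a1 a2.
 pt C (tensor C U) a1 (pt C U a2 b))) =
 tsum (tensor C (tensor C U)) (E x) (%a b.
 tsum (tensor C (tensor C U)) (E b) (%b1 b2.
 pt C (tensor C U) a (pt C U b1 b2)))"
 and x: "x : car U"
 shows "sw (E x) (%a b. sw (D a) (%a1 a2. F a1 a2 b)) = sw (E x) (%a b. sw (E b) (%b1 b2. F a b1 b2))"
 unfolding coassoc_sw_left[OF assms(1-4) x assms(5), symmetric]
 coassoc_sw_right[OF assms(1-4) x assms(5), symmetric] eq ..

lemma coassoc_swI:
 assumes "vs C" "vs U" "D : lin C (tensor C C)" "E : lin U (tensor C U)" "x : car U"
 and "!!F. tri C C U F ==>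
 sw (E x) (%a b. sw (D a) (%a1 a2. F a1 a2 b)) = sw (E x) (%a b. sw (E b) (%b1 b2. F a b1 b2))"
 shows "tsum (tensor C (tensor C U)) (E x) (%a b.
 tsum (tensor C (tensor C U)) (D a) (%a1 a2.
 pt C (tensor C U) a1 (pt C U a2 b))) =
 tsum (tensor C (tensor C U)) (E x) (%a b.
 tsum (tensor C (tensor C U)) (E b) (%b1 b2.
 pt C (tensor C U) a (pt C U b1 b2)))"
 by (rule tri_functional_eqI[OF assms(1,1,2) coassoc_closed[OF assms(1-5)]])
 (simp only: coassoc_sw_left[OF assms(1-5)] coassoc_sw_right[OF assms(1-5)] assms(6))

text \<open>Off the basis the value is zero, here and in the definitions that follow. Most
  identities of the coordinate locales then hold without membership assumptions, because both sides
  vanish off the basis.\<close>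

definition cD :: "('k::field, 'h, 'm) hopf_scheme => 'h => 'h \<times> 'h \<Rightarrow>\<^sub>0 'k" where
 "cD H h = (if h : basis H then vs2.coords2 H H (comult H h) else 0)"

definition ce :: "('k::field, 'h, 'm) hopf_scheme => 'h => 'k" where
 "ce H h = (if h : basis H then counit H h else 0)"

definition cmu :: "('k::field, 'h, 'm) hopf_scheme => 'h => 'h => 'h \<Rightarrow>\<^sub>0 'k" where
 "cmu H a b = (if a : basis H & b : basis H then coords H (a \<otimes>\<^bsub>H\<^esub> b) else 0)"

definition cS :: "('k::field, 'h, 'm) hopf_scheme => 'h => 'h \<Rightarrow>\<^sub>0 'k" where
 "cS H a = (if a : basis H then coords H (antipode H a) else 0)"

definition cSi :: "('k::field, 'h, 'm) hopf_scheme => 'h => 'h \<Rightarrow>\<^sub>0 'k" where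
 "cSi H a = (if a : basis H then coords H (Sinv H a) else 0)"

definition cA :: "('k::field, 'h, 'm) hopf_scheme => ('k, 'a, 'h, 'n) yd_scheme => 'h => 'a => 'a \<Rightarrow>\<^sub>0 'k" where
 "cA H M h x = (if h : basis H & x : basis M then coords M (act M h x) else 0)"

definition cC :: "('k::field, 'h, 'm) hopf_scheme => ('k, 'a, 'h, 'n) yd_scheme => 'a => 'h \<times> 'a \<Rightarrow>\<^sub>0 'k" where
 "cC H M x = (if x : basis M then vs2.coords2 H M (coact M x) else 0)"

abbreviation "cun H \<equiv> coords H (one H)"

lemma coact_general:
 assumes vs: "vs H" "vs M" and E: "E : lin M (tensor H M)" and x: "x : basis M"
 and F: "bil H M scalars F"
 shows "ev2 (vs2.coords2 H M (E x)) F = sw (E x) F"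
 by (rule vs2.ev2_coords2_bil[OF vs2I[OF vs] F lin_closed[OF E basis_carrier[OF vs(2) x]]])

locale hopf_bij = hopf_algebra H for H :: "('k::field, 'h, 'm) hopf_scheme" (structure) +
 assumes bij: "bijective_antipode H"
begin

lemma vs_H: "vs H" by unfold_locales

sublocale HH: vs2 H H by (rule vs2I[OF vs_H vs_H])

abbreviation "BH \<equiv> basis H"

lemma BH_carrier: "b : BH ==> b : car H" by (rule basis_carrier[OF vs_H])

lemma comult_closed: "h : car H ==> comult H h : car (tensor H H)"
 by (rule lin_closed[OF comult_linear])

lemma lin_multl: "f : lin M H ==> b : car H ==> (%x. f x \<otimes> b) : lin M H"
 by (rule linI) (simp_all add: lin_closed lin_add lin_smult l_distr smult_mult_left)

lemma lin_multr: "f : lin M H ==> b : car H ==> (%x. b \<otimes> f x) : lin M H"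
 by (rule linI) (simp_all add: lin_closed lin_add lin_smult r_distr smult_mult_right)

lemma lin_comult: "f : lin M H ==> (%x. comult H (f x)) : lin M (tensor H H)"
 by (rule lin_comp[OF _ comult_linear])

lemma lin_counit: "f : lin M H ==> (%x. counit H (f x)) : lin M scalars"
 by (rule lin_comp[OF _ counit_linear])

lemma antipode_closed: "h : car H ==> antipode H h : car H"
 by (rule lin_closed[OF antipode_linear])

lemma lin_antipode: "f : lin M H ==> (%x. antipode H (f x)) : lin M H"
 by (rule lin_comp[OF _ antipode_linear])

lemma inv_antipode_closed: "h : car H ==> Sinv H h : car H"
 using bij unfolding bijective_antipode_def inv_antipode_def
 by (metis bij_betw_def inv_into_into)

lemma antipode_inv: "h : car H ==> antipode H (Sinv H h) = h"
 using bij unfolding bijective_antipode_def inv_antipode_def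
 by (metis bij_betw_def f_inv_into_f)

lemma inv_antipode: "h : car H ==> Sinv H (antipode H h) = h"
 using bij unfolding bijective_antipode_def inv_antipode_def
 by (metis bij_betw_def inv_into_f_f)

lemma inv_antipode_linear: "Sinv H : lin H H"
proof (rule linI)
 fix x y c assume x: "x : car H" and y: "y : car H"
 have "antipode H (Sinv H x \<oplus> Sinv H y) = x \<oplus> y"
 by (simp add: lin_add[OF antipode_linear] inv_antipode_closed antipode_inv x y)
 hence "Sinv H (x \<oplus> y) = Sinv H (antipode H (Sinv H x \<oplus> Sinv H y))"
 by simp
 thus "Sinv H (x \<oplus> y) = Sinv H x \<oplus> Sinv H y"
 by (simp only: inv_antipode inv_antipode_closed x y M.a_closed)
next
 fix c x assume x: "x : car H"
 have "antipode H (c \<odot> Sinv H x) = c \<odot> x"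
 by (simp add: lin_smult[OF antipode_linear] inv_antipode_closed antipode_inv x)
 moreover have "c \<odot> Sinv H x : car H" using x by (simp add: inv_antipode_closed)
 ultimately show "Sinv H (c \<odot> x) = c \<odot> Sinv H x"
 by (metis inv_antipode)
qed (rule inv_antipode_closed)

lemma lin_inv_antipode: "f : lin M H ==> (%x. Sinv H (f x)) : lin M H"
 by (rule lin_comp[OF _ inv_antipode_linear])

lemmas Hlins = lins vs_H lin_multl lin_multr lin_comult lin_counit lin_antipode lin_inv_antipode
 comult_closed antipode_closed inv_antipode_closed m_closed one_closed

lemma cD_sw: "h : BH ==> bil H H scalars F ==> ev2 (cD H h) F = sw (comult H h) F"
 unfolding cD_def using HH.ev2_coords2_bil[OF _ comult_closed[OF BH_carrier]] by simp

lemma cmu_lin: "a : BH ==> b : BH ==> f : lin H scalars ==> ev (cmu H a b) f = f (a \<otimes> b)"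
 by (simp add: cmu_def ev_coords[OF vs_H] BH_carrier)

lemma cS_lin: "a : BH ==> f : lin H scalars ==> ev (cS H a) f = f (antipode H a)"
 by (simp add: cS_def ev_coords[OF vs_H] BH_carrier antipode_closed)

lemma cSi_lin: "a : BH ==> f : lin H scalars ==> ev (cSi H a) f = f (Sinv H a)"
 by (simp add: cSi_def ev_coords[OF vs_H] BH_carrier inv_antipode_closed)

lemma cun_lin: "f : lin H scalars ==> ev (cun H) f = f \<one>"
 by (rule ev_coords[OF vs_H _ one_closed])

lemma cD_keys: "ks (cD H h) <= BH \<times> BH"
 using HH.keys_coords2[OF comult_closed[OF BH_carrier]] by (simp add: cD_def)

lemma cmu_keys: "ks (cmu H a b) <= BH"
 using keys_coords[OF vs_H m_closed[OF BH_carrier BH_carrier]] by (simp add: cmu_def)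

lemma cS_keys: "ks (cS H a) <= BH"
 using keys_coords[OF vs_H antipode_closed[OF BH_carrier]] by (simp add: cS_def)

lemma cSi_keys: "ks (cSi H a) <= BH"
 using keys_coords[OF vs_H inv_antipode_closed[OF BH_carrier]] by (simp add: cSi_def)

lemma cun_keys: "ks (cun H) <= BH"
 by (rule keys_coords[OF vs_H one_closed])

lemma H_cong:
 "(!!a b. a : BH ==> b : BH ==> F a b = G a b) ==> ev2 (cD H h) F = ev2 (cD H h) G"
 "(!!a. a : BH ==> f a = g a) ==> ev (cmu H x y) f = ev (cmu H x y) g"
 "(!!a. a : BH ==> f a = g a) ==> ev (cS H x) f = ev (cS H x) g"
 "(!!a. a : BH ==> f a = g a) ==> ev (cSi H x) f = ev (cSi H x) g"
 "(!!a. a : BH ==> f a = g a) ==> ev (cun H) f = ev (cun H) g"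
 using cD_keys[of h] cmu_keys[of x y] cS_keys[of x] cSi_keys[of x] cun_keys
 by (intro ev2_cong ev_cong; blast)+

abbreviation "ext1 f \<equiv> %x. ev (coords H x) f"

lemma ext1_lin: "ext1 f : lin H scalars" by (intro lins vs_H)

lemma ext1_basis: "a : BH ==> ev (coords H a) f = f a" by (simp add: coords_basis[OF vs_H])

lemma coords_eq_ext1: "ks m <= BH ==> ev m f = ev m (ext1 f)"
 by (rule ev_cong) (simp add: ext1_basis subsetD)

lemma cmu_ext: "a : BH ==> b : BH ==> ev (cmu H a b) f = ext1 f (a \<otimes> b)"
 by (subst coords_eq_ext1[OF cmu_keys]) (rule cmu_lin[OF _ _ ext1_lin])

lemma cS_ext: "a : BH ==> ev (cS H a) f = ext1 f (antipode H a)"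
 by (subst coords_eq_ext1[OF cS_keys]) (rule cS_lin[OF _ ext1_lin])

lemma cSi_ext: "a : BH ==> ev (cSi H a) f = ext1 f (Sinv H a)"
 by (subst coords_eq_ext1[OF cSi_keys]) (rule cSi_lin[OF _ ext1_lin])

lemma cD_ext: "ev2 (cD H h) F = ev2 (cD H h) (ext2 H H F)"
 by (rule H_cong(1)) (simp add: ext2_basis[OF vs_H vs_H])

lemma sw_functional:
 assumes "X : car (tensor H H)" "bil H H H f" "ph : lin H scalars"
 shows "ph (tsum H X f) = sw X (%a b. ph (f a b))"
 by (rule HH.lin_tensor_sum[OF vs_H vsk assms(2,3,1)])

text \<open>Every law follows one scheme: the integrand is replaced by its multilinear extension,
  sums over coordinates become Sweedler sums and structure maps, the Hopf algebra axiom applies, and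
  the replacement is undone.\<close>

lemma antipode_coord:
 "antipode_coord (basis H) (cmu H) (cun H) (cD H) (ce H) (cS H) (cSi H)"
proof unfold_locales
 fix a b c h :: 'h and f :: "'h => 'k"
 show "ks (cmu H a b) <= BH" "ks (cun H) <= BH" "ks (cD H a) <= BH \<times> BH" "ks (cS H a) <= BH" "ks (cSi H a) <= BH"
 by (rule cmu_keys cun_keys cD_keys cS_keys cSi_keys)+
 show "a \<notin> BH ==> cD H a = 0" "a \<notin> BH ==> ce H a = 0" "a \<notin> BH ==> cS H a = 0" "a \<notin> BH ==> cSi H a = 0"
 "a \<notin> BH \<or> b \<notin> BH ==> cmu H a b = 0"
 by (auto simp: cD_def ce_def cS_def cSi_def cmu_def)
 show "ev (cmu H a b) (%x. ev (cmu H x c) f) = ev (cmu H b c) (%x. ev (cmu H a x) f)"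
 proof (cases "a : BH & b : BH & c : BH")
 case True
 hence "ev (cmu H a b) (%x. ev (cmu H x c) f) = ev (cmu H a b) (%x. ext1 f (x \<otimes> c))"
 "ev (cmu H b c) (%x. ev (cmu H a x) f) = ev (cmu H b c) (%x. ext1 f (a \<otimes> x))"
 by (intro H_cong cmu_ext; simp)+
 moreover have "(%x. ext1 f (x \<otimes> c)) : lin H scalars" "(%x. ext1 f (a \<otimes> x)) : lin H scalars"
 using True by (intro Hlins BH_carrier; simp)+
 ultimately show ?thesis using True by (simp add: cmu_lin m_assoc BH_carrier)
 qed (auto simp: cmu_def)
 show "ev (cun H) (%u. ev (cmu H u a) f) = f a" if "a : BH"
 proof -
 have "ev (cun H) (%u. ev (cmu H u a) f) = ev (cun H) (%x. ext1 f (x \<otimes> a))"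
 using that by (intro H_cong cmu_ext)
 also have "... = ext1 f (\<one> \<otimes> a)" by (rule cun_lin) (intro Hlins BH_carrier that)
 finally show ?thesis using that by (simp add: BH_carrier ext1_basis)
 qed
 show "ev (cun H) (%u. ev (cmu H a u) f) = f a" if "a : BH"
 proof -
 have "ev (cun H) (%u. ev (cmu H a u) f) = ev (cun H) (%x. ext1 f (a \<otimes> x))"
 using that by (intro H_cong cmu_ext)
 also have "... = ext1 f (a \<otimes> \<one>)" by (rule cun_lin) (intro Hlins BH_carrier that)
 finally show ?thesis using that by (simp add: BH_carrier ext1_basis)
 qed
 show "ev2 (cD H h) (%a b. ev2 (cD H a) (%c d. F c d b)) =
 ev2 (cD H h) (%a b. ev2 (cD H b) (%c d. F a c d))" for F
 proof (cases "h : BH")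
 case h: True
 let ?F = "ext3 H H H F"
 have t: "tri H H H ?F" by (rule tri_ext3[OF vs_H vs_H vs_H])
 note b = tri_sw12[OF vs_H vs_H comult_linear t] tri_sw23[OF vs_H vs_H comult_linear t]
 have "ev2 (cD H h) (%a b. ev2 (cD H a) (%c d. F c d b)) = ev2 (cD H h) (%a b. ev2 (cD H a) (%c d. ?F c d b))"
 by (intro H_cong) (simp add: ext3_basis[OF vs_H vs_H vs_H])
 also have "... = ev2 (cD H h) (%a b. sw (comult H a) (%c d. ?F c d b))"
 by (intro H_cong cD_sw tri_bil12[OF t] BH_carrier)
 also have "... = sw (comult H h) (%a b. sw (comult H a) (%c d. ?F c d b))"
 by (rule cD_sw[OF h b(1)])
 also have "... = sw (comult H h) (%a b. sw (comult H b) (%c d. ?F a c d))"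
 by (rule coassoc_sw[OF vs_H vs_H comult_linear comult_linear t coassoc]) (rule BH_carrier[OF h])+
 also have "... = ev2 (cD H h) (%a b. sw (comult H b) (%c d. ?F a c d))"
 by (rule cD_sw[OF h b(2), symmetric])
 also have "... = ev2 (cD H h) (%a b. ev2 (cD H b) (%c d. ?F a c d))"
 by (intro H_cong cD_sw[symmetric] tri_bil23[OF t] BH_carrier)
 also have "... = ev2 (cD H h) (%a b. ev2 (cD H b) (%c d. F a c d))"
 by (intro H_cong) (simp add: ext3_basis[OF vs_H vs_H vs_H])
 finally show ?thesis .
 qed (simp add: cD_def)
 show "ev2 (cD H h) (%a b. ce H a * f b) = f h" if h: "h : BH"
 proof -
 have "ev2 (cD H h) (%a b. ce H a * f b) = ev2 (cD H h) (%a b. counit H a * ext1 f b)"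
 by (intro H_cong) (simp add: ce_def ext1_basis)
 also have "... = sw (comult H h) (%a b. counit H a * ext1 f b)"
 by (rule cD_sw[OF h]) (intro Hlins)
 also have "... = sw (comult H h) (%a b. ext1 f (counit H a \<odot> b))"
 by (rule HH.tensor_sum_cong[OF vsk]) (intro Hlins BH_carrier[OF h] | simp add: lin_smult[OF ext1_lin])+
 also have "... = ext1 f (tsum H (comult H h) (%a b. counit H a \<odot> b))"
 by (rule sw_functional[symmetric, OF comult_closed[OF BH_carrier[OF h]] _ ext1_lin])
 (rule bilI; intro lin_smult_left lin_smult_right lin_counit lin_id vs_H; assumption)
 finally show ?thesis using h by (simp add: counit_left BH_carrier ext1_basis)
 qed
 show "ev2 (cD H h) (%a b. ce H b * f a) = f h" if h: "h : BH"
 proof -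
 have "ev2 (cD H h) (%a b. ce H b * f a) = ev2 (cD H h) (%a b. counit H b * ext1 f a)"
 by (intro H_cong) (simp add: ce_def ext1_basis)
 also have "... = sw (comult H h) (%a b. counit H b * ext1 f a)"
 by (rule cD_sw[OF h]) (intro Hlins)
 also have "... = sw (comult H h) (%a b. ext1 f (counit H b \<odot> a))"
 by (rule HH.tensor_sum_cong[OF vsk]) (intro Hlins BH_carrier[OF h] | simp add: lin_smult[OF ext1_lin])+
 also have "... = ext1 f (tsum H (comult H h) (%a b. counit H b \<odot> a))"
 by (rule sw_functional[symmetric, OF comult_closed[OF BH_carrier[OF h]] _ ext1_lin])
 (rule bilI; intro lin_smult_left lin_smult_right lin_counit lin_id vs_H; assumption)
 finally show ?thesis using h by (simp add: counit_right BH_carrier ext1_basis)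
 qed
 show "ev (cmu H a b) (%x. ev2 (cD H x) g) = ev2 (cD H a) (%a1 a2. ev2 (cD H b) (%b1 b2.
 ev (cmu H a1 b1) (%x. ev (cmu H a2 b2) (%y. g x y))))" for g
 proof (cases "a : BH & b : BH")
 case True
 hence a: "a : BH" and b: "b : BH" by auto
 let ?g = "ext2 H H g"
 have g: "bil H H scalars ?g" by (rule bil_ext2[OF vs_H vs_H])
 have gb: "bil H H scalars (%y z. ?g (a1 \<otimes> y) (a2 \<otimes> z))"
 if "a1 : car H" "a2 : car H" for a1 a2
 unfolding ext2_def using that by (intro bilI lin_ev_coords lin_ev_fun vs_H lin_multr lin_id)
 have "ev (cmu H a b) (%x. ev2 (cD H x) g) = ev (cmu H a b) (%x. sw (comult H x) ?g)"
 by (intro H_cong) (subst cD_ext, rule cD_sw[OF _ g])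
 also have "... = sw (comult H (a \<otimes> b)) ?g"
 by (rule cmu_lin[OF a b]) (rule lin_comp[OF comult_linear HH.tensor_sum_linear[OF vsk g]])
 also have "... = sw (comult H a) (%a1 a2. sw (comult H b) (%b1 b2. ?g (a1 \<otimes> b1) (a2 \<otimes> b2)))"
 proof -
 have b2: "bil H H (tensor H H) (%y1 y2. pt H H (a1 \<otimes> y1) (a2 \<otimes> y2))" if "a1 : car H" "a2 : car H" for a1 a2
 using that by (intro bilI lin_pure1 lin_pure2 vs_H lin_multr lin_id m_closed)
 have b1: "bil H H (tensor H H) (%x1 x2. tsum (tensor H H) (comult H b) (%y1 y2. pt H H (x1 \<otimes> y1) (x2 \<otimes> y2)))"
 by (rule bilI; rule lin_tsum_fun[OF vs_H vs_H HH.vs_tensor vs_H comult_closed[OF BH_carrier[OF b]] b2];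
 (assumption | intro lin_pure1 lin_pure2 vs_H lin_multl lin_id m_closed))
 note Ph = HH.tensor_sum_linear[OF vsk g]
 show ?thesis
 unfolding comult_mult[OF BH_carrier[OF a] BH_carrier[OF b]]
 HH.lin_tensor_sum[OF HH.vs_tensor vsk b1 Ph comult_closed[OF BH_carrier[OF a]]]
 proof (rule HH.tensor_sum_cong[OF vsk bil_comp[OF b1 Ph] comult_closed[OF BH_carrier[OF a]]])
 fix u v assume uv: "u : car H" "v : car H"
 show "sw (tsum (tensor H H) (comult H b) (%y1 y2. pt H H (u \<otimes> y1) (v \<otimes> y2))) ?g =
 sw (comult H b) (%b1 b2. ?g (u \<otimes> b1) (v \<otimes> b2))"
 unfolding HH.lin_tensor_sum[OF HH.vs_tensor vsk b2[OF uv] Ph comult_closed[OF BH_carrier[OF b]]]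
 by (rule HH.tensor_sum_cong[OF vsk bil_comp[OF b2[OF uv] Ph] comult_closed[OF BH_carrier[OF b]]])
 (simp add: HH.tensor_sum_pure[OF vsk g] uv)
 qed
 qed
 also have "... = ev2 (cD H a) (%a1 a2. sw (comult H b) (%b1 b2. ?g (a1 \<otimes> b1) (a2 \<otimes> b2)))"
 unfolding ext2_def by (rule cD_sw[symmetric, OF a], rule bilI;
 rule lin_tsum_fun[OF vs_H vs_H vsk vs_H comult_closed[OF BH_carrier[OF b]] gb[unfolded ext2_def]];
 (assumption | intro lin_ev_coords lin_ev_fun vs_H lin_multl lin_id m_closed))
 also have "... = ev2 (cD H a) (%a1 a2. ev2 (cD H b) (%b1 b2. ?g (a1 \<otimes> b1) (a2 \<otimes> b2)))"
 by (intro H_cong cD_sw[symmetric] b gb BH_carrier)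
 also have "... = ev2 (cD H a) (%a1 a2. ev2 (cD H b) (%b1 b2. ev (cmu H a1 b1) (%x. ev (cmu H a2 b2) (%y. g x y))))"
 proof (intro H_cong)
 fix a1 a2 b1 b2 assume "a1 : BH" "a2 : BH" "b1 : BH" "b2 : BH"
 thus "?g (a1 \<otimes> b1) (a2 \<otimes> b2) = ev (cmu H a1 b1) (%x. ev (cmu H a2 b2) (%y. g x y))"
 by (simp add: ext2_def cmu_def)
 qed
 finally show ?thesis .
 qed (auto simp: cmu_def cD_def)
 show "ev (cun H) (%u. ev2 (cD H u) g) = ev (cun H) (%u. ev (cun H) (%v. g u v))" for g
 proof -
 let ?g = "ext2 H H g"
 have g: "bil H H scalars ?g" by (rule bil_ext2[OF vs_H vs_H])
 have "ev (cun H) (%u. ev2 (cD H u) g) = ev (cun H) (%x. sw (comult H x) ?g)"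
 by (intro H_cong) (subst cD_ext, rule cD_sw[OF _ g])
 also have "... = sw (comult H \<one>) ?g" by (rule cun_lin) (rule lin_comp[OF comult_linear HH.tensor_sum_linear[OF vsk g]])
 finally show ?thesis by (simp add: comult_one HH.tensor_sum_pure[OF vsk g] ext2_def)
 qed
 show "ev (cmu H a b) (ce H) = ce H a * ce H b"
 proof (cases "a : BH & b : BH")
 case True
 have "ev (cmu H a b) (ce H) = ev (cmu H a b) (counit H)" by (intro H_cong) (simp add: ce_def)
 also have "... = counit H (a \<otimes> b)" using True by (intro cmu_lin counit_linear) auto
 finally show ?thesis using True by (simp add: counit_mult BH_carrier ce_def)
 qed (auto simp: cmu_def ce_def)
 have "ev (cun H) (ce H) = ev (cun H) (counit H)" by (intro H_cong) (simp add: ce_def)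
 thus "ev (cun H) (ce H) = 1" by (simp add: cun_lin counit_linear counit_one)
 show "ev2 (cD H h) (%a b. ev (cS H a) (%s. ev (cmu H s b) f)) = ce H h * ev (cun H) f"
 proof (cases "h : BH")
 case h: True
 have "ev2 (cD H h) (%a b. ev (cS H a) (%s. ev (cmu H s b) f)) = ev2 (cD H h) (%a b. ext1 f (antipode H a \<otimes> b))"
 proof (intro H_cong)
 fix a b assume ab: "a : BH" "b : BH"
 have "ev (cS H a) (%s. ev (cmu H s b) f) = ev (cS H a) (%s. ext1 f (s \<otimes> b))" (is "?x = _")
 by (intro H_cong cmu_ext ab)
 also have "... = ext1 f (antipode H a \<otimes> b)" (is "_ = ?y") by (rule cS_lin) (intro Hlins BH_carrier ab)+
 finally show "?x = ?y" .
 qed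
 also have "... = sw (comult H h) (%a b. ext1 f (antipode H a \<otimes> b))" by (rule cD_sw[OF h]) (intro Hlins)
 also have "... = ext1 f (tsum H (comult H h) (%a b. antipode H a \<otimes> b))"
 by (rule sw_functional[symmetric, OF _ _ ext1_lin]; intro Hlins BH_carrier[OF h])
 finally show ?thesis using h by (simp add: antipode_left BH_carrier lin_smult[OF ext1_lin] ce_def)
 qed (simp add: cD_def ce_def)
 show "ev2 (cD H h) (%a b. ev (cS H b) (%s. ev (cmu H a s) f)) = ce H h * ev (cun H) f"
 proof (cases "h : BH")
 case h: True
 have "ev2 (cD H h) (%a b. ev (cS H b) (%s. ev (cmu H a s) f)) = ev2 (cD H h) (%a b. ext1 f (a \<otimes> antipode H b))"
 proof (intro H_cong)
 fix a b assume ab: "a : BH" "b : BH"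
 have "ev (cS H b) (%s. ev (cmu H a s) f) = ev (cS H b) (%s. ext1 f (a \<otimes> s))" (is "?x = _")
 by (intro H_cong cmu_ext ab)
 also have "... = ext1 f (a \<otimes> antipode H b)" (is "_ = ?y") by (rule cS_lin) (intro Hlins BH_carrier ab)+
 finally show "?x = ?y" .
 qed
 also have "... = sw (comult H h) (%a b. ext1 f (a \<otimes> antipode H b))" by (rule cD_sw[OF h]) (intro Hlins)
 also have "... = ext1 f (tsum H (comult H h) (%a b. a \<otimes> antipode H b))"
 by (rule sw_functional[symmetric, OF _ _ ext1_lin]; intro Hlins BH_carrier[OF h])
 finally show ?thesis using h by (simp add: antipode_right BH_carrier lin_smult[OF ext1_lin] ce_def)
 qed (simp add: cD_def ce_def)
 show "ev (cS H a) (%s. ev (cSi H s) f) = f a" if a: "a : BH"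
 proof -
 have "ev (cS H a) (%s. ev (cSi H s) f) = ev (cS H a) (%s. ext1 f (Sinv H s))"
 by (intro H_cong cSi_ext)
 also have "... = ext1 f (Sinv H (antipode H a))" by (rule cS_lin[OF a]) (intro Hlins)
 finally show ?thesis using a by (simp add: inv_antipode BH_carrier ext1_basis)
 qed
 show "ev (cSi H a) (%s. ev (cS H s) f) = f a" if a: "a : BH"
 proof -
 have "ev (cSi H a) (%s. ev (cS H s) f) = ev (cSi H a) (%s. ext1 f (antipode H s))"
 by (intro H_cong cS_ext)
 also have "... = ext1 f (antipode H (Sinv H a))" by (rule cSi_lin[OF a]) (intro Hlins)
 finally show ?thesis using a by (simp add: antipode_inv BH_carrier ext1_basis)
 qed
qed

lemma hopf_coord: "hopf_coord (basis H) (cmu H) (cun H) (cD H) (ce H) (cSi H)"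
 by (rule antipode_coord.hopf_coord[OF antipode_coord])

end

section \<open>Yetter-Drinfel'd modules in coordinates\<close>

locale yd_bij = yd_module H M
 for H :: "('k::field, 'h, 'm) hopf_scheme" and M :: "('k, 'a, 'h, 'n) yd_scheme" +
 assumes bij: "bijective_antipode H"
begin

sublocale Hb: hopf_bij H
 by unfold_locales (rule bij)

lemma vs_M: "vs M" by unfold_locales

sublocale HM: vs2 H M by (rule vs2I[OF Hb.vs_H vs_M])

abbreviation "BM \<equiv> basis M"

lemma BM_carrier: "b : BM ==> b : car M" by (rule basis_carrier[OF vs_M])

lemma act_closed: "h : car H ==> x : car M ==> act M h x : car M"
 by (rule lin_closed[OF act_linear_right])

lemma coact_closed: "x : car M ==> coact M x : car (tensor H M)"
 by (rule lin_closed[OF coact_linear])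

lemma lin_act1: "f : lin N H ==> x : car M ==> (%z. act M (f z) x) : lin N M"
 by (rule lin_comp[OF _ act_linear_left])

lemma lin_act2: "f : lin N M ==> h : car H ==> (%z. act M h (f z)) : lin N M"
 by (rule lin_comp[OF _ act_linear_right])

lemma lin_coact: "f : lin N M ==> (%z. coact M (f z)) : lin N (tensor H M)"
 by (rule lin_comp[OF _ coact_linear])

lemma cA_keys: "ks (cA H M h x) <= BM"
 using keys_coords[OF vs_M act_closed[OF Hb.BH_carrier BM_carrier]] by (simp add: cA_def)

lemma cC_keys: "ks (cC H M x) <= Hb.BH \<times> BM"
 using HM.keys_coords2[OF coact_closed[OF BM_carrier]] by (simp add: cC_def)

lemma M_cong:
 "(!!a b. a : Hb.BH ==> b : BM ==> F a b = G a b) ==> ev2 (cC H M x) F = ev2 (cC H M x) G"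
 "(!!a. a : BM ==> f a = g a) ==> ev (cA H M h y) f = ev (cA H M h y) g"
 using cC_keys[of x] cA_keys[of h y] by (intro ev2_cong ev_cong; blast)+

lemma cA_lin: "h : Hb.BH ==> x : BM ==> f : lin M scalars ==> ev (cA H M h x) f = f (act M h x)"
 by (simp add: cA_def ev_coords[OF vs_M] act_closed Hb.BH_carrier BM_carrier)

lemma cC_sw: "x : BM ==> bil H M scalars F ==> ev2 (cC H M x) F = sw (coact M x) F"
 unfolding cC_def using HM.ev2_coords2_bil[OF _ coact_closed[OF BM_carrier]] by simp

abbreviation "extM f \<equiv> %x. ev (coords M x) f"

lemma extM_lin: "extM f : lin M scalars" by (rule lin_ev_coords[OF vs_M lin_id])

lemma extM_basis: "a : BM ==> ev (coords M a) f = f a" by (simp add: coords_basis[OF vs_M])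

lemma cA_ext: "h : Hb.BH ==> x : BM ==> ev (cA H M h x) f = extM f (act M h x)"
 by (simp add: cA_def)

lemma yd_coord: "yd_coord (basis H) (cmu H) (cun H) (cD H) (ce H) (cSi H) (basis M) (cA H M) (cC H M)"
proof (rule yd_coord.intro[OF Hb.hopf_coord], unfold_locales)
 fix g h x and f :: "'a => 'k"
 show "ks (cA H M h x) <= BM" "ks (cC H M x) <= Hb.BH \<times> BM" by (rule cA_keys cC_keys)+
 show "h \<notin> Hb.BH ==> cA H M h x = 0" by (simp add: cA_def)
 show "ev (cun H) (%u. ev (cA H M u x) f) = f x" if x: "x : BM"
 proof -
 have "ev (cun H) (%u. ev (cA H M u x) f) = ev (cun H) (%u. extM f (act M u x))"
 using x by (intro Hb.H_cong cA_ext)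
 also have "... = extM f (act M (one H) x)"
 by (rule Hb.cun_lin, rule lin_comp[OF act_linear_left extM_lin]) (rule BM_carrier[OF x])
 finally show ?thesis using x by (simp add: act_one BM_carrier extM_basis)
 qed
 show "ev (cmu H g h) (%p. ev (cA H M p x) f) = ev (cA H M h x) (%y. ev (cA H M g y) f)"
 proof (cases "g : Hb.BH & h : Hb.BH & x : BM")
 case True
 hence c: "g : car H" "h : car H" "x : car M" by (auto simp: Hb.BH_carrier BM_carrier)
 have "ev (cmu H g h) (%p. ev (cA H M p x) f) = ev (cmu H g h) (%u. extM f (act M u x))"
 using True by (intro Hb.H_cong cA_ext) auto
 also have "... = extM f (act M (g \<otimes>\<^bsub>H\<^esub> h) x)"
 using True by (intro Hb.cmu_lin lin_comp[OF act_linear_left extM_lin] c) auto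
 also have "... = extM f (act M g (act M h x))" using c by (simp add: act_mult)
 also have "... = ev (cA H M h x) (%y. extM f (act M g y))"
 using True by (intro cA_lin[symmetric] lin_comp[OF act_linear_right extM_lin] c) auto
 also have "... = ev (cA H M h x) (%y. ev (cA H M g y) f)"
 using True by (intro M_cong cA_ext[symmetric]) auto
 finally show ?thesis .
 qed (auto simp: cmu_def cA_def)
 show "ev2 (cC H M x) (%g y. ev2 (cD H g) (%a b. F a b y)) =
 ev2 (cC H M x) (%g y. ev2 (cC H M y) (%g' z. F g g' z))" for F
 proof (cases "x : BM")
 case x: True
 let ?F = "ext3 H H M F"
 have t: "tri H H M ?F" by (rule tri_ext3[OF Hb.vs_H Hb.vs_H vs_M])
 note b = tri_sw12[OF Hb.vs_H vs_M H.comult_linear t] tri_sw23[OF Hb.vs_H vs_M coact_linear t]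
 have "ev2 (cC H M x) (%g y. ev2 (cD H g) (%a b. F a b y)) = ev2 (cC H M x) (%g y. ev2 (cD H g) (%a b. ?F a b y))"
 by (intro M_cong Hb.H_cong) (simp add: ext3_basis[OF Hb.vs_H Hb.vs_H vs_M])
 also have "... = ev2 (cC H M x) (%a b. sw (comult H a) (%c d. ?F c d b))"
 by (intro M_cong Hb.cD_sw tri_bil12[OF t] BM_carrier)
 also have "... = sw (coact M x) (%a b. sw (comult H a) (%c d. ?F c d b))"
 by (rule cC_sw[OF x b(1)])
 also have "... = sw (coact M x) (%a b. sw (coact M b) (%c d. ?F a c d))"
 by (rule coassoc_sw[OF Hb.vs_H vs_M H.comult_linear coact_linear t coact_coassoc]) (rule BM_carrier[OF x])+
 also have "... = ev2 (cC H M x) (%a b. sw (coact M b) (%c d. ?F a c d))"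
 by (rule cC_sw[OF x b(2), symmetric])
 also have "... = ev2 (cC H M x) (%a b. ev2 (cC H M b) (%c d. ?F a c d))"
 by (intro M_cong cC_sw[symmetric] tri_bil23[OF t] Hb.BH_carrier)
 also have "... = ev2 (cC H M x) (%a b. ev2 (cC H M b) (%c d. F a c d))"
 by (intro M_cong) (simp add: ext3_basis[OF Hb.vs_H Hb.vs_H vs_M])
 finally show ?thesis .
 qed (simp add: cC_def)
 show "ev2 (cC H M x) (%g y. ce H g * f y) = f x" if x: "x : BM"
 proof -
 have cx: "coact M x : car (tensor H M)" by (rule coact_closed[OF BM_carrier[OF x]])
 have b: "bil H M M (%g y. counit H g \<odot>\<^bsub>M\<^esub> y)"
 by (rule bilI; intro lin_smult_left lin_smult_right Hb.lin_counit lin_id vs_M; assumption)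
 have b': "bil H M scalars (%g y. counit H g * extM f y)"
 by (rule bilI; intro lin_mult_left lin_mult_right Hb.lin_counit extM_lin lin_id)
 have "ev2 (cC H M x) (%g y. ce H g * f y) = ev2 (cC H M x) (%g y. counit H g * extM f y)"
 by (intro M_cong) (simp add: ce_def extM_basis)
 also have "... = sw (coact M x) (%g y. counit H g * extM f y)" by (rule cC_sw[OF x b'])
 also have "... = sw (coact M x) (%g y. extM f (counit H g \<odot>\<^bsub>M\<^esub> y))"
 by (rule HM.tensor_sum_cong[OF vsk b' cx]) (simp add: lin_smult[OF extM_lin])
 also have "... = extM f (tsum M (coact M x) (%g y. counit H g \<odot>\<^bsub>M\<^esub> y))"
 by (rule HM.lin_tensor_sum[OF vs_M vsk b extM_lin cx, symmetric])
 finally show ?thesis using x by (simp add: coact_counit BM_carrier extM_basis)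
 qed
 show "ev2 (cD H h) (%h1 h2. ev2 (cC H M x) (%g y. ev (cmu H h1 g) (%p. ev (cA H M h2 y) (%z. G p z)))) =
 ev2 (cD H h) (%h1 h2. ev (cA H M h1 x) (%y. ev2 (cC H M y) (%g z. ev (cmu H g h2) (%p. G p z))))" for G
 proof (cases "h : Hb.BH & x : BM")
 case True
 hence h: "h : Hb.BH" and x: "x : BM" by auto
 have hc: "h : car H" and xc: "x : car M" using h x by (auto simp: Hb.BH_carrier BM_carrier)
 let ?N = "tensor H M"
 let ?G = "ext2 H M G"
 have G: "bil H M scalars ?G" by (rule bil_ext2[OF Hb.vs_H vs_M])
 note Ph = HM.tensor_sum_linear[OF vsk G]
 have q1: "bil H M ?N (%g y. pt H M (h1 \<otimes>\<^bsub>H\<^esub> g) (act M h2 y))" if "h1 : car H" "h2 : car H" for h1 h2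
 using that by (intro bilI lin_pure1 lin_pure2 Hb.vs_H vs_M Hb.lin_multr lin_act2 lin_id act_closed H.m_closed)
 have q2: "bil H H ?N (%h1 h2. tsum ?N (coact M x) (%g y. pt H M (h1 \<otimes>\<^bsub>H\<^esub> g) (act M h2 y)))"
 by (intro bilI lin_tsum_fun[OF Hb.vs_H vs_M HM.vs_tensor Hb.vs_H coact_closed[OF xc] q1];
 (assumption | intro lin_pure1 lin_pure2 Hb.vs_H vs_M Hb.lin_multl lin_act1 lin_id act_closed H.m_closed))
 have q3: "bil H M ?N (%g y. pt H M (g \<otimes>\<^bsub>H\<^esub> h2) y)" if "h2 : car H" for h2
 using that by (intro bilI lin_pure1 lin_pure2 Hb.vs_H vs_M Hb.lin_multl lin_id H.m_closed)
 have q4: "bil H H ?N (%h1 h2. tsum ?N (coact M (act M h1 x)) (%g y. pt H M (g \<otimes>\<^bsub>H\<^esub> h2) y))"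
 proof (rule bilI)
 fix v assume "v : car H"
 thus "(%u. tsum ?N (coact M (act M u x)) (%g y. pt H M (g \<otimes>\<^bsub>H\<^esub> v) y)) : lin H ?N"
 by (intro lin_tsum_arg[OF Hb.vs_H vs_M HM.vs_tensor q3] lin_coact lin_act1 lin_id xc)
 next
 fix u assume u: "u : car H"
 show "(%v. tsum ?N (coact M (act M u x)) (%g y. pt H M (g \<otimes>\<^bsub>H\<^esub> v) y)) : lin H ?N"
 by (rule lin_tsum_fun[OF Hb.vs_H vs_M HM.vs_tensor Hb.vs_H coact_closed[OF act_closed[OF u xc]] q3], assumption)
 (intro lin_pure1 Hb.vs_H vs_M Hb.lin_multr lin_id; assumption)
 qed
 have p1: "sw (tsum ?N (coact M x) (%g y. pt H M (h1 \<otimes>\<^bsub>H\<^esub> g) (act M h2 y))) ?G =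
 ev2 (cC H M x) (%g y. ev (cmu H h1 g) (%p. ev (cA H M h2 y) (%z. G p z)))" if hh: "h1 : Hb.BH" "h2 : Hb.BH" for h1 h2
 proof -
 have c: "h1 : car H" "h2 : car H" using hh by (auto simp: Hb.BH_carrier)
 have "sw (tsum ?N (coact M x) (%g y. pt H M (h1 \<otimes>\<^bsub>H\<^esub> g) (act M h2 y))) ?G =
 ev2 (cC H M x) (%g y. sw (pt H M (h1 \<otimes>\<^bsub>H\<^esub> g) (act M h2 y)) ?G)"
 unfolding HM.lin_tensor_sum[OF HM.vs_tensor vsk q1[OF c] Ph coact_closed[OF xc]]
 by (rule cC_sw[OF x bil_comp[OF q1[OF c] Ph], symmetric])
 also have "... = ev2 (cC H M x) (%g y. ev (cmu H h1 g) (%p. ev (cA H M h2 y) (%z. G p z)))"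
 using hh by (intro M_cong) (simp add: HM.tensor_sum_pure[OF vsk G] act_closed Hb.BH_carrier BM_carrier
 ext2_def cmu_def cA_def)
 finally show ?thesis .
 qed
 have p2: "sw (tsum ?N (coact M (act M h1 x)) (%g y. pt H M (g \<otimes>\<^bsub>H\<^esub> h2) y)) ?G =
 ev (cA H M h1 x) (%y. ev2 (cC H M y) (%g z. ev (cmu H g h2) (%p. G p z)))" if hh: "h1 : Hb.BH" "h2 : Hb.BH" for h1 h2
 proof -
 have c: "h1 : car H" "h2 : car H" using hh by (auto simp: Hb.BH_carrier)
 have l: "(%y. sw (tsum ?N (coact M y) (%g y. pt H M (g \<otimes>\<^bsub>H\<^esub> h2) y)) ?G) : lin M scalars"
 by (rule lin_comp[OF _ Ph], intro lin_tsum_arg[OF Hb.vs_H vs_M HM.vs_tensor q3[OF c(2)]] lin_coact lin_id)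
 have "sw (tsum ?N (coact M (act M h1 x)) (%g y. pt H M (g \<otimes>\<^bsub>H\<^esub> h2) y)) ?G =
 ev (cA H M h1 x) (%y. sw (tsum ?N (coact M y) (%g y. pt H M (g \<otimes>\<^bsub>H\<^esub> h2) y)) ?G)"
 by (rule cA_lin[OF hh(1) x l, symmetric])
 also have "... = ev (cA H M h1 x) (%y. ev2 (cC H M y) (%g z. ev (cmu H g h2) (%p. G p z)))"
 proof (rule M_cong)
 fix y assume y: "y : BM"
 have "sw (tsum ?N (coact M y) (%g y. pt H M (g \<otimes>\<^bsub>H\<^esub> h2) y)) ?G =
 ev2 (cC H M y) (%g z. sw (pt H M (g \<otimes>\<^bsub>H\<^esub> h2) z) ?G)" (is "?x = _")
 unfolding HM.lin_tensor_sum[OF HM.vs_tensor vsk q3[OF c(2)] Ph coact_closed[OF BM_carrier[OF y]]]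
 by (rule cC_sw[OF y bil_comp[OF q3[OF c(2)] Ph], symmetric])
 also have "... = ev2 (cC H M y) (%g z. ev (cmu H g h2) (%p. G p z))" (is "_ = ?y")
 using hh by (intro M_cong) (simp add: HM.tensor_sum_pure[OF vsk G] Hb.BH_carrier BM_carrier
 ext2_def cmu_def extM_basis)
 finally show "?x = ?y" .
 qed
 finally show ?thesis .
 qed
 have "ev2 (cD H h) (%h1 h2. ev2 (cC H M x) (%g y. ev (cmu H h1 g) (%p. ev (cA H M h2 y) (%z. G p z)))) =
 ev2 (cD H h) (%h1 h2. sw (tsum ?N (coact M x) (%g y. pt H M (h1 \<otimes>\<^bsub>H\<^esub> g) (act M h2 y))) ?G)"
 by (intro Hb.H_cong p1[symmetric])
 also have "... = sw (tsum ?N (comult H h) (%h1 h2. tsum ?N (coact M x) (%g y. pt H M (h1 \<otimes>\<^bsub>H\<^esub> g) (act M h2 y)))) ?G"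
 unfolding Hb.HH.lin_tensor_sum[OF HM.vs_tensor vsk q2 Ph Hb.comult_closed[OF hc]]
 by (rule Hb.cD_sw[OF h bil_comp[OF q2 Ph]])
 also have "... = sw (tsum ?N (comult H h) (%h1 h2. tsum ?N (coact M (act M h1 x)) (%g y. pt H M (g \<otimes>\<^bsub>H\<^esub> h2) y))) ?G"
 by (simp only: yd_compat[OF hc xc])
 also have "... = ev2 (cD H h) (%h1 h2. sw (tsum ?N (coact M (act M h1 x)) (%g y. pt H M (g \<otimes>\<^bsub>H\<^esub> h2) y)) ?G)"
 unfolding Hb.HH.lin_tensor_sum[OF HM.vs_tensor vsk q4 Ph Hb.comult_closed[OF hc]]
 by (rule Hb.cD_sw[OF h bil_comp[OF q4 Ph], symmetric])
 also have "... = ev2 (cD H h) (%h1 h2. ev (cA H M h1 x) (%y. ev2 (cC H M y) (%g z. ev (cmu H g h2) (%p. G p z))))"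
 by (intro Hb.H_cong p2)
 finally show ?thesis .
 qed (auto simp: cD_def cC_def cA_def)
qed

end

section \<open>Algebras spanned by words\<close>

text \<open>One vector space underlies several records that differ in their product or in extra
  fields. Tensor products, linear maps and Sweedler sums read only these four fields, so they are
  equal for such records, not merely isomorphic.\<close>

definition same_space :: "('k::field, 'a, 'm) module_scheme => ('k, 'a, 'n) module_scheme => bool" where
 "same_space V V' \<longleftrightarrow> car V = car V' & add V = add V' & zero V = zero V' & smult V = smult V'"

lemma finsum_same:
 "car V = car V' ==> add V = add V' ==> zero V = zero V' ==> finsum V f = finsum V' f"
 by (rule ext) (simp add: finsum_def finprod_def)

lemma same_space:
 assumes "same_space V V'"
 shows "tensor U V = tensor U V'" "tensor V U = tensor V' U" "tensor V V = tensor V' V'"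
 and "pt U V = pt U V'" "pt V U = pt V' U" "pt V V = pt V' V'"
 and "lin V N = lin V' N" "lin N V = lin N V'"
 and "tsum V X f = tsum V' X f"
proof -
 have e: "car V = car V'" "add V = add V'" "zero V = zero V'" "smult V = smult V'"
 using assms by (simp_all add: same_space_def)
 show "tensor U V = tensor U V'" "tensor V U = tensor V' U" "tensor V V = tensor V' V'"
 "pt U V = pt U V'" "pt V U = pt V' U" "pt V V = pt V' V'"
 "lin V N = lin V' N" "lin N V = lin N V'"
 by (simp_all only: tensor_def tensor_relations_def pure_tensor_def[abs_def] linear_maps_def e)
 show "tsum V X f = tsum V' X f"
 by (simp add: tensor_sum_def class_sum_def finsum_same[OF e(1-3)] e(4))
qed

lemma yd_tensor_simps [simp]:
 "act (yd_tensor H M N) h X = tsum (tensor M N) (comult H h) (%h1 h2.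
 tsum (tensor M N) X (%x y. pt M N (act M h1 x) (act N h2 y)))"
 "coact (yd_tensor H M N) X = tsum (tensor H (tensor M N)) X (%x y.
 tsum (tensor H (tensor M N)) (coact M x) (%g x0.
 tsum (tensor H (tensor M N)) (coact N y) (%g' y0.
 pt H (tensor M N) (g \<otimes>\<^bsub>H\<^esub> g') (pt M N x0 y0))))"
 "car (yd_tensor H M N) = car (tensor M N)"
 by (simp_all add: yd_tensor_def module.defs yd.defs)

lemma same_yd_tensor: "same_space (yd_tensor H M N) (tensor M N)"
 by (simp add: same_space_def yd_tensor_def module.defs yd.defs)

lemma yd_unit_simps [simp]:
 fixes H :: "('k::field, 'h, 'm) hopf_scheme"
 shows "act (yd_unit H) h c = counit H h * c"
 and "coact (yd_unit H) c = pt H (scalars :: ('k, 'k) module) (one H) c"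
 and "car (yd_unit H) = UNIV"
 by (simp_all add: yd_unit_def module.defs yd.defs)

lemma same_yd_unit: "same_space (yd_unit H) scalars"
 by (simp add: same_space_def yd_unit_def module.defs yd.defs)

section \<open>Algebras with a bilinear action and a linear coaction\<close>

lemma lin_bil1: "bil U V N F ==> f : lin M U ==> v : car V ==> (%x. F (f x) v) : lin M N"
 and lin_bil2: "bil U V N F ==> g : lin M V ==> u : car U ==> (%x. F u (g x)) : lin M N"
 by (rule lin_comp[OF _ bil_left] lin_comp[OF _ bil_right]; assumption)+

lemma lin_tri1: "tri U V W F ==> f : lin M U ==> v : car V ==> w : car W ==>
 (%x. F (f x) v w) : lin M scalars"
 and lin_tri2: "tri U V W F ==> g : lin M V ==> u : car U ==> w : car W ==>
 (%x. F u (g x) w) : lin M scalars"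
 and lin_tri3: "tri U V W F ==> h : lin M W ==> u : car U ==> v : car V ==>
 (%x. F u v (h x)) : lin M scalars"
 by (rule lin_comp[OF _ tri1] lin_comp[OF _ tri2] lin_comp[OF _ tri3]; assumption)+

text \<open>Records just the linearity of action and coaction, so that the braided product on T(M)
  can be handled while its coproduct is still being constructed.\<close>

locale op_space = Hb: hopf_bij H + RA: k_algebra R
 for H :: "('k::field, 'h, 'm) hopf_scheme" and R :: "('k, 'r, 'h, 'p) yd_scheme" +
 assumes R_act_left: "x : car R ==> (%h. act R h x) : lin H R"
 and R_act_right: "h : car H ==> act R h : lin R R"
 and R_coact: "coact R : lin R (tensor H R)"
begin

abbreviation mulR (infixl "**" 70) where "x ** y \<equiv> x \<otimes>\<^bsub>R\<^esub> y"
abbreviation "RR \<equiv> tensor R R"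
abbreviation "HR \<equiv> tensor H R"
abbreviation "de \<equiv> coact R"

lemma vs_R: "vs R" by (rule RA.module_axioms)

sublocale HR: vs2 H R by (rule vs2I[OF Hb.vs_H vs_R])
sublocale RR: vs2 R R by (rule vs2I[OF vs_R vs_R])

lemma R_act_closed: "h : car H ==> x : car R ==> act R h x : car R"
 by (rule lin_closed[OF R_act_right])

lemma R_coact_closed: "x : car R ==> de x : car HR"
 by (rule lin_closed[OF R_coact])

lemma lin_R_act1: "g : lin N H ==> x : car R ==> (%z. act R (g z) x) : lin N R"
 and lin_R_act2: "f : lin N R ==> h : car H ==> (%z. act R h (f z)) : lin N R"
 and lin_R_coact: "f : lin N R ==> (%z. de (f z)) : lin N HR"
 by (rule lin_comp[OF _ R_act_left] lin_comp[OF _ R_act_right] lin_comp[OF _ R_coact]; assumption)+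

lemma lin_R_multl: "f : lin N R ==> y : car R ==> (%z. f z ** y) : lin N R"
 by (rule linI) (simp_all add: lin_closed lin_add lin_smult RA.l_distr RA.smult_mult_left)

lemma lin_R_multr: "f : lin N R ==> y : car R ==> (%z. y ** f z) : lin N R"
 by (rule linI) (simp_all add: lin_closed lin_add lin_smult RA.r_distr RA.smult_mult_right)

lemmas Ol = bilI lin_id lin_pure1 lin_pure2 lin_R_act1 lin_R_act2 lin_R_coact
 lin_R_multl lin_R_multr Hb.lin_multl Hb.lin_multr Hb.lin_comult Hb.lin_counit lin_tsum_arg' lin_tsum_fun'
 lin_mult_left lin_mult_right vs_R Hb.vs_H vsk HR.vs_tensor RR.vs_tensor vs2.vs_tensor[OF vs2I]
 R_act_closed R_coact_closed RA.m_closed RA.one_closed Hb.m_closed Hb.one_closed Hb.comult_closed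
 HR.pure_closed RR.pure_closed vs2.pure_closed[OF vs2I] Hb.BH_carrier

lemma RR_ball: "f : lin RR scalars ==> g : lin RR scalars ==>
 (!!x y. x : car R ==> y : car R ==> f (pt R R x y) = g (pt R R x y)) ==>
 ALL X:car RR. f X = (g X :: 'k)"
 using RR.tensor_ext[OF vsk] by blast

text \<open>The action in \<open>yd_tensor\<close> is a nested Sweedler sum. Since bilinear forms
  separate tensors, its effect on forms is what the comparison of module maps uses;
  \<open>coact2_sw\<close> plays the same part for the coaction.\<close>

lemma act2_sw:
 assumes G: "bil R R scalars G" and h: "h : car H" and X: "X : car RR"
 shows "act (yd_tensor H R R) h X : car RR"
 and "sw (act (yd_tensor H R R) h X) G = sw (comult H h) (%h1 h2. sw X (%x y. G (act R h1 x) (act R h2 y)))"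
proof -
 have b1: "bil R R RR (%x y. pt R R (act R h1 x) (act R h2 y))"
 if "h1 : car H" "h2 : car H" for h1 h2
 using that by - ((assumption | rule Ol)+)
 have b2: "bil H H RR (%h1 h2. tsum RR X (%x y. pt R R (act R h1 x) (act R h2 y)))"
 using X by - ((assumption | rule Ol)+)
 show "act (yd_tensor H R R) h X : car RR"
 unfolding yd_tensor_simps by (rule Hb.HH.tensor_sum_closed[OF RR.vs_tensor b2 Hb.comult_closed[OF h]])
 show "sw (act (yd_tensor H R R) h X) G = sw (comult H h) (%h1 h2. sw X (%x y. G (act R h1 x) (act R h2 y)))"
 unfolding yd_tensor_simps sw_tsum[OF Hb.comult_closed[OF h] b2 G Hb.vs_H Hb.vs_H vs_R vs_R]
 proof (rule sw_cong[OF Hb.vs_H Hb.vs_H Hb.comult_closed[OF h]])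
 fix h1 h2 assume hh: "h1 : car H" "h2 : car H"
 show "sw (tsum RR X (%x y. pt R R (act R h1 x) (act R h2 y))) G =
 sw X (%x y. G (act R h1 x) (act R h2 y))"
 unfolding sw_tsum[OF X b1[OF hh] G vs_R vs_R vs_R vs_R]
 by (rule sw_cong[OF vs_R vs_R X]) (intro sw_pure G R_act_closed hh vs_R)
 qed
qed

lemma coact2_sw:
 assumes X: "X : car RR"
 shows "coact (yd_tensor H R R) X : car (tensor H RR)"
 and "tri H R R F ==> sw (coact (yd_tensor H R R) X) (%a Y. sw Y (F a)) =
 sw X (%x y. sw (de x) (%g x0. sw (de y) (%g' y0. F (g \<otimes>\<^bsub>H\<^esub> g') x0 y0)))"
proof -
 let ?N = "tensor H RR"
 have vN: "vs ?N" by ((assumption | rule Ol)+)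
 let ?p = "%g x0 g' y0. pt H RR (g \<otimes>\<^bsub>H\<^esub> g') (pt R R x0 y0)"
 have b1: "bil H R ?N (?p g x0)" if "g : car H" "x0 : car R" for g x0
 using that by - ((assumption | rule Ol)+)
 have b2: "bil H R ?N (%g x0. tsum ?N (de y) (?p g x0))" if "y : car R" for y
 using that by - ((assumption | rule Ol)+)
 have b3: "bil R R ?N (%x y. tsum ?N (de x) (%g x0. tsum ?N (de y) (?p g x0)))"
 by ((assumption | rule Ol)+)
 show "coact (yd_tensor H R R) X : car ?N"
 unfolding yd_tensor_simps by (rule RR.tensor_sum_closed[OF vN b3 X])
 assume F: "tri H R R F"
 note Ph = tri_functional[OF Hb.vs_H vs_R vs_R F]
 show "sw (coact (yd_tensor H R R) X) (%a Y. sw Y (F a)) =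
 sw X (%x y. sw (de x) (%g x0. sw (de y) (%g' y0. F (g \<otimes>\<^bsub>H\<^esub> g') x0 y0)))"
 unfolding yd_tensor_simps lin_tsum[OF X Ph(1) b3 vs_R vs_R vN vsk]
 proof (rule sw_cong[OF vs_R vs_R X])
 fix x y assume x: "x : car R" and y: "y : car R"
 show "sw (tsum ?N (de x) (%g x0. tsum ?N (de y) (?p g x0))) (%a Y. sw Y (F a)) =
 sw (de x) (%g x0. sw (de y) (%g' y0. F (g \<otimes>\<^bsub>H\<^esub> g') x0 y0))"
 unfolding lin_tsum[OF R_coact_closed[OF x] Ph(1) b2[OF y] Hb.vs_H vs_R vN vsk]
 proof (rule sw_cong[OF Hb.vs_H vs_R R_coact_closed[OF x]])
 fix g x0 assume g: "g : car H" "x0 : car R"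
 show "sw (tsum ?N (de y) (?p g x0)) (%a Y. sw Y (F a)) = sw (de y) (%g' y0. F (g \<otimes>\<^bsub>H\<^esub> g') x0 y0)"
 unfolding lin_tsum[OF R_coact_closed[OF y] Ph(1) b1[OF g] Hb.vs_H vs_R vN vsk]
 by (rule sw_cong[OF Hb.vs_H vs_R R_coact_closed[OF y]]) (rule Ph(2); (assumption | rule Ol g)+)
 qed
 qed
qed

lemma braided_bil:
 shows "a : car R ==> a' : car R ==> b' : car R ==>
 bil H R RR (%g b0. pt R R (a ** act R g a') (b0 ** b'))"
 and "a : car R ==> b : car R ==> bil R R RR (%a' b'. tsum RR (de b) (%g b0.
 pt R R (a ** act R g a') (b0 ** b')))"
 and "Y : car RR ==> bil R R RR (%a b. tsum RR Y (%a' b'. tsum RR (de b) (%g b0.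
 pt R R (a ** act R g a') (b0 ** b'))))"
 and "a : car R ==> b : car R ==> a' : car R ==> b' : car R ==>
 tsum RR (de b) (%g b0. pt R R (a ** act R g a') (b0 ** b')) : car RR"
 by ((assumption | rule Ol HR.tensor_sum_closed)+)

lemma braided_closed: "X : car RR ==> Y : car RR ==> braided_mult R X Y : car RR"
 unfolding braided_mult_def by (rule RR.tensor_sum_closed[OF RR.vs_tensor braided_bil(3)])

lemma braided_sw:
 assumes G: "bil R R scalars G" and X: "X : car RR" and Y: "Y : car RR"
 shows "sw (braided_mult R X Y) G = sw X (%a b. sw Y (%a' b'. sw (de b) (%g b0.
 G (a ** act R g a') (b0 ** b'))))"
 unfolding braided_mult_def sw_tsum[OF X braided_bil(3)[OF Y] G vs_R vs_R vs_R vs_R]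
proof (rule sw_cong[OF vs_R vs_R X])
 fix a b assume a: "a : car R" and b: "b : car R"
 show "sw (tsum RR Y (%a' b'. tsum RR (de b) (%g b0.
 pt R R (a ** act R g a') (b0 ** b')))) G =
 sw Y (%a' b'. sw (de b) (%g b0. G (a ** act R g a') (b0 ** b')))"
 unfolding sw_tsum[OF Y braided_bil(2)[OF a b] G vs_R vs_R vs_R vs_R]
 proof (rule sw_cong[OF vs_R vs_R Y])
 fix a' b' assume a': "a' : car R" and b': "b' : car R"
 show "sw (tsum RR (de b) (%g b0. pt R R (a ** act R g a') (b0 ** b'))) G =
 sw (de b) (%g b0. G (a ** act R g a') (b0 ** b'))"
 unfolding sw_tsum[OF R_coact_closed[OF b] braided_bil(1)[OF a a' b'] G Hb.vs_H vs_R vs_R vs_R]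
 by (rule sw_cong[OF Hb.vs_H vs_R R_coact_closed[OF b]])
 (intro sw_pure G RA.m_closed R_act_closed a a' b' vs_R)
 qed
qed

end

text \<open>An algebra with images \<open>E w\<close> of the basis words, on which action, coaction,
  coproduct and counit follow the word formulas. \<open>E_ext\<close> says that these images span,
  in the form that functionals are determined by their values on them. Spanning suffices for every
  axiom of a braided bialgebra, so T(M) and its quotient, the Nichols algebra, are treated
  alike.\<close>

locale word_model = yd_bij H M + op_space H R
 for H :: "('k::field, 'h, 'm) hopf_scheme" and M :: "('k, 'a, 'h, 'n) yd_scheme"
 and R :: "('k, 'r, 'h, 'p) yd_bialg_scheme" +
 fixes E :: "'a list => 'r"
 assumes E_closed: "w : lists BM ==> E w : car R"
 and E_ext: "f : lin R scalars ==> g : lin R scalars ==>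
 (!!w. w : lists BM ==> f (E w) = g (E w)) ==> x : car R ==> f x = (g x :: 'k)"
 and E_append: "u : lists BM ==> v : lists BM ==> E u ** E v = E (u @ v)"
 and E_Nil: "(one R) = E []"
 and act_E: "h : basis H ==> w : lists BM ==> ph : lin R scalars ==>
 ph (act R h (E w)) = ev (yd_coord.aT (cD H) (ce H) (cA H M) w h) (%v. ph (E v))"
 and coact_E: "w : lists BM ==> bil H R scalars F ==>
 sw (coact R (E w)) F = ev2 (yd_coord.cT (cmu H) (cun H) (cC H M) w) (%g v. F g (E v))"
 and R_comult: "br_comult R : lin R (tensor R R)"
 and comult_E: "w : lists BM ==> bil R R scalars G ==>
 sw (br_comult R (E w)) G = ev2 (yd_coord.dT (cD H) (ce H) (cA H M) (cC H M) w) (%u v. G (E u) (E v))"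
 and R_counit: "br_counit R : lin R scalars"
 and counit_E: "w : lists BM ==> br_counit R (E w) = yd_coord.eT w"
begin

sublocale Y: yd_coord "basis H" "cmu H" "cun H" "cD H" "ce H" "cSi H" "basis M" "cA H M" "cC H M"
 by (rule yd_coord)

sublocale YT: ybi_coord "basis H" "cmu H" "cun H" "cD H" "ce H" "cSi H" "lists (basis M)" "%h w. Y.aT w h"
 Y.cT "(@)" "[]" Y.dT Y.eT
 by (rule Y.ybi_coord_T)

abbreviation "LB \<equiv> lists BM"
abbreviation "De \<equiv> br_comult R"
abbreviation "ep \<equiv> br_counit R"

lemma R_comult_closed: "x : car R ==> De x : car RR"
 by (rule lin_closed[OF R_comult])

lemma lin_R_comult: "f : lin N R ==> (%z. De (f z)) : lin N RR"
 and lin_R_counit: "f : lin N R ==> (%z. br_counit R (f z)) : lin N scalars"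
 by (rule lin_comp[OF _ R_comult] lin_comp[OF _ R_counit]; assumption)+

lemmas Rl = Ol lin_R_comult lin_R_counit R_comult_closed E_closed

text \<open>The quantifier ranges over the argument that is varied, so that a multilinear identity
  is extended from words one argument at a time; \<open>H_ball\<close> does the same for arguments
  in H.\<close>

lemma E_ball: "f : lin R scalars ==> g : lin R scalars ==>
 (!!w. w : LB ==> f (E w) = g (E w)) ==> ALL x:car R. f x = (g x :: 'k)"
 using E_ext by blast

lemma H_ball: "f : lin H scalars ==> g : lin H scalars ==>
 (!!h. h : basis H ==> f h = g h) ==> ALL h:car H. f h = (g h :: 'k)"
 using basis_ext[OF Hb.vs_H vsk] by blast

lemma R_act_one:
 assumes "x : car R" shows "act R (one H) x = x"
proof (rule functional_eqI[OF vs_R])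
 fix ph assume ph: "ph : lin R scalars"
 have "ph (act R (one H) (E w)) = ph (E w)" if w: "w : LB" for w
 proof -
 have "ph (act R (one H) (E w)) = ev (cun H) (%u. ph (act R u (E w)))"
 by (rule Hb.cun_lin[symmetric]) ((assumption | rule lin_comp[OF _ ph] Rl w)+)
 also have "... = ev (cun H) (%u. ev (Y.aT w u) (%v. ph (E v)))"
 by (intro Hb.H_cong act_E w ph)
 finally show ?thesis using w by (simp add: YT.A_un)
 qed
 hence "ALL x:car R. ph (act R (one H) x) = ph x"
 by (intro E_ball) ((assumption | rule lin_comp[OF _ ph] Rl)+)
 thus "ph (act R (one H) x) = ph x" using assms by blast
qed ((assumption | rule assms Rl)+)

text \<open>The pattern of the laws below: a functional makes the identity scalar, the case of basis
  elements and words is a coordinate identity (here \<open>YT.A_mu\<close>), and linearity extends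
  it to one argument after the other.\<close>

lemma R_act_mult:
 assumes g: "g : car H" and h: "h : car H" and x: "x : car R"
 shows "act R (g \<otimes>\<^bsub>H\<^esub> h) x = act R g (act R h x)"
proof (rule functional_eqI[OF vs_R])
 fix ph assume ph: "ph : lin R scalars"
 have "ph (act R (g \<otimes>\<^bsub>H\<^esub> h) (E w)) = ph (act R g (act R h (E w)))"
 if w: "w : LB" and g: "g : basis H" and h: "h : basis H" for w g h
 proof -
 have "ph (act R (g \<otimes>\<^bsub>H\<^esub> h) (E w)) = ev (cmu H g h) (%u. ph (act R u (E w)))"
 by (rule Hb.cmu_lin[symmetric]) ((assumption | rule lin_comp[OF _ ph] Rl w g h)+)
 also have "... = ev (cmu H g h) (%u. ev (Y.aT w u) (%v. ph (E v)))"
 by (intro Hb.H_cong act_E w ph)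
 also have "... = ev (Y.aT w h) (%v. ph (act R g (E v)))"
 unfolding YT.A_mu by (rule YT.A_cong) (intro act_E[symmetric] g ph)
 also have "... = ph (act R g (act R h (E w)))"
 by (rule act_E[where ph="%z. ph (act R g z)", symmetric]) ((assumption | rule lin_comp[OF _ ph] Rl w g h)+)
 finally show ?thesis .
 qed
 hence "ALL x:car R. ph (act R (g \<otimes>\<^bsub>H\<^esub> h) x) = ph (act R g (act R h x))"
 if "g : basis H" "h : basis H" for g h
 using that by (intro E_ball) ((assumption | rule lin_comp[OF _ ph] Rl)+)
 hence "ALL h:car H. ph (act R (g \<otimes>\<^bsub>H\<^esub> h) x) = ph (act R g (act R h x))" if "g : basis H" for g
 using that x by (intro H_ball) ((assumption | rule lin_comp[OF _ ph] Rl)+, blast)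
 hence "ALL g:car H. ph (act R (g \<otimes>\<^bsub>H\<^esub> h) x) = ph (act R g (act R h x))"
 using h x by (intro H_ball) ((assumption | rule lin_comp[OF _ ph] Rl)+, blast)
 thus "ph (act R (g \<otimes>\<^bsub>H\<^esub> h) x) = ph (act R g (act R h x))" using g by blast
qed ((assumption | rule assms Rl)+)

lemma R_coact_coassoc_sw:
 assumes F: "tri H H R F"
 shows "ALL x:car R. sw (de x) (%g y. sw (comult H g) (%a b. F a b y)) = sw (de x) (%g y. sw (de y) (%a b. F g a b))"
proof (rule E_ball)
 note b = tri_sw12[OF Hb.vs_H vs_R H.comult_linear F] tri_sw23[OF Hb.vs_H vs_R R_coact F]
 show "(%x. sw (de x) (%g y. sw (comult H g) (%a b. F a b y))) : lin R scalars"
 by ((assumption | rule b Rl)+)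
 show "(%x. sw (de x) (%g y. sw (de y) (%a b. F g a b))) : lin R scalars"
 by ((assumption | rule b Rl)+)
 fix w assume w: "w : LB"
 have "sw (de (E w)) (%g y. sw (comult H g) (%a b. F a b y)) =
 ev2 (Y.cT w) (%g v. sw (comult H g) (%a b. F a b (E v)))" (is "?x = _") by (rule coact_E[OF w b(1)])
 also have "... = ev2 (Y.cT w) (%g v. ev2 (cD H g) (%a b. F a b (E v)))"
 by (intro YT.C_cong Hb.cD_sw[symmetric] tri_bil12[OF F] E_closed)
 also have "... = ev2 (Y.cT w) (%g v. ev2 (Y.cT v) (%a b. F g a (E b)))"
 by (rule YT.C_coassoc)
 also have "... = ev2 (Y.cT w) (%g v. sw (de (E v)) (%a b. F g a b))"
 by (intro YT.C_cong coact_E[symmetric] tri_bil23[OF F] Hb.BH_carrier)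
 also have "... = sw (de (E w)) (%g y. sw (de y) (%a b. F g a b))" (is "_ = ?y") by (rule coact_E[OF w b(2), symmetric])
 finally show "?x = ?y" .
qed

lemma R_coassoc_sw:
 assumes F: "tri R R R F"
 shows "ALL x:car R. sw (De x) (%g y. sw (De g) (%a b. F a b y)) = sw (De x) (%g y. sw (De y) (%a b. F g a b))"
proof (rule E_ball)
 note b = tri_sw12[OF vs_R vs_R R_comult F] tri_sw23[OF vs_R vs_R R_comult F]
 show "(%x. sw (De x) (%g y. sw (De g) (%a b. F a b y))) : lin R scalars"
 by ((assumption | rule b Rl)+)
 show "(%x. sw (De x) (%g y. sw (De y) (%a b. F g a b))) : lin R scalars"
 by ((assumption | rule b Rl)+)
 fix w assume w: "w : LB"
 have "sw (De (E w)) (%g y. sw (De g) (%a b. F a b y)) =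
 ev2 (Y.dT w) (%g v. sw (De (E g)) (%a b. F a b (E v)))" (is "?x = _") by (rule comult_E[OF w b(1)])
 also have "... = ev2 (Y.dT w) (%g v. ev2 (Y.dT g) (%a b. F (E a) (E b) (E v)))"
 by (intro YT.Dr_cong[OF w] comult_E tri_bil12[OF F] E_closed)
 also have "... = ev2 (Y.dT w) (%g v. ev2 (Y.dT v) (%a b. F (E g) (E a) (E b)))"
 by (rule YT.Dr_coassoc)
 also have "... = ev2 (Y.dT w) (%g v. sw (De (E v)) (%a b. F (E g) a b))"
 by (intro YT.Dr_cong[OF w] comult_E[symmetric] tri_bil23[OF F] E_closed)
 also have "... = sw (De (E w)) (%g y. sw (De y) (%a b. F g a b))" (is "_ = ?y") by (rule comult_E[OF w b(2), symmetric])
 finally show "?x = ?y" .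
qed

lemma R_compat_sw:
 assumes F: "bil H R scalars F" and h: "h : car H" and x: "x : car R"
 shows "sw (comult H h) (%h1 h2. sw (de x) (%g y. F (h1 \<otimes>\<^bsub>H\<^esub> g) (act R h2 y))) =
 sw (comult H h) (%h1 h2. sw (de (act R h1 x)) (%g y. F (g \<otimes>\<^bsub>H\<^esub> h2) y))"
proof -
 note Fl = lin_bil1[OF F] lin_bil2[OF F]
 have 1: "sw (comult H h) (%h1 h2. sw (de (E w)) (%g y. F (h1 \<otimes>\<^bsub>H\<^esub> g) (act R h2 y))) =
 sw (comult H h) (%h1 h2. sw (de (act R h1 (E w))) (%g y. F (g \<otimes>\<^bsub>H\<^esub> h2) y))"
 if h: "h : basis H" and w: "w : LB" for h w
 proof -
 have "sw (comult H h) (%h1 h2. sw (de (E w)) (%g y. F (h1 \<otimes>\<^bsub>H\<^esub> g) (act R h2 y))) =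
 ev2 (cD H h) (%h1 h2. sw (de (E w)) (%g y. F (h1 \<otimes>\<^bsub>H\<^esub> g) (act R h2 y)))"
 by (rule Hb.cD_sw[OF h, symmetric]) ((assumption | rule Fl Rl w)+)
 also have "... = ev2 (cD H h) (%h1 h2. ev2 (Y.cT w) (%g v. ev (cmu H h1 g) (%p. ev (Y.aT v h2) (%z. F p (E z)))))"
 proof (rule Hb.H_cong(1))
 fix h1 h2 assume hh: "h1 : basis H" "h2 : basis H"
 have "sw (de (E w)) (%g y. F (h1 \<otimes>\<^bsub>H\<^esub> g) (act R h2 y)) = ev2 (Y.cT w) (%g v. F (h1 \<otimes>\<^bsub>H\<^esub> g) (act R h2 (E v)))" (is "?x = _")
 by (rule coact_E[OF w]) ((assumption | rule Fl Rl hh)+)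
 also have "... = ev2 (Y.cT w) (%g v. ev (cmu H h1 g) (%p. ev (Y.aT v h2) (%z. F p (E z))))" (is "_ = ?y")
 proof (rule YT.C_cong)
 fix g v assume gv: "g : basis H" "v : LB"
 have "F (h1 \<otimes>\<^bsub>H\<^esub> g) (act R h2 (E v)) = ev (cmu H h1 g) (%p. F p (act R h2 (E v)))" (is "?x = _")
 by (rule Hb.cmu_lin[symmetric]) ((assumption | rule Fl Rl hh gv)+)
 also have "... = ev (cmu H h1 g) (%p. ev (Y.aT v h2) (%z. F p (E z)))" (is "_ = ?y")
 by (intro Hb.H_cong act_E hh gv bil_right[OF F] Hb.BH_carrier)
 finally show "?x = ?y" .
 qed
 finally show "?x = ?y" .
 qed
 also have "... = ev2 (cD H h) (%h1 h2. ev (Y.aT w h1) (%v. ev2 (Y.cT v) (%g z. ev (cmu H g h2) (%p. F p (E z)))))"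
 by (rule YT.compat)
 also have "... = ev2 (cD H h) (%h1 h2. sw (de (act R h1 (E w))) (%g y. F (g \<otimes>\<^bsub>H\<^esub> h2) y))"
 proof (rule Hb.H_cong(1))
 fix h1 h2 assume hh: "h1 : basis H" "h2 : basis H"
 have "sw (de (act R h1 (E w))) (%g y. F (g \<otimes>\<^bsub>H\<^esub> h2) y) = ev (Y.aT w h1) (%v. sw (de (E v)) (%g y. F (g \<otimes>\<^bsub>H\<^esub> h2) y))" (is "?x = _")
 by (rule act_E[OF hh(1) w, where ph="%z. sw (de z) (%g y. F (g \<otimes>\<^bsub>H\<^esub> h2) y)"]) ((assumption | rule Fl Rl hh)+)
 also have "... = ev (Y.aT w h1) (%v. ev2 (Y.cT v) (%g z. F (g \<otimes>\<^bsub>H\<^esub> h2) (E z)))"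
 by (rule YT.A_cong, rule coact_E, assumption) ((assumption | rule Fl Rl hh)+)
 also have "... = ev (Y.aT w h1) (%v. ev2 (Y.cT v) (%g z. ev (cmu H g h2) (%p. F p (E z))))" (is "_ = ?y")
 by (intro YT.A_cong YT.C_cong Hb.cmu_lin[symmetric] hh bil_left[OF F] E_closed)
 finally show "?y = ?x" by simp
 qed
 also have "... = sw (comult H h) (%h1 h2. sw (de (act R h1 (E w))) (%g y. F (g \<otimes>\<^bsub>H\<^esub> h2) y))"
 by (rule Hb.cD_sw[OF h]) ((assumption | rule Fl Rl w)+)
 finally show ?thesis .
 qed
 have 2: "ALL x:car R. sw (comult H h) (%h1 h2. sw (de x) (%g y. F (h1 \<otimes>\<^bsub>H\<^esub> g) (act R h2 y))) =
 sw (comult H h) (%h1 h2. sw (de (act R h1 x)) (%g y. F (g \<otimes>\<^bsub>H\<^esub> h2) y))" if h: "h : basis H" for h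
 by (rule E_ball; ((assumption | rule 1[OF h] Fl Rl h)+))
 have "ALL h:car H. sw (comult H h) (%h1 h2. sw (de x) (%g y. F (h1 \<otimes>\<^bsub>H\<^esub> g) (act R h2 y))) =
 sw (comult H h) (%h1 h2. sw (de (act R h1 x)) (%g y. F (g \<otimes>\<^bsub>H\<^esub> h2) y))"
 by (rule H_ball; ((assumption | rule bspec[OF 2] Fl Rl x)+))
 thus ?thesis using h by blast
qed

lemma R_act_prod_sw:
 assumes ph: "ph : lin R scalars" and h: "h : car H" and x: "x : car R" and y: "y : car R"
 shows "ph (act R h (x ** y)) = sw (comult H h) (%h1 h2. ph (act R h1 x ** act R h2 y))"
proof -
 note l = lin_comp[OF _ ph]
 have 1: "ph (act R h (E u ** E v)) = sw (comult H h) (%h1 h2. ph (act R h1 (E u) ** act R h2 (E v)))"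
 if h: "h : basis H" and u: "u : LB" and v: "v : LB" for h u v
 proof -
 have uv: "u @ v : LB" using u v by auto
 have "ph (act R h (E u ** E v)) = ev (Y.aT (u @ v) h) (%w. ph (E w))"
 unfolding E_append[OF u v] by (rule act_E[OF h uv ph])
 also have "... = ev2 (cD H h) (%h1 h2. ev (Y.aT u h1) (%x'. ev (Y.aT v h2) (%y'. ph (E (x' @ y')))))"
 by (rule YT.A_rm)
 also have "... = ev2 (cD H h) (%h1 h2. ph (act R h1 (E u) ** act R h2 (E v)))"
 proof (rule Hb.H_cong(1))
 fix h1 h2 assume hh: "h1 : basis H" "h2 : basis H"
 have "ph (act R h1 (E u) ** act R h2 (E v)) = ev (Y.aT u h1) (%x'. ph (E x' ** act R h2 (E v)))" (is "?x = _")
 by (rule act_E[OF hh(1) u, of "%z. ph (z ** act R h2 (E v))"]) ((assumption | rule l Rl hh u v)+)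
 also have "... = ev (Y.aT u h1) (%x'. ev (Y.aT v h2) (%y'. ph (E (x' @ y'))))" (is "_ = ?y")
 proof (rule YT.A_cong)
 fix x' assume x': "x' : LB"
 have "ph (E x' ** act R h2 (E v)) = ev (Y.aT v h2) (%y'. ph (E x' ** E y'))" (is "?x = _")
 by (rule act_E[OF hh(2) v, of "%z. ph (E x' ** z)"]) ((assumption | rule l Rl x')+)
 also have "... = ev (Y.aT v h2) (%y'. ph (E (x' @ y')))" (is "_ = ?y")
 by (rule YT.A_cong) (simp add: E_append x')
 finally show "?x = ?y" .
 qed
 finally show "?y = ?x" by simp
 qed
 also have "... = sw (comult H h) (%h1 h2. ph (act R h1 (E u) ** act R h2 (E v)))"
 by (rule Hb.cD_sw[OF h]) ((assumption | rule l Rl u v)+)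
 finally show ?thesis .
 qed
 have 2: "ALL x:car R. ph (act R h (x ** E v)) = sw (comult H h) (%h1 h2. ph (act R h1 x ** act R h2 (E v)))"
 if h: "h : basis H" and v: "v : LB" for h v
 by (rule E_ball; ((assumption | rule 1[OF h] l Rl h v)+))
 have 3: "ALL y:car R. ph (act R h (x ** y)) = sw (comult H h) (%h1 h2. ph (act R h1 x ** act R h2 y))"
 if h: "h : basis H" for h
 by (rule E_ball; ((assumption | rule bspec[OF 2] l Rl h x)+))
 have "ALL h:car H. ph (act R h (x ** y)) = sw (comult H h) (%h1 h2. ph (act R h1 x ** act R h2 y))"
 by (rule H_ball; ((assumption | rule bspec[OF 3] l Rl x y)+))
 thus ?thesis using h by blast
qed

lemma R_coact_prod_sw:
 assumes F: "bil H R scalars F" and x: "x : car R" and y: "y : car R"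
 shows "sw (de (x ** y)) F = sw (de x) (%g x0. sw (de y) (%g' y0. F (g \<otimes>\<^bsub>H\<^esub> g') (x0 ** y0)))"
proof -
 note l = lin_bil1[OF F] lin_bil2[OF F]
 have 1: "sw (de (E u ** E v)) F = sw (de (E u)) (%g x0. sw (de (E v)) (%g' y0. F (g \<otimes>\<^bsub>H\<^esub> g') (x0 ** y0)))"
 if u: "u : LB" and v: "v : LB" for u v
 proof -
 have uv: "u @ v : LB" using u v by auto
 have "sw (de (E u ** E v)) F = ev2 (Y.cT (u @ v)) (%g v. F g (E v))"
 unfolding E_append[OF u v] by (rule coact_E[OF uv F])
 also have "... = ev2 (Y.cT u) (%g x0. ev2 (Y.cT v) (%g' y0. ev (cmu H g g') (%p. F p (E (x0 @ y0)))))"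
 by (rule YT.C_rm)
 also have "... = ev2 (Y.cT u) (%g x0. sw (de (E v)) (%g' y0. F (g \<otimes>\<^bsub>H\<^esub> g') (E x0 ** y0)))"
 proof (rule YT.C_cong)
 fix g x0 assume g: "g : basis H" "x0 : LB"
 have "sw (de (E v)) (%g' y0. F (g \<otimes>\<^bsub>H\<^esub> g') (E x0 ** y0)) = ev2 (Y.cT v) (%g' y0. F (g \<otimes>\<^bsub>H\<^esub> g') (E x0 ** E y0))" (is "?x = _")
 by (rule coact_E[OF v]) ((assumption | rule l Rl g)+)
 also have "... = ev2 (Y.cT v) (%g' y0. ev (cmu H g g') (%p. F p (E (x0 @ y0))))" (is "_ = ?y")
 by (rule YT.C_cong) (simp add: E_append g Hb.cmu_lin bil_left[OF F] E_closed)
 finally show "?y = ?x" by simp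
 qed
 also have "... = sw (de (E u)) (%g x0. sw (de (E v)) (%g' y0. F (g \<otimes>\<^bsub>H\<^esub> g') (x0 ** y0)))"
 by (rule coact_E[OF u, symmetric]) ((assumption | rule l Rl v)+)
 finally show ?thesis .
 qed
 have 2: "ALL x:car R. sw (de (x ** E v)) F = sw (de x) (%g x0. sw (de (E v)) (%g' y0. F (g \<otimes>\<^bsub>H\<^esub> g') (x0 ** y0)))"
 if v: "v : LB" for v
 by (rule E_ball; ((assumption | rule F 1 l Rl v)+))
 have "ALL y:car R. sw (de (x ** y)) F = sw (de x) (%g x0. sw (de y) (%g' y0. F (g \<otimes>\<^bsub>H\<^esub> g') (x0 ** y0)))"
 by (rule E_ball; ((assumption | rule F bspec[OF 2] l Rl x)+))
 thus ?thesis using y by blast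
qed

lemma R_comult_act_sw:
 assumes G: "bil R R scalars G" and h: "h : car H" and x: "x : car R"
 shows "sw (De (act R h x)) G = sw (comult H h) (%h1 h2. sw (De x) (%a b. G (act R h1 a) (act R h2 b)))"
proof -
 note l = lin_bil1[OF G] lin_bil2[OF G]
 have 1: "sw (De (act R h (E w))) G = sw (comult H h) (%h1 h2. sw (De (E w)) (%a b. G (act R h1 a) (act R h2 b)))"
 if h: "h : basis H" and w: "w : LB" for h w
 proof -
 have "sw (De (act R h (E w))) G = ev (Y.aT w h) (%v. sw (De (E v)) G)"
 by (rule act_E[OF h w, of "%z. sw (De z) G"]) ((assumption | rule G l Rl)+)
 also have "... = ev (Y.aT w h) (%v. ev2 (Y.dT v) (%a b. G (E a) (E b)))"
 by (intro YT.A_cong comult_E G)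
 also have "... = ev2 (cD H h) (%h1 h2. ev2 (Y.dT w) (%a b. ev (Y.aT a h1) (%a'. ev (Y.aT b h2) (%b'. G (E a') (E b')))))"
 by (rule YT.Dr_A)
 also have "... = ev2 (cD H h) (%h1 h2. sw (De (E w)) (%a b. G (act R h1 a) (act R h2 b)))"
 proof (rule Hb.H_cong(1))
 fix h1 h2 assume hh: "h1 : basis H" "h2 : basis H"
 have "sw (De (E w)) (%a b. G (act R h1 a) (act R h2 b)) = ev2 (Y.dT w) (%a b. G (act R h1 (E a)) (act R h2 (E b)))" (is "?x = _")
 by (rule comult_E[OF w]) ((assumption | rule l Rl hh)+)
 also have "... = ev2 (Y.dT w) (%a b. ev (Y.aT a h1) (%a'. ev (Y.aT b h2) (%b'. G (E a') (E b'))))" (is "_ = ?y")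
 proof (rule YT.Dr_cong[OF w])
 fix a b assume ab: "a : LB" "b : LB"
 have "G (act R h1 (E a)) (act R h2 (E b)) = ev (Y.aT a h1) (%a'. G (E a') (act R h2 (E b)))" (is "?x = _")
 by (rule act_E[OF hh(1) ab(1)]) ((assumption | rule l Rl hh ab)+)
 also have "... = ev (Y.aT a h1) (%a'. ev (Y.aT b h2) (%b'. G (E a') (E b')))" (is "_ = ?y")
 by (intro YT.A_cong act_E hh ab bil_right[OF G] E_closed)
 finally show "?x = ?y" .
 qed
 finally show "?y = ?x" by simp
 qed
 also have "... = sw (comult H h) (%h1 h2. sw (De (E w)) (%a b. G (act R h1 a) (act R h2 b)))"
 by (rule Hb.cD_sw[OF h]) ((assumption | rule l Rl w)+)
 finally show ?thesis .
 qed
 have 2: "ALL x:car R. sw (De (act R h x)) G = sw (comult H h) (%h1 h2. sw (De x) (%a b. G (act R h1 a) (act R h2 b)))"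
 if h: "h : basis H" for h
 by (rule E_ball; ((assumption | rule G 1[OF h] l Rl h)+))
 have "ALL h:car H. sw (De (act R h x)) G = sw (comult H h) (%h1 h2. sw (De x) (%a b. G (act R h1 a) (act R h2 b)))"
 by (rule H_ball; ((assumption | rule G bspec[OF 2] l Rl x)+))
 thus ?thesis using h by blast
qed

lemma R_comult_coact_sw:
 assumes F: "tri H R R F"
 shows "ALL x:car R. sw (de x) (%g y. sw (De y) (F g)) =
 sw (De x) (%a b. sw (de a) (%g a0. sw (de b) (%g' b0. F (g \<otimes>\<^bsub>H\<^esub> g') a0 b0)))"
proof (rule E_ball)
 note l = lin_tri1[OF F] lin_tri2[OF F] lin_tri3[OF F] tri_bil23[OF F]
 show "(%x. sw (de x) (%g y. sw (De y) (F g))) : lin R scalars"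
 "(%x. sw (De x) (%a b. sw (de a) (%g a0. sw (de b) (%g' b0. F (g \<otimes>\<^bsub>H\<^esub> g') a0 b0)))) : lin R scalars"
 by ((assumption | rule l Rl)+)
 fix w assume w: "w : LB"
 have "sw (de (E w)) (%g y. sw (De y) (F g)) = ev2 (Y.cT w) (%g v. sw (De (E v)) (F g))" (is "?x = _")
 by (rule coact_E[OF w]) ((assumption | rule l Rl)+)
 also have "... = ev2 (Y.cT w) (%g v. ev2 (Y.dT v) (%a b. F g (E a) (E b)))"
 by (intro YT.C_cong comult_E tri_bil23[OF F] Hb.BH_carrier)
 also have "... = ev2 (Y.dT w) (%a b. ev2 (Y.cT a) (%g a0. ev2 (Y.cT b) (%g' b0.
 ev (cmu H g g') (%p. F p (E a0) (E b0)))))" by (rule YT.Dr_C)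
 also have "... = ev2 (Y.dT w) (%a b. ev2 (Y.cT a) (%g a0. ev2 (Y.cT b) (%g' b0.
 F (g \<otimes>\<^bsub>H\<^esub> g') (E a0) (E b0))))"
 by (intro YT.Dr_cong[OF w] YT.C_cong Hb.cmu_lin tri1[OF F] E_closed)
 also have "... = ev2 (Y.dT w) (%a b. sw (de (E a)) (%g a0. sw (de (E b)) (%g' b0. F (g \<otimes>\<^bsub>H\<^esub> g') a0 b0)))"
 proof (rule YT.Dr_cong[OF w])
 fix a b assume ab: "a : LB" "b : LB"
 have "sw (de (E a)) (%g a0. sw (de (E b)) (%g' b0. F (g \<otimes>\<^bsub>H\<^esub> g') a0 b0)) =
 ev2 (Y.cT a) (%g a0. sw (de (E b)) (%g' b0. F (g \<otimes>\<^bsub>H\<^esub> g') (E a0) b0))" (is "?x = _")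
 by (rule coact_E[OF ab(1)]) ((assumption | rule l Rl ab)+)
 also have "... = ev2 (Y.cT a) (%g a0. ev2 (Y.cT b) (%g' b0. F (g \<otimes>\<^bsub>H\<^esub> g') (E a0) (E b0)))" (is "_ = ?y")
 by (rule YT.C_cong, rule coact_E[OF ab(2)]) ((assumption | rule l Rl)+)
 finally show "?y = ?x" by simp
 qed
 also have "... = sw (De (E w)) (%a b. sw (de a) (%g a0. sw (de b) (%g' b0. F (g \<otimes>\<^bsub>H\<^esub> g') a0 b0)))" (is "_ = ?y")
 by (rule comult_E[OF w, symmetric]) ((assumption | rule l Rl)+)
 finally show "?x = ?y" .
qed

lemma R_comult_prod_sw:
 assumes G: "bil R R scalars G" and x: "x : car R" and y: "y : car R"
 shows "sw (De (x ** y)) G = sw (De x) (%a b. sw (De y) (%c d. sw (de b) (%g b0.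
 G (a ** act R g c) (b0 ** d))))"
proof -
 note l = lin_bil1[OF G] lin_bil2[OF G]
 have 1: "sw (De (E u ** E v)) G = sw (De (E u)) (%a b. sw (De (E v)) (%c d. sw (de b) (%g b0.
 G (a ** act R g c) (b0 ** d))))"
 if u: "u : LB" and v: "v : LB" for u v
 proof -
 have uv: "u @ v : LB" using u v by auto
 have "sw (De (E u ** E v)) G = ev2 (Y.dT (u @ v)) (%a b. G (E a) (E b))"
 unfolding E_append[OF u v] by (rule comult_E[OF uv G])
 also have "... = ev2 (Y.dT u) (%a b. ev2 (Y.dT v) (%c d. ev2 (Y.cT b) (%g b0.
 ev (Y.aT c g) (%c'. G (E (a @ c')) (E (b0 @ d))))))" by (rule YT.Dr_rm[OF v])
 also have "... = ev2 (Y.dT u) (%a b. sw (De (E v)) (%c d. sw (de (E b)) (%g b0.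
 G (E a ** act R g c) (b0 ** d))))"
 proof (rule YT.Dr_cong[OF u])
 fix a b assume ab: "a : LB" "b : LB"
 have "sw (De (E v)) (%c d. sw (de (E b)) (%g b0. G (E a ** act R g c) (b0 ** d))) =
 ev2 (Y.dT v) (%c d. sw (de (E b)) (%g b0. G (E a ** act R g (E c)) (b0 ** E d)))" (is "?x = _")
 by (rule comult_E[OF v]) ((assumption | rule l Rl ab)+)
 also have "... = ev2 (Y.dT v) (%c d. ev2 (Y.cT b) (%g b0. G (E a ** act R g (E c)) (E b0 ** E d)))"
 by (rule YT.Dr_cong[OF v], rule coact_E[OF ab(2)]) ((assumption | rule l Rl ab)+)
 also have "... = ev2 (Y.dT v) (%c d. ev2 (Y.cT b) (%g b0.
 ev (Y.aT c g) (%c'. G (E (a @ c')) (E (b0 @ d)))))" (is "_ = ?y")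
 proof (rule YT.Dr_cong[OF v], rule YT.C_cong)
 fix c d g b0 assume cd: "c : LB" "d : LB" "g : basis H" "b0 : LB"
 have "G (E a ** act R g (E c)) (E b0 ** E d) = ev (Y.aT c g) (%c'. G (E a ** E c') (E b0 ** E d))" (is "?x = _")
 by (rule act_E[OF cd(3,1), of "%z. G (E a ** z) (E b0 ** E d)"]) ((assumption | rule l Rl ab cd)+)
 also have "... = ev (Y.aT c g) (%c'. G (E (a @ c')) (E (b0 @ d)))" (is "_ = ?y")
 by (rule YT.A_cong) (simp add: E_append ab cd)
 finally show "?x = ?y" .
 qed
 finally show "?y = ?x" by simp
 qed
 also have "... = sw (De (E u)) (%a b. sw (De (E v)) (%c d. sw (de b) (%g b0. G (a ** act R g c) (b0 ** d))))"
 by (rule comult_E[OF u, symmetric]) ((assumption | rule l Rl v)+)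
 finally show ?thesis .
 qed
 have 2: "ALL x:car R. sw (De (x ** E v)) G = sw (De x) (%a b. sw (De (E v)) (%c d. sw (de b) (%g b0.
 G (a ** act R g c) (b0 ** d))))"
 if v: "v : LB" for v
 by (rule E_ball; ((assumption | rule G 1 l Rl v)+))
 have "ALL y:car R. sw (De (x ** y)) G = sw (De x) (%a b. sw (De y) (%c d. sw (de b) (%g b0.
 G (a ** act R g c) (b0 ** d))))"
 by (rule E_ball; ((assumption | rule G bspec[OF 2] l Rl x)+))
 thus ?thesis using y by blast
qed

lemma R_coact_counit_sw:
 assumes ph: "ph : lin R scalars"
 shows "ALL x:car R. sw (de x) (%g y. counit H g * ph y) = ph x"
proof (rule E_ball[OF _ ph])
 show "(%x. sw (de x) (%g y. counit H g * ph y)) : lin R scalars"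
 by ((assumption | rule ph Rl)+)
 fix w assume w: "w : LB"
 have "sw (de (E w)) (%g y. counit H g * ph y) = ev2 (Y.cT w) (%g v. counit H g * ph (E v))"
 by (rule coact_E[OF w]) ((assumption | rule ph Rl)+)
 also have "... = ev2 (Y.cT w) (%g v. ce H g * ph (E v))" by (rule YT.C_cong) (simp add: ce_def)
 finally show "sw (de (E w)) (%g y. counit H g * ph y) = ph (E w)" using w by (simp add: YT.C_counit)
qed

lemma R_counit_sw:
 assumes ph: "ph : lin R scalars"
 shows "ALL x:car R. sw (De x) (%a b. ep a * ph b) = ph x" "ALL x:car R. sw (De x) (%a b. ep b * ph a) = ph x"
proof -
 have l: "bil R R scalars (%a b. ep a * ph b)" "bil R R scalars (%a b. ep b * ph a)"
 by ((assumption | rule ph lin_comp[OF _ ph] Rl)+)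
 show "ALL x:car R. sw (De x) (%a b. ep a * ph b) = ph x"
 proof (rule E_ball[OF _ ph])
 show "(%x. sw (De x) (%a b. ep a * ph b)) : lin R scalars" by ((assumption | rule l Rl)+)
 fix w assume w: "w : LB"
 have "sw (De (E w)) (%a b. ep a * ph b) = ev2 (Y.dT w) (%a b. Y.eT a * ph (E b))"
 unfolding comult_E[OF w l(1)] by (rule YT.Dr_cong[OF w]) (simp add: counit_E)
 thus "sw (De (E w)) (%a b. ep a * ph b) = ph (E w)" by (simp add: YT.Dr_counit_l w)
 qed
 show "ALL x:car R. sw (De x) (%a b. ep b * ph a) = ph x"
 proof (rule E_ball[OF _ ph])
 show "(%x. sw (De x) (%a b. ep b * ph a)) : lin R scalars" by ((assumption | rule l Rl)+)
 fix w assume w: "w : LB"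
 have "sw (De (E w)) (%a b. ep b * ph a) = ev2 (Y.dT w) (%a b. Y.eT b * ph (E a))"
 unfolding comult_E[OF w l(2)] by (rule YT.Dr_cong[OF w]) (simp add: counit_E)
 thus "sw (De (E w)) (%a b. ep b * ph a) = ph (E w)" by (simp add: YT.Dr_counit_r w)
 qed
qed

lemma R_counit_act:
 assumes h: "h : car H" and x: "x : car R" shows "ep (act R h x) = counit H h * ep x"
proof -
 have 1: "ep (act R h (E w)) = counit H h * ep (E w)" if h: "h : basis H" and w: "w : LB" for h w
 proof -
 have "ep (act R h (E w)) = ev (Y.aT w h) (%v. ep (E v))" by (rule act_E[OF h w R_counit])
 also have "... = ev (Y.aT w h) Y.eT" by (rule YT.A_cong) (simp add: counit_E)
 finally show ?thesis using h w by (simp add: YT.er_A ce_def counit_E)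
 qed
 have 2: "ALL x:car R. ep (act R h x) = counit H h * ep x" if h: "h : basis H" for h
 by (rule E_ball; ((assumption | rule 1[OF h] Rl h)+))
 have "ALL h:car H. ep (act R h x) = counit H h * ep x"
 by (rule H_ball; ((assumption | rule bspec[OF 2] Rl x)+))
 thus ?thesis using h by blast
qed

lemma R_counit_coact_sw:
 assumes \<kappa>: "\<kappa> : lin H scalars"
 shows "ALL x:car R. sw (de x) (%g y. ep y * \<kappa> g) = ep x * \<kappa> (one H)"
proof (rule E_ball)
 have l: "bil H R scalars (%g y. ep y * \<kappa> g)" by ((assumption | rule \<kappa> Rl)+)
 show "(%x. sw (de x) (%g y. ep y * \<kappa> g)) : lin R scalars" "(%x. ep x * \<kappa> (one H)) : lin R scalars"
 by ((assumption | rule l Rl)+)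
 fix w assume w: "w : LB"
 have "sw (de (E w)) (%g y. ep y * \<kappa> g) = ev2 (Y.cT w) (%g y. Y.eT y * \<kappa> g)"
 unfolding coact_E[OF w l] by (rule YT.C_cong) (simp add: counit_E)
 thus "sw (de (E w)) (%g y. ep y * \<kappa> g) = ep (E w) * \<kappa> (one H)"
 by (simp add: YT.er_C Hb.cun_lin \<kappa> counit_E w)
qed

lemma R_counit_mult:
 assumes x: "x : car R" and y: "y : car R" shows "ep (x ** y) = ep x * ep y"
proof -
 have 1: "ep (E u ** E v) = ep (E u) * ep (E v)" if "u : LB" "v : LB" for u v
 using that by (simp add: E_append counit_E Y.counitT_append)
 have 2: "ALL x:car R. ep (x ** E v) = ep x * ep (E v)" if v: "v : LB" for v
 by (rule E_ball; ((assumption | rule 1 Rl v)+))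
 have "ALL y:car R. ep (x ** y) = ep x * ep y"
 by (rule E_ball; ((assumption | rule bspec[OF 2] Rl x)+))
 thus ?thesis using y by blast
qed

end

lemma scalars_carrier: "c : car scalars" by simp

section \<open>From scalar identities to the axioms of a braided bialgebra\<close>

context word_model
begin

lemma R_coact_one: "de (one R) = pt H R (one H) (one R)"
proof (rule HR.tensor_functional_eqI)
 fix F :: "'h => 'r => 'k" assume F: "bil H R scalars F"
 have "sw (de (one R)) F = ev (cun H) (%u. F u (E []))"
 unfolding E_Nil by (subst coact_E[OF _ F]) (simp_all only: lists.Nil YT.C_r1)
 also have "... = F (one H) (one R)" by (simp add: Hb.cun_lin bil_left[OF F] E_closed E_Nil)
 finally show "sw (de (one R)) F = sw (pt H R (one H) (one R)) F"
 by (simp add: HR.tensor_sum_pure[OF vsk F])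
qed ((assumption | rule Rl)+)

lemma R_act_unit: "h : car H ==> act R h (one R) = counit H h \<odot>\<^bsub>R\<^esub> (one R)"
proof (rule functional_eqI[OF vs_R])
 fix ph assume ph: "ph : lin R scalars" and h: "h : car H"
 have "ph (act R h (one R)) = counit H h * ph (one R)" if h: "h : basis H" for h
 unfolding E_Nil using h by (subst act_E[OF h _ ph]) (simp_all add: ce_def)
 hence "ALL h:car H. ph (act R h (one R)) = counit H h * ph (one R)"
 by (intro H_ball) ((assumption | rule lin_comp[OF _ ph] Rl)+)
 thus "ph (act R h (one R)) = ph (counit H h \<odot>\<^bsub>R\<^esub> (one R))"
 using h by (simp add: lin_smult[OF ph])
qed ((assumption | rule Rl RA.smult_closed scalars_carrier)+)

lemma R_comult_one: "De (one R) = pt R R (one R) (one R)"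
proof (rule RR.tensor_functional_eqI)
 fix G :: "'r => 'r => 'k" assume G: "bil R R scalars G"
 have "sw (De (one R)) G = G (one R) (one R)"
 unfolding E_Nil by (subst comult_E[OF _ G]) simp_all
 thus "sw (De (one R)) G = sw (pt R R (one R) (one R)) G"
 by (simp add: RR.tensor_sum_pure[OF vsk G])
qed ((assumption | rule Rl)+)

lemma R_counit_one: "ep (one R) = 1"
 unfolding E_Nil by (subst counit_E) simp_all

lemma R_act_prod:
 assumes h: "h : car H" and x: "x : car R" and y: "y : car R"
 shows "act R h (x ** y) = tsum R (comult H h) (%h1 h2. act R h1 x ** act R h2 y)"
proof -
 have b: "bil H H R (%h1 h2. act R h1 x ** act R h2 y)" by ((assumption | rule Rl x y)+)
 show ?thesis
 by (rule functional_eqI[OF vs_R])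
 (simp_all add: R_act_closed RA.m_closed assms Hb.HH.tensor_sum_closed[OF vs_R b] Hb.comult_closed
 R_act_prod_sw Hb.HH.lin_tensor_sum[OF vs_R vsk b])
qed

lemma R_coact_prod:
 assumes x: "x : car R" and y: "y : car R"
 shows "de (x ** y) = tsum HR (de x) (%g x0. tsum HR (de y) (%g' y0.
 pt H R (g \<otimes>\<^bsub>H\<^esub> g') (x0 ** y0)))"
proof -
 have b1: "bil H R HR (%g' y0. pt H R (g \<otimes>\<^bsub>H\<^esub> g') (x0 ** y0))" if "g : car H" "x0 : car R" for g x0
 using that by - ((assumption | rule Rl)+)
 have b2: "bil H R HR (%g x0. tsum HR (de y) (%g' y0. pt H R (g \<otimes>\<^bsub>H\<^esub> g') (x0 ** y0)))"
 by ((assumption | rule Rl y)+)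
 show ?thesis
 proof (rule HR.tensor_functional_eqI)
 fix F :: "'h => 'r => 'k" assume F: "bil H R scalars F"
 show "sw (de (x ** y)) F = sw (tsum HR (de x) (%g x0. tsum HR (de y) (%g' y0.
 pt H R (g \<otimes>\<^bsub>H\<^esub> g') (x0 ** y0)))) F"
 unfolding R_coact_prod_sw[OF F x y] sw_tsum[OF R_coact_closed[OF x] b2 F Hb.vs_H vs_R Hb.vs_H vs_R]
 proof (rule sw_cong[OF Hb.vs_H vs_R R_coact_closed[OF x]])
 fix g x0 assume g: "g : car H" "x0 : car R"
 show "sw (de y) (%g' y0. F (g \<otimes>\<^bsub>H\<^esub> g') (x0 ** y0)) =
 sw (tsum HR (de y) (%g' y0. pt H R (g \<otimes>\<^bsub>H\<^esub> g') (x0 ** y0))) F"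
 unfolding sw_tsum[OF R_coact_closed[OF y] b1[OF g] F Hb.vs_H vs_R Hb.vs_H vs_R]
 by (rule sw_cong[OF Hb.vs_H vs_R R_coact_closed[OF y]])
 (simp add: HR.tensor_sum_pure[OF vsk F] g)
 qed
 qed (rule HR.tensor_sum_closed[OF HR.vs_tensor b2] | (assumption | rule Rl x y)+)+
qed

lemma R_comult_prod:
 assumes x: "x : car R" and y: "y : car R"
 shows "De (x ** y) = braided_mult R (De x) (De y)"
 by (rule RR.tensor_functional_eqI)
 (simp_all add: R_comult_closed braided_closed x y RA.m_closed R_comult_prod_sw braided_sw)

theorem yd_module_R: "yd_module H R"
proof unfold_locales
 fix x assume x: "x : car R"
 show "tsum (tensor H (tensor H R)) (coact R x) (%g y.
 tsum (tensor H (tensor H R)) (comult H g) (%g1 g2.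
 pt H (tensor H R) g1 (pt H R g2 y))) =
 tsum (tensor H (tensor H R)) (coact R x) (%g y.
 tsum (tensor H (tensor H R)) (coact R y) (%g' z.
 pt H (tensor H R) g (pt H R g' z)))"
 by (rule coassoc_swI[OF Hb.vs_H vs_R H.comult_linear R_coact x]) (rule bspec[OF R_coact_coassoc_sw x])
 have b: "bil H R R (%g y. counit H g \<odot>\<^bsub>R\<^esub> y)"
 by ((assumption | rule Rl lin_smult_left lin_smult_right)+)
 show "tsum R (coact R x) (%g y. counit H g \<odot>\<^bsub>R\<^esub> y) = x"
 proof (rule functional_eqI[OF vs_R HR.tensor_sum_closed[OF vs_R b R_coact_closed[OF x]] x])
 fix ph assume ph: "ph : lin R scalars"
 show "ph (tsum R (coact R x) (%g y. counit H g \<odot>\<^bsub>R\<^esub> y)) = ph x"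
 unfolding HR.lin_tensor_sum[OF vs_R vsk b ph R_coact_closed[OF x]]
 bspec[OF R_coact_counit_sw[OF ph] x, symmetric]
 by (rule sw_cong[OF Hb.vs_H vs_R R_coact_closed[OF x]]) (simp add: lin_smult[OF ph])
 qed
next
 fix h x assume h: "h : car H" and x: "x : car R"
 have b1: "bil H R HR (%g y. pt H R (h1 \<otimes>\<^bsub>H\<^esub> g) (act R h2 y))"
 and b2: "bil H R HR (%g y. pt H R (g \<otimes>\<^bsub>H\<^esub> h2) y)" if "h1 : car H" "h2 : car H" for h1 h2
 using that by - ((assumption | rule Rl)+)
 have b3: "bil H H HR (%h1 h2. tsum HR (de x) (%g y. pt H R (h1 \<otimes>\<^bsub>H\<^esub> g) (act R h2 y)))"
 and b4: "bil H H HR (%h1 h2. tsum HR (de (act R h1 x)) (%g y. pt H R (g \<otimes>\<^bsub>H\<^esub> h2) y))"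
 by ((assumption | rule Rl x)+)
 show "tsum HR (comult H h) (%h1 h2.
 tsum HR (coact R x) (%g y. pt H R (h1 \<otimes>\<^bsub>H\<^esub> g) (act R h2 y))) =
 tsum HR (comult H h) (%h1 h2.
 tsum HR (coact R (act R h1 x)) (%g y. pt H R (g \<otimes>\<^bsub>H\<^esub> h2) y))"
 proof (rule HR.tensor_functional_eqI)
 fix F :: "'h => 'r => 'k" assume F: "bil H R scalars F"
 note hc = Hb.comult_closed[OF h]
 have "sw (tsum HR (comult H h) (%h1 h2.
 tsum HR (coact R x) (%g y. pt H R (h1 \<otimes>\<^bsub>H\<^esub> g) (act R h2 y)))) F =
 sw (comult H h) (%h1 h2. sw (de x) (%g y. F (h1 \<otimes>\<^bsub>H\<^esub> g) (act R h2 y)))" (is "?x = _")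
 unfolding sw_tsum[OF hc b3 F Hb.vs_H Hb.vs_H Hb.vs_H vs_R]
 proof (rule sw_cong[OF Hb.vs_H Hb.vs_H hc])
 fix h1 h2 assume hh: "h1 : car H" "h2 : car H"
 show "sw (tsum HR (coact R x) (%g y. pt H R (h1 \<otimes>\<^bsub>H\<^esub> g) (act R h2 y))) F =
 sw (de x) (%g y. F (h1 \<otimes>\<^bsub>H\<^esub> g) (act R h2 y))"
 unfolding sw_tsum[OF R_coact_closed[OF x] b1[OF hh] F Hb.vs_H vs_R Hb.vs_H vs_R]
 by (rule sw_cong[OF Hb.vs_H vs_R R_coact_closed[OF x]])
 (simp add: HR.tensor_sum_pure[OF vsk F] hh R_act_closed)
 qed
 also have "... = sw (comult H h) (%h1 h2. sw (de (act R h1 x)) (%g y. F (g \<otimes>\<^bsub>H\<^esub> h2) y))"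
 by (rule R_compat_sw[OF F h x])
 also have "... = sw (tsum HR (comult H h) (%h1 h2.
 tsum HR (coact R (act R h1 x)) (%g y. pt H R (g \<otimes>\<^bsub>H\<^esub> h2) y))) F" (is "_ = ?y")
 unfolding sw_tsum[OF hc b4 F Hb.vs_H Hb.vs_H Hb.vs_H vs_R]
 proof (rule sw_cong[OF Hb.vs_H Hb.vs_H hc])
 fix h1 h2 assume hh: "h1 : car H" "h2 : car H"
 note c = R_coact_closed[OF R_act_closed[OF hh(1) x]]
 show "sw (de (act R h1 x)) (%g y. F (g \<otimes>\<^bsub>H\<^esub> h2) y) =
 sw (tsum HR (coact R (act R h1 x)) (%g y. pt H R (g \<otimes>\<^bsub>H\<^esub> h2) y)) F"
 unfolding sw_tsum[OF c b2[OF hh] F Hb.vs_H vs_R Hb.vs_H vs_R]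
 by (rule sw_cong[OF Hb.vs_H vs_R c]) (simp add: HR.tensor_sum_pure[OF vsk F] hh)
 qed
 finally show "?x = ?y" .
 qed (rule Hb.HH.tensor_sum_closed[OF HR.vs_tensor] b3 b4 Hb.comult_closed h)+
qed (rule R_act_left R_act_right R_act_one R_act_mult R_coact; assumption)+

lemma k_coalgebra_R: "k_coalgebra R De ep"
proof unfold_locales
 fix x assume x: "x : car R"
 show "tsum (tensor R (tensor R R)) (De x) (%a b.
 tsum (tensor R (tensor R R)) (De a) (%a1 a2.
 pt R (tensor R R) a1 (pt R R a2 b))) =
 tsum (tensor R (tensor R R)) (De x) (%a b.
 tsum (tensor R (tensor R R)) (De b) (%b1 b2.
 pt R (tensor R R) a (pt R R b1 b2)))"
 by (rule coassoc_swI[OF vs_R vs_R R_comult R_comult x]) (rule bspec[OF R_coassoc_sw x])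
 have b: "bil R R R (%a b. ep a \<odot>\<^bsub>R\<^esub> b)" "bil R R R (%a b. ep b \<odot>\<^bsub>R\<^esub> a)"
 by ((assumption | rule Rl lin_smult_left lin_smult_right)+)
 note D = R_comult_closed[OF x]
 show "tsum R (De x) (%a b. ep a \<odot>\<^bsub>R\<^esub> b) = x"
 proof (rule functional_eqI[OF vs_R RR.tensor_sum_closed[OF vs_R b(1) D] x])
 fix ph assume ph: "ph : lin R scalars"
 show "ph (tsum R (De x) (%a b. ep a \<odot>\<^bsub>R\<^esub> b)) = ph x"
 unfolding RR.lin_tensor_sum[OF vs_R vsk b(1) ph D] bspec[OF R_counit_sw(1)[OF ph] x, symmetric]
 by (rule sw_cong[OF vs_R vs_R D]) (simp add: lin_smult[OF ph])
 qed
 show "tsum R (De x) (%a b. ep b \<odot>\<^bsub>R\<^esub> a) = x"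
 proof (rule functional_eqI[OF vs_R RR.tensor_sum_closed[OF vs_R b(2) D] x])
 fix ph assume ph: "ph : lin R scalars"
 show "ph (tsum R (De x) (%a b. ep b \<odot>\<^bsub>R\<^esub> a)) = ph x"
 unfolding RR.lin_tensor_sum[OF vs_R vsk b(2) ph D] bspec[OF R_counit_sw(2)[OF ph] x, symmetric]
 by (rule sw_cong[OF vs_R vs_R D]) (simp add: lin_smult[OF ph])
 qed
qed (rule R_comult R_counit)+

lemma mult_hom_R: "(%X. tsum R X (%x y. x ** y)) : yd_hom H (yd_tensor H R R) R"
proof -
 let ?m = "%X. tsum R X (%x y. x ** y)"
 have mb: "bil R R R (%x y. x ** y)" by ((assumption | rule Rl)+)
 note ml = RR.tensor_sum_linear[OF vs_R mb]
 have m_sw: "ph (?m X) = sw X (%a b. ph (a ** b))" if "ph : lin R scalars" "X : car RR" for ph :: "'r => 'k" and X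
 by (rule RR.lin_tensor_sum[OF vs_R vsk mb that])
 have mc: "?m X : car R" if "X : car RR" for X by (rule lin_closed[OF ml that])
 have 1: "?m (act (yd_tensor H R R) h X) = act R h (?m X)" if h: "h : car H" and X: "X : car RR" for h X
 proof (rule functional_eqI[OF vs_R])
 fix ph assume ph: "ph : lin R scalars"
 note l = lin_comp[OF _ ph] lin_comp[OF _ ml]
 have b: "bil R R scalars (%a b. ph (a ** b))" by ((assumption | rule l Rl)+)
 have "ALL X:car RR. sw (comult H h) (%h1 h2. sw X (%x y. ph (act R h1 x ** act R h2 y))) = ph (act R h (?m X))"
 proof (rule RR_ball)
 show "(%X. sw (comult H h) (%h1 h2. sw X (%x y. ph (act R h1 x ** act R h2 y)))) : lin RR scalars"
 "(%X. ph (act R h (?m X))) : lin RR scalars"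
 by ((assumption | rule l(1) Rl h mb)+)
 fix x y assume x: "x : car R" and y: "y : car R"
 have "sw (comult H h) (%h1 h2. sw (pt R R x y) (%x y. ph (act R h1 x ** act R h2 y))) =
 sw (comult H h) (%h1 h2. ph (act R h1 x ** act R h2 y))"
 by (rule sw_cong[OF Hb.vs_H Hb.vs_H Hb.comult_closed[OF h]], rule sw_pure) ((assumption | rule l Rl x y)+)
 also have "... = ph (act R h (x ** y))" by (rule R_act_prod_sw[OF ph h x y, symmetric])
 finally show "sw (comult H h) (%h1 h2. sw (pt R R x y) (%x y. ph (act R h1 x ** act R h2 y))) =
 ph (act R h (?m (pt R R x y)))"
 by (simp add: RR.tensor_sum_pure[OF vs_R mb x y])
 qed
 thus "ph (?m (act (yd_tensor H R R) h X)) = ph (act R h (?m X))"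
 using X by (simp add: m_sw[OF ph] act2_sw[OF b h X] del: yd_tensor_simps)
 qed (rule mc act2_sw(1)[OF bil_ext2 h X] R_act_closed vs_R h X)+
 have 2: "coact R (?m X) = tsum HR (coact (yd_tensor H R R) X) (%g Y. pt H R g (?m Y))" if X: "X : car RR" for X
 proof -
 have b: "bil H RR HR (%g Y. pt H R g (?m Y))"
 by ((assumption | rule Rl mb mc)+)
 have v: "vs (tensor H RR)" by ((assumption | rule Rl)+)
 show ?thesis
 proof (rule HR.tensor_functional_eqI)
 fix F :: "'h => 'r => 'k" assume F: "bil H R scalars F"
 note l = lin_bil1[OF F] lin_bil2[OF F]
 have t: "tri H R R (%g a b. F g (a ** b))"
 unfolding tri_def by (intro conjI ballI; (assumption | rule l Rl)+)
 have "sw (coact R (?m X)) F = sw X (%a b. sw (de (a ** b)) F)" (is "?x = _")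
 by (rule m_sw[of "%z. sw (de z) F", OF _ X]) ((assumption | rule F Rl)+)
 also have "... = sw X (%x y. sw (de x) (%g x0. sw (de y) (%g' y0. F (g \<otimes>\<^bsub>H\<^esub> g') (x0 ** y0))))"
 by (rule sw_cong[OF vs_R vs_R X]) (rule R_coact_prod_sw[OF F])
 also have "... = sw (coact (yd_tensor H R R) X) (%g Y. sw Y (%a b. F g (a ** b)))"
 by (rule coact2_sw(2)[OF X t, symmetric])
 also have "... = sw (coact (yd_tensor H R R) X) (%g Y. F g (?m Y))"
 by (rule sw_cong[OF Hb.vs_H RR.vs_tensor coact2_sw(1)[OF X]]) (rule m_sw[symmetric, OF bil_right[OF F]])
 also have "... = sw (coact (yd_tensor H R R) X) (%g Y. sw (pt H R g (?m Y)) F)"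
 by (rule sw_cong[OF Hb.vs_H RR.vs_tensor coact2_sw(1)[OF X]]) (simp add: HR.tensor_sum_pure[OF vsk F] mc)
 also have "... = sw (tsum HR (coact (yd_tensor H R R) X) (%g Y. pt H R g (?m Y))) F" (is "_ = ?y")
 by (rule sw_tsum[OF coact2_sw(1)[OF X] b F Hb.vs_H RR.vs_tensor Hb.vs_H vs_R, symmetric])
 finally show "?x = ?y" .
 qed (rule vs2.tensor_sum_closed[OF vs2I] b coact2_sw(1)[OF X] R_coact_closed mc X Hb.vs_H RR.vs_tensor HR.vs_tensor)+
 qed
 show ?thesis
 unfolding yd_hom_def same_space(7)[OF same_yd_tensor] yd_tensor_simps(3) using ml 1 2 by blast
qed

lemma unit_hom_R: "(%c. c \<odot>\<^bsub>R\<^esub> (one R)) : yd_hom H (yd_unit H) R"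
proof -
 have l: "(%c. c \<odot>\<^bsub>R\<^esub> (one R)) : lin scalars R"
 by (rule lin_smult_left[OF vs_R lin_id RA.one_closed])
 have b: "bil H scalars HR (%g y. pt H R g (y \<odot>\<^bsub>R\<^esub> (one R)))"
 by ((assumption | rule lin_smult_left lin_closed[OF l] Rl)+)
 have 1: "(counit H h * c) \<odot>\<^bsub>R\<^esub> (one R) = act R h (c \<odot>\<^bsub>R\<^esub> (one R))" if h: "h : car H" for h c
 unfolding lin_smult[OF R_act_right[OF h] RA.one_closed] R_act_unit[OF h]
 by (subst RA.smult_assoc1[symmetric, simplified]) (simp_all add: mult.commute)
 have 2: "de (c \<odot>\<^bsub>R\<^esub> (one R)) = tsum HR (pt H scalars (one H) c) (%g y. pt H R g (y \<odot>\<^bsub>R\<^esub> (one R)))" for c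
 unfolding vs2.tensor_sum_pure[OF vs2I HR.vs_tensor b, OF Hb.vs_H vsk H.one_closed scalars_carrier]
 lin_smult[OF R_coact RA.one_closed] R_coact_one
 by (rule lin_smult[OF lin_pure2[OF Hb.vs_H vs_R H.one_closed lin_id] RA.one_closed, symmetric])
 show ?thesis
 unfolding yd_hom_def same_space(7)[OF same_yd_unit] using l 1 2 by simp
qed

lemma comult_hom_R: "De : yd_hom H R (yd_tensor H R R)"
proof -
 have 1: "De (act R h x) = act (yd_tensor H R R) h (De x)" if h: "h : car H" and x: "x : car R" for h x
 by (rule RR.tensor_functional_eqI)
 (simp_all add: R_comult_closed R_act_closed h x act2_sw act2_sw(1)[OF bil_ext2[OF vs_R vs_R]] R_comult_act_sw del: yd_tensor_simps)
 have b: "bil H R (tensor H RR) (%g y. pt H RR g (De y))" by ((assumption | rule Rl)+)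
 have v: "vs (tensor H RR)" by ((assumption | rule Rl)+)
 have 2: "coact (yd_tensor H R R) (De x) = tsum (tensor H RR) (de x) (%g y. pt H RR g (De y))" if x: "x : car R" for x
 proof (rule tri_functional_eqI[OF Hb.vs_H vs_R vs_R coact2_sw(1)[OF R_comult_closed[OF x]]
 HR.tensor_sum_closed[OF v b R_coact_closed[OF x]]])
 fix F assume F: "tri H R R F"
 note Ph = tri_functional[OF Hb.vs_H vs_R vs_R F]
 have g: "sw (pt H RR g Y) (%a Y. sw Y (F a)) = sw Y (F g)" if "g : car H" "Y : car RR" for g Y
 by (rule sw_pure) (rule lin_tsum_fun' bilI RR.tensor_sum_linear lin_id lin_tri1[OF F] tri_bil23[OF F] that vsk vs_R Hb.vs_H RR.vs_tensor | assumption)+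
 show "sw (coact (yd_tensor H R R) (De x)) (%a Z. sw Z (F a)) =
 sw (tsum (tensor H RR) (de x) (%g y. pt H RR g (De y))) (%a Z. sw Z (F a))"
 unfolding coact2_sw(2)[OF R_comult_closed[OF x] F] bspec[OF R_comult_coact_sw[OF F] x, symmetric]
 lin_tsum[OF R_coact_closed[OF x] Ph(1) b Hb.vs_H vs_R v vsk]
 by (rule sw_cong[OF Hb.vs_H vs_R R_coact_closed[OF x]]) (rule g[symmetric, OF _ R_comult_closed])
 qed
 show ?thesis
 unfolding yd_hom_def same_space(8)[OF same_yd_tensor] same_space(1,4)[OF same_yd_tensor] using R_comult 1 2 by blast
qed

lemma counit_hom_R: "ep : yd_hom H R (yd_unit H)"
proof -
 interpret HS: vs2 H "scalars :: ('k, 'k) module" by (rule vs2I[OF Hb.vs_H vsk])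
 have b: "bil H R (tensor H scalars) (%g y. pt H scalars g (ep y))"
 by ((assumption | rule Rl scalars_carrier)+)
 have 2: "pt H scalars (one H) (ep x) = tsum (tensor H scalars) (de x) (%g y. pt H scalars g (ep y))"
 if x: "x : car R" for x
 proof (rule HS.tensor_functional_eqI)
 fix F :: "'h => 'k => 'k" assume F: "bil H scalars scalars F"
 have e: "F g c = c * F g 1" if "g : car H" for g c
 using lin_smult[OF bil_right[OF F that], of 1 c] by simp
 have "sw (de x) (%g y. ep y * F g 1) = F (one H) (ep x)"
 by (subst e) (simp_all add: bspec[OF R_counit_coact_sw x] bil_left[OF F])
 moreover have "sw (de x) (%g y. sw (pt H scalars g (ep y)) F) = sw (de x) (%g y. ep y * F g 1)"
 by (rule sw_cong[OF Hb.vs_H vs_R R_coact_closed[OF x]])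
 (simp add: HS.tensor_sum_pure[OF vsk F] e[symmetric])
 ultimately show "sw (pt H scalars (one H) (ep x)) F =
 sw (tsum (tensor H scalars) (de x) (%g y. pt H scalars g (ep y))) F"
 by (simp add: HS.tensor_sum_pure[OF vsk F] sw_tsum[OF R_coact_closed[OF x] b F Hb.vs_H vs_R Hb.vs_H vsk])
 qed (simp_all add: HS.pure_closed HR.tensor_sum_closed[OF HS.vs_tensor b R_coact_closed[OF x]])
 show ?thesis
 unfolding yd_hom_def same_space(8)[OF same_yd_unit] same_space(1,4)[OF same_yd_unit] yd_unit_simps
 using R_counit R_counit_act 2 by blast
qed

theorem yd_bialgebra_R: "yd_bialgebra H R"
proof (intro yd_bialgebra.intro yd_bialgebra_axioms.intro)
 show "yd_module H R" "k_algebra R" "k_coalgebra R De ep"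
 by (rule yd_module_R k_coalgebra_R RA.k_algebra_axioms)+
qed (rule mult_hom_R unit_hom_R comult_hom_R counit_hom_R R_comult_prod R_comult_one R_counit_mult R_counit_one; assumption?)+

end

section \<open>Quotient algebras and the tensor algebra\<close>

lemma vs_same:
 assumes "same_space V V'" "vs V'"
 shows "vs V"
proof -
 interpret V': vspace V' using assms(2) by (rule vspaceI)
 have e: "car V = car V'" "add V = add V'" "zero V = zero V'" "smult V = smult V'"
 using assms(1) by (simp_all add: same_space_def)
 show ?thesis
 proof (rule moduleI[OF cring_scalars])
 show "abelian_group V"
 proof (rule abelian_groupI)
 show "EX y:car V. y \<oplus>\<^bsub>V\<^esub> x = (zero V)" if "x : car V" for x
 using that by (intro bexI[of _ "\<ominus>\<^bsub>V'\<^esub> x"]) (simp_all add: e V'.M.l_neg)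
 qed (simp_all add: e V'.M.a_ac)
 qed (simp_all add: e V'.smult_l_distr[simplified] V'.smult_r_distr V'.smult_assoc1[simplified] V'.smult_one[simplified])
qed

lemma submodule_same:
 assumes "same_space V V'" "vs V'"
 shows "submodule N scalars V = submodule N scalars V'"
 using assms(1) unfolding vs_subspace_iff[OF assms(2)] vs_subspace_iff[OF vs_same[OF assms]]
 by (simp add: same_space_def)

lemma vspan_same: "same_space V V' ==> vs V' ==> vspan V S = vspan V' S"
 by (simp add: vspan_def submodule_same)

section \<open>Quotients of algebras by two-sided ideals\<close>

locale alg_ideal = k_algebra A for A :: "('k::field, 'a, 'm) module_scheme" (structure) +
 fixes I
 assumes sub: "submodule I scalars A"
 and I_left: "x : I ==> a : car A ==> a \<otimes> x : I"
 and I_right: "x : I ==> a : car A ==> x \<otimes> a : I"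
begin

abbreviation "Q \<equiv> factor_space A I"
abbreviation "cl x \<equiv> I +> x"

lemma vs_A: "vs A" by unfold_locales

lemma vs_Q: "vs Q" by (rule vs_factor_space[OF vs_A sub])

lemma cl_linear: "(%x. cl x) : lin A Q" by (rule proj_linear[OF vs_A sub])

lemma cl_closed: "x : car A ==> cl x : car Q" by (rule lin_closed[OF cl_linear])

lemma cl_mult:
 assumes "x : car A" "y : car A" shows "cl x \<otimes>\<^bsub>Q\<^esub> cl y = cl (x \<otimes> y)"
proof -
 interpret ideal I A
 by (rule idealI[OF ring_axioms]) (use sub in \<open>auto simp: submodule_def I_left I_right\<close>)
 show ?thesis using rcoset_mult_add[OF assms] by simp
qed

lemma cl_add: "x : car A ==> y : car A ==> cl x \<oplus>\<^bsub>Q\<^esub> cl y = cl (x \<oplus> y)"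
 and cl_smult: "x : car A ==> c \<odot>\<^bsub>Q\<^esub> cl x = cl (c \<odot> x)"
 by (simp_all add: lin_add[OF cl_linear] lin_smult[OF cl_linear])

lemma k_algebra_Q: "k_algebra Q"
proof -
 interpret Q: vspace Q using vs_Q by (rule vspaceI)
 have m: "monoid Q"
 by (rule monoidI) (auto simp: carrier_factor_space cl_mult m_assoc simp del: factor_space_simps(3))
 have "ring Q"
 by (rule ringI[OF Q.M.abelian_group_axioms m])
 (auto simp: carrier_factor_space cl_mult cl_add l_distr r_distr simp del: factor_space_simps(3))
 thus ?thesis
 by (intro k_algebra.intro vs_Q k_algebra_axioms.intro)
 (auto simp: carrier_factor_space cl_mult cl_smult smult_mult_left smult_mult_right simp del: factor_space_simps(3))
qed

end

section \<open>The tensor algebra as a quotient of the word algebra\<close>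

locale tensor_words =
 fixes M :: "('k::field, 'a, 'n) module_scheme"
 assumes vsM: "vs M"
begin

abbreviation "LC \<equiv> lists (car M)"
abbreviation "W \<equiv> word_algebra M"
abbreviation "FW \<equiv> free_space LC :: ('k, 'a list \<Rightarrow>\<^sub>0 'k) module"
abbreviation "rel \<equiv> word_relations M"
abbreviation "T \<equiv> tensor_alg M"
abbreviation "cw \<equiv> word_class M"

lemma same_W: "same_space W FW" by (simp add: same_space_def word_algebra_def)

lemma W_simps [simp]: "car W = {f. ks f <= LC}" "zero W = 0" "add W = (+)" "smult W = cmul" "one W = sg [] 1"
 by (simp_all add: word_algebra_def)

lemma vs_W: "vs W" by (rule vs_same[OF same_W vs_free_space])

lemma ev_W_mult: "ev (f \<otimes>\<^bsub>W\<^esub> g) h = ev f (%u. ev g (%v. h (u @ v)))"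
proof -
 have "ev (f \<otimes>\<^bsub>W\<^esub> g) h = (\<Sum>u\<in>ks f. \<Sum>v\<in>ks g. lk f u * lk g v * h (u @ v))"
 by (simp add: word_algebra_def)
 also have "... = ev f (%u. ev g (%v. h (u @ v)))"
 by (simp add: ev_def sum_distrib_left mult.assoc)
 finally show ?thesis .
qed

lemma W_mult_closed: "f : car W ==> g : car W ==> f \<otimes>\<^bsub>W\<^esub> g : car W"
proof -
 assume "f : car W" "g : car W"
 hence "u @ v : LC" if "u : ks f" "v : ks g" for u v using that by auto
 moreover have "f \<otimes>\<^bsub>W\<^esub> g = (\<Sum>u\<in>ks f. \<Sum>v\<in>ks g. sg (u @ v) (lk f u * lk g v))" by (simp add: word_algebra_def)
 ultimately show ?thesis by (simp only: W_simps mem_Collect_eq) (intro keys_sum_subset keys_sg_subset)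
qed

lemma k_algebra_W: "k_algebra W"
proof -
 interpret W: vspace W using vs_W by (rule vspaceI)
 have m: "monoid W"
 proof (rule monoidI)
 show "(one W) : car W" by simp
 qed (rule W_mult_closed; assumption | rule ev_eqI, simp add: ev_W_mult ev_fun_mult_left)+
 have "ring W"
 by (rule ringI[OF W.M.abelian_group_axioms m]) (rule ev_eqI, simp add: ev_W_mult ev_fun_plus)+
 thus ?thesis
 by (intro k_algebra.intro vs_W k_algebra_axioms.intro) (assumption | rule ev_eqI, simp add: ev_W_mult ev_fun_mult_left)+
qed

definition word_gens :: "('a list \<Rightarrow>\<^sub>0 'k) set" where
 "word_gens = ({Poly_Mapping.single (u @ (x \<oplus>\<^bsub>M\<^esub> y) # v) 1 - Poly_Mapping.single (u @ x # v) 1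
 - Poly_Mapping.single (u @ y # v) 1 | u x y v.
 u : lists (car M) & v : lists (car M) & x : car M & y : car M}
 \<union> {Poly_Mapping.single (u @ (c \<odot>\<^bsub>M\<^esub> x) # v) 1 - Poly_Mapping.single (u @ x # v) c | c u x v.
 u : lists (car M) & v : lists (car M) & x : car M})"

lemma rel_gens: "rel = vspan W word_gens" by (simp add: word_relations_def word_gens_def)

lemma word_gens_add: "u : LC ==> v : LC ==> x : car M ==> y : car M ==>
 sg (u @ (x \<oplus>\<^bsub>M\<^esub> y) # v) 1 - sg (u @ x # v) 1 - sg (u @ y # v) 1 : word_gens"
 and word_gens_smult: "u : LC ==> v : LC ==> x : car M ==>
 sg (u @ (c \<odot>\<^bsub>M\<^esub> x) # v) 1 - sg (u @ x # v) c : word_gens"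
 unfolding word_gens_def by blast+

lemma word_gens_carrier: "word_gens <= car W"
proof
 interpret vspace M using vsM by (rule vspaceI)
 fix z assume "z : word_gens"
 thus "z : car W" unfolding word_gens_def
 by (elim UnE CollectE exE conjE) (simp_all only: W_simps mem_Collect_eq,
 (intro keys_diff_subset keys_sg_subset; simp add: smult_closed[simplified])+)
qed

lemma rel_sub: "submodule rel scalars W"
 unfolding rel_gens by (rule vspan_submodule(1)[OF vs_W word_gens_carrier])

lemma gens_rel: "word_gens <= rel"
 unfolding rel_gens by (rule vspan_submodule(2)[OF vs_W word_gens_carrier])

lemma W_span: "g : car W ==> g : vspan W ((%x. sg x 1) ` LC)"
 unfolding vspan_same[OF same_W vs_free_space] by (rule free_space_span) simp

lemma W_mult_lin: "a : car W ==> (%x. x \<otimes>\<^bsub>W\<^esub> a) : lin W W"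
 "a : car W ==> (%x. a \<otimes>\<^bsub>W\<^esub> x) : lin W W"
proof -
 interpret k_algebra W by (rule k_algebra_W)
 show "a : car W ==> (%x. x \<otimes>\<^bsub>W\<^esub> a) : lin W W" "a : car W ==> (%x. a \<otimes>\<^bsub>W\<^esub> x) : lin W W"
 by (rule linI, rule m_closed, assumption+, rule l_distr r_distr, assumption+, rule smult_mult_left smult_mult_right, assumption+)+
qed

lemma sg_mult: "sg u c \<otimes>\<^bsub>W\<^esub> sg v d = sg (u @ v) (c * d)"
 by (rule ev_eqI) (simp add: ev_W_mult)

lemma W_mult_diff: "(f - g) \<otimes>\<^bsub>W\<^esub> h = f \<otimes>\<^bsub>W\<^esub> h - g \<otimes>\<^bsub>W\<^esub> h" "h \<otimes>\<^bsub>W\<^esub> (f - g) = h \<otimes>\<^bsub>W\<^esub> f - h \<otimes>\<^bsub>W\<^esub> g"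
proof -
 have *: "ev h (%u. ev f (%v. k (u @ v)) - ev g (%v. k (u @ v))) = ev h (%u. ev f (%v. k (u @ v))) - ev h (%u. ev g (%v. k (u @ v)))" for k
 by (simp add: ev_def right_diff_distrib sum_subtractf)
 show "(f - g) \<otimes>\<^bsub>W\<^esub> h = f \<otimes>\<^bsub>W\<^esub> h - g \<otimes>\<^bsub>W\<^esub> h" "h \<otimes>\<^bsub>W\<^esub> (f - g) = h \<otimes>\<^bsub>W\<^esub> f - h \<otimes>\<^bsub>W\<^esub> g"
 by (rule ev_eqI, simp add: ev_W_mult *)+
qed

text \<open>A word times a generating relation is again a generating relation, the word being
  absorbed into the surrounding \<open>u\<close> or \<open>v\<close>. Spanning extends this over all
  relations and then over all elements of the word algebra.\<close>

lemma rel_mult: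
 assumes z: "z : rel" and a: "a : car W"
 shows "a \<otimes>\<^bsub>W\<^esub> z : rel" "z \<otimes>\<^bsub>W\<^esub> a : rel"
proof -
 have sgW: "sg w 1 : car W" if "w : LC" for w using that by simp
 have zW: "z : car W" using submodule_subset[OF vs_W rel_sub] z by blast
 have sgsub: "(%x. sg x (1 :: 'k)) ` LC <= car W" by auto
 have 1: "sg w 1 \<otimes>\<^bsub>W\<^esub> z : rel" if w: "w : LC" for w
 proof (rule vspan_image[OF vs_W vs_W W_mult_lin(2)[OF sgW[OF w]] rel_sub word_gens_carrier _ z[unfolded rel_gens]])
 fix x assume "x : word_gens"
 thus "sg w 1 \<otimes>\<^bsub>W\<^esub> x : rel"
 unfolding word_gens_def by (elim UnE CollectE exE conjE; simp only: sg_mult W_mult_diff mult_1_left append_assoc[symmetric];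
 intro subsetD[OF gens_rel] word_gens_add word_gens_smult; (assumption | simp add: w))
 qed
 show "a \<otimes>\<^bsub>W\<^esub> z : rel"
 by (rule vspan_image[OF vs_W vs_W W_mult_lin(1)[OF zW] rel_sub sgsub _ W_span[OF a]]) (use 1 in auto)
 have 2: "z \<otimes>\<^bsub>W\<^esub> sg w 1 : rel" if w: "w : LC" for w
 proof (rule vspan_image[OF vs_W vs_W W_mult_lin(1)[OF sgW[OF w]] rel_sub word_gens_carrier _ z[unfolded rel_gens]])
 fix x assume "x : word_gens"
 thus "x \<otimes>\<^bsub>W\<^esub> sg w 1 : rel"
 unfolding word_gens_def by (elim UnE CollectE exE conjE; simp only: sg_mult W_mult_diff mult_1_right append_assoc append_Cons;
 intro subsetD[OF gens_rel] word_gens_add word_gens_smult; (assumption | simp add: w))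
 qed
 show "z \<otimes>\<^bsub>W\<^esub> a : rel"
 by (rule vspan_image[OF vs_W vs_W W_mult_lin(2)[OF zW] rel_sub sgsub _ W_span[OF a]]) (use 2 in auto)
qed

sublocale WI: alg_ideal W rel
 by (intro alg_ideal.intro alg_ideal_axioms.intro k_algebra_W rel_sub rel_mult)

sublocale TA: k_algebra T
 unfolding tensor_alg_def by (rule WI.k_algebra_Q)

lemma vs_T: "vs T" by (rule TA.module_axioms)

lemma cw_closed: "w : LC ==> cw w : car T"
 unfolding word_class_def tensor_alg_def by (rule WI.cl_closed) simp

lemma cw_append: "u : LC ==> v : LC ==> cw u \<otimes>\<^bsub>T\<^esub> cw v = cw (u @ v)"
 unfolding word_class_def tensor_alg_def by (subst WI.cl_mult) (simp_all add: sg_mult)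

lemma cw_Nil: "(one T) = cw []"
 by (simp add: word_class_def tensor_alg_def)

lemma cw_linear: "u : LC ==> v : LC ==> (%x. cw (u @ x # v)) : lin M T"
proof (rule linI)
 interpret vspace M using vsM by (rule vspaceI)
 assume u: "u : LC" and v: "v : LC"
 fix x y c assume x: "x : car M"
 show "cw (u @ x # v) : car T" using u v x by (simp add: cw_closed)
 have eq: "rel +>\<^bsub>W\<^esub> a = rel +>\<^bsub>W\<^esub> b" if "a - b : rel" "a : car W" "b : car W" for a b
 proof -
 have "a \<ominus>\<^bsub>W\<^esub> b = a - b"
 unfolding a_minus_def vs_minus[OF vs_W that(3)] by (rule ev_eqI) simp
 thus ?thesis using coset_eq_iff[OF vs_W rel_sub that(2,3)] that(1) by simp
 qed
 have c: "sg (u @ z # v) d : car W" if "z : car M" for z and d :: 'k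
 using that u v keys_sg_subset[of "u @ z # v" LC d] by simp
 {
 assume y: "y : car M"
 have "cw (u @ (x \<oplus>\<^bsub>M\<^esub> y) # v) = rel +>\<^bsub>W\<^esub> (sg (u @ x # v) 1 + sg (u @ y # v) 1)" (is "?x = _")
 unfolding word_class_def using c[of _ 1] x y keys_add_subset subsetD[OF gens_rel word_gens_add[OF u v x y]]
 by (intro eq) (simp_all add: diff_diff_eq keys_add_subset)
 also have "... = cw (u @ x # v) \<oplus>\<^bsub>T\<^esub> cw (u @ y # v)" (is "_ = ?y")
 unfolding word_class_def tensor_alg_def using WI.cl_add[OF c[OF x, of 1] c[OF y, of 1]] by simp
 finally show "?x = ?y" .
 }
 have "cw (u @ (c \<odot>\<^bsub>M\<^esub> x) # v) = rel +>\<^bsub>W\<^esub> sg (u @ x # v) c" (is "?x = _")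
 unfolding word_class_def
 by (rule eq[OF subsetD[OF gens_rel word_gens_smult[OF u v x]] c[OF smult_closed[OF scalars_carrier x]] c[OF x]])
 also have "... = c \<odot>\<^bsub>T\<^esub> cw (u @ x # v)" (is "_ = ?y")
 unfolding word_class_def tensor_alg_def using WI.cl_smult[OF c[OF x, of 1], of c] by simp
 finally show "?x = ?y" .
qed


text \<open>Linearity in each letter with the others fixed: the condition under which a function on
  words descends to T(M), as \<open>class_sum_linear\<close> shows.\<close>

definition mlin :: "('k, 'z, 'p) module_scheme => ('a list => 'z) => bool" where
 "mlin N f \<longleftrightarrow> (ALL w:LC. f w : car N) & (ALL u:LC. ALL v:LC. (%x. f (u @ x # v)) : lin M N)"

lemma mlinD: "mlin N f ==> w : LC ==> f w : car N"
 "mlin N f ==> u : LC ==> v : LC ==> (%x. f (u @ x # v)) : lin M N"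
 by (simp_all add: mlin_def)

lemma mlin_comp:
 assumes "mlin N f" "ph : lin N P" shows "mlin P (%w. ph (f w))"
 unfolding mlin_def
 by (intro conjI ballI lin_closed[OF assms(2) mlinD(1)[OF assms(1)]] lin_comp[OF mlinD(2)[OF assms(1)] assms(2)])

lemma rel_kill:
 assumes "mlin scalars h" "z : rel" shows "ev z h = 0"
proof -
 have "ev z h : {0}"
 proof (rule vspan_image[OF vs_W vsk _ _ word_gens_carrier _ assms(2)[unfolded rel_gens]])
 show "submodule {0} scalars scalars" using submodule_zero[OF vsk] by simp
 show "(%z. ev z h) : lin W scalars"
 unfolding same_space(7)[OF same_W] by (rule lin_ev)
 fix g assume "g : word_gens"
 thus "ev g h : {0}" unfolding word_gens_def
 by (elim UnE CollectE exE conjE)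
 (simp_all add: lin_add[OF mlinD(2)[OF assms(1)]] lin_smult[OF mlinD(2)[OF assms(1)]] del: in_lists_conv_set)
 qed
 thus ?thesis by simp
qed

text \<open>As for Sweedler sums, the relations are killed after every functional by the scalar case
  \<open>rel_kill\<close>, and functionals separate the points of \<open>N\<close>.\<close>

lemma
 assumes "vs N" "mlin N f"
 shows class_sum_linear: "(%X. class_sum N X f) : lin T N"
 and class_sum_word: "w : LC ==> class_sum N (cw w) f = f w"
proof -
 interpret N: vspace N using assms(1) by (rule vspaceI)
 have fN: "f : LC \<rightarrow> car N" using mlinD(1)[OF assms(2)] by auto
 have l: "lift N f : lin W N"
 unfolding same_space(7)[OF same_W] by (rule lift_linear[OF assms(1) fN])
 have kill: "lift N f z = (zero N)" if z: "z : rel" for z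
 proof (rule functional_eqI[OF assms(1)])
 have zW: "z : car W" using submodule_subset[OF vs_W rel_sub] z by blast
 show "lift N f z : car N" by (rule lin_closed[OF l zW])
 show "(zero N) : car N" by (rule N.M.zero_closed)
 fix ph assume ph: "ph : lin N scalars"
 have "ph (lift N f z) = ev z (%w. ph (f w))"
 by (rule lin_lift_scalars[OF assms(1) ph]) (use fN zW in auto)
 also have "... = 0" by (rule rel_kill[OF mlin_comp[OF assms(2) ph] z])
 finally show "ph (lift N f z) = ph (zero N)" using lin_zero[OF assms(1) vsk ph] by simp
 qed
 show "(%X. class_sum N X f) : lin T N"
 unfolding class_sum_lift tensor_alg_def by (rule factor_lift_linear[OF vs_W rel_sub assms(1) l kill])
 assume w: "w : LC"
 have "class_sum N (cw w) f = lift N f (sg w 1)"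
 unfolding class_sum_lift word_class_def by (rule coset_the_elem[OF vs_W rel_sub assms(1) l kill]) (use w in simp_all)
 also have "... = f w"
 using mlinD(1)[OF assms(2) w] N.smult_one by (simp add: lift_single[OF assms(1)])
 finally show "class_sum N (cw w) f = f w" .
qed

lemma T_span: "X : car T ==> X : vspan T (cw ` LC)"
proof -
 assume "X : car T"
 then obtain g where g: "g : car W" "X = rel +>\<^bsub>W\<^esub> g" by (auto simp: tensor_alg_def carrier_factor_space)
 have s: "cw ` LC <= car T" using cw_closed by blast
 show ?thesis unfolding g(2)
 proof (rule vspan_image[OF vs_W vs_T _ vspan_submodule(1)[OF vs_T s] _ _ W_span[OF g(1)]])
 show "(%x. rel +>\<^bsub>W\<^esub> x) : lin W T" unfolding tensor_alg_def by (rule WI.cl_linear)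
 show "(%x. sg x (1 :: 'k)) ` LC <= car W" by auto
 fix x :: "'a list \<Rightarrow>\<^sub>0 'k" assume "x : (%x. sg x 1) ` LC"
 thus "rel +>\<^bsub>W\<^esub> x : vspan T (cw ` LC)"
 using vspan_submodule(2)[OF vs_T s] by (auto simp: word_class_def)
 qed
qed

text \<open>Letters are reduced to basis letters one by one. In the auxiliary claim the prefix
  \<open>u\<close> already consists of basis letters and the suffix \<open>v\<close> is arbitrary;
  the induction moves the first letter of the suffix into the prefix.\<close>

lemma T_ext:
 assumes "vs N" "f : lin T N" "g : lin T N"
 and "!!w. w : lists (basis M) ==> f (cw w) = g (cw w)" and "X : car T"
 shows "f X = g X"
proof -
 have BL: "u : LC" if "u : lists (basis M)" for u
 using lists_mono[of "basis M" "car M"] basis_carrier[OF vsM] that by blast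
 have "ALL u:lists (basis M). f (cw (u @ v)) = g (cw (u @ v))" if "v : LC" for v
 using that
 proof (induction v)
 case Nil thus ?case using assms(4) by simp
 next
 case (Cons x v)
 show ?case
 proof
 fix u assume u: "u : lists (basis M)"
 note l = cw_linear[OF BL[OF u] Cons.hyps(2)]
 show "f (cw (u @ x # v)) = g (cw (u @ x # v))"
 proof (rule basis_ext[OF vsM assms(1) lin_comp[OF l assms(2)] lin_comp[OF l assms(3)] _ Cons.hyps(1)])
 fix b assume "b : basis M"
 hence "u @ [b] : lists (basis M)" using u by simp
 thus "f (cw (u @ b # v)) = g (cw (u @ b # v))"
 using bspec[OF Cons.IH, of "u @ [b]"] by (simp only: append_assoc append_Cons append_Nil)
 qed
 qed
 qed
 hence "f (cw v) = g (cw v)" if "v : LC" for v using that by (metis append_Nil lists.Nil)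
 thus ?thesis
 using vspan_ext[OF vs_T assms(1-3) _ _ T_span[OF assms(5)]] cw_closed by blast
qed

end

lemma k_algebra_same:
 assumes "same_space A A'" "mult A = mult A'" "one A = one A'" "k_algebra A'"
 shows "k_algebra A"
proof -
 interpret A': k_algebra A' by (rule assms(4))
 have v: "vs A" by (rule vs_same[OF assms(1) A'.module_axioms])
 interpret A: vspace A using v by (rule vspaceI)
 have e: "car A = car A'" "add A = add A'" "zero A = zero A'" "smult A = smult A'"
 using assms(1) by (simp_all add: same_space_def)
 have "monoid A" by (rule monoidI) (simp_all add: e assms(2,3) A'.m_assoc)
 hence "ring A"
 by (intro ringI A.M.abelian_group_axioms) (simp_all add: e assms(2) A'.l_distr A'.r_distr)
 thus ?thesis
 by (intro k_algebra.intro v k_algebra_axioms.intro)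
 (simp_all add: e assms(2) A'.smult_mult_left A'.smult_mult_right)
qed

context op_space
begin

lemma lin_braided1: "f : lin N RR ==> Y : car RR ==> (%z. braided_mult R (f z) Y) : lin N RR"
 unfolding braided_mult_def by (rule lin_tsum_arg'[OF _ braided_bil(3) vs_R vs_R RR.vs_tensor])

lemma lin_braided2: "f : lin N RR ==> X : car RR ==> vs N ==> (%z. braided_mult R X (f z)) : lin N RR"
 unfolding braided_mult_def
 by (rule lin_tsum_fun'[OF _ braided_bil(3)]) (assumption | rule lin_closed lin_tsum_arg' braided_bil(2) vs_R RR.vs_tensor)+

end

section \<open>Action, coaction and coproduct of the tensor algebra on words\<close>

locale yd_words = yd_bij H M
 for H :: "('k::field, 'h, 'm) hopf_scheme" and M :: "('k, 'a, 'h, 'n) yd_scheme"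
begin

sublocale TW: tensor_words M
 by (rule tensor_words.intro) (rule vs_M)

sublocale Y: yd_coord "basis H" "cmu H" "cun H" "cD H" "ce H" "cSi H" "basis M" "cA H M" "cC H M"
 by (rule yd_coord)

sublocale YT: ybi_coord "basis H" "cmu H" "cun H" "cD H" "ce H" "cSi H" "lists (basis M)" "%h w. Y.aT w h"
 Y.cT "(@)" "[]" Y.dT Y.eT
 by (rule Y.ybi_coord_T)

abbreviation "LC \<equiv> lists (car M)"
abbreviation "LB \<equiv> lists (basis M)"
abbreviation "T \<equiv> tensor_alg M"
abbreviation "TY \<equiv> tensor_alg_yd H M"
abbreviation "TB \<equiv> tensor_algebra H M"
abbreviation "TT \<equiv> tensor T T"
abbreviation "HT \<equiv> tensor H T"
abbreviation "cw \<equiv> word_class M"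
abbreviation "wa \<equiv> word_act H M"
abbreviation "wc \<equiv> word_coact H M"
abbreviation "wd \<equiv> word_comult H M"

lemma LB_LC: "w : LB ==> w : LC"
 using lists_mono[of "basis M" "car M"] BM_carrier by blast

lemma same_TY: "same_space TY T" and same_TB: "same_space TB T"
 by (simp_all add: same_space_def tensor_alg_yd_def tensor_algebra_def module.defs yd.defs yd_bialg.defs)

lemma T_ops [simp]: "mult TY = mult T" "one TY = one T" "mult TB = mult T" "one TB = one T"
 "act TY h X = class_sum T X (%w. wa w h)" "coact TY X = class_sum HT X wc" "act TB = act TY" "coact TB = coact TY"
 "br_comult TB X = class_sum TT X wd" "br_counit TB X = class_sum scalars X (%w. if w = [] then 1 else 0)"
 "car TB = car T" "car TY = car T"
 by (simp_all add: tensor_alg_yd_def tensor_algebra_def module.defs yd.defs yd_bialg.defs)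

lemmas STY = same_space(1-8)[OF same_TY]
lemmas STB = same_space(1-8)[OF same_TB]

lemma vs_T: "vs T" by (rule TW.vs_T)

sublocale HT: vs2 H T by (rule vs2I[OF Hb.vs_H vs_T])
sublocale TT: vs2 T T by (rule vs2I[OF vs_T vs_T])

lemma lin_cw: "f : lin N M ==> v : LC ==> (%z. cw (f z # v)) : lin N T"
 by (rule lin_comp[OF _ TW.cw_linear[of "[]", simplified append_Nil]]) simp_all

lemma lin_T_multl: "f : lin N T ==> y : car T ==> (%z. f z \<otimes>\<^bsub>T\<^esub> y) : lin N T"
 by (rule linI) (simp_all add: lin_closed lin_add lin_smult TW.TA.l_distr TW.TA.smult_mult_left)

lemma lin_T_multr: "f : lin N T ==> y : car T ==> (%z. y \<otimes>\<^bsub>T\<^esub> f z) : lin N T"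
 by (rule linI) (simp_all add: lin_closed lin_add lin_smult TW.TA.r_distr TW.TA.smult_mult_right)

lemmas Tl = bilI lin_id lin_cw lin_pure1 lin_pure2 lin_act1 lin_act2 lin_coact lin_T_multl lin_T_multr
 Hb.lin_multl Hb.lin_multr Hb.lin_comult Hb.lin_counit lin_tsum_arg' lin_tsum_fun' lin_smult_left
 vs_T vs_M Hb.vs_H vsk HT.vs_tensor TT.vs_tensor TW.cw_closed TW.TA.m_closed TW.TA.one_closed
 H.m_closed H.one_closed Hb.comult_closed HT.pure_closed TT.pure_closed act_closed coact_closed
 lists.Nil lists.Cons Hb.BH_carrier BM_carrier

lemma wa_left: assumes "w : LC" shows "(%h. wa w h) : lin H T"
 using assms
proof (induction w)
 case Nil show ?case unfolding word_act.simps by ((assumption | rule Tl)+)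
next
 case (Cons x w)
 show ?case unfolding word_act.simps
 by ((assumption | rule Cons.IH Cons.hyps lin_closed[OF Cons.IH] Tl)+)
qed

lemma wa_closed: "w : LC ==> h : car H ==> wa w h : car T"
 by (rule lin_closed[OF wa_left])

lemma wa_letter:
 assumes "u : LC" "v : LC" "h : car H" shows "(%x. wa (u @ x # v) h) : lin M T"
 using assms
proof (induction u arbitrary: h)
 case Nil
 thus ?case unfolding append_Nil word_act.simps
 by - ((assumption | rule wa_left wa_closed Tl)+)
next
 case (Cons a u)
 have uv: "u @ x # v : LC" if "x : car M" for x using Cons.hyps Cons.prems that by simp
 show ?case unfolding append_Cons word_act.simps
 by ((assumption | rule Cons.IH Cons.prems Cons.hyps wa_left wa_closed uv Tl)+)
qed

lemma mlin_wa: "h : car H ==> TW.mlin T (%w. wa w h)"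
 unfolding TW.mlin_def by (intro conjI ballI wa_closed wa_letter)

lemma wc_closed: assumes "w : LC" shows "wc w : car HT"
 using assms
proof (induction w)
 case Nil show ?case unfolding word_coact.simps by ((assumption | rule Tl)+)
next
 case (Cons x w)
 show ?case unfolding word_coact.simps
 by ((assumption | rule HM.tensor_sum_closed Cons.IH Cons.hyps Tl)+)
qed

lemma wc_letter: assumes "u : LC" "v : LC" shows "(%x. wc (u @ x # v)) : lin M HT"
 using assms
proof (induction u)
 case Nil
 show ?case unfolding append_Nil word_coact.simps
 by ((assumption | rule wc_closed Nil.prems Tl)+)
next
 case (Cons a u)
 have uv: "u @ x # v : LC" if "x : car M" for x using Cons.hyps Cons.prems that by simp
 show ?case unfolding append_Cons word_coact.simps
 by ((assumption | rule Cons.IH Cons.prems Cons.hyps wc_closed uv Tl)+)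
qed

lemma mlin_wc: "TW.mlin HT wc"
 unfolding TW.mlin_def by (intro conjI ballI wc_closed wc_letter)

lemma act_T_right: "h : car H ==> act TY h : lin T T"
 unfolding T_ops[abs_def] by (rule TW.class_sum_linear[OF vs_T mlin_wa])

lemma coact_T: "coact TY : lin T HT"
 unfolding T_ops[abs_def] by (rule TW.class_sum_linear[OF HT.vs_tensor mlin_wc])

lemma act_T_word: "h : car H ==> w : LC ==> act TY h (cw w) = wa w h"
 unfolding T_ops by (rule TW.class_sum_word[OF vs_T mlin_wa])

lemma coact_T_word: "w : LC ==> coact TY (cw w) = wc w"
 unfolding T_ops by (rule TW.class_sum_word[OF HT.vs_tensor mlin_wc])

text \<open>For fixed elements of H both sides are linear in \<open>X\<close>, so the claim reduces
  to classes of words, where it is \<open>wa_left\<close>.\<close>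

lemma act_T_left: "X : car T ==> (%h. act TY h X) : lin H T"
proof (rule linI)
 assume X: "X : car T"
 fix h h' assume h: "h : car H" and h': "h' : car H"
 show "act TY h X : car T" by (rule lin_closed[OF act_T_right[OF h] X])
 have hh: "h \<oplus>\<^bsub>H\<^esub> h' : car H" using h h' by (rule H.a_closed)
 show "act TY (h \<oplus>\<^bsub>H\<^esub> h') X = act TY h X \<oplus>\<^bsub>T\<^esub> act TY h' X"
 by (rule TW.T_ext[OF vs_T act_T_right[OF hh] lin_plus[OF vs_T act_T_right[OF h] act_T_right[OF h']] _ X])
 (simp only: act_T_word LB_LC h h' hh lin_add[OF wa_left])
next
 assume X: "X : car T"
 fix c h assume h: "h : car H"
 have ch: "c \<odot>\<^bsub>H\<^esub> h : car H" using h by simp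
 show "act TY (c \<odot>\<^bsub>H\<^esub> h) X = c \<odot>\<^bsub>T\<^esub> act TY h X"
 by (rule TW.T_ext[OF vs_T act_T_right[OF ch] lin_smult_right[OF vs_T act_T_right[OF h]] _ X])
 (simp only: act_T_word LB_LC h ch lin_smult[OF wa_left])
qed

lemma k_algebra_TY: "k_algebra TY"
 by (rule k_algebra_same[OF same_TY _ _ TW.TA.k_algebra_axioms]) simp_all

sublocale O: op_space H TY
proof (intro op_space.intro op_space_axioms.intro k_algebra_TY)
 show "hopf_bij H" by unfold_locales
qed (simp_all only: STY T_ops(12) act_T_left act_T_right coact_T)

lemma lin_wd1: "f : lin N TT ==> Y : car TT ==> (%z. braided_mult TY (f z) Y) : lin N TT"
 and lin_wd2: "g : lin N TT ==> X : car TT ==> vs N ==> (%z. braided_mult TY X (g z)) : lin N TT"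
 and wd_mult_closed: "X : car TT ==> Y : car TT ==> braided_mult TY X Y : car TT"
 by (rule O.lin_braided1[unfolded STY] O.lin_braided2[unfolded STY] O.braided_closed[unfolded STY]; assumption)+

abbreviation "prim x \<equiv> pt T T (cw [x]) (one T) \<oplus>\<^bsub>TT\<^esub> pt T T (one T) (cw [x])"

lemma prim_linear: "prim : lin M TT"
 by ((assumption | rule lin_plus Tl)+)

lemma wd_closed: assumes "w : LC" shows "wd w : car TT"
 using assms
proof (induction w)
 case Nil show ?case unfolding word_comult.simps by ((assumption | rule Tl)+)
next
 case (Cons x w)
 show ?case unfolding word_comult.simps
 by (rule wd_mult_closed[OF lin_closed[OF prim_linear Cons.hyps(1)] Cons.IH])
qed

lemma wd_letter: assumes "u : LC" "v : LC" shows "(%x. wd (u @ x # v)) : lin M TT"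
 using assms
proof (induction u)
 case Nil
 show ?case unfolding append_Nil word_comult.simps by (rule lin_wd1[OF prim_linear wd_closed[OF Nil.prems]])
next
 case (Cons a u)
 show ?case unfolding append_Cons word_comult.simps
 by (rule lin_wd2[OF Cons.IH[OF Cons.prems] lin_closed[OF prim_linear Cons.hyps(1)] vs_M])
qed

lemma mlin_wd: "TW.mlin TT wd"
 unfolding TW.mlin_def by (intro conjI ballI wd_closed wd_letter)

lemma mlin_counit: "TW.mlin scalars (%w. if w = [] then 1 else (0 :: 'k))"
 unfolding TW.mlin_def by (auto intro!: linI)

lemma comult_TB: "br_comult TB : lin T TT" "w : LC ==> br_comult TB (cw w) = wd w"
 unfolding T_ops[abs_def]
 by (rule TW.class_sum_linear[OF TT.vs_tensor mlin_wd] TW.class_sum_word[OF TT.vs_tensor mlin_wd]; assumption?)+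

lemma counit_TB: "br_counit TB : lin T scalars" "w : LC ==> br_counit TB (cw w) = Y.eT w"
 unfolding T_ops[abs_def] Y.eT_def
 by (rule TW.class_sum_linear[OF vsk mlin_counit] TW.class_sum_word[OF vsk mlin_counit]; assumption?)+

lemma act_TY_E:
 assumes "w : LB" "h : basis H" "ph : lin T scalars"
 shows "ph (wa w h) = ev (Y.aT w h) (%v. ph (cw v))"
 using assms
proof (induction w arbitrary: h ph)
 case Nil
 thus ?case
 by (simp only: word_act.simps Y.ev_actT TW.cw_Nil lin_smult[OF Nil(2) TW.cw_closed[OF lists.Nil]]) (simp add: ce_def)
next
 case (Cons x w)
 note h = \<open>h \<in> basis H\<close> and ph = \<open>ph \<in> linear_maps T scalars\<close>
 note w = LB_LC[OF Cons.hyps(2)] and x = BM_carrier[OF Cons.hyps(1)] and l = lin_comp[OF _ ph]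
 have b: "bil H H T (%h1 h2. cw [act M h1 x] \<otimes>\<^bsub>T\<^esub> wa w h2)"
 by ((assumption | rule w x wa_left wa_closed Tl)+)
 have "ph (wa (x # w) h) = ev2 (cD H h) (%h1 h2. ph (cw [act M h1 x] \<otimes>\<^bsub>T\<^esub> wa w h2))"
 unfolding word_act.simps Hb.HH.lin_tensor_sum[OF vs_T vsk b ph Hb.comult_closed[OF Hb.BH_carrier[OF h]]]
 by (rule Hb.cD_sw[OF h bil_comp[OF b ph], symmetric])
 also have "... = ev2 (cD H h) (%h1 h2. ev (cA H M h1 x) (%y. ev (Y.aT w h2) (%v. ph (cw (y # v)))))"
 proof (rule Hb.H_cong(1))
 fix h1 h2 assume hh: "h1 : basis H" "h2 : basis H"
 have "ph (cw [act M h1 x] \<otimes>\<^bsub>T\<^esub> wa w h2) = ev (cA H M h1 x) (%y. ph (cw [y] \<otimes>\<^bsub>T\<^esub> wa w h2))" (is "?x = _")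
 by (rule cA_lin[OF hh(1) Cons.hyps(1), symmetric]) ((assumption | rule l hh wa_closed w Tl)+)
 also have "... = ev (cA H M h1 x) (%y. ev (Y.aT w h2) (%v. ph (cw (y # v))))" (is "_ = ?y")
 proof (rule M_cong(2))
 fix y assume y: "y : basis M"
 have "ph (cw [y] \<otimes>\<^bsub>T\<^esub> wa w h2) = ev (Y.aT w h2) (%v. ph (cw [y] \<otimes>\<^bsub>T\<^esub> cw v))" (is "?x = _")
 by (rule Cons.IH[OF hh(2), of "%z. ph (cw [y] \<otimes>\<^bsub>T\<^esub> z)"]) ((assumption | rule l y Tl)+)
 also have "... = ev (Y.aT w h2) (%v. ph (cw (y # v)))" (is "_ = ?y")
 by (rule YT.A_cong, subst TW.cw_append) (simp_all add: y BM_carrier LB_LC del: in_lists_conv_set)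
 finally show "?x = ?y" .
 qed
 finally show "?x = ?y" .
 qed
 finally show ?case by simp
qed

lemma coact_TY_E:
 assumes "w : LB" "bil H T scalars F"
 shows "sw (wc w) F = ev2 (Y.cT w) (%g v. F g (cw v))"
 using assms
proof (induction w arbitrary: F)
 case Nil
 thus ?case
 by (simp add: HT.tensor_sum_pure[OF vsk Nil] TW.cw_Nil[symmetric] Hb.cun_lin bil_left[OF Nil])
next
 case (Cons x w)
 note F = \<open>bil H T scalars F\<close> note w = LB_LC[OF Cons.hyps(2)] and x = BM_carrier[OF Cons.hyps(1)]
 note l = lin_bil1[OF F] lin_bil2[OF F]
 let ?p = "%g x0 g' Y. pt H T (g \<otimes>\<^bsub>H\<^esub> g') (cw [x0] \<otimes>\<^bsub>T\<^esub> Y)"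
 have b1: "bil H T HT (?p g x0)" if "g : car H" "x0 : car M" for g x0
 using that by - ((assumption | rule Tl)+)
 have b2: "bil H M HT (%g x0. tsum HT (wc w) (?p g x0))"
 by ((assumption | rule wc_closed w Tl)+)
 have "sw (wc (x # w)) F = sw (coact M x) (%g x0. sw (tsum HT (wc w) (?p g x0)) F)"
 unfolding word_coact.simps by (rule sw_tsum[OF coact_closed[OF x] b2 F Hb.vs_H vs_M Hb.vs_H vs_T])
 also have "... = sw (coact M x) (%g x0. sw (wc w) (%g' Y. F (g \<otimes>\<^bsub>H\<^esub> g') (cw [x0] \<otimes>\<^bsub>T\<^esub> Y)))"
 proof (rule sw_cong[OF Hb.vs_H vs_M coact_closed[OF x]])
 fix g x0 assume g: "g : car H" "x0 : car M"
 show "sw (tsum HT (wc w) (?p g x0)) F = sw (wc w) (%g' Y. F (g \<otimes>\<^bsub>H\<^esub> g') (cw [x0] \<otimes>\<^bsub>T\<^esub> Y))"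
 unfolding sw_tsum[OF wc_closed[OF w] b1[OF g] F Hb.vs_H vs_T Hb.vs_H vs_T]
 by (rule sw_cong[OF Hb.vs_H vs_T wc_closed[OF w]], rule sw_pure) ((assumption | rule F g Tl)+)
 qed
 also have "... = ev2 (cC H M x) (%g x0. sw (wc w) (%g' Y. F (g \<otimes>\<^bsub>H\<^esub> g') (cw [x0] \<otimes>\<^bsub>T\<^esub> Y)))"
 by (rule cC_sw[OF Cons.hyps(1), symmetric]) ((assumption | rule l wc_closed w Tl)+)
 also have "... = ev2 (cC H M x) (%g y. ev2 (Y.cT w) (%g' v. ev (cmu H g g') (%p. F p (cw (y # v)))))"
 proof (rule M_cong(1))
 fix g y assume g: "g : basis H" "y : basis M"
 have "sw (wc w) (%g' Y. F (g \<otimes>\<^bsub>H\<^esub> g') (cw [y] \<otimes>\<^bsub>T\<^esub> Y)) =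
 ev2 (Y.cT w) (%g' v. F (g \<otimes>\<^bsub>H\<^esub> g') (cw [y] \<otimes>\<^bsub>T\<^esub> cw v))" (is "?x = _")
 by (rule Cons.IH) ((assumption | rule l g Tl)+)
 also have "... = ev2 (Y.cT w) (%g' v. ev (cmu H g g') (%p. F p (cw (y # v))))" (is "_ = ?y")
 proof (rule YT.C_cong)
 fix g' v assume v: "g' : basis H" "v : LB"
 have "cw [y] \<otimes>\<^bsub>T\<^esub> cw v = cw (y # v)"
 by (subst TW.cw_append) (simp_all add: g BM_carrier LB_LC v del: in_lists_conv_set)
 thus "F (g \<otimes>\<^bsub>H\<^esub> g') (cw [y] \<otimes>\<^bsub>T\<^esub> cw v) = ev (cmu H g g') (%p. F p (cw (y # v)))"
 by (simp add: Hb.cmu_lin[OF g(1) v(1) bil_left[OF F]] TW.cw_closed LB_LC v g BM_carrier del: in_lists_conv_set)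
 qed
 finally show "?x = ?y" .
 qed
 finally show ?case by simp
qed

lemma comult_TB_E:
 assumes "w : LB" "bil T T scalars G"
 shows "sw (wd w) G = ev2 (Y.dT w) (%u v. G (cw u) (cw v))"
 using assms
proof (induction w arbitrary: G)
 case Nil
 thus ?case by (simp add: TT.tensor_sum_pure[OF vsk Nil] TW.cw_Nil[symmetric])
next
 case (Cons x w)
 note G = \<open>bil T T scalars G\<close> note w = LB_LC[OF Cons.hyps(2)] and x = BM_carrier[OF Cons.hyps(1)]
 note l = lin_bil1[OF G] lin_bil2[OF G]
 note Ol = O.Ol[unfolded STY T_ops(1,2,11,12)]
 have x1: "cw [x] : car T" and x2: "[x] : LB" by (rule TW.cw_closed, simp add: x) (simp add: Cons.hyps)
 have c: "car TY = car T" by simp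
 \<comment> \<open>\<open>Z a b\<close> is the value of \<open>G\<close> at (a tensor b) times the
   coproduct of \<open>w\<close>. It is bilinear in a and b, so it can be evaluated at the primitive
   element \<open>prim x\<close>, whose two terms give the two summands of
   \<open>dT\<close>.\<close>
 define Z where "Z = (%a b. sw (wd w) (%a' b'. sw (coact TY b) (%g b0.
 G (a \<otimes>\<^bsub>T\<^esub> act TY g a') (b0 \<otimes>\<^bsub>T\<^esub> b'))))"
 have act_l: "(%z. act TY h (f z)) : lin N T" if "f : lin N T" "h : car H" for f h and N :: "('k, 'zz, 'zzz) module_scheme"
 by (rule lin_comp[OF that(1) act_T_right[OF that(2)]])
 have act_r: "(%z. act TY (f z) X) : lin N T" if "f : lin N H" "X : car T" for f X and N :: "('k, 'zz, 'zzz) module_scheme"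
 by (rule lin_comp[OF that(1) act_T_left[OF that(2)]])
 have co_l: "(%z. coact TY (f z)) : lin N HT" if "f : lin N T" for f and N :: "('k, 'zz, 'zzz) module_scheme"
 by (rule lin_comp[OF that coact_T])
 have act_c: "act TY h X : car T" if "h : car H" "X : car T" for h X
 by (rule lin_closed[OF act_T_right[OF that(1)] that(2)])
 have co_c: "coact TY X : car HT" if "X : car T" for X by (rule lin_closed[OF coact_T that])
 note L = l act_l act_r co_l act_c co_c wd_closed[OF w] Tl
 have Zb: "bil T T scalars Z" unfolding Z_def by ((assumption | rule L)+)
 have Z_E: "Z (cw a) (cw b) = ev2 (Y.dT w) (%u v. ev2 (Y.cT b) (%g b0. ev (Y.aT u g) (%u'. G (cw (a @ u')) (cw (b0 @ v)))))"
 if a: "a : LB" and b: "b : LB" for a b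
 proof -
 note ab = TW.cw_closed[OF LB_LC[OF a]] TW.cw_closed[OF LB_LC[OF b]]
 have "Z (cw a) (cw b) = ev2 (Y.dT w) (%u v. sw (coact TY (cw b)) (%g b0. G (cw a \<otimes>\<^bsub>T\<^esub> act TY g (cw u)) (b0 \<otimes>\<^bsub>T\<^esub> cw v)))"
 unfolding Z_def by (rule Cons.IH) ((assumption | rule ab L)+)
 also have "... = ev2 (Y.dT w) (%u v. ev2 (Y.cT b) (%g b0. ev (Y.aT u g) (%u'. G (cw (a @ u')) (cw (b0 @ v)))))"
 proof (rule YT.Dr_cong[OF Cons.hyps(2)])
 fix u v assume u: "u : LB" and v: "v : LB"
 note uv = TW.cw_closed[OF LB_LC[OF u]] TW.cw_closed[OF LB_LC[OF v]]
 have "sw (coact TY (cw b)) (%g b0. G (cw a \<otimes>\<^bsub>T\<^esub> act TY g (cw u)) (b0 \<otimes>\<^bsub>T\<^esub> cw v)) =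
 ev2 (Y.cT b) (%g b0. G (cw a \<otimes>\<^bsub>T\<^esub> act TY g (cw u)) (cw b0 \<otimes>\<^bsub>T\<^esub> cw v))" (is "?x = _")
 unfolding coact_T_word[OF LB_LC[OF b]] by (rule coact_TY_E[OF b]) ((assumption | rule ab uv L)+)
 also have "... = ev2 (Y.cT b) (%g b0. ev (Y.aT u g) (%u'. G (cw (a @ u')) (cw (b0 @ v))))" (is "_ = ?y")
 proof (rule YT.C_cong)
 fix g b0 assume g: "g : basis H" and b0: "b0 : LB"
 note b0c = TW.cw_closed[OF LB_LC[OF b0]]
 have "G (cw a \<otimes>\<^bsub>T\<^esub> act TY g (cw u)) (cw b0 \<otimes>\<^bsub>T\<^esub> cw v) = ev (Y.aT u g) (%u'. G (cw a \<otimes>\<^bsub>T\<^esub> cw u') (cw b0 \<otimes>\<^bsub>T\<^esub> cw v))" (is "?x = _")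
 unfolding act_T_word[OF Hb.BH_carrier[OF g] LB_LC[OF u]]
 by (rule act_TY_E[OF u g, of "%z. G (cw a \<otimes>\<^bsub>T\<^esub> z) (cw b0 \<otimes>\<^bsub>T\<^esub> cw v)"]) ((assumption | rule ab uv b0c L)+)
 also have "... = ev (Y.aT u g) (%u'. G (cw (a @ u')) (cw (b0 @ v)))" (is "_ = ?y")
 by (rule YT.A_cong) (simp only: TW.cw_append LB_LC a b0 v)
 finally show "?x = ?y" .
 qed
 finally show "?x = ?y" .
 qed
 finally show ?thesis .
 qed
 have Gy: "bil TY TY scalars G" using G unfolding bil_def STY T_ops(12) .
 have "sw (wd (x # w)) G = sw (prim x) Z"
 unfolding word_comult.simps Z_def
 by (rule O.braided_sw[unfolded STY T_ops(1), OF Gy lin_closed[OF prim_linear x] wd_closed[OF w]])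
 also have "... = Z (cw [x]) (one T) + Z (one T) (cw [x])"
 using lin_add[OF TT.tensor_sum_linear[OF vsk Zb] TT.pure_closed TT.pure_closed]
 by (simp add: x1 TT.tensor_sum_pure[OF vsk Zb])
 also have "... = Z (cw [x]) (cw []) + Z (cw []) (cw [x])" by (simp only: TW.cw_Nil)
 also have "Z (cw [x]) (cw []) = ev2 (Y.dT w) (%u v. G (cw (x # u)) (cw v))"
 unfolding Z_E[OF x2 lists.Nil]
 by (rule YT.Dr_cong[OF Cons.hyps(2)]) (simp add: YT.A_un)
 also have "Z (cw []) (cw [x]) = ev2 (Y.dT w) (%u v. ev2 (cC H M x) (%g y. ev (Y.aT u g) (%u'. G (cw u') (cw (y # v)))))"
 unfolding Z_E[OF lists.Nil x2]
 proof (rule YT.Dr_cong[OF Cons.hyps(2)])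
 fix u v assume "u : LB" "v : LB"
 have "ev2 (cC H M x) (%g y. ev (cun H) (%u'. ev (cmu H g u') (%p. ev (Y.aT u p) (%u'. G (cw u') (cw (y # v)))))) =
 ev2 (cC H M x) (%g y. ev (Y.aT u g) (%u'. G (cw u') (cw (y # v))))"
 by (rule M_cong(1)) (rule Y.un_r)
 thus "ev2 (Y.cT [x]) (%g b0. ev (Y.aT u g) (%u'. G (cw ([] @ u')) (cw (b0 @ v)))) =
 ev2 (cC H M x) (%g y. ev (Y.aT u g) (%u'. G (cw u') (cw (y # v))))" by simp
 qed
 finally show ?case by (simp add: ev2_fun_plus)
qed

text \<open>The recursions that define \<open>tensor_algebra\<close> agree with the coordinate
  recursions once functionals or bilinear forms are applied. Thus T(M) is a word model, and with it
  a braided bialgebra.\<close>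

sublocale TM: word_model H M TB cw
proof (intro word_model.intro op_space.intro word_model_axioms.intro op_space_axioms.intro)
 show "yd_bij H M" "hopf_bij H" by unfold_locales
 show "k_algebra TB" by (rule k_algebra_same[OF same_TB _ _ TW.TA.k_algebra_axioms]) simp_all
 show "(%h. act TB h x) : lin H TB" if "x : car TB" for x
 using that by (simp only: STB T_ops(7,11) act_T_left)
 show "act TB h : lin TB TB" if "h : car H" for h
 using that by (simp only: STB T_ops(7) act_T_right)
 show "coact TB : lin TB (tensor H TB)" by (simp only: STB T_ops(8) coact_T)
 show "cw w : car TB" if "w : LB" for w using that by (simp only: T_ops(11) TW.cw_closed LB_LC)
 show "f x = g x" if "f : lin TB scalars" "g : lin TB scalars"
 "!!w. w : LB ==> f (cw w) = g (cw w)" "x : car TB" for f g :: "_ => 'k" and x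
 using that unfolding STB T_ops(11) by (rule TW.T_ext[OF vsk])
 show "cw u \<otimes>\<^bsub>TB\<^esub> cw v = cw (u @ v)" if "u : LB" "v : LB" for u v
 using that by (simp only: T_ops(3) TW.cw_append LB_LC)
 show "(one TB) = cw []" by (simp only: T_ops(4) TW.cw_Nil)
 show "ph (act TB h (cw w)) = ev (Y.aT w h) (%v. ph (cw v))"
 if "h : basis H" "w : LB" "ph : lin TB scalars" for h w and ph :: "_ => 'k"
 using that act_TY_E unfolding STB by (simp only: T_ops(7) act_T_word LB_LC Hb.BH_carrier)
 show "sw (coact TB (cw w)) F = ev2 (Y.cT w) (%g v. F g (cw v))"
 if "w : LB" "bil H TB scalars F" for w F
 using that coact_TY_E[of w F] unfolding bil_def STB by (simp only: T_ops(8,11) coact_T_word LB_LC)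
 show "br_comult TB : lin TB (tensor TB TB)" unfolding STB by (rule comult_TB)
 show "sw (br_comult TB (cw w)) G = ev2 (Y.dT w) (%u v. G (cw u) (cw v))"
 if "w : LB" "bil TB TB scalars G" for w G
 using that comult_TB_E[of w G] unfolding bil_def STB by (simp only: T_ops(11) comult_TB(2) LB_LC)
 show "br_counit TB : lin TB scalars" unfolding STB by (rule counit_TB)
 show "br_counit TB (cw w) = Y.eT w" if "w : LB" for w
 using that by (simp only: counit_TB(2) LB_LC)
qed

end

section \<open>The maximal coideal and the Nichols algebra\<close>

lemma
 assumes "vs M"
 shows vs_zero_closed: "(zero M) : car M"
 and vs_smult_closed: "x : car M ==> c \<odot>\<^bsub>M\<^esub> x : car M"
 and vs_add_closed: "x : car M ==> y : car M ==> x \<oplus>\<^bsub>M\<^esub> y : car M"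
 and vs_zero_add: "x : car M ==> (zero M) \<oplus>\<^bsub>M\<^esub> x = x"
 and vs_smult_zero: "c \<odot>\<^bsub>M\<^esub> (zero M) = (zero M)"
 and vs_zero_smult: "x : car M ==> 0 \<odot>\<^bsub>M\<^esub> x = (zero M)"
 and vs_minus_zero: "x : car M ==> x \<ominus>\<^bsub>M\<^esub> (zero M) = x"
proof -
 interpret vspace M using assms by (rule vspaceI)
 show z: "(zero M) : car M" by simp
 show "x : car M ==> c \<odot>\<^bsub>M\<^esub> x : car M" by (rule smult_closed[OF scalars_carrier])
 show "x : car M ==> y : car M ==> x \<oplus>\<^bsub>M\<^esub> y : car M" "x : car M ==> (zero M) \<oplus>\<^bsub>M\<^esub> x = x" by simp_all
 show "c \<odot>\<^bsub>M\<^esub> (zero M) = (zero M)" by (rule smult_r_null[OF scalars_carrier])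
 show "x : car M ==> 0 \<odot>\<^bsub>M\<^esub> x = (zero M)" using smult_l_null[of x] by simp
 show "x : car M ==> x \<ominus>\<^bsub>M\<^esub> (zero M) = x"
 using M.minus_equality[OF M.l_zero[OF z] z z] by (simp add: a_minus_def)
qed

lemma submodule_set_add:
 assumes "vs M" "submodule A scalars M" "submodule B scalars M"
 shows "submodule (A <+>\<^bsub>M\<^esub> B) scalars M" "A <= A <+>\<^bsub>M\<^esub> B" "B <= A <+>\<^bsub>M\<^esub> B"
proof -
 interpret vspace M using assms(1) by (rule vspaceI)
 note A = assms(2)[unfolded vs_subspace_iff[OF assms(1)]] and B = assms(3)[unfolded vs_subspace_iff[OF assms(1)]]
 have Ac: "a : car M" if "a : A" for a using A that by blast
 have Bc: "b : car M" if "b : B" for b using B that by blast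
 have mem: "a \<oplus>\<^bsub>M\<^esub> b : A <+>\<^bsub>M\<^esub> B" if "a : A" "b : B" for a b
 using that unfolding set_add_def' by blast
 have dest: "EX a:A. EX b:B. x = a \<oplus>\<^bsub>M\<^esub> b" if "x : A <+>\<^bsub>M\<^esub> B" for x
 using that unfolding set_add_def' by blast
 show "A <= A <+>\<^bsub>M\<^esub> B"
 proof
 fix a assume "a : A"
 thus "a : A <+>\<^bsub>M\<^esub> B" using mem[of a "(zero M)"] B Ac by simp
 qed
 show "B <= A <+>\<^bsub>M\<^esub> B"
 proof
 fix b assume "b : B"
 thus "b : A <+>\<^bsub>M\<^esub> B" using mem[of "(zero M)" b] A Bc by simp
 qed
 show "submodule (A <+>\<^bsub>M\<^esub> B) scalars M" unfolding vs_subspace_iff[OF assms(1)]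
 proof (intro conjI ballI allI)
 show "A <+>\<^bsub>M\<^esub> B <= car M"
 proof
 fix x assume "x : A <+>\<^bsub>M\<^esub> B"
 then obtain a b where "a : A" "b : B" "x = a \<oplus>\<^bsub>M\<^esub> b" using dest by blast
 thus "x : car M" by (simp add: Ac Bc)
 qed
 show "(zero M) : A <+>\<^bsub>M\<^esub> B" using mem[of "(zero M)" "(zero M)"] A B by simp
 fix x assume "x : A <+>\<^bsub>M\<^esub> B"
 then obtain a b where ab: "a : A" "b : B" "x = a \<oplus>\<^bsub>M\<^esub> b" using dest by blast
 show "c \<odot>\<^bsub>M\<^esub> x : A <+>\<^bsub>M\<^esub> B" for c
 using ab A B mem[of "c \<odot>\<^bsub>M\<^esub> a" "c \<odot>\<^bsub>M\<^esub> b"] by (simp add: smult_r_distr Ac Bc)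
 fix y assume "y : A <+>\<^bsub>M\<^esub> B"
 then obtain a' b' where ab': "a' : A" "b' : B" "y = a' \<oplus>\<^bsub>M\<^esub> b'" using dest by blast
 have "x \<oplus>\<^bsub>M\<^esub> y = (a \<oplus>\<^bsub>M\<^esub> a') \<oplus>\<^bsub>M\<^esub> (b \<oplus>\<^bsub>M\<^esub> b')"
 using ab ab' by (simp add: Ac Bc M.a_ac)
 thus "x \<oplus>\<^bsub>M\<^esub> y : A <+>\<^bsub>M\<^esub> B" using ab ab' A B by (simp add: mem)
 qed
qed

lemma set_add_mono: "A <= A' ==> B <= B' ==> A <+>\<^bsub>M\<^esub> B <= A' <+>\<^bsub>M\<^esub> B'"
 unfolding set_add_def' by blast

lemma tensor_span_mono: "A <= A' ==> B <= B' ==> tensor_span U V A B <= tensor_span U V A' B'"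
 unfolding tensor_span_def by (rule vspan_mono) blast

lemma tensor_span_sub:
 assumes "vs U" "vs V" "A <= car U" "B <= car V"
 shows "submodule (tensor_span U V A B) scalars (tensor U V)"
 and "u : A ==> v : B ==> pt U V u v : tensor_span U V A B"
proof -
 interpret vs2 U V by (rule vs2I) fact+
 have "{pt U V u v | u v. u : A & v : B} <= car (tensor U V)"
 using assms(3,4) pure_closed by blast
 note s = vspan_submodule[OF vs_tensor this]
 show "submodule (tensor_span U V A B) scalars (tensor U V)" unfolding tensor_span_def by (rule s(1))
 show "u : A ==> v : B ==> pt U V u v : tensor_span U V A B"
 unfolding tensor_span_def using s(2) by blast
qed

text \<open>\<open>p1\<close> is the projection onto degree one, and it carries all arguments about
  the condition on M: a graded subspace meets M trivially exactly when \<open>p1\<close> kills it,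
  and \<open>p1_mult\<close> says that \<open>p1\<close> is a derivation relative to the counit, so
  that vanishing spreads to products.\<close>

locale graded_model = word_model H M R E
 for H :: "('k::field, 'h, 'm) hopf_scheme" and M :: "('k, 'a, 'h, 'n) yd_scheme"
 and R :: "('k, 'r, 'h, 'p) yd_bialg_scheme" and E +
 fixes deg :: "nat => 'r set" and \<iota> :: "'a => 'r" and p1 :: "'r => 'a"
 assumes deg_carrier: "deg n <= car R"
 and E_deg: "w : lists (basis M) ==> E w : deg (length w)"
 and deg_mult: "x : deg m ==> y : deg n ==> x ** y : deg (m + n)"
 and \<iota>_linear: "\<iota> : lin M R" and p1_linear: "p1 : lin R M"
 and p1_\<iota>: "m' : car M ==> p1 (\<iota> m') = m'"
 and deg_1: "deg 1 <= \<iota> ` car M"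
 and p1_deg: "x : deg n ==> n ~= 1 ==> p1 x = (zero M)"
 and p1_mult: "u : lists (basis M) ==> v : lists (basis M) ==>
 p1 (E u ** E v) = br_counit R (E u) \<odot>\<^bsub>M\<^esub> p1 (E v) \<oplus>\<^bsub>M\<^esub> br_counit R (E v) \<odot>\<^bsub>M\<^esub> p1 (E u)"
begin

definition cand :: "'r set => bool" where
 "cand I \<longleftrightarrow> yd_subobject H R I & I = vspan R (\<Union>n. I \<inter> deg n) & yd_coideal R I &
 I \<inter> \<iota> ` car M = {(zero R)}"

abbreviation "hsp J \<equiv> tensor_span H R (car H) J"
abbreviation "ksp J \<equiv> tensor_span R R J (car R) <+>\<^bsub>RR\<^esub> tensor_span R R (car R) J"

text \<open>\<open>E_ext\<close> speaks of functionals only. Membership in \<open>S\<close> is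
  vanishing in the quotient by \<open>S\<close>, and there functionals separate points.\<close>

lemma E_mem:
 assumes "vs N" "submodule S scalars N" "f : lin R N" "!!w. w : LB ==> f (E w) : S" "x : car R"
 shows "f x : S"
proof -
 let ?c = "%y. S +>\<^bsub>N\<^esub> y"
 have mem: "?c y = ?c (zero N) \<longleftrightarrow> y : S" if "y : car N" for y
 using coset_eq_iff[OF assms(1,2) that vs_zero_closed[OF assms(1)]] by (simp add: vs_minus_zero[OF assms(1) that])
 note pl = proj_linear[OF assms(1,2)]
 have "?c (f x) = ?c (zero N)"
 proof (rule functional_eqI[OF vs_factor_space[OF assms(1,2)]])
 fix ph assume ph: "ph : lin (factor_space N S) scalars"
 note l = lin_comp[OF assms(3) lin_comp[OF pl ph]]
 have z: "ph (?c (zero N)) = 0" using lin_zero[OF assms(1) vsk lin_comp[OF pl ph]] by simp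
 show "ph (?c (f x)) = ph (?c (zero N))"
 by (rule E_ext[OF l _ _ assms(5), of "%_. ph (?c (zero N))"])
 (simp_all add: z linI assms(4) mem[THEN iffD2] lin_closed[OF assms(3)] E_closed)
 qed (rule lin_closed[OF pl] lin_closed[OF assms(3)] assms(5) vs_zero_closed[OF assms(1)])+
 thus ?thesis using mem lin_closed[OF assms(3,5)] by blast
qed

lemma hsp_sub: "J <= car R ==> submodule (hsp J) scalars HR"
 and hsp_pure: "J <= car R ==> g : car H ==> y : J ==> pt H R g y : hsp J"
 by (rule tensor_span_sub[OF Hb.vs_H vs_R subset_refl]; assumption)+

lemma ksp_sub:
 assumes "J <= car R"
 shows "submodule (ksp J) scalars RR" "tensor_span R R J (car R) <= ksp J" "tensor_span R R (car R) J <= ksp J"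
 by (rule submodule_set_add[OF RR.vs_tensor tensor_span_sub(1)[OF vs_R vs_R assms subset_refl]
 tensor_span_sub(1)[OF vs_R vs_R subset_refl assms]])+

lemma ksp_pure:
 assumes "J <= car R" "x : car R" "y : car R" "x : J \<or> y : J"
 shows "pt R R x y : ksp J"
 using assms(4)
proof
 assume "x : J"
 thus ?thesis using tensor_span_sub(2)[OF vs_R vs_R assms(1) subset_refl _ assms(3)] ksp_sub(2)[OF assms(1)] by blast
next
 assume "y : J"
 thus ?thesis using tensor_span_sub(2)[OF vs_R vs_R subset_refl assms(1) assms(2)] ksp_sub(3)[OF assms(1)] by blast
qed

lemma ksp_mem:
 assumes "J <= car R" "vs N" "submodule S scalars N" "bil R R N f" "X : ksp J"
 and "!!u v. u : car R ==> v : car R ==> u : J \<or> v : J ==> f u v : S"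
 shows "tsum N X f : S"
proof -
 obtain X1 X2 where X: "X1 : tensor_span R R J (car R)" "X2 : tensor_span R R (car R) J" "X = X1 \<oplus>\<^bsub>RR\<^esub> X2"
 using assms(5) unfolding set_add_def' by blast
 have c: "X1 : car RR" "X2 : car RR"
 using submodule_subset[OF RR.vs_tensor tensor_span_sub(1)[OF vs_R vs_R assms(1) subset_refl]]
 submodule_subset[OF RR.vs_tensor tensor_span_sub(1)[OF vs_R vs_R subset_refl assms(1)]] X by blast+
 have "tsum N X1 f : S"
 by (rule RR.tensor_sum_mem[OF assms(2-4) X(1) assms(1) subset_refl]) (use assms(1,6) in blast)
 moreover have "tsum N X2 f : S"
 by (rule RR.tensor_sum_mem[OF assms(2-4) X(2) subset_refl assms(1)]) (use assms(1,6) in blast)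
 ultimately show ?thesis
 unfolding X(3) lin_add[OF RR.tensor_sum_linear[OF assms(2,4)] c] by (rule submodule_add[OF assms(2,3)])
qed

text \<open>The conditions on a candidate become linear once trivial intersection with M is replaced
  by vanishing of \<open>p1\<close>, and can then be checked on a spanning set. The last premise
  expresses that the span is graded.\<close>

lemma candI:
 assumes S: "S <= car R" and J: "J = vspan R S"
 and 1: "!!x h. x : S ==> h : car H ==> act R h x : J" "!!x. x : S ==> de x : hsp J"
 "!!x. x : S ==> De x : ksp J" "!!x. x : S ==> ep x = 0" "!!x. x : S ==> p1 x = (zero M)"
 "!!x. x : S ==> x : vspan R (\<Union>n. J \<inter> deg n)"
 shows "cand J"
proof -
 have sub: "submodule J scalars R" and SJ: "S <= J" unfolding J by (rule vspan_submodule[OF vs_R S])+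
 have Jc: "J <= car R" by (rule submodule_subset[OF vs_R sub])
 have dJ: "(\<Union>n. J \<inter> deg n) <= car R" using Jc by blast
 have z: "submodule {0} scalars (scalars :: ('k, 'k) module)" using submodule_zero[OF vsk] by simp
 have a: "act R h x : J" if "h : car H" "x : J" for h x
 by (rule vspan_image[OF vs_R vs_R R_act_right[OF that(1)] sub S 1(1)[OF _ that(1)] that(2)[unfolded J]])
 have c: "de x : hsp J" if "x : J" for x
 by (rule vspan_image[OF vs_R HR.vs_tensor R_coact hsp_sub[OF Jc] S 1(2) that[unfolded J]])
 have d: "De x : ksp J" if "x : J" for x
 by (rule vspan_image[OF vs_R RR.vs_tensor R_comult ksp_sub(1)[OF Jc] S 1(3) that[unfolded J]])
 have e: "ep x : {0}" if "x : J" for x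
 by (rule vspan_image[OF vs_R vsk R_counit z S _ that[unfolded J]]) (use 1(4) in simp)
 have p: "p1 x : {(zero M)}" if "x : J" for x
 by (rule vspan_image[OF vs_R vs_M p1_linear submodule_zero[OF vs_M] S _ that[unfolded J]]) (use 1(5) in simp)
 have g: "J = vspan R (\<Union>n. J \<inter> deg n)"
 proof
 show "J <= vspan R (\<Union>n. J \<inter> deg n)"
 by (subst (1) J, rule vspan_minimal[OF vspan_submodule(1)[OF vs_R dJ]]) (use 1(6) in blast)
 show "vspan R (\<Union>n. J \<inter> deg n) <= J" by (rule vspan_minimal[OF sub]) blast
 qed
 have z1: "x = (zero R)" if x: "x : J \<inter> \<iota> ` car M" for x
 proof -
 obtain m where m: "m : car M" "x = \<iota> m" using x by (elim IntE imageE)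
 have "m = p1 x" unfolding m(2) by (rule p1_\<iota>[OF m(1), symmetric])
 also have "... = (zero M)" by (rule singletonD[OF p[OF IntD1[OF x]]])
 finally have "x = \<iota> (zero M)" using m(2) by (simp only:)
 thus ?thesis unfolding lin_zero[OF vs_M vs_R \<iota>_linear] .
 qed
 have z2: "(zero R) : J \<inter> \<iota> ` car M"
 proof
 show "(zero R) : J" by (rule submodule_zero_mem[OF vs_R sub])
 show "(zero R) : \<iota> ` car M"
 by (rule image_eqI[where f=\<iota>, OF lin_zero[OF vs_M vs_R \<iota>_linear, symmetric] vs_zero_closed[OF vs_M]])
 qed
 have i: "J \<inter> \<iota> ` car M = {(zero R)}"
 proof (intro equalityI subsetI)
 fix x assume "x : J \<inter> \<iota> ` car M"
 thus "x : {(zero R)}" unfolding singleton_iff by (rule z1)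
 next
 fix x assume "x : {(zero R)}"
 thus "x : J \<inter> \<iota> ` car M" by (elim singletonE) (simp only: z2)
 qed
 show ?thesis
 unfolding cand_def yd_subobject_def yd_coideal_def
 by (intro conjI ballI sub a c d g i singletonD[OF e])
qed

lemma candD:
 assumes "cand I"
 shows "submodule I scalars R" "x : I ==> h : car H ==> act R h x : I" "x : I ==> de x : hsp I"
 and "x : I ==> De x : ksp I" "x : I ==> ep x = 0" "I = vspan R (\<Union>n. I \<inter> deg n)" "I <= car R"
proof -
 note c = assms[unfolded cand_def yd_subobject_def yd_coideal_def]
 show "submodule I scalars R" using c by (elim conjE)
 thus "I <= car R" by (rule submodule_subset[OF vs_R])
 show "I = vspan R (\<Union>n. I \<inter> deg n)" using c by (elim conjE)
 show "x : I ==> h : car H ==> act R h x : I" "x : I ==> de x : hsp I" "x : I ==> De x : ksp I" "x : I ==> ep x = 0"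
 using c by (elim conjE, simp only: Ball_def)+
qed

text \<open>A candidate is spanned by homogeneous elements. Those of degree one lie in M and are
  therefore zero; the others are killed by \<open>p1\<close>.\<close>

lemma cand_p1:
 assumes "cand I" "x : I" shows "p1 x = (zero M)"
proof -
 have s: "(\<Union>n. I \<inter> deg n) <= car R" using candD(7)[OF assms(1)] by blast
 have "p1 y : {(zero M)}" if "y : I" "y : deg n" for y n
 proof (cases "n = 1")
 case True
 hence "y : I \<inter> \<iota> ` car M" using that deg_1 by blast
 hence "y = (zero R)" using assms(1) unfolding cand_def by blast
 thus ?thesis using lin_zero[OF vs_R vs_M p1_linear] by simp
 qed (use p1_deg that in simp)
 hence "p1 x : {(zero M)}"
 by (intro vspan_image[OF vs_R vs_M p1_linear submodule_zero[OF vs_M] s _ assms(2)[THEN subsetD[OF equalityD1[OF candD(6)[OF assms(1)]]]]]) blast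
 thus ?thesis by simp
qed

section \<open>The largest candidate and the ideal generated by it\<close>

definition J where "J = vspan R (\<Union>{I. cand I})"

text \<open>Trivial intersection with M is not visibly stable under sums. By \<open>cand_p1\<close>,
  however, every candidate is killed by \<open>p1\<close>, and this linear condition passes to the
  span of all candidates.\<close>

lemma cand_J: "cand J"
proof (rule candI[OF _ J_def])
 show S: "\<Union>{I. cand I} <= car R" using candD(7) by blast
 have IJ: "I <= J" if "cand I" for I
 unfolding J_def using vspan_submodule(2)[OF vs_R S] that by blast
 fix x assume "x : \<Union>{I. cand I}"
 then obtain I where I: "cand I" and x: "x : I" by blast
 show "act R h x : J" if "h : car H" for h using candD(2)[OF I x that] IJ[OF I] by blast
 show "de x : hsp J" using candD(3)[OF I x] tensor_span_mono[OF subset_refl IJ[OF I]] by blast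
 show "De x : ksp J"
 using candD(4)[OF I x] set_add_mono[OF tensor_span_mono[OF IJ[OF I] subset_refl] tensor_span_mono[OF subset_refl IJ[OF I]]] by blast
 show "ep x = 0" by (rule candD(5)[OF I x])
 show "p1 x = (zero M)" by (rule cand_p1[OF I x])
 have "vspan R (\<Union>n. I \<inter> deg n) <= vspan R (\<Union>n. J \<inter> deg n)" by (rule vspan_mono) (use IJ[OF I] in blast)
 thus "x : vspan R (\<Union>n. J \<inter> deg n)" using x candD(6)[OF I] by blast
qed

lemma cand_le_J: "cand I ==> I <= J"
proof -
 have S: "\<Union>{I. cand I} <= car R" using candD(7) by blast
 show "cand I ==> I <= J" unfolding J_def using vspan_submodule(2)[OF vs_R S] by blast
qed

lemma J_maximal: "(THE I. cand I & (\<forall>J. cand J & I <= J \<longrightarrow> J = I)) = J"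
 using cand_J cand_le_J by (intro the_equality) blast+

text \<open>As \<open>x\<close> is homogeneous, so are these elements, and they span the two-sided
  ideal generated by \<open>J\<close>. This ideal turns out to be a candidate again, hence equals
  \<open>J\<close>; that is how \<open>J\<close> is seen to be an ideal.\<close>

definition gens where "gens = {E u ** (x ** E v) | u x v. u : LB & v : LB & x : (\<Union>n. J \<inter> deg n)}"
definition J' where "J' = vspan R gens"

lemma J_carrier: "J <= car R" and J_sub: "submodule J scalars R"
 by (rule candD(7)[OF cand_J] candD(1)[OF cand_J])+

lemma gens_carrier: "gens <= car R"
 unfolding gens_def using J_carrier E_closed RA.m_closed by blast

lemma J'_sub: "submodule J' scalars R" and gens_J': "gens <= J'"
 unfolding J'_def by (rule vspan_submodule[OF vs_R gens_carrier])+

lemma J'_carrier: "J' <= car R" by (rule submodule_subset[OF vs_R J'_sub])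

lemma lin_left: "a : car R ==> (%x. a ** x) : lin R R"
 and lin_right: "a : car R ==> (%x. x ** a) : lin R R"
 by (rule lin_R_multr[OF lin_id] lin_R_multl[OF lin_id]; assumption)+

lemma J'_left: assumes a: "a : car R" and y: "y : J'" shows "a ** y : J'"
proof -
 have yc: "y : car R" using y J'_carrier by blast
 have 1: "E w ** y : J'" if w: "w : LB" for w
 proof (rule vspan_image[OF vs_R vs_R lin_left[OF E_closed[OF w]] J'_sub gens_carrier _ y[unfolded J'_def]])
 fix z assume "z : gens"
 then obtain u x v where z: "z = E u ** (x ** E v)" "u : LB" "v : LB" "x : (\<Union>n. J \<inter> deg n)"
 unfolding gens_def by blast
 have "x ** E v : car R" using z(3,4) J_carrier E_closed RA.m_closed by blast
 hence "E w ** z = E (w @ u) ** (x ** E v)"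
 unfolding z(1) by (simp only: RA.m_assoc[symmetric] E_closed w z(2) E_append)
 moreover have "w @ u : LB" using w z(2) by simp
 ultimately have "E w ** z : gens" unfolding gens_def using z(3,4) by blast
 thus "E w ** z : J'" using gens_J' by blast
 qed
 show ?thesis by (rule E_mem[OF vs_R J'_sub lin_right[OF yc] 1 a])
qed

lemma J'_right: assumes a: "a : car R" and y: "y : J'" shows "y ** a : J'"
proof -
 have yc: "y : car R" using y J'_carrier by blast
 have 1: "y ** E w : J'" if w: "w : LB" for w
 proof (rule vspan_image[OF vs_R vs_R lin_right[OF E_closed[OF w]] J'_sub gens_carrier _ y[unfolded J'_def]])
 fix z assume "z : gens"
 then obtain u x v where z: "z = E u ** (x ** E v)" "u : LB" "v : LB" "x : (\<Union>n. J \<inter> deg n)"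
 unfolding gens_def by blast
 have x: "x : car R" using z(4) J_carrier by blast
 have "z ** E w = E u ** (x ** (E v ** E w))" (is "?x = _")
 unfolding z(1) by (simp only: RA.m_assoc RA.m_closed E_closed w z(2,3) x)
 also have "... = E u ** (x ** E (v @ w))" (is "_ = ?y") by (simp only: E_append z(3) w)
 finally have "?x = ?y" .
 moreover have "v @ w : LB" using w z(3) by simp
 ultimately have "z ** E w : gens" unfolding gens_def using z(2,4) by blast
 thus "z ** E w : J'" using gens_J' by blast
 qed
 show ?thesis by (rule E_mem[OF vs_R J'_sub lin_left[OF yc] 1 a])
qed

lemma J_le_J': "J <= J'"
proof -
 have "x : gens" if "x : (\<Union>n. J \<inter> deg n)" for x
 proof -
 have "x : car R" using that J_carrier by blast
 hence "x = E [] ** (x ** E [])" by (simp add: E_Nil[symmetric])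
 thus ?thesis unfolding gens_def using that lists.Nil by blast
 qed
 hence "vspan R (\<Union>n. J \<inter> deg n) <= J'" using gens_J' by (intro vspan_minimal[OF J'_sub]) blast
 thus ?thesis using candD(6)[OF cand_J] by blast
qed

lemma p1_prod:
 assumes x: "x : car R" and y: "y : car R"
 shows "p1 (x ** y) = ep x \<odot>\<^bsub>M\<^esub> p1 y \<oplus>\<^bsub>M\<^esub> ep y \<odot>\<^bsub>M\<^esub> p1 x"
proof (rule functional_eqI[OF vs_M])
 fix ph assume ph: "ph : lin M scalars"
 note l = lin_comp[OF _ lin_comp[OF p1_linear ph]]
 have pc: "p1 z : car M" if "z : car R" for z by (rule lin_closed[OF p1_linear that])
 have f: "ph (c \<odot>\<^bsub>M\<^esub> m \<oplus>\<^bsub>M\<^esub> d \<odot>\<^bsub>M\<^esub> m') = c * ph m + d * ph m'" if "m : car M" "m' : car M" for c d m m'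
 using that by (simp add: lin_add[OF ph] lin_smult[OF ph] vs_smult_closed[OF vs_M])
 have q: "(%z. ep z * c + d * ph (p1 z)) : lin R scalars" for c d
 using lin_plus[OF vsk lin_mult_right[OF R_counit, of c] lin_mult_left[OF l[OF lin_id], of d]] by simp
 have 1: "ph (p1 (E u ** E v)) = ep (E u) * ph (p1 (E v)) + ep (E v) * ph (p1 (E u))" if "u : LB" "v : LB" for u v
 by (simp only: p1_mult[OF that] f pc E_closed that)
 have 2: "ALL x:car R. ph (p1 (x ** E v)) = ep x * ph (p1 (E v)) + ep (E v) * ph (p1 x)" if v: "v : LB" for v
 by (rule E_ball[OF l[OF lin_right[OF E_closed[OF v]]] q 1[OF _ v]])
 have q': "(%z. c * ph (p1 z) + ep z * d) : lin R scalars" for c d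
 using lin_plus[OF vsk lin_mult_left[OF l[OF lin_id], of c] lin_mult_right[OF R_counit, of d]] by simp
 have "ALL y:car R. ph (p1 (x ** y)) = ep x * ph (p1 y) + ep y * ph (p1 x)"
 by (rule E_ball[OF l[OF lin_left[OF x]] q' bspec[OF 2 x]])
 thus "ph (p1 (x ** y)) = ph (ep x \<odot>\<^bsub>M\<^esub> p1 y \<oplus>\<^bsub>M\<^esub> ep y \<odot>\<^bsub>M\<^esub> p1 x)"
 using x y by (simp add: f pc)
next
 have pc: "p1 z : car M" if "z : car R" for z by (rule lin_closed[OF p1_linear that])
 show "p1 (x ** y) : car M" "ep x \<odot>\<^bsub>M\<^esub> p1 y \<oplus>\<^bsub>M\<^esub> ep y \<odot>\<^bsub>M\<^esub> p1 x : car M"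
 by (intro pc RA.m_closed x y vs_add_closed[OF vs_M] vs_smult_closed[OF vs_M])+
qed

lemma J'_prod: "x : car R ==> y : car R ==> x : J' \<or> y : J' ==> x ** y : J'"
 using J'_left J'_right by blast

text \<open>Stability under action and coaction relative to \<open>J'\<close>, stated for single
  elements because it passes from one factor to a product with an arbitrary element; see
  \<open>good_prod\<close>.\<close>

definition good where
 "good x \<longleftrightarrow> (ALL h:car H. act R h x : J') & de x : hsp J'"

lemma good_prod:
 assumes x: "x : car R" and y: "y : car R" and g: "good x \<or> good y"
 shows "good (x ** y)"
proof -
 have a: "act R h (x ** y) : J'" if h: "h : car H" for h
 unfolding R_act_prod[OF h x y]
 proof (rule Hb.HH.tensor_sum_mem[OF vs_R J'_sub _ _ subset_refl subset_refl])
 show "bil H H R (%h1 h2. act R h1 x ** act R h2 y)" by ((assumption | rule Rl x y)+)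
 show "comult H h : tensor_span H H (car H) (car H)"
 unfolding Hb.HH.tensor_span_carrier by (rule Hb.comult_closed[OF h])
 fix h1 h2 assume "h1 : car H" "h2 : car H"
 thus "act R h1 x ** act R h2 y : J'"
 by (intro J'_prod R_act_closed x y) (use g in \<open>auto simp: good_def\<close>)
 qed
 have b1: "bil H R HR (%g' y0. pt H R (g \<otimes>\<^bsub>H\<^esub> g') (x0 ** y0))" if "g : car H" "x0 : car R" for g x0
 using that by - ((assumption | rule Rl)+)
 have b2: "bil H R HR (%g x0. tsum HR (de y) (%g' y0. pt H R (g \<otimes>\<^bsub>H\<^esub> g') (x0 ** y0)))"
 by ((assumption | rule Rl y)+)
 \<comment> \<open>One of \<open>A\<close> and \<open>B\<close> is \<open>J'\<close>, for the factor
   known to be good, and the other is the whole space, so that both cases share the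
   argument.\<close>
 have "\<exists>A B. A <= car R & B <= car R & de x : hsp A & de y : hsp B & (A = J' \<or> B = J')"
 using g R_coact_closed[OF x] R_coact_closed[OF y] J'_carrier HR.tensor_span_carrier unfolding good_def by blast
 then obtain A B where A: "A <= car R" "de x : hsp A" and B: "B <= car R" "de y : hsp B" and AB: "A = J' \<or> B = J'"
 by blast
 have "de (x ** y) : hsp J'"
 unfolding R_coact_prod[OF x y]
 proof (rule HR.tensor_sum_mem[OF HR.vs_tensor hsp_sub[OF J'_carrier] b2 A(2) subset_refl A(1)])
 fix g x0 assume g: "g : car H" and x0: "x0 : A"
 have x0c: "x0 : car R" using x0 A by blast
 show "tsum HR (de y) (%g' y0. pt H R (g \<otimes>\<^bsub>H\<^esub> g') (x0 ** y0)) : hsp J'"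
 proof (rule HR.tensor_sum_mem[OF HR.vs_tensor hsp_sub[OF J'_carrier] b1[OF g x0c] B(2) subset_refl B(1)])
 fix g' y0 assume "g' : car H" "y0 : B"
 thus "pt H R (g \<otimes>\<^bsub>H\<^esub> g') (x0 ** y0) : hsp J'"
 by (intro hsp_pure J'_carrier J'_prod H.m_closed g) (use A B AB x0 in blast)+
 qed
 qed
 with a show ?thesis by (simp add: good_def)
qed

lemma gensE:
 assumes "z : gens"
 obtains u x v n where "z = E u ** (x ** E v)" "u : LB" "v : LB" "x : J" "x : deg n" "x : car R"
 using assms J_carrier unfolding gens_def by blast

lemma J'_good: "y : J' ==> good y"
proof -
 assume y: "y : J'"
 have g: "good z" if zg: "z : gens" for z
 proof -
 obtain u x v n where z: "z = E u ** (x ** E v)" "u : LB" "v : LB" "x : J" "x : deg n" "x : car R"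
 by (rule gensE[OF zg])
 have "good x"
 unfolding good_def using candD(2,3)[OF cand_J z(4)] tensor_span_mono[OF subset_refl J_le_J'] J_le_J' by blast
 thus ?thesis unfolding z(1) by (intro good_prod RA.m_closed E_closed z disjI2 disjI1)
 qed
 have "act R h y : J'" if h: "h : car H" for h
 by (rule vspan_image[OF vs_R vs_R R_act_right[OF h] J'_sub gens_carrier _ y[unfolded J'_def]])
 (use g h in \<open>simp add: good_def\<close>)
 moreover have "de y : hsp J'"
 by (rule vspan_image[OF vs_R HR.vs_tensor R_coact hsp_sub[OF J'_carrier] gens_carrier _ y[unfolded J'_def]])
 (use g in \<open>simp add: good_def\<close>)
 ultimately show ?thesis by (simp add: good_def)
qed

lemma braided_ksp:
 assumes c: "a : car R" "b : car R" "a' : car R" "b' : car R"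
 and J: "a : J' \<or> b : J' \<or> a' : J' \<or> b' : J'"
 shows "tsum RR (de b) (%g b0. pt R R (a ** act R g a') (b0 ** b')) : ksp J'"
proof -
 define B where "B = (if b : J' then J' else car R)"
 have B: "B <= car R" "de b : hsp B"
 using J'_good[of b] R_coact_closed[OF c(2)] J'_carrier by (simp_all add: B_def good_def HR.tensor_span_carrier)
 show ?thesis
 proof (rule HR.tensor_sum_mem[OF RR.vs_tensor ksp_sub(1)[OF J'_carrier] braided_bil(1)[OF c(1,3,4)] B(2) subset_refl B(1)])
 fix g b0 assume g: "g : car H" and b0: "b0 : B"
 have b0c: "b0 : car R" and b0J: "b : J' ==> b0 : J'" using b0 B by (auto simp: B_def)
 have ga: "act R g a' : car R" "a' : J' ==> act R g a' : J'"
 using R_act_closed[OF g c(3)] J'_good[of a'] g by (auto simp: good_def)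
 have "a ** act R g a' : J' \<or> b0 ** b' : J'"
 using J J'_prod[OF c(1) ga(1)] J'_prod[OF b0c c(4)] ga(2) b0J by blast
 thus "pt R R (a ** act R g a') (b0 ** b') : ksp J'"
 by (intro ksp_pure J'_carrier RA.m_closed c ga(1) b0c)
 qed
qed

text \<open>A braided product with one factor in J' tensor R + R tensor J' stays there:
  \<open>J'\<close> is an ideal, and it is stable under the coaction and the action through which
  the middle factors are braided.\<close>

lemma comult_ksp:
 assumes x: "x : car R" and y: "y : car R" and d: "De x : ksp J' \<or> De y : ksp J'"
 shows "De (x ** y) : ksp J'"
proof -
 note D = R_comult_closed[OF x] R_comult_closed[OF y] and k = ksp_sub(1)[OF J'_carrier]
 from d show ?thesis
 proof
 assume X: "De x : ksp J'"
 show ?thesis unfolding R_comult_prod[OF x y] braided_mult_def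
 proof (rule ksp_mem[OF J'_carrier RR.vs_tensor k braided_bil(3)[OF D(2)] X])
 fix a b assume ab: "a : car R" "b : car R" "a : J' \<or> b : J'"
 show "tsum RR (De y) (%a' b'. tsum RR (de b) (%g b0.
 pt R R (a ** act R g a') (b0 ** b'))) : ksp J'"
 by (rule RR.tensor_sum_mem[OF RR.vs_tensor k braided_bil(2)[OF ab(1,2)] D(2)[folded RR.tensor_span_carrier] subset_refl subset_refl])
 (rule braided_ksp; use ab in blast)
 qed
 next
 assume Y: "De y : ksp J'"
 show ?thesis unfolding R_comult_prod[OF x y] braided_mult_def
 proof (rule RR.tensor_sum_mem[OF RR.vs_tensor k braided_bil(3)[OF D(2)] D(1)[folded RR.tensor_span_carrier] subset_refl subset_refl])
 fix a b assume ab: "a : car R" "b : car R"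
 show "tsum RR (De y) (%a' b'. tsum RR (de b) (%g b0.
 pt R R (a ** act R g a') (b0 ** b'))) : ksp J'"
 by (rule ksp_mem[OF J'_carrier RR.vs_tensor k braided_bil(2)[OF ab] Y]) (rule braided_ksp; use ab in blast)
 qed
 qed
qed

text \<open>Degrees add, so the generators are homogeneous. The middle factor \<open>x\<close> is
  killed by the counit and by \<open>p1\<close>, and \<open>p1\<close> is a derivation relative to
  the counit; hence both kill the whole product.\<close>

lemma cand_J': "cand J'"
proof (rule candI[OF gens_carrier J'_def])
 fix z assume zg: "z : gens"
 hence zJ: "z : J'" using gens_J' by blast
 obtain u x v n where z: "z = E u ** (x ** E v)" "u : LB" "v : LB" "x : J" "x : deg n" and x: "x : car R"
 by (rule gensE[OF zg])
 note c = E_closed[OF z(2)] E_closed[OF z(3)]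
 note xc = RA.m_closed[OF x c(2)]
 show "act R h z : J'" if "h : car H" for h using J'_good[OF zJ] that by (simp add: good_def)
 show "de z : hsp J'" using J'_good[OF zJ] by (simp add: good_def)
 have "De x : ksp J'"
 using candD(4)[OF cand_J z(4)] set_add_mono[OF tensor_span_mono[OF J_le_J' subset_refl] tensor_span_mono[OF subset_refl J_le_J']] by blast
 thus "De z : ksp J'" unfolding z(1) by (intro comult_ksp c x xc disjI2 disjI1)
 have e: "ep x = 0" "p1 x = (zero M)" using candD(5)[OF cand_J z(4)] cand_p1[OF cand_J z(4)] by auto
 show "ep z = 0" unfolding z(1) by (simp add: R_counit_mult c x xc e)
 have n: "c \<odot>\<^bsub>M\<^esub> (zero M) = (zero M)" "m : car M ==> 0 \<odot>\<^bsub>M\<^esub> m = (zero M)" for c m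
 by (rule vs_smult_zero[OF vs_M] vs_zero_smult[OF vs_M])+
 show "p1 z = (zero M)" unfolding z(1)
 by (simp add: p1_prod R_counit_mult c x xc e n lin_closed[OF p1_linear] vs_zero_add[OF vs_M] vs_zero_closed[OF vs_M])
 have "z : deg (length u + (n + length v))" unfolding z(1) by (intro deg_mult E_deg z)
 hence "z : (\<Union>n. J' \<inter> deg n)" using zJ by blast
 thus "z : vspan R (\<Union>n. J' \<inter> deg n)"
 using vspan_submodule(2)[OF vs_R, of "\<Union>n. J' \<inter> deg n"] J'_carrier by blast
qed

lemma J'_eq: "J' = J"
 using cand_le_J[OF cand_J'] J_le_J' by blast

section \<open>The quotient by the largest candidate\<close>

sublocale JI: alg_ideal R J
proof (intro alg_ideal.intro alg_ideal_axioms.intro RA.k_algebra_axioms J_sub)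
 fix x a assume "x : J" "a : car R"
 thus "a ** x : J" "x ** a : J" using J'_left[of a x] J'_right[of a x] unfolding J'_eq by auto
qed

abbreviation "Q \<equiv> factor_space R J"
abbreviation "NR \<equiv> yd_quotient H R J"
abbreviation "cl x \<equiv> J +>\<^bsub>R\<^esub> x"

lemma same_NR: "same_space NR Q"
 by (simp add: same_space_def yd_quotient_def Let_def module.defs yd.defs yd_bialg.defs)

lemma NR_ops: "mult NR = mult Q" "one NR = one Q" "car NR = car Q"
 "act NR h X = (\<Union>x\<in>X. J +>\<^bsub>R\<^esub> act R h x)"
 "coact NR X = the_elem ((%x. tsum (tensor H Q) (coact R x) (%g y. pt H Q g (J +>\<^bsub>R\<^esub> y))) ` X)"
 "br_comult NR X = the_elem ((%x. tsum (tensor Q Q) (br_comult R x)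
 (%y z. pt Q Q (J +>\<^bsub>R\<^esub> y) (J +>\<^bsub>R\<^esub> z))) ` X)"
 "br_counit NR X = the_elem (br_counit R ` X)"
 by (simp_all add: yd_quotient_def Let_def module.defs yd.defs yd_bialg.defs)

lemmas SN = same_space(1-8)[OF same_NR]

sublocale HQ: vs2 H Q by (rule vs2I[OF Hb.vs_H JI.vs_Q])
sublocale QQ: vs2 Q Q by (rule vs2I[OF JI.vs_Q JI.vs_Q])

lemma lin_cl: "f : lin N R ==> (%x. cl (f x)) : lin N Q"
 by (rule lin_comp[OF _ JI.cl_linear])

lemma cl_zero: "x : J ==> cl x = (zero Q)"
proof -
 assume x: "x : J"
 hence xc: "x : car R" using J_carrier by blast
 have "cl x = cl (zero R)" using coset_eq_iff[OF vs_R J_sub xc vs_zero_closed[OF vs_R]] x by (simp add: vs_minus_zero[OF vs_R xc])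
 thus ?thesis using lin_zero[OF vs_R JI.vs_Q JI.cl_linear] by simp
qed

lemma coactQ_bil: "bil H R (tensor H Q) (%g y. pt H Q g (cl y))"
 and comultQ_bil: "bil R R (tensor Q Q) (%y z. pt Q Q (cl y) (cl z))"
 by ((assumption | rule bilI lin_pure1 lin_pure2 lin_cl lin_id Hb.vs_H JI.vs_Q JI.cl_closed)+)

lemma act_cl: "h : car H ==> x : car R ==> act NR h (cl x) = cl (act R h x)"
 unfolding NR_ops by (rule coset_UN[OF vs_R J_sub vs_R J_sub R_act_right]) (assumption | rule candD(2)[OF cand_J])+

lemma coact_cl: "x : car R ==>
 coact NR (cl x) = tsum (tensor H Q) (de x) (%g y. pt H Q g (cl y))"
 unfolding NR_ops
proof (rule coset_the_elem[OF vs_R J_sub HQ.vs_tensor lin_tsum_arg'[OF R_coact coactQ_bil Hb.vs_H vs_R HQ.vs_tensor]])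
 fix z assume z: "z : J"
 have "tsum (tensor H Q) (de z) (%g y. pt H Q g (cl y)) : {(zero (tensor H Q))}"
 proof (rule HR.tensor_sum_mem[OF HQ.vs_tensor submodule_zero[OF HQ.vs_tensor] coactQ_bil candD(3)[OF cand_J z] subset_refl J_carrier])
 fix g y assume g: "g : car H" and y: "y : J"
 show "pt H Q g (cl y) : {(zero (tensor H Q))}"
 unfolding cl_zero[OF y] using lin_zero[OF JI.vs_Q HQ.vs_tensor lin_pure2[OF Hb.vs_H JI.vs_Q g lin_id]] by simp
 qed
 thus "tsum (tensor H Q) (de z) (%g y. pt H Q g (cl y)) = (zero (tensor H Q))" by simp
qed

lemma comult_cl: "x : car R ==>
 br_comult NR (cl x) = tsum (tensor Q Q) (De x) (%y z. pt Q Q (cl y) (cl z))"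
 unfolding NR_ops
proof (rule coset_the_elem[OF vs_R J_sub QQ.vs_tensor lin_tsum_arg'[OF R_comult comultQ_bil vs_R vs_R QQ.vs_tensor]])
 fix z assume z: "z : J"
 have "tsum (tensor Q Q) (De z) (%y z. pt Q Q (cl y) (cl z)) : {(zero (tensor Q Q))}"
 proof (rule ksp_mem[OF J_carrier QQ.vs_tensor submodule_zero[OF QQ.vs_tensor] comultQ_bil candD(4)[OF cand_J z]])
 fix u v assume u: "u : car R" and v: "v : car R" and uv: "u : J \<or> v : J"
 have "pt Q Q (cl u) (cl v) = (zero (tensor Q Q))"
 using uv lin_zero[OF JI.vs_Q QQ.vs_tensor lin_pure2[OF JI.vs_Q JI.vs_Q JI.cl_closed[OF u] lin_id]]
 lin_zero[OF JI.vs_Q QQ.vs_tensor lin_pure1[OF JI.vs_Q JI.vs_Q JI.cl_closed[OF v] lin_id]]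
 by (elim disjE) (simp_all only: cl_zero)
 thus "pt Q Q (cl u) (cl v) : {(zero (tensor Q Q))}" by simp
 qed
 thus "tsum (tensor Q Q) (De z) (%y z. pt Q Q (cl y) (cl z)) = (zero (tensor Q Q))" by simp
qed

lemma counit_cl: "x : car R ==> br_counit NR (cl x) = ep x"
 unfolding NR_ops by (rule coset_the_elem[OF vs_R J_sub vsk R_counit]) (simp_all add: candD(5)[OF cand_J])

lemma Q_linI: "(%x. f (cl x)) : lin R N ==> f : lin Q N"
proof (rule linI)
 assume l: "(%x. f (cl x)) : lin R N"
 fix X Y assume "X : car Q" "Y : car Q"
 then obtain x y where xy: "x : car R" "y : car R" "X = cl x" "Y = cl y"
 unfolding carrier_factor_space by blast
 show "f X : car N" using lin_closed[OF l xy(1)] xy by simp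
 show "f (X \<oplus>\<^bsub>Q\<^esub> Y) = f X \<oplus>\<^bsub>N\<^esub> f Y" using lin_add[OF l xy(1,2)] xy by (simp only: JI.cl_add)
next
 assume l: "(%x. f (cl x)) : lin R N"
 fix X c assume "X : car Q"
 then obtain x where x: "x : car R" "X = cl x" unfolding carrier_factor_space by blast
 show "f (c \<odot>\<^bsub>Q\<^esub> X) = c \<odot>\<^bsub>N\<^esub> f X" using lin_smult[OF l x(1)] x by (simp only: JI.cl_smult)
qed

lemma Q_cases: "X : car Q ==> EX x:car R. X = cl x"
 unfolding carrier_factor_space by blast

text \<open>The word formulas for the structure maps survive the projection, whatever linear
  relations hold between the classes of words. So the quotient is a word model, and therefore a
  braided bialgebra.\<close>

theorem word_model_NR: "word_model H M NR (%w. cl (E w))"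
proof (intro word_model.intro op_space.intro word_model_axioms.intro op_space_axioms.intro)
 show "yd_bij H M" "hopf_bij H" by unfold_locales
 show "k_algebra NR" by (rule k_algebra_same[OF same_NR NR_ops(1,2) JI.k_algebra_Q])
 show "(%h. act NR h X) : lin H NR" if X: "X : car NR" for X
 proof -
 obtain x where x: "x : car R" "X = cl x" using Q_cases X unfolding NR_ops(3) by blast
 show ?thesis unfolding SN x(2)
 by (rule lin_cong[OF Hb.vs_H lin_cl[OF R_act_left[OF x(1)]] act_cl[OF _ x(1), symmetric]])
 qed
 show "act NR h : lin NR NR" if h: "h : car H" for h
 unfolding SN by (rule Q_linI, rule lin_cong[OF vs_R lin_cl[OF R_act_right[OF h]] act_cl[OF h, symmetric]])
 show "coact NR : lin NR (tensor H NR)"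
 unfolding SN by (rule Q_linI, rule lin_cong[OF vs_R lin_tsum_arg'[OF R_coact coactQ_bil Hb.vs_H vs_R HQ.vs_tensor] coact_cl[symmetric]])
 show "br_comult NR : lin NR (tensor NR NR)"
 unfolding SN by (rule Q_linI, rule lin_cong[OF vs_R lin_tsum_arg'[OF R_comult comultQ_bil vs_R vs_R QQ.vs_tensor] comult_cl[symmetric]])
 show "br_counit NR : lin NR scalars"
 unfolding SN by (rule Q_linI, rule lin_cong[OF vs_R R_counit counit_cl[symmetric]])
 show "cl (E w) : car NR" if "w : LB" for w unfolding NR_ops by (rule JI.cl_closed[OF E_closed[OF that]])
 show "f X = g X" if f: "f : lin NR scalars" and g: "g : lin NR scalars"
 and w: "!!w. w : LB ==> f (cl (E w)) = g (cl (E w))" and X: "X : car NR" for f g :: "_ => 'k" and X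
 proof -
 obtain x where x: "x : car R" "X = cl x" using Q_cases X unfolding NR_ops(3) by blast
 show ?thesis unfolding x(2)
 by (rule E_ext[OF lin_comp[OF JI.cl_linear f[unfolded SN]] lin_comp[OF JI.cl_linear g[unfolded SN]] w x(1)])
 qed
 show "cl (E u) \<otimes>\<^bsub>NR\<^esub> cl (E v) = cl (E (u @ v))" if "u : LB" "v : LB" for u v
 unfolding NR_ops JI.cl_mult[OF E_closed[OF that(1)] E_closed[OF that(2)]] E_append[OF that] ..
 show "(one NR) = cl (E [])" unfolding NR_ops by (simp add: E_Nil)
 show "ph (act NR h (cl (E w))) = ev (Y.aT w h) (%v. ph (cl (E v)))"
 if "h : basis H" "w : LB" "ph : lin NR scalars" for h w and ph :: "_ => 'k"
 unfolding act_cl[OF Hb.BH_carrier[OF that(1)] E_closed[OF that(2)]]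
 by (rule act_E[OF that(1,2) lin_comp[OF JI.cl_linear that(3)[unfolded SN]]])
 show "sw (coact NR (cl (E w))) F = ev2 (Y.cT w) (%g v. F g (cl (E v)))"
 if w: "w : LB" and F0: "bil H NR scalars F" for w F
 proof -
 have F: "bil H Q scalars F" using F0 unfolding bil_def SN NR_ops(3) .
 have "sw (coact NR (cl (E w))) F = sw (de (E w)) (%g y. sw (pt H Q g (cl y)) F)"
 unfolding coact_cl[OF E_closed[OF w]]
 by (rule sw_tsum[OF R_coact_closed[OF E_closed[OF w]] coactQ_bil F Hb.vs_H vs_R Hb.vs_H JI.vs_Q])
 also have "... = sw (de (E w)) (%g y. F g (cl y))"
 by (rule sw_cong[OF Hb.vs_H vs_R R_coact_closed[OF E_closed[OF w]]])
 (rule sw_pure[OF F _ JI.cl_closed Hb.vs_H JI.vs_Q])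
 also have "... = ev2 (Y.cT w) (%g v. F g (cl (E v)))"
 by (rule coact_E[OF w]) ((assumption | rule lin_bil1[OF F] lin_bil2[OF F] lin_cl JI.cl_closed bilI lin_id)+)
 finally show ?thesis .
 qed
 show "sw (br_comult NR (cl (E w))) G = ev2 (Y.dT w) (%u v. G (cl (E u)) (cl (E v)))"
 if w: "w : LB" and G0: "bil NR NR scalars G" for w G
 proof -
 have G: "bil Q Q scalars G" using G0 unfolding bil_def SN NR_ops(3) .
 have "sw (br_comult NR (cl (E w))) G = sw (De (E w)) (%y z. sw (pt Q Q (cl y) (cl z)) G)"
 unfolding comult_cl[OF E_closed[OF w]]
 by (rule sw_tsum[OF R_comult_closed[OF E_closed[OF w]] comultQ_bil G vs_R vs_R JI.vs_Q JI.vs_Q])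
 also have "... = sw (De (E w)) (%y z. G (cl y) (cl z))"
 by (rule sw_cong[OF vs_R vs_R R_comult_closed[OF E_closed[OF w]]])
 (rule sw_pure[OF G JI.cl_closed JI.cl_closed JI.vs_Q JI.vs_Q])
 also have "... = ev2 (Y.dT w) (%u v. G (cl (E u)) (cl (E v)))"
 by (rule comult_E[OF w]) ((assumption | rule lin_bil1[OF G] lin_bil2[OF G] lin_cl JI.cl_closed bilI lin_id)+)
 finally show ?thesis .
 qed
 show "br_counit NR (cl (E w)) = Y.eT w" if "w : LB" for w
 unfolding counit_cl[OF E_closed[OF that]] by (rule counit_E[OF that])
qed

end

lemma image_submodule:
 assumes "vs M" "vs N" "f : lin M N" shows "submodule (f ` car M) scalars N"
 unfolding vs_subspace_iff[OF assms(2)]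
proof (intro conjI ballI allI)
 show "f ` car M <= car N" using lin_closed[OF assms(3)] by blast
 show "(zero N) : f ` car M"
 by (rule image_eqI[where f=f, OF lin_zero[OF assms, symmetric] vs_zero_closed[OF assms(1)]])
 fix x assume "x : f ` car M"
 then obtain a where a: "x = f a" "a : car M" by (rule imageE)
 show "c \<odot>\<^bsub>N\<^esub> x : f ` car M" for c
 unfolding a(1) by (rule image_eqI[where f=f, OF lin_smult[OF assms(3) a(2), symmetric] vs_smult_closed[OF assms(1) a(2)]])
 fix y assume "y : f ` car M"
 then obtain b where b: "y = f b" "b : car M" by (rule imageE)
 show "x \<oplus>\<^bsub>N\<^esub> y : f ` car M"
 unfolding a(1) b(1) by (rule image_eqI[where f=f, OF lin_add[OF assms(3) a(2) b(2), symmetric] vs_add_closed[OF assms(1) a(2) b(2)]])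
qed

lemma lin_zero_map: "vs N ==> (%x. (zero N)) : lin M N"
 by (rule linI) (simp_all add: vs_zero_closed vs_zero_add vs_smult_zero)

section \<open>Degrees in the tensor algebra and the projection onto degree one\<close>

context tensor_words
begin

abbreviation "words n \<equiv> {w : LC. length w = n}"

lemma T_coset_eq: "X : car T ==> f : X ==> f : car W & X = rel +>\<^bsub>W\<^esub> f"
proof -
 assume "X : car T" and f: "f : X"
 then obtain g where g: "g : car W" "X = rel +>\<^bsub>W\<^esub> g" unfolding tensor_alg_def carrier_factor_space by blast
 show ?thesis using f coset_mem_iff[OF vs_W rel_sub g(1), of f] unfolding g(2) by blast
qed

lemma degree_iff: "X : tensor_alg_degree M n \<longleftrightarrow> (\<exists>f. ks f <= words n & X = rel +>\<^bsub>W\<^esub> f)" (is "?l \<longleftrightarrow> ?r")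
proof
 assume ?l
 then obtain f where X: "X : car T" and f: "f : X" "ALL w:ks f. length w = n"
 unfolding tensor_alg_degree_def by blast
 hence "f : car W" "X = rel +>\<^bsub>W\<^esub> f" using T_coset_eq by blast+
 thus ?r using f(2) by auto
next
 assume ?r
 then obtain f where f: "ks f <= words n" "X = rel +>\<^bsub>W\<^esub> f" by blast
 have fW: "f : car W" using f(1) by auto
 have "X : car T" unfolding f(2) tensor_alg_def by (rule WI.cl_closed[OF fW])
 moreover have "f : X" unfolding f(2) coset_mem_iff[OF vs_W rel_sub fW] using fW by blast
 ultimately show ?l unfolding tensor_alg_degree_def using f(1) by blast
qed

text \<open>A homogeneous element has a representative supported on words of its degree, and such
  representatives are spanned by single words.\<close>

lemma degree_mem:
 assumes "vs N" "ph : lin T N" "submodule S scalars N" "X : tensor_alg_degree M n"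
 and "!!w. w : LC ==> length w = n ==> ph (cw w) : S"
 shows "ph X : S"
proof -
 obtain f where f: "ks f <= words n" "X = rel +>\<^bsub>W\<^esub> f" using assms(4) unfolding degree_iff by blast
 have cl: "(%x. rel +>\<^bsub>W\<^esub> x) : lin W T" unfolding tensor_alg_def by (rule WI.cl_linear)
 note l = lin_comp[OF cl assms(2)]
 have FW: "f : car W" if "f : car (free_space (words n) :: ('k, _) module)" for f using that by auto
 have l': "(%f. ph (rel +>\<^bsub>W\<^esub> f)) : lin (free_space (words n)) N"
 by (rule linI)
 (use lin_closed[OF l FW] lin_add[OF l FW FW] lin_smult[OF l FW] in simp_all)
 show ?thesis unfolding f(2)
 proof (rule vspan_image[OF vs_free_space assms(1) l' assms(3)])
 show "f : vspan (free_space (words n)) ((%x. sg x 1) ` words n)" by (rule free_space_span) (use f(1) in simp)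
 show "(%x. sg x (1 :: 'k)) ` words n <= car (free_space (words n))" by auto
 fix x :: "'a list \<Rightarrow>\<^sub>0 'k" assume "x : (%x. sg x 1) ` words n"
 thus "ph (rel +>\<^bsub>W\<^esub> x) : S" using assms(5) unfolding word_class_def by blast
 qed
qed

lemma degree_word: "w : LC ==> cw w : tensor_alg_degree M (length w)"
 unfolding degree_iff word_class_def by (rule exI[of _ "sg w 1"]) (simp add: keys_sg_subset)

lemma degree_mult: "X : tensor_alg_degree M m ==> Y : tensor_alg_degree M n ==> X \<otimes>\<^bsub>T\<^esub> Y : tensor_alg_degree M (m + n)"
proof -
 assume "X : tensor_alg_degree M m" "Y : tensor_alg_degree M n"
 then obtain f g where f: "ks f <= words m" "X = rel +>\<^bsub>W\<^esub> f" and g: "ks g <= words n" "Y = rel +>\<^bsub>W\<^esub> g"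
 unfolding degree_iff by blast
 have uv: "u @ v : words (m + n)" if "u : ks f" "v : ks g" for u v using that f(1) g(1) by auto
 have "f \<otimes>\<^bsub>W\<^esub> g = (\<Sum>u\<in>ks f. \<Sum>v\<in>ks g. sg (u @ v) (lk f u * lk g v))" by (simp add: word_algebra_def)
 hence "ks (f \<otimes>\<^bsub>W\<^esub> g) <= words (m + n)" by (simp only:) (intro keys_sum_subset keys_sg_subset uv)
 moreover have "X \<otimes>\<^bsub>T\<^esub> Y = rel +>\<^bsub>W\<^esub> (f \<otimes>\<^bsub>W\<^esub> g)"
 unfolding f(2) g(2) tensor_alg_def by (rule WI.cl_mult) (use f(1) g(1) in auto)
 ultimately show ?thesis unfolding degree_iff by blast
qed

text \<open>The function on words whose linear extension \<open>p1\<close> is the projection of T(M)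
  onto its part of degree one, identified with M. The default zero is the value on words of every
  other length.\<close>

definition letter :: "'a list => 'a" where
 "letter w = (case w of [x] => x | _ => (zero M))"

lemma letter_simps [simp]: "letter [] = (zero M)" "letter [x] = x" "letter (x # y # w) = (zero M)"
 by (simp_all add: letter_def)

lemma letter_length: "length w ~= 1 ==> letter w = (zero M)"
 by (cases w rule: list.exhaust; cases "tl w") simp_all

lemma mlin_letter: "mlin M letter"
 unfolding mlin_def
proof (intro conjI ballI)
 fix w assume "w : LC"
 thus "letter w : car M"
 by (cases w; cases "tl w") (auto simp: vs_zero_closed[OF vsM])
next
 fix u v
 show "(%x. letter (u @ x # v)) : lin M M"
 proof (cases "u = [] & v = []")
 case True thus ?thesis by (simp add: lin_id)
 next
 case False
 hence "length (u @ x # v) ~= 1" for x by auto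
 hence "(%x. letter (u @ x # v)) = (%x. (zero M))" using letter_length by blast
 thus ?thesis by (simp only: lin_zero_map[OF vsM])
 qed
qed


text \<open>The multilinear function that agrees with \<open>f\<close> on basis words, the analogue
  of \<open>ext2\<close> for words. It shows that the values of a functional on T(M) can be
  prescribed on basis words, as \<open>T_functional\<close> states.\<close>

primrec word_ext :: "('a list => 'k) => 'a list => 'k" where
 "word_ext f [] = f []"
| "word_ext f (x # w) = ev (coords M x) (%a. word_ext (%v. f (a # v)) w)"

lemma word_ext_basis: "w : lists (basis M) ==> word_ext f w = f w"
 by (induction w arbitrary: f) (simp_all add: coords_basis[OF vsM])

lemma mlin_word_ext: "mlin scalars (word_ext f)"
proof -
 have "(%x. word_ext f (u @ x # v)) : lin M scalars" for u v
 proof (induction u arbitrary: f)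
 case Nil show ?case by (simp, rule lin_ev_coords[OF vsM lin_id])
 next
 case (Cons a u) show ?case by (simp, rule lin_ev_fun, rule Cons)
 qed
 thus ?thesis unfolding mlin_def by simp
qed

end

declare (in yd_words) T_ops [simp del]

section \<open>The Nichols algebra as a word model\<close>

context yd_words
begin

abbreviation "p1 X \<equiv> class_sum M X TW.letter"

sublocale GM: graded_model H M TB cw "tensor_alg_degree M" "%x. cw [x]" "%X. p1 X"
proof
 note p1l = TW.class_sum_linear[OF vs_M TW.mlin_letter] and p1w = TW.class_sum_word[OF vs_M TW.mlin_letter]
 show "tensor_alg_degree M n <= car TB" for n unfolding T_ops tensor_alg_degree_def by blast
 show "cw w : tensor_alg_degree M (length w)" if "w : LB" for w by (rule TW.degree_word[OF LB_LC[OF that]])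
 show "X \<otimes>\<^bsub>TB\<^esub> Y : tensor_alg_degree M (m + n)" if "X : tensor_alg_degree M m" "Y : tensor_alg_degree M n" for X Y m n
 unfolding T_ops(3) by (rule TW.degree_mult[OF that])
 have i: "(%x. cw [x]) : lin M T" by (rule lin_cw[OF lin_id lists.Nil])
 thus "(%x. cw [x]) : lin M TB" unfolding STB .
 show "(%X. p1 X) : lin TB M" unfolding STB by (rule p1l)
 show "p1 (cw [x]) = x" if "x : car M" for x using that by (subst p1w) simp_all
 show "tensor_alg_degree M 1 <= (%x. cw [x]) ` car M"
 proof
 fix X assume X: "X : tensor_alg_degree M 1"
 show "X : (%x. cw [x]) ` car M"
 proof (rule TW.degree_mem[OF vs_T lin_id image_submodule[OF vs_M vs_T i] X])
 fix w assume "w : LC" "length w = 1"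
 thus "cw w : (%x. cw [x]) ` car M" by (cases w) auto
 qed
 qed
 show "p1 X = (zero M)" if X: "X : tensor_alg_degree M n" and n: "n ~= 1" for X n
 using TW.degree_mem[OF vs_M p1l submodule_zero[OF vs_M] X] p1w TW.letter_length n by simp
 show "p1 (cw u \<otimes>\<^bsub>TB\<^esub> cw v) = br_counit TB (cw u) \<odot>\<^bsub>M\<^esub> p1 (cw v) \<oplus>\<^bsub>M\<^esub> br_counit TB (cw v) \<odot>\<^bsub>M\<^esub> p1 (cw u)"
 if u: "u : LB" and v: "v : LB" for u v
 proof -
 have c: "TW.letter w : car M" if "w : LB" for w by (rule TW.mlinD(1)[OF TW.mlin_letter LB_LC[OF that]])
 have uv: "u @ v : LC" using LB_LC u v by auto
 have one: "1 \<odot>\<^bsub>M\<^esub> x = x" if "x : car M" for x using smult_one[OF that] by simp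
 have z: "x \<oplus>\<^bsub>M\<^esub> (zero M) = x" if "x : car M" for x using that by simp
 have "TW.letter (u @ v) = Y.eT u \<odot>\<^bsub>M\<^esub> TW.letter v \<oplus>\<^bsub>M\<^esub> Y.eT v \<odot>\<^bsub>M\<^esub> TW.letter u"
 proof (cases "u = [] \<or> v = []")
 case True
 thus ?thesis using c[OF u] c[OF v]
 by (elim disjE) (simp_all add: one z Y.eT_def vs_smult_zero[OF vs_M] vs_zero_smult[OF vs_M] vs_zero_add[OF vs_M] vs_zero_closed[OF vs_M] vs_smult_closed[OF vs_M])
 next
 case False
 hence "length (u @ v) ~= 1" by (cases u; cases v) auto
 thus ?thesis using False c[OF u] c[OF v]
 by (simp add: TW.letter_length Y.eT_def vs_zero_smult[OF vs_M] vs_zero_add[OF vs_M] vs_zero_closed[OF vs_M])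
 qed
 thus ?thesis
 unfolding T_ops(3) TW.cw_append[OF LB_LC[OF u] LB_LC[OF v]] counit_TB(2)[OF LB_LC[OF u]] counit_TB(2)[OF LB_LC[OF v]]
 p1w[OF uv] p1w[OF LB_LC[OF u]] p1w[OF LB_LC[OF v]] .
 qed
qed

lemma nichols_ideal_eq: "nichols_ideal H M = GM.J"
proof -
 have "nichols_candidate H M = GM.cand" by (rule ext) (simp only: nichols_candidate_def GM.cand_def)
 thus ?thesis unfolding nichols_ideal_def by (simp only: GM.J_maximal)
qed

lemma nichols_algebra_eq: "nichols_algebra H M = GM.NR"
 by (simp only: nichols_algebra_def nichols_ideal_eq)

abbreviation "N \<equiv> nichols_algebra H M"
abbreviation "nw w \<equiv> nichols_ideal H M +>\<^bsub>TB\<^esub> cw w"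

lemma word_model_N: "word_model H M N nw"
 unfolding nichols_algebra_eq nichols_ideal_eq by (rule GM.word_model_NR)

lemma incl_N: "nichols_incl H M x = nw [x]"
 by (simp only: nichols_incl_def)

lemma nw_letter_linear: "(%x. nw [x]) : lin M N"
 unfolding nichols_algebra_eq nichols_ideal_eq GM.SN by (rule GM.lin_cl[OF GM.\<iota>_linear])

lemma T_functional: "\<exists>Ph\<in>lin TB scalars. ALL w:LB. Ph (cw w) = f w"
proof
 show "(%X. class_sum scalars X (TW.word_ext f)) : lin TB scalars"
 unfolding STB by (rule TW.class_sum_linear[OF vsk TW.mlin_word_ext])
 show "ALL w:LB. class_sum scalars (cw w) (TW.word_ext f) = f w"
 proof
 fix w assume w: "w : LB"
 show "class_sum scalars (cw w) (TW.word_ext f) = f w"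
 by (simp only: TW.class_sum_word[OF vsk TW.mlin_word_ext LB_LC[OF w]] TW.word_ext_basis[OF w])
 qed
qed

end

context letters_coord
begin

text \<open>The letter \<open>v\<close> is primitive, and of its coproduct only v tensor 1
  contributes, since \<open>b1\<close> vanishes on the empty word.\<close>

lemma bT_letter: "v : BV ==> bT (w # u) [v] = b0 w v * W.eT u"
proof -
 assume v: "v : BV"
 hence vl: "[v] : lists BV" by simp
 have "bT (w # u) [v] = ev unH (%g. ev (V.aT [v] g) (%x. b1 w x * bT u []))"
 by (simp add: VT.ev2_Do H.Si_un del: V.ev_actT(2))
 also have "... = b0 w v * W.eT u" by (simp add: VT.A_un[OF vl] bT_Nil_right del: V.ev_actT(2))
 finally show ?thesis .
qed

end

section \<open>The bi-product in coordinates\<close>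

context graded_model
begin

lemma Q_functional:
 assumes ph: "ph : lin R scalars" and k: "!!x. x : J ==> ph x = 0"
 shows "\<exists>ps\<in>lin NR scalars. ALL x:car R. ps (cl x) = ph x"
proof
 have k': "ph x = (zero scalars)" if "x : J" for x using k[OF that] by simp
 show "(%X. the_elem (ph ` X)) : lin NR scalars"
 unfolding SN by (rule factor_lift_linear[OF vs_R J_sub vsk ph k'])
 show "ALL x:car R. the_elem (ph ` cl x) = ph x"
 using coset_the_elem[OF vs_R J_sub vsk ph k'] by blast
qed

end

section \<open>The bi-product on words and basis elements\<close>

context word_model
begin

lemma Do_bil:
 assumes ph: "ph : lin R scalars" and ps: "ps : lin R scalars"
 shows "bil R R scalars (%r1 r2. sw (de r2) (%g r20. ph (act R (Sinv H g) r1) * ps r20))"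
 by ((assumption | rule lin_comp[OF _ ph] ps Hb.lin_inv_antipode Hb.inv_antipode_closed Rl)+)

text \<open>Identifies the right-hand side of (B.1), with functionals in place of beta(t, -) and
  beta(t', -), with the coordinate version \<open>Do\<close>.\<close>

lemma Do_sw:
 assumes ph: "ph : lin R scalars" and ps: "ps : lin R scalars" and r: "r : LB"
 shows "sw (De (E r)) (%r1 r2. sw (de r2) (%g r20. ph (act R (Sinv H g) r1) * ps r20)) =
 ev2 (YT.Do r) (%x y. ph (E x) * ps (E y))"
 unfolding comult_E[OF r Do_bil[OF ph ps]] YT.ev2_Do
proof (rule YT.Dr_cong[OF r])
 fix r1 r2 assume r12: "r1 : LB" "r2 : LB"
 have "sw (de (E r2)) (%g r20. ph (act R (Sinv H g) (E r1)) * ps r20) =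
 ev2 (Y.cT r2) (%g z. ph (act R (Sinv H g) (E r1)) * ps (E z))" (is "?x = _")
 by (rule coact_E[OF r12(2)]) ((assumption | rule lin_comp[OF _ ph] ps Hb.lin_inv_antipode Hb.inv_antipode_closed Rl r12)+)
 also have "... = ev2 (Y.cT r2) (%g z. ev (cSi H g) (%s. ev (Y.aT r1 s) (%a. ph (E a) * ps (E z))))" (is "_ = ?y")
 proof (rule YT.C_cong)
 fix g z assume g: "g : basis H" and z: "z : LB"
 have "ph (act R (Sinv H g) (E r1)) = ev (cSi H g) (%s. ph (act R s (E r1)))"
 by (rule Hb.cSi_lin[OF g, symmetric]) ((assumption | rule lin_comp[OF _ ph] Rl r12)+)
 also have "... = ev (cSi H g) (%s. ev (Y.aT r1 s) (%a. ph (E a)))"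
 by (intro Hb.H_cong act_E r12 ph)
 finally show "ph (act R (Sinv H g) (E r1)) * ps (E z) =
 ev (cSi H g) (%s. ev (Y.aT r1 s) (%a. ph (E a) * ps (E z)))"
 by (simp add: ev_fun_mult_right)
 qed
 finally show "?x = ?y" .
qed

abbreviation "P \<equiv> tensor R H"
abbreviation "BP \<equiv> biproduct R H"
abbreviation "PP \<equiv> tensor P P"

sublocale RH: vs2 R H by (rule vs2I[OF vs_R Hb.vs_H])
sublocale PP: vs2 P P by (rule vs2I[OF RH.vs_tensor RH.vs_tensor])

lemma same_BP: "same_space BP P"
 by (simp add: same_space_def biproduct_def Let_def module.defs bialg.defs)

lemma BP_ops:
 "mult BP X Y = tsum P X (%r h. tsum P Y (%r' h'.
 tsum P (comult H h) (%h1 h2.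
 pt R H (r ** act R h1 r') (h2 \<otimes>\<^bsub>H\<^esub> h'))))"
 "one BP = pt R H (one R) (one H)"
 "comult BP X = tsum PP X (%r h.
 tsum PP (br_comult R r) (%r1 r2.
 tsum PP (coact R r2) (%g r20.
 tsum PP (comult H h) (%h1 h2.
 pt P P (pt R H r1 (g \<otimes>\<^bsub>H\<^esub> h1)) (pt R H r20 h2)))))"
 "counit BP X = sw X (%r h. br_counit R r * counit H h)" "car BP = car P"
 by (simp_all add: biproduct_def Let_def module.defs bialg.defs)

lemmas Pl = Rl RH.vs_tensor PP.vs_tensor RH.pure_closed PP.pure_closed

abbreviation "e2 w h \<equiv> pt R H (E w) h"

lemma e2_closed: "w : LB ==> h : basis H ==> e2 w h : car P"
 by (intro RH.pure_closed E_closed Hb.BH_carrier)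

lemma P_ball:
 assumes f: "f : lin P scalars" and g: "g : lin P scalars"
 and eq: "!!w h. w : LB ==> h : basis H ==> f (e2 w h) = (g (e2 w h) :: 'k)"
 shows "ALL X:car P. f X = g X"
proof
 note lf = lin_comp[OF _ f] and lg = lin_comp[OF _ g]
 have "ALL x:car R. f (pt R H x h) = g (pt R H x h)" if h: "h : basis H" for h
 by (rule E_ball; ((assumption | rule eq lf lg Pl h)+))
 hence 2: "ALL h:car H. f (pt R H x h) = g (pt R H x h)" if x: "x : car R" for x
 using x by (intro H_ball lin_comp[OF _ f] lin_comp[OF _ g] lin_pure2 lin_id vs_R Hb.vs_H) blast+
 fix X assume X: "X : car P"
 show "f X = g X" by (rule RH.tensor_ext[OF vsk f g _ X]) (use 2 in blast)
qed

lemma mult_bils: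
 "r : car R ==> r' : car R ==> h' : car H ==>
 bil H H P (%h1 h2. pt R H (r ** act R h1 r') (h2 \<otimes>\<^bsub>H\<^esub> h'))"
 "r : car R ==> h : car H ==> bil R H P (%r' h'. tsum P (comult H h) (%h1 h2.
 pt R H (r ** act R h1 r') (h2 \<otimes>\<^bsub>H\<^esub> h')))"
 "Y : car P ==> bil R H P (%r h. tsum P Y (%r' h'. tsum P (comult H h) (%h1 h2.
 pt R H (r ** act R h1 r') (h2 \<otimes>\<^bsub>H\<^esub> h'))))"
 by ((assumption | rule Pl)+)

lemma BP_mult1: "Y : car P ==> (%X. X \<otimes>\<^bsub>BP\<^esub> Y) : lin P P"
 unfolding BP_ops by (rule lin_tsum_arg'[OF lin_id mult_bils(3) vs_R Hb.vs_H RH.vs_tensor])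

lemma BP_mult2: "X : car P ==> (%Y. X \<otimes>\<^bsub>BP\<^esub> Y) : lin P P"
 unfolding BP_ops
 by (rule lin_tsum_fun'[OF _ mult_bils(3)])
 (assumption | rule lin_tsum_arg'[OF lin_id mult_bils(2)] vs_R Hb.vs_H RH.vs_tensor)+

lemma BP_mult_closed: "X : car P ==> Y : car P ==> X \<otimes>\<^bsub>BP\<^esub> Y : car P"
 by (rule lin_closed[OF BP_mult1])

lemma BP_mult_E:
 assumes ph: "ph : lin P scalars" and r: "r : LB" and h: "h : basis H" and r': "r' : LB" and h': "h' : basis H"
 shows "ph (e2 r h \<otimes>\<^bsub>BP\<^esub> e2 r' h') =
 ev2 (cD H h) (%h1 h2. ev (Y.aT r' h1) (%x. ev (cmu H h2 h') (%m. ph (e2 (r @ x) m))))"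
proof -
 note l = lin_comp[OF _ ph] and c = E_closed[OF r] E_closed[OF r'] Hb.BH_carrier[OF h] Hb.BH_carrier[OF h']
 have "e2 r h \<otimes>\<^bsub>BP\<^esub> e2 r' h' = tsum P (comult H h) (%h1 h2.
 pt R H (E r ** act R h1 (E r')) (h2 \<otimes>\<^bsub>H\<^esub> h'))"
 unfolding BP_ops RH.tensor_sum_pure[OF RH.vs_tensor mult_bils(3)[OF RH.pure_closed[OF c(2,4)]] c(1,3)]
 by (rule RH.tensor_sum_pure[OF RH.vs_tensor mult_bils(2)[OF c(1,3)] c(2,4)])
 hence "ph (e2 r h \<otimes>\<^bsub>BP\<^esub> e2 r' h') = sw (comult H h) (%h1 h2.
 ph (pt R H (E r ** act R h1 (E r')) (h2 \<otimes>\<^bsub>H\<^esub> h')))"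
 using Hb.HH.lin_tensor_sum[OF RH.vs_tensor vsk mult_bils(1)[OF c(1,2,4)] ph Hb.comult_closed[OF c(3)]] by simp
 also have "... = ev2 (cD H h) (%h1 h2. ph (pt R H (E r ** act R h1 (E r')) (h2 \<otimes>\<^bsub>H\<^esub> h')))"
 by (rule Hb.cD_sw[OF h bil_comp[OF mult_bils(1)[OF c(1,2,4)] ph], symmetric])
 also have "... = ev2 (cD H h) (%h1 h2. ev (Y.aT r' h1) (%x. ev (cmu H h2 h') (%m. ph (e2 (r @ x) m))))"
 proof (rule Hb.H_cong(1))
 fix h1 h2 assume hh: "h1 : basis H" "h2 : basis H"
 have "ph (pt R H (E r ** act R h1 (E r')) (h2 \<otimes>\<^bsub>H\<^esub> h')) =
 ev (Y.aT r' h1) (%x. ph (pt R H (E r ** E x) (h2 \<otimes>\<^bsub>H\<^esub> h')))" (is "?x = _")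
 by (rule act_E[OF hh(1) r', of "%z. ph (pt R H (E r ** z) (h2 \<otimes>\<^bsub>H\<^esub> h'))"])
 ((assumption | rule l Pl c hh)+)
 also have "... = ev (Y.aT r' h1) (%x. ev (cmu H h2 h') (%m. ph (e2 (r @ x) m)))" (is "_ = ?y")
 proof (rule YT.A_cong)
 fix x assume x: "x : LB"
 have rx: "r @ x : LB" using r x by simp
 show "ph (pt R H (E r ** E x) (h2 \<otimes>\<^bsub>H\<^esub> h')) = ev (cmu H h2 h') (%m. ph (e2 (r @ x) m))"
 unfolding E_append[OF r x]
 by (rule Hb.cmu_lin[OF hh(2) h', symmetric]) ((assumption | rule l Pl rx)+)
 qed
 finally show "?x = ?y" .
 qed
 finally show ?thesis .
qed

lemma comult_bils:
 "r1 : car R ==> g : car H ==> r20 : car R ==>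
 bil H H PP (%h1 h2. pt P P (pt R H r1 (g \<otimes>\<^bsub>H\<^esub> h1)) (pt R H r20 h2))"
 "r1 : car R ==> h : car H ==> bil H R PP (%g r20. tsum PP (comult H h) (%h1 h2.
 pt P P (pt R H r1 (g \<otimes>\<^bsub>H\<^esub> h1)) (pt R H r20 h2)))"
 "h : car H ==> bil R R PP (%r1 r2. tsum PP (de r2) (%g r20. tsum PP (comult H h) (%h1 h2.
 pt P P (pt R H r1 (g \<otimes>\<^bsub>H\<^esub> h1)) (pt R H r20 h2))))"
 "bil R H PP (%r h. tsum PP (De r) (%r1 r2. tsum PP (de r2) (%g r20. tsum PP (comult H h) (%h1 h2.
 pt P P (pt R H r1 (g \<otimes>\<^bsub>H\<^esub> h1)) (pt R H r20 h2)))))"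
 by ((assumption | rule Pl)+)

lemma BP_comult: "comult BP : lin P PP"
 unfolding BP_ops[abs_def] by (rule RH.tensor_sum_linear[OF PP.vs_tensor comult_bils(4)])

lemma BP_comult_E:
 assumes G: "bil P P scalars G" and r: "r : LB" and h: "h : basis H"
 shows "sw (comult BP (e2 r h)) G = ev2 (Y.dT r) (%u1 u2. ev2 (Y.cT u2) (%g u20. ev2 (cD H h) (%k1 k2.
 ev (cmu H g k1) (%p. G (e2 u1 p) (e2 u20 k2)))))"
proof -
 note l = lin_bil1[OF G] lin_bil2[OF G] and rc = E_closed[OF r] and hc = Hb.BH_carrier[OF h]
 note pv = vs_R Hb.vs_H RH.vs_tensor
 let ?G = "%r1 g r20 h1 h2. G (pt R H r1 (g \<otimes>\<^bsub>H\<^esub> h1)) (pt R H r20 h2)"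
 have "sw (comult BP (e2 r h)) G = sw (De (E r)) (%r1 r2. sw (de r2) (%g r20. sw (comult H h) (?G r1 g r20)))"
 unfolding BP_ops RH.tensor_sum_pure[OF PP.vs_tensor comult_bils(4) rc hc]
 sw_tsum[OF R_comult_closed[OF rc] comult_bils(3)[OF hc] G vs_R vs_R RH.vs_tensor RH.vs_tensor]
 proof (rule sw_cong[OF vs_R vs_R R_comult_closed[OF rc]])
 fix r1 r2 assume r1: "r1 : car R" and r2: "r2 : car R"
 show "sw (tsum PP (de r2) (%g r20. tsum PP (comult H h) (%h1 h2.
 pt P P (pt R H r1 (g \<otimes>\<^bsub>H\<^esub> h1)) (pt R H r20 h2)))) G =
 sw (de r2) (%g r20. sw (comult H h) (?G r1 g r20))"
 unfolding sw_tsum[OF R_coact_closed[OF r2] comult_bils(2)[OF r1 hc] G Hb.vs_H vs_R RH.vs_tensor RH.vs_tensor]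
 proof (rule sw_cong[OF Hb.vs_H vs_R R_coact_closed[OF r2]])
 fix g r20 assume g: "g : car H" and r20: "r20 : car R"
 show "sw (tsum PP (comult H h) (%h1 h2.
 pt P P (pt R H r1 (g \<otimes>\<^bsub>H\<^esub> h1)) (pt R H r20 h2))) G =
 sw (comult H h) (?G r1 g r20)"
 unfolding sw_tsum[OF Hb.comult_closed[OF hc] comult_bils(1)[OF r1 g r20] G Hb.vs_H Hb.vs_H RH.vs_tensor RH.vs_tensor]
 by (rule sw_cong[OF Hb.vs_H Hb.vs_H Hb.comult_closed[OF hc]], rule sw_pure[OF G])
 ((assumption | rule Pl r1 g r20)+)
 qed
 qed
 also have "... = ev2 (Y.dT r) (%r1 r2. sw (de (E r2)) (%g r20. sw (comult H h) (?G (E r1) g r20)))"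
 by (rule comult_E[OF r]) ((assumption | rule l Pl hc)+)
 also have "... = ev2 (Y.dT r) (%u1 u2. ev2 (Y.cT u2) (%g u20. ev2 (cD H h) (%k1 k2.
 ev (cmu H g k1) (%p. G (e2 u1 p) (e2 u20 k2)))))"
 proof (rule YT.Dr_cong[OF r])
 fix u1 u2 assume u: "u1 : LB" "u2 : LB"
 have "sw (de (E u2)) (%g r20. sw (comult H h) (?G (E u1) g r20)) =
 ev2 (Y.cT u2) (%g u20. sw (comult H h) (?G (E u1) g (E u20)))" (is "?x = _")
 by (rule coact_E[OF u(2)]) ((assumption | rule l Pl hc u)+)
 also have "... = ev2 (Y.cT u2) (%g u20. ev2 (cD H h) (%k1 k2. ?G (E u1) g (E u20) k1 k2))"
 by (rule YT.C_cong, rule Hb.cD_sw[OF h, symmetric]) ((assumption | rule l Pl u)+)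
 also have "... = ev2 (Y.cT u2) (%g u20. ev2 (cD H h) (%k1 k2. ev (cmu H g k1) (%p. G (e2 u1 p) (e2 u20 k2))))" (is "_ = ?y")
 by (rule YT.C_cong, rule Hb.H_cong(1), rule Hb.cmu_lin[symmetric]) ((assumption | rule l Pl u)+)
 finally show "?x = ?y" .
 qed
 finally show ?thesis .
qed

lemma counit_bil: "bil R H scalars (%r h. ep r * counit H h)"
 by ((assumption | rule H.counit_linear Pl)+)

lemma BP_counit: "counit BP : lin P scalars"
 unfolding BP_ops[abs_def] by (rule RH.tensor_sum_linear[OF vsk counit_bil])

lemma BP_counit_E: "w : LB ==> h : basis H ==> counit BP (e2 w h) = Y.eT w * ce H h"
 unfolding BP_ops by (subst RH.tensor_sum_pure[OF vsk counit_bil])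
 (simp_all add: E_closed Hb.BH_carrier counit_E ce_def)

lemma BP_one: "(one BP) = pt R H (E []) (one H)" "(one BP) : car P"
 unfolding BP_ops by (simp add: E_Nil, rule RH.pure_closed[OF RA.one_closed H.one_closed])

end

text \<open>Images of words may satisfy linear relations, so a bilinear form cannot be prescribed on
  them freely. It is enough that \<open>f\<close> factors through A for each fixed word r and
  through B for each fixed word w: values extend from word images to all of B by spanning, and
  linearity follows because functionals on A are determined on words.\<close>

lemma bilinear_extension:
 fixes f :: "'w list => 'v list => 'k::field"
 assumes A: "word_model K W A EA" and B: "word_model H V B EB"
 and 1: "!!r. r : lists (basis V) ==> \<exists>Ph\<in>lin A scalars. ALL w:lists (basis W). Ph (EA w) = f w r"
 and 2: "!!w. w : lists (basis W) ==> \<exists>Ps\<in>lin B scalars. ALL r:lists (basis V). Ps (EB r) = f w r"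
 shows "\<exists>F. bil A B scalars F & (ALL w:lists (basis W). ALL r:lists (basis V). F (EA w) (EB r) = f w r)"
proof -
 interpret A: word_model K W A EA by (rule A)
 interpret B: word_model H V B EB by (rule B)
 have "ALL w:lists (basis W). \<exists>Ps. Ps : lin B scalars & (ALL r:lists (basis V). Ps (EB r) = f w r)"
 using 2 by blast
 then obtain Ps where Ps: "!!w. w : lists (basis W) ==> Ps w : lin B scalars"
 "!!w r. w : lists (basis W) ==> r : lists (basis V) ==> Ps w (EB r) = f w r"
 unfolding bchoice_iff by blast
 \<comment> \<open>The vectors \<open>Y\<close> at which the values of the functionals
   \<open>Ps w\<close> fit together to a functional on A. They form a subspace that contains all
   word images, and this subspace is then everything.\<close>
 define S where "S = {Y : car B. \<exists>Ph\<in>lin A scalars. ALL w:lists (basis W). Ph (EA w) = Ps w Y}"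
 have S: "submodule S scalars B"
 unfolding vs_subspace_iff[OF B.vs_R]
 proof (intro conjI ballI allI)
 show "S <= car B" unfolding S_def by blast
 have l: "(%x. 0 :: 'k) : lin A scalars" using lin_zero_map[OF vsk, of A] by simp
 show "(zero B) : S"
 unfolding S_def by (intro CollectI conjI vs_zero_closed[OF B.vs_R] bexI[OF _ l] ballI)
 (use lin_zero[OF B.vs_R vsk Ps(1)] in simp)
 fix Y assume "Y : S"
 then obtain Ph where Y: "Y : car B" and Ph: "Ph : lin A scalars" "ALL w:lists (basis W). Ph (EA w) = Ps w Y"
 unfolding S_def by blast
 show "c \<odot>\<^bsub>B\<^esub> Y : S" for c
 unfolding S_def
 by (intro CollectI conjI vs_smult_closed[OF B.vs_R Y] bexI[OF _ lin_mult_left[OF Ph(1), of c]] ballI)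
 (use Ph(2) lin_smult[OF Ps(1) Y] in simp)
 fix Z assume "Z : S"
 then obtain Ph' where Z: "Z : car B" and Ph': "Ph' : lin A scalars" "ALL w:lists (basis W). Ph' (EA w) = Ps w Z"
 unfolding S_def by blast
 show "Y \<oplus>\<^bsub>B\<^esub> Z : S"
 unfolding S_def
 by (intro CollectI conjI vs_add_closed[OF B.vs_R Y Z] bexI[OF _ lin_plus[OF vsk Ph(1) Ph'(1)]] ballI)
 (use Ph(2) Ph'(2) lin_add[OF Ps(1) Y Z] in simp)
 qed
 have "Y : S" if Y: "Y : car B" for Y
 proof -
 interpret BG: vspace B using B.vs_R by (rule vspaceI)
 have "EB r : S" if r: "r : lists (basis V)" for r
 proof -
 obtain Ph where Ph: "Ph : lin A scalars" "ALL w:lists (basis W). Ph (EA w) = f w r" using 1[OF r] by blast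
 show ?thesis unfolding S_def
 by (intro CollectI conjI B.E_closed[OF r] bexI[OF _ Ph(1)] ballI) (use Ph(2) Ps(2)[OF _ r] in simp)
 qed
 hence *: "S +>\<^bsub>B\<^esub> EB r = S +>\<^bsub>B\<^esub> (zero B)" if "r : lists (basis V)" for r
 using coset_eq_iff[OF B.vs_R S B.E_closed[OF that] vs_zero_closed[OF B.vs_R]] that
 by (simp only: vs_minus_zero[OF B.vs_R B.E_closed[OF that]])
 note pl = proj_linear[OF B.vs_R S]
 have "S +>\<^bsub>B\<^esub> Y = S +>\<^bsub>B\<^esub> (zero B)"
 proof (rule functional_eqI[OF vs_factor_space[OF B.vs_R S]])
 fix ph assume ph: "ph : lin (factor_space B S) scalars"
 have z: "ph (S +>\<^bsub>B\<^esub> (zero B)) = 0" using lin_zero[OF B.vs_R vsk lin_comp[OF pl ph]] by simp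
 have "ph (S +>\<^bsub>B\<^esub> Y) = 0"
 by (rule B.E_ext[OF lin_comp[OF pl ph] lin_zero_map[OF vsk, simplified] _ Y]) (simp only: * z)
 thus "ph (S +>\<^bsub>B\<^esub> Y) = ph (S +>\<^bsub>B\<^esub> (zero B))" using z by simp
 qed (rule lin_closed[OF pl] Y vs_zero_closed[OF B.vs_R])+
 thus ?thesis
 using coset_eq_iff[OF B.vs_R S Y vs_zero_closed[OF B.vs_R]] by (simp only: vs_minus_zero[OF B.vs_R Y])
 qed
 hence "ALL Y:car B. \<exists>Ph. Ph : lin A scalars & (ALL w:lists (basis W). Ph (EA w) = Ps w Y)"
 unfolding S_def by blast
 then obtain Ph where Ph: "!!Y. Y : car B ==> Ph Y : lin A scalars"
 "!!Y w. Y : car B ==> w : lists (basis W) ==> Ph Y (EA w) = Ps w Y"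
 unfolding bchoice_iff by blast
 have "bil A B scalars (%X Y. Ph Y X)"
 proof (rule bilI)
 show "(%X. Ph Y X) : lin A scalars" if "Y : car B" for Y by (rule Ph(1)[OF that])
 fix X assume X: "X : car A"
 show "(%Y. Ph Y X) : lin B scalars"
 proof (rule linI)
 fix Y Z assume Y: "Y : car B" and Z: "Z : car B"
 note YZ = vs_add_closed[OF B.vs_R Y Z]
 show "Ph (Y \<oplus>\<^bsub>B\<^esub> Z) X = Ph Y X \<oplus>\<^bsub>scalars\<^esub> Ph Z X"
 by (rule A.E_ext[OF Ph(1)[OF YZ] lin_plus[OF vsk Ph(1)[OF Y] Ph(1)[OF Z]] _ X])
 (simp only: Ph(2) Y Z YZ lin_add[OF Ps(1) Y Z])
 next
 fix c Y assume Y: "Y : car B"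
 note cY = vs_smult_closed[OF B.vs_R Y, of c]
 have "Ph (c \<odot>\<^bsub>B\<^esub> Y) X = c * Ph Y X"
 by (rule A.E_ext[OF Ph(1)[OF cY] lin_mult_left[OF Ph(1)[OF Y]] _ X])
 (simp add: Ph(2) Y cY lin_smult[OF Ps(1) Y] del: in_lists_conv_set)
 thus "Ph (c \<odot>\<^bsub>B\<^esub> Y) X = c \<odot>\<^bsub>scalars\<^esub> Ph Y X" by simp
 qed simp
 qed
 moreover have "ALL w:lists (basis W). ALL r:lists (basis V). Ph (EB r) (EA w) = f w r"
 by (intro ballI) (simp only: Ph(2) B.E_closed Ps(2))
 ultimately show ?thesis by blast
qed

section \<open>The form on Nichols algebras\<close>

locale nichols_pair = WY: yd_words K W + VY: yd_words H V
 for K :: "('k::field, 'g, 'm1) hopf_scheme" and W :: "('k, 'w, 'g, 'm2) yd_scheme"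
 and H :: "('k, 'h, 'm3) hopf_scheme" and V :: "('k, 'v, 'h, 'm4) yd_scheme" +
 fixes \<tau> :: "('g \<times> 'h \<Rightarrow>\<^sub>0 'k) set => 'k" and \<beta> :: "('w \<times> 'v \<Rightarrow>\<^sub>0 'k) set => 'k"
 assumes \<tau>_form: "\<tau> : linear_forms K H" and \<tau>_A: "conditions_A K H \<tau>"
 and \<beta>_form: "\<beta> : linear_forms W V" and \<beta>_C: "conditions_C K H W V \<tau> \<beta>"
begin

sublocale KH: vs2 K H by (rule vs2I[OF WY.Hb.vs_H VY.Hb.vs_H])
sublocale WV: vs2 W V by (rule vs2I[OF WY.vs_M VY.vs_M])

abbreviation "tau k h \<equiv> \<tau> (pt K H k h)"
abbreviation "beta w v \<equiv> \<beta> (pt W V w v)"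

lemma tau_bil: "bil K H scalars tau"
 by (rule bil_comp[OF KH.bil_pure \<tau>_form[unfolded linear_forms_def]])

lemma beta_bil: "bil W V scalars beta"
 by (rule bil_comp[OF WV.bil_pure \<beta>_form[unfolded linear_forms_def]])

lemma tau_A:
 "u : car K ==> a : car H ==> a' : car H ==>
 tau u (a \<otimes>\<^bsub>H\<^esub> a') = sw (comult K u) (%u1 u2. tau u2 a * tau u1 a')"
 "a : car H ==> tau (one K) a = counit H a"
 "u : car K ==> u' : car K ==> a : car H ==>
 tau (u \<otimes>\<^bsub>K\<^esub> u') a = sw (comult H a) (%a1 a2. tau u a1 * tau u' a2)"
 "u : car K ==> tau u (one H) = counit K u"
 using \<tau>_A unfolding conditions_A_def Let_def by blast+

definition tc where "tc k h = (if k : basis K & h : basis H then tau k h else 0)"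
definition b0 where "b0 w v = (if w : basis W & v : basis V then beta w v else 0)"

lemma tc_simps: "k : basis K ==> h : basis H ==> tc k h = tau k h"
 "k \<notin> basis K \<or> h \<notin> basis H ==> tc k h = 0"
 by (auto simp: tc_def)

lemma b0_simps: "w : basis W ==> v : basis V ==> b0 w v = beta w v"
 "w \<notin> basis W \<or> v \<notin> basis V ==> b0 w v = 0"
 by (auto simp: b0_def)

lemma pairing: "pairing_coord (basis K) (cmu K) (cun K) (cD K) (ce K) (cSi K) (basis H) (cmu H) (cun H) (cD H) (ce H) (cSi H) tc"
proof (intro pairing_coord.intro pairing_coord_axioms.intro WY.Hb.hopf_coord VY.Hb.hopf_coord)
 fix a b u
 show "ev (cmu H a b) (tc u) = ev2 (cD K u) (%u1 u2. tc u2 a * tc u1 b)"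
 proof (cases "a : basis H & b : basis H & u : basis K")
 case True
 hence u: "u : basis K" and a: "a : basis H" and b: "b : basis H" by auto
 note c = WY.Hb.BH_carrier[OF u] VY.Hb.BH_carrier[OF a] VY.Hb.BH_carrier[OF b]
 have "ev (cmu H a b) (tc u) = ev (cmu H a b) (tau u)" by (rule VY.Hb.H_cong) (simp add: tc_simps u)
 also have "... = sw (comult K u) (%u1 u2. tau u2 a * tau u1 b)"
 unfolding VY.Hb.cmu_lin[OF a b bil_right[OF tau_bil c(1)]] by (rule tau_A(1)[OF c])
 also have "... = ev2 (cD K u) (%u1 u2. tau u2 a * tau u1 b)"
 by (rule WY.Hb.cD_sw[OF u, symmetric], rule bilI) (rule lin_mult_left lin_mult_right bil_left[OF tau_bil] c)+
 also have "... = ev2 (cD K u) (%u1 u2. tc u2 a * tc u1 b)"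
 by (rule WY.Hb.H_cong(1)) (simp add: tc_simps a b)
 finally show ?thesis .
 next
 case False
 then consider "u \<notin> basis K" | "a \<notin> basis H" | "b \<notin> basis H" by blast
 thus ?thesis
 proof cases
 case 1
 hence "tc u = (%_. 0)" by (simp add: fun_eq_iff tc_simps)
 thus ?thesis using 1 by (simp add: cD_def)
 qed (simp_all add: cmu_def tc_simps)
 qed
 show "ev (cun K) (%u. tc u a) = ce H a"
 proof (cases "a : basis H")
 case a: True
 have "ev (cun K) (%u. tc u a) = ev (cun K) (%u. tau u a)" by (rule WY.Hb.H_cong) (simp add: tc_simps a)
 thus ?thesis using a
 by (simp add: WY.Hb.cun_lin bil_left[OF tau_bil] VY.Hb.BH_carrier tau_A(2) ce_def)
 qed (simp add: tc_simps ce_def)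
 fix u'
 show "ev (cmu K u u') (%x. tc x a) = ev2 (cD H a) (%a1 a2. tc u a1 * tc u' a2)"
 proof (cases "u : basis K & u' : basis K & a : basis H")
 case True
 hence u: "u : basis K" and u': "u' : basis K" and a: "a : basis H" by auto
 note c = WY.Hb.BH_carrier[OF u] WY.Hb.BH_carrier[OF u'] VY.Hb.BH_carrier[OF a]
 have "ev (cmu K u u') (%x. tc x a) = ev (cmu K u u') (%x. tau x a)" by (rule WY.Hb.H_cong) (simp add: tc_simps a)
 also have "... = sw (comult H a) (%a1 a2. tau u a1 * tau u' a2)"
 unfolding WY.Hb.cmu_lin[OF u u' bil_left[OF tau_bil c(3)]] by (rule tau_A(3)[OF c])
 also have "... = ev2 (cD H a) (%a1 a2. tau u a1 * tau u' a2)"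
 by (rule VY.Hb.cD_sw[OF a, symmetric], rule bilI) (rule lin_mult_left lin_mult_right bil_right[OF tau_bil] c)+
 also have "... = ev2 (cD H a) (%a1 a2. tc u a1 * tc u' a2)"
 by (rule VY.Hb.H_cong(1)) (simp add: tc_simps u u')
 finally show ?thesis .
 next
 case False
 then consider "a \<notin> basis H" | "u \<notin> basis K" | "u' \<notin> basis K" by blast
 thus ?thesis by cases (simp_all add: cmu_def cD_def tc_simps)
 qed
 show "ev (cun H) (tc u) = ce K u"
 proof (cases "u : basis K")
 case u: True
 have "ev (cun H) (tc u) = ev (cun H) (tau u)" by (rule VY.Hb.H_cong) (simp add: tc_simps u)
 thus ?thesis using u
 by (simp add: VY.Hb.cun_lin bil_right[OF tau_bil] WY.Hb.BH_carrier tau_A(4) ce_def)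
 next
 case False
 hence "tc u = (%_. 0)" by (simp add: fun_eq_iff tc_simps)
 thus ?thesis using False by (simp add: ce_def)
 qed
qed

lemma coact_apply_V:
 assumes v: "v : car V" and p: "p : lin H scalars" and ph: "ph : lin V scalars"
 shows "ph (coact_apply V v p) = sw (coact V v) (%h v0. p h * ph v0)"
proof -
 have b: "bil H V V (%g y. p g \<odot>\<^bsub>V\<^esub> y)" by (rule bilI) (rule lin_smult_left lin_smult_right p lin_id VY.vs_M | assumption)+
 show ?thesis unfolding coact_apply_def VY.HM.lin_tensor_sum[OF VY.vs_M vsk b ph VY.coact_closed[OF v]]
 by (rule sw_cong[OF VY.Hb.vs_H VY.vs_M VY.coact_closed[OF v]]) (simp add: lin_smult[OF ph])
qed

lemma coact_apply_W:
 assumes v: "v : car W" and p: "p : lin K scalars" and ph: "ph : lin W scalars"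
 shows "ph (coact_apply W v p) = sw (coact W v) (%h v0. p h * ph v0)"
proof -
 have b: "bil K W W (%g y. p g \<odot>\<^bsub>W\<^esub> y)" by (rule bilI) (rule lin_smult_left lin_smult_right p lin_id WY.vs_M | assumption)+
 show ?thesis unfolding coact_apply_def WY.HM.lin_tensor_sum[OF WY.vs_M vsk b ph WY.coact_closed[OF v]]
 by (rule sw_cong[OF WY.Hb.vs_H WY.vs_M WY.coact_closed[OF v]]) (simp add: lin_smult[OF ph])
qed

sublocale L: letters_coord "basis K" "cmu K" "cun K" "cD K" "ce K" "cSi K" "basis H" "cmu H" "cun H" "cD H" "ce H" "cSi H"
 tc "basis W" "cA K W" "cC K W" "basis V" "cA H V" "cC H V" b0
proof (intro letters_coord.intro letters_coord_axioms.intro pairing WY.yd_coord VY.yd_coord)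
 fix k w v h
 show "ev (cA K W k w) (%w'. b0 w' v) = ev2 (cC H V v) (%h v0. tc k h * b0 w v0)"
 proof (cases "k : basis K & w : basis W & v : basis V")
 case True
 hence k: "k : basis K" and w: "w : basis W" and v: "v : basis V" by auto
 note c = WY.Hb.BH_carrier[OF k] WY.BM_carrier[OF w] VY.BM_carrier[OF v]
 have "ev (cA K W k w) (%w'. b0 w' v) = ev (cA K W k w) (%w'. beta w' v)" by (rule WY.M_cong) (simp add: b0_simps v)
 also have "... = beta (act W k w) v" by (rule WY.cA_lin[OF k w bil_left[OF beta_bil c(3)]])
 also have "... = beta w (coact_apply V v (tau k))" using \<beta>_C c unfolding conditions_C_def by blast
 also have "... = sw (coact V v) (%h v0. tau k h * beta w v0)"
 by (rule coact_apply_V[OF c(3) bil_right[OF tau_bil c(1)] bil_right[OF beta_bil c(2)]])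
 also have "... = ev2 (cC H V v) (%h v0. tau k h * beta w v0)"
 by (rule VY.cC_sw[OF v, symmetric], rule bilI)
 (rule lin_mult_left lin_mult_right bil_right[OF tau_bil] bil_right[OF beta_bil] c)+
 also have "... = ev2 (cC H V v) (%h v0. tc k h * b0 w v0)"
 by (rule VY.M_cong(1)) (simp add: tc_simps b0_simps k w)
 finally show ?thesis .
 next
 case False
 then consider "k \<notin> basis K" | "w \<notin> basis W" | "v \<notin> basis V" by blast
 thus ?thesis by cases (simp_all add: tc_simps b0_simps cA_def cC_def)
 qed
 show "ev2 (cC K W w) (%k w0. tc k h * b0 w0 v) = ev (cSi H h) (%s. ev (cA H V s v) (b0 w))"
 proof (cases "h : basis H & w : basis W & v : basis V")
 case True
 hence h: "h : basis H" and w: "w : basis W" and v: "v : basis V" by auto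
 note c = VY.Hb.BH_carrier[OF h] WY.BM_carrier[OF w] VY.BM_carrier[OF v]
 have "ev2 (cC K W w) (%k w0. tc k h * b0 w0 v) = ev2 (cC K W w) (%k w0. tau k h * beta w0 v)"
 by (rule WY.M_cong(1)) (simp add: tc_simps b0_simps h v)
 also have "... = sw (coact W w) (%k w0. tau k h * beta w0 v)"
 by (rule WY.cC_sw[OF w], rule bilI)
 (rule lin_mult_left lin_mult_right bil_left[OF tau_bil] bil_left[OF beta_bil] c)+
 also have "... = beta (coact_apply W w (%k. tau k h)) v"
 by (rule coact_apply_W[OF c(2) bil_left[OF tau_bil c(1)] bil_left[OF beta_bil c(3)], symmetric])
 also have "... = beta w (act V (Sinv H h) v)" using \<beta>_C c unfolding conditions_C_def by blast
 also have "... = ev (cSi H h) (%s. beta w (act V s v))"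
 by (rule VY.Hb.cSi_lin[OF h, symmetric]) (rule lin_comp[OF VY.act_linear_left[OF c(3)] bil_right[OF beta_bil c(2)]])
 also have "... = ev (cSi H h) (%s. ev (cA H V s v) (beta w))"
 by (rule VY.Hb.H_cong) (rule VY.cA_lin[symmetric, OF _ v bil_right[OF beta_bil c(2)]])
 also have "... = ev (cSi H h) (%s. ev (cA H V s v) (b0 w))"
 by (rule VY.Hb.H_cong, rule VY.M_cong) (simp add: b0_simps w)
 finally show ?thesis .
 next
 case False
 then consider "h \<notin> basis H" | "v \<notin> basis V" | "w \<notin> basis W" by blast
 thus ?thesis
 proof cases
 case 3
 hence "b0 w = (%_. 0)" by (simp add: fun_eq_iff b0_simps)
 thus ?thesis using 3 by (simp add: cC_def)
 qed (simp_all add: tc_simps b0_simps cA_def cSi_def)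
 qed
qed

section \<open>The coideals pair to zero, and the form descends to the Nichols algebras\<close>

abbreviation "LW \<equiv> lists (basis W)"
abbreviation "LV \<equiv> lists (basis V)"

text \<open>Induction on \<open>r\<close> by (B.3): pairing with v # r pairs the second leg of the
  coproduct with v and the first leg with r. The coideal property puts one of the legs into
  \<open>J\<close>; there the pairing with v vanishes because it factors through \<open>p1\<close>,
  and the pairing with r vanishes by induction.\<close>

lemma radical_left:
 assumes "r : LV" "Ph : lin WY.TB scalars" "!!w. w : LW ==> Ph (WY.cw w) = L.bT w r" "x : WY.GM.J"
 shows "Ph x = 0"
 using assms
proof (induction r arbitrary: Ph x)
 case Nil
 have "ALL x:car WY.TB. Ph x = br_counit WY.TB x"
 by (rule WY.TM.E_ball[OF Nil(1) WY.TM.R_counit]) (simp only: Nil(2) L.bT_Nil_right WY.TM.counit_E)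
 thus ?case using WY.GM.candD(5)[OF WY.GM.cand_J Nil(3)] WY.GM.J_carrier Nil(3) by fastforce
next
 case (Cons v r)
 note v = Cons.hyps(1) and r = Cons.hyps(2) and vc = VY.BM_carrier[OF Cons.hyps(1)]
 define Ph1 where "Ph1 = (%X. beta (WY.p1 X) v)"
 have l1: "Ph1 : lin WY.TB scalars"
 unfolding Ph1_def by (rule lin_comp[OF WY.GM.p1_linear bil_left[OF beta_bil vc]])
 have E1: "Ph1 (WY.cw w) = L.bT w [v]" if w: "w : LW" for w
 proof -
 have p: "WY.p1 (WY.cw w) = WY.TW.letter w"
 by (rule WY.TW.class_sum_word[OF WY.vs_M WY.TW.mlin_letter WY.LB_LC[OF w]])
 have z: "beta (zero W) v = 0" using lin_zero[OF WY.vs_M vsk bil_left[OF beta_bil vc]] by simp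
 show ?thesis
 proof (cases w)
 case Nil thus ?thesis unfolding Ph1_def p by (simp add: z)
 next
 case (Cons a u)
 thus ?thesis using w unfolding Ph1_def p
 by (cases u) (simp_all add: L.bT_letter[OF v] z b0_simps v del: L.bT.simps)
 qed
 qed
 have J1: "Ph1 y = 0" if "y : WY.GM.J" for y
 unfolding Ph1_def WY.GM.cand_p1[OF WY.GM.cand_J that] using lin_zero[OF WY.vs_M vsk bil_left[OF beta_bil vc]] by simp
 obtain Ph2 where l2: "Ph2 : lin WY.TB scalars" and E2: "!!w. w : LW ==> Ph2 (WY.cw w) = L.bT w r"
 using WY.T_functional[of "%w. L.bT w r"] by blast
 have b: "bil WY.TB WY.TB scalars (%x1 x2. Ph1 x2 * Ph2 x1)"
 by (rule bilI) (rule lin_mult_left lin_mult_right l1 l2)+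
 have "ALL x:car WY.TB. Ph x = sw (br_comult WY.TB x) (%x1 x2. Ph1 x2 * Ph2 x1)"
 proof (rule WY.TM.E_ball[OF Cons.prems(1)])
 show "(%x. sw (br_comult WY.TB x) (%x1 x2. Ph1 x2 * Ph2 x1)) : lin WY.TB scalars"
 by (rule lin_tsum_arg'[OF WY.TM.R_comult b WY.TM.vs_R WY.TM.vs_R vsk])
 fix w assume w: "w : LW"
 have "L.bT w (v # r) = ev2 (WY.Y.dT w) (%u1 u2. L.bT u2 [v] * L.bT u1 r)"
 using L.bT_append_right[OF w _ r, of "[v]"] v by simp
 also have "... = sw (br_comult WY.TB (WY.cw w)) (%x1 x2. Ph1 x2 * Ph2 x1)"
 unfolding WY.TM.comult_E[OF w b] by (rule WY.YT.Dr_cong[OF w]) (simp only: E1 E2)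
 finally show "Ph (WY.cw w) = sw (br_comult WY.TB (WY.cw w)) (%x1 x2. Ph1 x2 * Ph2 x1)"
 unfolding Cons.prems(2)[OF w] .
 qed
 hence "Ph x = sw (br_comult WY.TB x) (%x1 x2. Ph1 x2 * Ph2 x1)" using WY.GM.J_carrier Cons.prems(3) by blast
 also have "... : {0}"
 proof (rule WY.GM.ksp_mem[OF WY.GM.J_carrier vsk _ b WY.GM.candD(4)[OF WY.GM.cand_J Cons.prems(3)]])
 show "submodule {0} scalars (scalars :: ('k, 'k) module)" using submodule_zero[OF vsk] by simp
 show "Ph1 x2 * Ph2 x1 : {0}" if "x1 : WY.GM.J \<or> x2 : WY.GM.J" for x1 x2
 using that J1[of x2] Cons.IH[OF l2 E2, of x1] by auto
 qed
 finally show ?case by simp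
qed

text \<open>Induction on \<open>w\<close> by (B.1). Its right side involves the coaction of the
  second leg and the action on the first, so stability of the coideal under action and coaction
  enters here besides the coideal property.\<close>

lemma radical_right:
 assumes "w : LW" "Ps : lin VY.TB scalars" "!!r. r : LV ==> Ps (VY.cw r) = L.bT w r" "y : VY.GM.J"
 shows "Ps y = 0"
 using assms
proof (induction w arbitrary: Ps y)
 case Nil
 have "ALL x:car VY.TB. Ps x = br_counit VY.TB x"
 by (rule VY.TM.E_ball[OF Nil(1) VY.TM.R_counit]) (simp only: Nil(2) L.bT.simps VY.TM.counit_E)
 thus ?case using VY.GM.candD(5)[OF VY.GM.cand_J Nil(3)] VY.GM.J_carrier Nil(3) by fastforce
next
 case (Cons a u)
 note ac = WY.BM_carrier[OF Cons.hyps(1)]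
 have z: "beta a (zero V) = 0" using lin_zero[OF VY.vs_M vsk bil_right[OF beta_bil ac]] by simp
 define Ps1 where "Ps1 = (%X. beta a (VY.p1 X))"
 have l1: "Ps1 : lin VY.TB scalars"
 unfolding Ps1_def by (rule lin_comp[OF VY.GM.p1_linear bil_right[OF beta_bil ac]])
 have E1: "Ps1 (VY.cw r) = L.b1 a r" if r: "r : LV" for r
 proof -
 have p: "VY.p1 (VY.cw r) = VY.TW.letter r"
 by (rule VY.TW.class_sum_word[OF VY.vs_M VY.TW.mlin_letter VY.LB_LC[OF r]])
 show ?thesis using r unfolding Ps1_def p
 by (cases r; cases "tl r") (auto simp: z b0_simps Cons.hyps(1))
 qed
 have J1: "Ps1 x = 0" if "x : VY.GM.J" for x
 unfolding Ps1_def VY.GM.cand_p1[OF VY.GM.cand_J that] by (rule z)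
 obtain Ps2 where l2: "Ps2 : lin VY.TB scalars" and E2: "!!r. r : LV ==> Ps2 (VY.cw r) = L.bT u r"
 using VY.T_functional[of "%r. L.bT u r"] by blast
 note b = VY.TM.Do_bil[OF l1 l2]
 let ?D = "%y. sw (br_comult VY.TB y) (%r1 r2. sw (coact VY.TB r2) (%g r20. Ps1 (act VY.TB (Sinv H g) r1) * Ps2 r20))"
 have "ALL y:car VY.TB. Ps y = ?D y"
 proof (rule VY.TM.E_ball[OF Cons.prems(1)])
 show "?D : lin VY.TB scalars"
 by (rule lin_tsum_arg'[OF VY.TM.R_comult b VY.TM.vs_R VY.TM.vs_R vsk])
 fix r assume r: "r : LV"
 have "L.bT (a # u) r = ev2 (VY.YT.Do r) (%x y. L.b1 a x * L.bT u y)" by simp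
 also have "... = ?D (VY.cw r)"
 unfolding VY.TM.Do_sw[OF l1 l2 r] by (rule VY.YT.Do_cong[OF r]) (simp only: E1 E2)
 finally show "Ps (VY.cw r) = ?D (VY.cw r)" unfolding Cons.prems(2)[OF r] .
 qed
 hence "Ps y = ?D y" using VY.GM.J_carrier Cons.prems(3) by blast
 also have "... : {0}"
 proof (rule VY.GM.ksp_mem[OF VY.GM.J_carrier vsk _ b VY.GM.candD(4)[OF VY.GM.cand_J Cons.prems(3)]])
 show z0: "submodule {0} scalars (scalars :: ('k, 'k) module)" using submodule_zero[OF vsk] by simp
 fix r1 r2 assume c: "r1 : car VY.TB" "r2 : car VY.TB" and J: "r1 : VY.GM.J \<or> r2 : VY.GM.J"
 \<comment> \<open>If r_2 lies in the coideal, so does the module part of its coaction; otherwise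
   r_1 lies in it and the whole space suffices for r_2.\<close>
 define B where "B = (if r2 : VY.GM.J then VY.GM.J else car VY.TB)"
 have B: "B <= car VY.TB" "coact VY.TB r2 : tensor_span H VY.TB (car H) B"
 using VY.GM.J_carrier VY.GM.candD(3)[OF VY.GM.cand_J] VY.TM.R_coact_closed[OF c(2)]
 by (simp_all add: B_def VY.TM.HR.tensor_span_carrier)
 have b': "bil H VY.TB scalars (%g r20. Ps1 (act VY.TB (Sinv H g) r1) * Ps2 r20)"
 by ((assumption | rule bilI lin_mult_left lin_mult_right l2 lin_comp[OF _ l1] VY.TM.lin_R_act1 VY.Hb.lin_inv_antipode lin_id c)+)
 show "sw (coact VY.TB r2) (%g r20. Ps1 (act VY.TB (Sinv H g) r1) * Ps2 r20) : {0}"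
 proof (rule VY.TM.HR.tensor_sum_mem[OF vsk z0 b' B(2) subset_refl B(1)])
 fix g r20 assume g: "g : car H" and r20: "r20 : B"
 have "r1 : VY.GM.J ==> Ps1 (act VY.TB (Sinv H g) r1) = 0"
 by (rule J1[OF VY.GM.candD(2)[OF VY.GM.cand_J _ VY.Hb.inv_antipode_closed[OF g]]])
 moreover have "r2 : VY.GM.J ==> Ps2 r20 = 0" using r20 Cons.IH[OF l2 E2, of r20] by (simp add: B_def)
 ultimately show "Ps1 (act VY.TB (Sinv H g) r1) * Ps2 r20 : {0}" using J by auto
 qed
 qed
 finally show ?case by simp
qed

sublocale NW: word_model K W "WY.N" "WY.nw" by (rule WY.word_model_N)
sublocale NV: word_model H V "VY.N" "VY.nw" by (rule VY.word_model_N)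

lemma functional_left:
 assumes r: "r : LV" shows "\<exists>Ph\<in>lin WY.N scalars. ALL w:LW. Ph (WY.nw w) = L.bT w r"
proof -
 obtain Ph where l: "Ph : lin WY.TB scalars" and E: "!!w. w : LW ==> Ph (WY.cw w) = L.bT w r"
 using WY.T_functional[of "%w. L.bT w r"] by blast
 obtain ps where ps: "ps : lin WY.N scalars" and e: "!!x. x : car WY.TB ==> ps (nichols_ideal K W +>\<^bsub>WY.TB\<^esub> x) = Ph x"
 using WY.GM.Q_functional[OF l radical_left[OF r l E]] unfolding WY.nichols_algebra_eq WY.nichols_ideal_eq by blast
 show ?thesis
 proof (rule bexI[OF _ ps], rule ballI)
 fix w assume w: "w : LW"
 show "ps (WY.nw w) = L.bT w r" by (rule trans[OF e[OF WY.TM.E_closed[OF w]] E[OF w]])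
 qed
qed

lemma functional_right:
 assumes w: "w : LW" shows "\<exists>Ps\<in>lin VY.N scalars. ALL r:LV. Ps (VY.nw r) = L.bT w r"
proof -
 obtain Ph where l: "Ph : lin VY.TB scalars" and E: "!!r. r : LV ==> Ph (VY.cw r) = L.bT w r"
 using VY.T_functional[of "%r. L.bT w r"] by blast
 obtain ps where ps: "ps : lin VY.N scalars" and e: "!!x. x : car VY.TB ==> ps (nichols_ideal H V +>\<^bsub>VY.TB\<^esub> x) = Ph x"
 using VY.GM.Q_functional[OF l radical_right[OF w l E]] unfolding VY.nichols_algebra_eq VY.nichols_ideal_eq by blast
 show ?thesis
 proof (rule bexI[OF _ ps], rule ballI)
 fix r assume r: "r : LV"
 show "ps (VY.nw r) = L.bT w r" by (rule trans[OF e[OF VY.TM.E_closed[OF r]] E[OF r]])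
 qed
qed

definition B0 where
 "B0 = (SOME F. bil WY.N VY.N scalars F & (ALL w:LW. ALL r:LV. F (WY.nw w) (VY.nw r) = L.bT w r))"

lemma B0: "bil WY.N VY.N scalars B0 & (ALL w:LW. ALL r:LV. B0 (WY.nw w) (VY.nw r) = L.bT w r)"
 unfolding B0_def
 by (rule someI_ex[OF bilinear_extension[OF WY.word_model_N VY.word_model_N functional_left functional_right]])

end

context op_space
begin

lemma coact_apply_sw:
 assumes x: "x : car R" and p: "p : lin H scalars"
 shows "coact_apply R x p : car R"
 and "ph : lin R scalars ==> ph (coact_apply R x p) = sw (de x) (%g y. p g * ph y)"
proof -
 have b: "bil H R R (%g y. p g \<odot>\<^bsub>R\<^esub> y)" by (rule bilI) (rule lin_smult_left lin_smult_right p lin_id vs_R | assumption)+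
 show "coact_apply R x p : car R"
 unfolding coact_apply_def by (rule HR.tensor_sum_closed[OF vs_R b R_coact_closed[OF x]])
 assume ph: "ph : lin R scalars"
 show "ph (coact_apply R x p) = sw (de x) (%g y. p g * ph y)"
 unfolding coact_apply_def HR.lin_tensor_sum[OF vs_R vsk b ph R_coact_closed[OF x]]
 by (rule sw_cong[OF Hb.vs_H vs_R R_coact_closed[OF x]]) (simp add: lin_smult[OF ph])
qed

end

section \<open>The conditions for the form on Nichols algebras, and its uniqueness\<close>

context nichols_pair
begin

abbreviation "NN \<equiv> tensor WY.N VY.N"
abbreviation "pN \<equiv> pt WY.N VY.N"

sublocale NN: vs2 "WY.N" "VY.N" by (rule vs2I[OF NW.vs_R NV.vs_R])

text \<open>The restriction to the carrier supplies the extensional representative demanded by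
  \<open>is_nichols_form\<close>, which makes uniqueness as a HOL function possible.\<close>

definition gamma where "gamma = restrict (%Z. sw Z B0) (car NN)"

lemma gamma_linear: "gamma : lin NN scalars"
 by (rule lin_cong[OF NN.vs_tensor NN.tensor_sum_linear[OF vsk conjunct1[OF B0]]]) (simp add: gamma_def)

abbreviation "gb x y \<equiv> gamma (pN x y)"

lemma gb_bil: "bil WY.N VY.N scalars gb"
 by (rule bil_comp[OF NN.bil_pure gamma_linear])

lemma gb_E: "w : LW ==> r : LV ==> gb (WY.nw w) (VY.nw r) = L.bT w r"
proof -
 assume w: "w : LW" and r: "r : LV"
 note c = NW.E_closed[OF w] NV.E_closed[OF r]
 have "gb (WY.nw w) (VY.nw r) = B0 (WY.nw w) (VY.nw r)"
 using NN.pure_closed[OF c] by (simp add: gamma_def NN.tensor_sum_pure[OF vsk conjunct1[OF B0] c])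
 also have "... = L.bT w r" using conjunct2[OF B0] w r by blast
 finally show ?thesis .
qed

lemmas gl = lin_bil1[OF gb_bil] lin_bil2[OF gb_bil]
lemmas tl = lin_bil1[OF tau_bil] lin_bil2[OF tau_bil]
lemmas NL = gl tl VY.Hb.lin_inv_antipode VY.Hb.inv_antipode_closed NW.Rl NV.Rl

text \<open>On words this is \<open>L.bT_append\<close>, translated by \<open>NV.Do_sw\<close>; by
  linearity it spreads over \<open>r\<close>, \<open>t\<close> and \<open>t'\<close> in
  turn.\<close>

lemma gb_B1:
 assumes t: "t : car WY.N" and t': "t' : car WY.N" and r: "r : car VY.N"
 shows "gb (t \<otimes>\<^bsub>WY.N\<^esub> t') r = sw (br_comult VY.N r) (%r1 r2. sw (coact VY.N r2) (%g r20.
 gb t (act VY.N (Sinv H g) r1) * gb t' r20))"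
proof -
 let ?D = "%t t' r. sw (br_comult VY.N r) (%r1 r2. sw (coact VY.N r2) (%g r20.
 gb t (act VY.N (Sinv H g) r1) * gb t' r20))"
 have 1: "gb (WY.nw u \<otimes>\<^bsub>WY.N\<^esub> WY.nw u') (VY.nw r) = ?D (WY.nw u) (WY.nw u') (VY.nw r)"
 if u: "u : LW" and u': "u' : LW" and r: "r : LV" for u u' r
 proof -
 have uu: "u @ u' : LW" using u u' by simp
 note c = NW.E_closed[OF u] NW.E_closed[OF u']
 have "gb (WY.nw u \<otimes>\<^bsub>WY.N\<^esub> WY.nw u') (VY.nw r) = ev2 (VY.YT.Do r) (%x y. L.bT u x * L.bT u' y)"
 unfolding NW.E_append[OF u u'] gb_E[OF uu r] by (rule L.bT_append[OF r])
 also have "... = ev2 (VY.YT.Do r) (%x y. gb (WY.nw u) (VY.nw x) * gb (WY.nw u') (VY.nw y))"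
 by (rule VY.YT.Do_cong[OF r]) (simp only: gb_E u u')
 also have "... = ?D (WY.nw u) (WY.nw u') (VY.nw r)"
 by (rule NV.Do_sw[OF bil_right[OF gb_bil c(1)] bil_right[OF gb_bil c(2)] r, symmetric])
 finally show ?thesis .
 qed
 have 2: "ALL r:car VY.N. gb (WY.nw u \<otimes>\<^bsub>WY.N\<^esub> WY.nw u') r = ?D (WY.nw u) (WY.nw u') r"
 if u: "u : LW" and u': "u' : LW" for u u'
 by (rule NV.E_ball; (assumption | rule 1 NL u u')+)
 have 3: "ALL t:car WY.N. gb (t \<otimes>\<^bsub>WY.N\<^esub> WY.nw u') r = ?D t (WY.nw u') r" if u': "u' : LW" for u'
 by (rule NW.E_ball; (assumption | rule bspec[OF 2] NL u' r)+)
 have "ALL t':car WY.N. gb (t \<otimes>\<^bsub>WY.N\<^esub> t') r = ?D t t' r"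
 by (rule NW.E_ball; (assumption | rule bspec[OF 3] NL t r)+)
 thus ?thesis using t' by blast
qed

lemma gb_B3:
 assumes t: "t : car WY.N" and r: "r : car VY.N" and r': "r' : car VY.N"
 shows "gb t (r \<otimes>\<^bsub>VY.N\<^esub> r') = sw (br_comult WY.N t) (%t1 t2. gb t2 r * gb t1 r')"
proof -
 let ?D = "%t r r'. sw (br_comult WY.N t) (%t1 t2. gb t2 r * gb t1 r')"
 have 1: "gb (WY.nw u) (VY.nw r \<otimes>\<^bsub>VY.N\<^esub> VY.nw r') = ?D (WY.nw u) (VY.nw r) (VY.nw r')"
 if u: "u : LW" and r: "r : LV" and r': "r' : LV" for u r r'
 proof -
 have rr: "r @ r' : LV" using r r' by simp
 note c = NV.E_closed[OF r] NV.E_closed[OF r']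
 have b: "bil WY.N WY.N scalars (%t1 t2. gb t2 (VY.nw r) * gb t1 (VY.nw r'))"
 by ((assumption | rule NL c)+)
 have "gb (WY.nw u) (VY.nw r \<otimes>\<^bsub>VY.N\<^esub> VY.nw r') = ev2 (WY.Y.dT u) (%u1 u2. L.bT u2 r * L.bT u1 r')"
 unfolding NV.E_append[OF r r'] gb_E[OF u rr] by (rule L.bT_append_right[OF u r r'])
 also have "... = ?D (WY.nw u) (VY.nw r) (VY.nw r')"
 unfolding NW.comult_E[OF u b] by (rule WY.YT.Dr_cong[OF u]) (simp only: gb_E r r')
 finally show ?thesis .
 qed
 have 2: "ALL t:car WY.N. gb t (VY.nw r \<otimes>\<^bsub>VY.N\<^esub> VY.nw r') = ?D t (VY.nw r) (VY.nw r')"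
 if r: "r : LV" and r': "r' : LV" for r r'
 by (rule NW.E_ball; (assumption | rule 1 NL r r')+)
 have 3: "ALL r:car VY.N. gb t (r \<otimes>\<^bsub>VY.N\<^esub> VY.nw r') = ?D t r (VY.nw r')" if r': "r' : LV" for r'
 by (rule NV.E_ball; (assumption | rule bspec[OF 2] NL r' t)+)
 have "ALL r':car VY.N. gb t (r \<otimes>\<^bsub>VY.N\<^esub> r') = ?D t r r'"
 by (rule NV.E_ball; (assumption | rule bspec[OF 3] NL t r)+)
 thus ?thesis using r' by blast
qed

lemma gb_B2: "r : car VY.N ==> gb (one (WY.N)) r = br_counit VY.N r"
proof -
 have "ALL r:car VY.N. gb (one (WY.N)) r = br_counit VY.N r"
 by (rule NV.E_ball[OF bil_right[OF gb_bil NW.RA.one_closed] NV.R_counit])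
 (simp only: NW.E_Nil gb_E[OF lists.Nil] NV.counit_E L.bT.simps)
 thus "r : car VY.N ==> gb (one (WY.N)) r = br_counit VY.N r" by blast
qed

lemma gb_B4: "t : car WY.N ==> gb t (one (VY.N)) = br_counit WY.N t"
proof -
 have "ALL t:car WY.N. gb t (one (VY.N)) = br_counit WY.N t"
 by (rule NW.E_ball[OF bil_left[OF gb_bil NV.RA.one_closed] NW.R_counit])
 (simp only: NV.E_Nil gb_E[OF _ lists.Nil] NW.counit_E L.bT_Nil_right)
 thus "t : car WY.N ==> gb t (one (VY.N)) = br_counit WY.N t" by blast
qed

lemma gamma_B: "conditions_B H WY.N VY.N gamma"
 unfolding conditions_B_def Let_def by (intro conjI ballI gb_B1 gb_B2 gb_B3 gb_B4)

lemma gb_C1: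
 assumes k: "k : car K" and t: "t : car WY.N" and r: "r : car VY.N"
 shows "gb (act WY.N k t) r = sw (coact VY.N r) (%g y. tau k g * gb t y)"
proof -
 have 1: "gb (act WY.N k (WY.nw u)) (VY.nw r) = sw (coact VY.N (VY.nw r)) (%g y. tau k g * gb (WY.nw u) y)"
 if k: "k : basis K" and u: "u : LW" and r: "r : LV" for k u r
 proof -
 note c = NW.E_closed[OF u] NV.E_closed[OF r] WY.Hb.BH_carrier[OF k]
 have b: "bil H VY.N scalars (%g y. tau k g * gb (WY.nw u) y)" by ((assumption | rule NL c)+)
 have "gb (act WY.N k (WY.nw u)) (VY.nw r) = ev (WY.Y.aT u k) (%v. gb (WY.nw v) (VY.nw r))"
 by (rule NW.act_E[OF k u bil_left[OF gb_bil c(2)]])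
 also have "... = ev (WY.Y.aT u k) (%v. L.bT v r)" by (rule WY.YT.A_cong) (simp only: gb_E r)
 also have "... = ev2 (VY.Y.cT r) (%h x. tc k h * L.bT u x)" by (rule L.bT_C1[OF r])
 also have "... = sw (coact VY.N (VY.nw r)) (%g y. tau k g * gb (WY.nw u) y)"
 unfolding NV.coact_E[OF r b] by (rule VY.YT.C_cong) (simp only: gb_E u tc_simps(1) k)
 finally show ?thesis .
 qed
 have 2: "ALL r:car VY.N. gb (act WY.N k (WY.nw u)) r = sw (coact VY.N r) (%g y. tau k g * gb (WY.nw u) y)"
 if k: "k : basis K" and u: "u : LW" for k u
 by (rule NV.E_ball; (assumption | rule 1 NL k u)+)
 have 3: "ALL t:car WY.N. gb (act WY.N k t) r = sw (coact VY.N r) (%g y. tau k g * gb t y)" if k: "k : basis K" for k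
 by (rule NW.E_ball; (assumption | rule bspec[OF 2] NL k r)+)
 have "ALL k:car K. gb (act WY.N k t) r = sw (coact VY.N r) (%g y. tau k g * gb t y)"
 by (rule NW.H_ball; (assumption | rule bspec[OF 3] NL t r)+)
 thus ?thesis using k by blast
qed

lemma gb_C2:
 assumes h: "h : car H" and t: "t : car WY.N" and r: "r : car VY.N"
 shows "sw (coact WY.N t) (%k y. tau k h * gb y r) = gb t (act VY.N (Sinv H h) r)"
proof -
 have 1: "sw (coact WY.N (WY.nw u)) (%k y. tau k h * gb y (VY.nw r)) = gb (WY.nw u) (act VY.N (Sinv H h) (VY.nw r))"
 if h: "h : basis H" and u: "u : LW" and r: "r : LV" for h u r
 proof -
 note c = NW.E_closed[OF u] NV.E_closed[OF r] VY.Hb.BH_carrier[OF h]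
 have b: "bil K WY.N scalars (%k y. tau k h * gb y (VY.nw r))" by ((assumption | rule NL c)+)
 have "sw (coact WY.N (WY.nw u)) (%k y. tau k h * gb y (VY.nw r)) = ev2 (WY.Y.cT u) (%k u0. tc k h * L.bT u0 r)"
 unfolding NW.coact_E[OF u b] by (rule WY.YT.C_cong) (simp only: gb_E r tc_simps(1) h)
 also have "... = ev (cSi H h) (%s. ev (VY.Y.aT r s) (L.bT u))" by (rule L.bT_C2[OF r])
 also have "... = ev (cSi H h) (%s. ev (VY.Y.aT r s) (%v. gb (WY.nw u) (VY.nw v)))"
 by (rule VY.Hb.H_cong, rule VY.YT.A_cong) (simp only: gb_E u)
 also have "... = ev (cSi H h) (%s. gb (WY.nw u) (act VY.N s (VY.nw r)))"
 by (rule VY.Hb.H_cong, rule NV.act_E[symmetric, OF _ r bil_right[OF gb_bil c(1)]])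
 also have "... = gb (WY.nw u) (act VY.N (Sinv H h) (VY.nw r))"
 by (rule VY.Hb.cSi_lin[OF h]) ((assumption | rule NL c)+)
 finally show ?thesis .
 qed
 have 2: "ALL r:car VY.N. sw (coact WY.N (WY.nw u)) (%k y. tau k h * gb y r) = gb (WY.nw u) (act VY.N (Sinv H h) r)"
 if h: "h : basis H" and u: "u : LW" for h u
 by (rule NV.E_ball; (assumption | rule 1 NL h u)+)
 have 3: "ALL t:car WY.N. sw (coact WY.N t) (%k y. tau k h * gb y r) = gb t (act VY.N (Sinv H h) r)"
 if h: "h : basis H" for h
 by (rule NW.E_ball; (assumption | rule bspec[OF 2] NL h r)+)
 have "ALL h:car H. sw (coact WY.N t) (%k y. tau k h * gb y r) = gb t (act VY.N (Sinv H h) r)"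
 by (rule NV.H_ball; (assumption | rule bspec[OF 3] NL t r)+)
 thus ?thesis using h by blast
qed

lemma gamma_C: "conditions_C K H WY.N VY.N \<tau> gamma"
 unfolding conditions_C_def
proof (intro conjI ballI)
 fix k t r assume k: "k : car K" and t: "t : car WY.N" and r: "r : car VY.N"
 show "gb (act WY.N k t) r = gb t (coact_apply VY.N r (tau k))"
 unfolding gb_C1[OF k t r]
 by (rule NV.coact_apply_sw(2)[OF r bil_right[OF tau_bil k] bil_right[OF gb_bil t], symmetric])
next
 fix h t r assume h: "h : car H" and t: "t : car WY.N" and r: "r : car VY.N"
 show "gb (coact_apply WY.N t (%k. tau k h)) r = gb t (act VY.N (Sinv H h) r)"
 unfolding gb_C2[OF h t r, symmetric]
 by (rule NW.coact_apply_sw(2)[OF t bil_left[OF tau_bil h] bil_left[OF gb_bil r]])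
qed

lemma gamma_letters: "w : car W ==> v : car V ==> gb (WY.nw [w]) (VY.nw [v]) = beta w v"
proof -
 assume w: "w : car W" and v: "v : car V"
 have nW: "WY.nw [w] : car WY.N" if "w : car W" for w by (rule lin_closed[OF WY.nw_letter_linear that])
 have nV: "VY.nw [v] : car VY.N" if "v : car V" for v by (rule lin_closed[OF VY.nw_letter_linear that])
 have 1: "gb (WY.nw [w]) (VY.nw [v]) = beta w v" if w: "w : basis W" and v: "v : basis V" for w v
 proof -
 have "gb (WY.nw [w]) (VY.nw [v]) = L.bT [w] [v]" by (rule gb_E) (simp_all add: w v)
 thus ?thesis by (simp add: L.bT_letter[OF v] b0_simps w v del: L.bT.simps)
 qed
 have 2: "gb (WY.nw [w]) (VY.nw [v]) = beta w v" if w: "w : basis W" for w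
 by (rule basis_ext[OF VY.vs_M vsk lin_comp[OF VY.nw_letter_linear bil_right[OF gb_bil nW]]
 bil_right[OF beta_bil] 1[OF w] v]) (rule WY.BM_carrier[OF w])+
 show ?thesis
 by (rule basis_ext[OF WY.vs_M vsk lin_comp[OF WY.nw_letter_linear bil_left[OF gb_bil nV[OF v]]]
 bil_left[OF beta_bil v] 2 w])
qed

lemma gamma_nichols: "is_nichols_form K H W V \<beta> gamma"
 unfolding is_nichols_form_def WY.incl_N VY.incl_N linear_forms_def
 by (intro conjI ballI gamma_linear gamma_B gamma_letters) (simp_all add: gamma_def)

text \<open>The conditions force the values on words: (B.4) and (B.3) when the left word is a single
  letter, then (B.1) for longer left words. As words span, the form is determined on pure tensors
  and hence on the carrier; extensionality settles the rest.\<close>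

lemma gamma_unique:
 assumes g: "is_nichols_form K H W V \<beta> g" shows "g = gamma"
proof -
 let ?b = "%x y. g (pN x y)"
 note d = g[unfolded is_nichols_form_def WY.incl_N VY.incl_N linear_forms_def conditions_B_def Let_def]
 have gl: "g : lin NN scalars" and ge: "g : extensional (car NN)" using d by blast+
 have b: "bil WY.N VY.N scalars ?b" by (rule bil_comp[OF NN.bil_pure gl])
 have B1: "?b (t \<otimes>\<^bsub>WY.N\<^esub> t') r = sw (br_comult VY.N r) (%r1 r2. sw (coact VY.N r2) (%g r20.
 ?b t (act VY.N (Sinv H g) r1) * ?b t' r20))"
 if "t : car WY.N" "t' : car WY.N" "r : car VY.N" for t t' r using d that by blast
 have B2: "?b (one (WY.N)) r = br_counit VY.N r" if "r : car VY.N" for r using d that by blast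
 have B3: "?b t (r \<otimes>\<^bsub>VY.N\<^esub> r') = sw (br_comult WY.N t) (%t1 t2. ?b t2 r * ?b t1 r')"
 if "t : car WY.N" "r : car VY.N" "r' : car VY.N" for t r r' using d that by blast
 have B4: "?b t (one (VY.N)) = br_counit WY.N t" if "t : car WY.N" for t using d that by blast
 have le: "?b (WY.nw [w]) (VY.nw [v]) = beta w v" if "w : car W" "v : car V" for w v using d that by blast
 have N: "?b (WY.nw []) (VY.nw r) = VY.Y.eT r" if r: "r : LV" for r
 using B2[OF NV.E_closed[OF r]] unfolding NW.E_Nil NV.counit_E[OF r] .
 \<comment> \<open>The letter is primitive, so when \<open>r\<close> has at least two letters each
   term of (B.3) contains a pairing of the empty word with a nonempty one, which is zero by
   (B.2).\<close>
 have one: "?b (WY.nw [a]) (VY.nw r) = L.b1 a r" if a: "a : basis W" and r: "r : LV" for a r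
 proof -
 have al: "[a] : LW" using a by simp
 note ac = NW.E_closed[OF al]
 show ?thesis
 proof (cases r)
 case Nil
 thus ?thesis using B4[OF ac] unfolding NV.E_Nil NW.counit_E[OF al] by (simp add: WY.Y.eT_def)
 next
 case (Cons v r')
 hence v: "v : basis V" and r': "r' : LV" using r by auto
 show ?thesis
 proof (cases "r' = []")
 case True
 thus ?thesis unfolding Cons
 by (simp add: le WY.BM_carrier VY.BM_carrier a v b0_simps)
 next
 case False
 have vl: "[v] : LV" using v by simp
 note c = NV.E_closed[OF vl] NV.E_closed[OF r']
 have bb: "bil WY.N WY.N scalars (%t1 t2. ?b t2 (VY.nw [v]) * ?b t1 (VY.nw r'))"
 by (rule bilI) (rule lin_mult_left lin_mult_right bil_left[OF b] c)+
 have "?b (WY.nw [a]) (VY.nw r) = ?b (WY.nw [a]) (VY.nw [v] \<otimes>\<^bsub>VY.N\<^esub> VY.nw r')"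
 unfolding NV.E_append[OF vl r'] by (simp add: Cons)
 also have "... = ev2 (WY.Y.dT [a]) (%u1 u2. ?b (WY.nw u2) (VY.nw [v]) * ?b (WY.nw u1) (VY.nw r'))"
 unfolding B3[OF ac c] by (rule NW.comult_E[OF al bb])
 also have "... = 0"
 using False by (simp add: N[OF vl] N[OF r'] VY.Y.eT_def)
 also have "0 = L.b1 a r" using False unfolding Cons by (cases r') simp_all
 finally show ?thesis .
 qed
 qed
 qed
 have E: "?b (WY.nw w) (VY.nw r) = L.bT w r" if "w : LW" "r : LV" for w r
 using that
 proof (induction w arbitrary: r)
 case Nil
 thus ?case by (simp only: N L.bT.simps)
 next
 case (Cons a u)
 have al: "[a] : LW" using Cons.hyps by simp
 note c = NW.E_closed[OF al] NW.E_closed[OF Cons.hyps(2)] NV.E_closed[OF Cons.prems]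
 have "?b (WY.nw (a # u)) (VY.nw r) = ?b (WY.nw [a] \<otimes>\<^bsub>WY.N\<^esub> WY.nw u) (VY.nw r)"
 unfolding NW.E_append[OF al Cons.hyps(2)] by simp
 also have "... = ev2 (VY.YT.Do r) (%x y. ?b (WY.nw [a]) (VY.nw x) * ?b (WY.nw u) (VY.nw y))"
 unfolding B1[OF c] by (rule NV.Do_sw[OF bil_right[OF b c(1)] bil_right[OF b c(2)] Cons.prems])
 also have "... = ev2 (VY.YT.Do r) (%x y. L.b1 a x * L.bT u y)"
 by (rule VY.YT.Do_cong[OF Cons.prems]) (simp only: one Cons.hyps(1) Cons.IH)
 finally show ?case by simp
 qed
 have 1: "ALL y:car VY.N. ?b (WY.nw w) y = gb (WY.nw w) y" if w: "w : LW" for w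
 by (rule NV.E_ball[OF bil_right[OF b NW.E_closed[OF w]] bil_right[OF gb_bil NW.E_closed[OF w]]])
 (simp only: E gb_E w)
 have 2: "ALL x:car WY.N. ?b x y = gb x y" if y: "y : car VY.N" for y
 by (rule NW.E_ball[OF bil_left[OF b y] bil_left[OF gb_bil y] bspec[OF 1 y]])
 show ?thesis
 proof (rule extensionalityI[OF ge])
 show "gamma : extensional (car NN)" by (simp add: gamma_def)
 fix Z assume Z: "Z : car NN"
 show "g Z = gamma Z" by (rule NN.tensor_ext[OF vsk gl gamma_linear _ Z]) (use 2 in blast)
 qed
qed

lemma nichols_form_eq: "nichols_form K H W V \<beta> = gamma"
 unfolding nichols_form_def using gamma_nichols gamma_unique by (rule the_equality)

lemma twist: "twist_datum K H \<tau> WY.N VY.N gamma"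
 unfolding twist_datum_def linear_forms_def
 by (intro conjI WY.H.hopf_algebra_axioms VY.H.hopf_algebra_axioms WY.bij VY.bij NW.yd_bialgebra_R NV.yd_bialgebra_R
 \<tau>_form[unfolded linear_forms_def] \<tau>_A gamma_linear gamma_B gamma_C)

section \<open>The twisted form on the bi-products\<close>

text \<open>The twisted form is computed for words of the two tensor algebras with the form
  \<open>L.bT\<close>; \<open>tb_E\<close> then identifies these values with those of the twisted
  form on the Nichols algebras.\<close>

sublocale TC: twist_coord "basis K" "cmu K" "cun K" "cD K" "ce K" "cSi K" "basis H" "cmu H" "cun H" "cD H" "ce H" "cSi H"
 tc "lists (basis W)" "%h w. WY.Y.aT w h" WY.Y.cT "(@)" "[]" WY.Y.dT WY.Y.eT
 "lists (basis V)" "%h w. VY.Y.aT w h" VY.Y.cT "(@)" "[]" VY.Y.dT VY.Y.eT L.bT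
proof (intro twist_coord.intro twist_coord_axioms.intro pairing WY.Y.ybi_coord_T VY.Y.ybi_coord_T)
qed (rule L.bT_append L.bT_append_right L.bT_Nil_right L.bT_C1 L.bT_C2 fun_cong[OF L.bT.simps(1)]; assumption)+

abbreviation "TF \<equiv> twist_form K H \<tau> WY.N VY.N gamma"
abbreviation "PW \<equiv> tensor WY.N K"
abbreviation "PV \<equiv> tensor VY.N H"
abbreviation "BW \<equiv> biproduct WY.N K"
abbreviation "BV \<equiv> biproduct VY.N H"

sublocale PP2: vs2 PW PV by (rule vs2I[OF NW.RH.vs_tensor NV.RH.vs_tensor])

lemmas NL2 = NL NW.Pl NV.Pl

lemma tf_bils:
 "t : car WY.N ==> k : car K ==> bil VY.N H scalars (%r h. sw (comult H h) (%h1 h2.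
 gb t (act VY.N (Sinv H h1) r) * tau k h2))"
 "Y : car PV ==> bil WY.N K scalars (%t k. sw Y (%r h. sw (comult H h) (%h1 h2.
 gb t (act VY.N (Sinv H h1) r) * tau k h2)))"
 "bil PW PV scalars (%X Y. sw X (%t k. sw Y (%r h. sw (comult H h) (%h1 h2.
 gb t (act VY.N (Sinv H h1) r) * tau k h2))))"
 by ((assumption | rule NL2)+)

lemma TF_linear: "TF : lin (tensor PW PV) scalars"
 unfolding twist_form_def[abs_def] by (rule PP2.tensor_sum_linear[OF vsk tf_bils(3)])

text \<open>A bi-product and the tensor product it is built on share their vector space, so forms on
  the two are the same objects.\<close>

lemma BW_BV: "tensor BW BV = tensor PW PV" "pt BW BV = pt PW PV"
 unfolding same_space(2)[OF NW.same_BP] same_space(1)[OF NV.same_BP] same_space(5)[OF NW.same_BP] same_space(4)[OF NV.same_BP]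
 by (rule refl)+

abbreviation "tb X Y \<equiv> TF (pt PW PV X Y)"

lemma tb_bil: "bil PW PV scalars tb"
 by (rule bil_comp[OF PP2.bil_pure TF_linear])

text \<open>On pure tensors the outer Sweedler sums of \<open>twist_form\<close> collapse. The
  coproduct of \<open>h\<close> is expanded over the basis, and the inverse antipode followed by the
  action becomes \<open>TC.G\<close>.\<close>

lemma tb_E:
 assumes u: "u : LW" and k: "k : basis K" and r: "r : LV" and h: "h : basis H"
 shows "tb (NW.e2 u k) (NV.e2 r h) = TC.F u k r h"
proof -
 note c = NW.E_closed[OF u] WY.Hb.BH_carrier[OF k] NV.E_closed[OF r] VY.Hb.BH_carrier[OF h]
 note e = NW.e2_closed[OF u k] NV.e2_closed[OF r h]
 have "tb (NW.e2 u k) (NV.e2 r h) = sw (comult H h) (%h1 h2. gb (WY.nw u) (act VY.N (Sinv H h1) (VY.nw r)) * tau k h2)"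
 unfolding twist_form_def PP2.tensor_sum_pure[OF vsk tf_bils(3) e]
 NW.RH.tensor_sum_pure[OF vsk tf_bils(2)[OF e(2)] c(1,2)]
 by (rule NV.RH.tensor_sum_pure[OF vsk tf_bils(1)[OF c(1,2)] c(3,4)])
 also have "... = ev2 (cD H h) (%h1 h2. gb (WY.nw u) (act VY.N (Sinv H h1) (VY.nw r)) * tau k h2)"
 by (rule VY.Hb.cD_sw[OF h, symmetric]) ((assumption | rule NL c)+)
 also have "... = TC.F u k r h"
 unfolding TC.F_def
 proof (rule VY.Hb.H_cong(1))
 fix h1 h2 assume hh: "h1 : basis H" "h2 : basis H"
 have "gb (WY.nw u) (act VY.N (Sinv H h1) (VY.nw r)) = ev (cSi H h1) (%s. gb (WY.nw u) (act VY.N s (VY.nw r)))"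
 by (rule VY.Hb.cSi_lin[OF hh(1), symmetric]) ((assumption | rule NL c)+)
 also have "... = ev (cSi H h1) (%s. ev (VY.Y.aT r s) (%v. gb (WY.nw u) (VY.nw v)))"
 by (rule VY.Hb.H_cong, rule NV.act_E[OF _ r bil_right[OF gb_bil c(1)]])
 also have "... = TC.G u r h1"
 unfolding TC.G_def by (rule VY.Hb.H_cong, rule VY.YT.A_cong) (simp only: gb_E u)
 finally show "gb (WY.nw u) (act VY.N (Sinv H h1) (VY.nw r)) * tau k h2 = TC.G u r h1 * tc k h2"
 by (simp add: tc_simps k hh)
 qed
 finally show ?thesis .
qed

text \<open>On words and basis elements this is \<open>TC.F_A1\<close>. Linearity then removes the
  restriction from \<open>X\<close>, \<open>Y\<close> and \<open>Y'\<close> in turn, which is why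
  the linearity of the right side in each argument is recorded at the start.\<close>

lemma tb_A1:
 assumes X: "X : car PW" and Y: "Y : car PV" and Y': "Y' : car PV"
 shows "tb X (Y \<otimes>\<^bsub>BV\<^esub> Y') = sw (comult BW X) (%X1 X2. tb X2 Y * tb X1 Y')"
proof -
 have G: "bil PW PW scalars (%X1 X2. tb X2 Y * tb X1 Y')" if "Y : car PV" "Y' : car PV" for Y Y'
 by (rule bilI) (rule lin_mult_left lin_mult_right bil_left[OF tb_bil] that)+
 have lX: "(%X. sw (comult BW X) (%X1 X2. tb X2 Y * tb X1 Y')) : lin PW scalars" if "Y : car PV" "Y' : car PV" for Y Y'
 by (rule lin_tsum_arg'[OF NW.BP_comult G[OF that] NW.RH.vs_tensor NW.RH.vs_tensor vsk])
 have cX: "comult BW X : car (tensor PW PW)" if "X : car PW" for X by (rule lin_closed[OF NW.BP_comult that])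
 note vP = NW.RH.vs_tensor NV.RH.vs_tensor vsk
 have lY: "(%Y. sw (comult BW X) (%X1 X2. tb X2 Y * tb X1 Y')) : lin PV scalars" if X: "X : car PW" and Y': "Y' : car PV" for X Y'
 by (rule lin_tsum_fun'[OF cX[OF X] G[OF _ Y']])
 (assumption | rule lin_mult_right bil_right[OF tb_bil] vP)+
 have lY': "(%Y'. sw (comult BW X) (%X1 X2. tb X2 Y * tb X1 Y')) : lin PV scalars" if X: "X : car PW" and Y: "Y : car PV" for X Y
 by (rule lin_tsum_fun'[OF cX[OF X] G[OF Y]])
 (assumption | rule lin_mult_left bil_right[OF tb_bil] vP)+
 have 1: "tb (NW.e2 u k) (NV.e2 r h \<otimes>\<^bsub>BV\<^esub> NV.e2 r' h') =
 sw (comult BW (NW.e2 u k)) (%X1 X2. tb X2 (NV.e2 r h) * tb X1 (NV.e2 r' h'))"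
 if u: "u : LW" and k: "k : basis K" and r: "r : LV" and h: "h : basis H" and r': "r' : LV" and h': "h' : basis H"
 for u k r h r' h'
 proof -
 have "tb (NW.e2 u k) (NV.e2 r h \<otimes>\<^bsub>BV\<^esub> NV.e2 r' h') =
 ev2 (cD H h) (%h1 h2. ev (VY.Y.aT r' h1) (%x. ev (cmu H h2 h') (%m. tb (NW.e2 u k) (NV.e2 (r @ x) m))))"
 by (rule NV.BP_mult_E[OF bil_right[OF tb_bil NW.e2_closed[OF u k]] r h r' h'])
 also have "... = ev2 (cD H h) (%h1 h2. ev (VY.Y.aT r' h1) (%x. ev (cmu H h2 h') (%m. TC.F u k (r @ x) m)))"
 by (rule VY.Hb.H_cong(1), rule VY.YT.A_cong, rule VY.Hb.H_cong(2)) (simp add: tb_E u k r)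
 also have "... = ev2 (WY.Y.dT u) (%u1 u2. ev2 (WY.Y.cT u2) (%g u20. ev2 (cD K k) (%k1 k2. ev (cmu K g k1) (%p.
 TC.F u20 k2 r h * TC.F u1 p r' h'))))"
 by (rule TC.F_A1[OF u r r'])
 also have "... = sw (comult BW (NW.e2 u k)) (%X1 X2. tb X2 (NV.e2 r h) * tb X1 (NV.e2 r' h'))"
 unfolding NW.BP_comult_E[OF G[OF NV.e2_closed[OF r h] NV.e2_closed[OF r' h']] u k]
 by (rule WY.YT.Dr_cong[OF u], rule WY.YT.C_cong, rule WY.Hb.H_cong(1), rule WY.Hb.H_cong(2))
 (simp only: tb_E r h r' h')
 finally show ?thesis .
 qed
 have 2: "ALL X:car PW. tb X (NV.e2 r h \<otimes>\<^bsub>BV\<^esub> NV.e2 r' h') = sw (comult BW X) (%X1 X2. tb X2 (NV.e2 r h) * tb X1 (NV.e2 r' h'))"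
 if r: "r : LV" and h: "h : basis H" and r': "r' : LV" and h': "h' : basis H" for r h r' h'
 by (rule NW.P_ball[OF bil_left[OF tb_bil NV.BP_mult_closed[OF NV.e2_closed[OF r h] NV.e2_closed[OF r' h']]]
 lX[OF NV.e2_closed[OF r h] NV.e2_closed[OF r' h']] 1[OF _ _ r h r' h']])
 have 3: "ALL Y:car PV. tb X (Y \<otimes>\<^bsub>BV\<^esub> NV.e2 r' h') = sw (comult BW X) (%X1 X2. tb X2 Y * tb X1 (NV.e2 r' h'))"
 if r': "r' : LV" and h': "h' : basis H" for r' h'
 by (rule NV.P_ball[OF lin_comp[OF NV.BP_mult1[OF NV.e2_closed[OF r' h']] bil_right[OF tb_bil X]]
 lY[OF X NV.e2_closed[OF r' h']] bspec[OF 2[OF _ _ r' h'] X]])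
 have "ALL Y':car PV. tb X (Y \<otimes>\<^bsub>BV\<^esub> Y') = sw (comult BW X) (%X1 X2. tb X2 Y * tb X1 Y')"
 by (rule NV.P_ball[OF lin_comp[OF NV.BP_mult2[OF Y] bil_right[OF tb_bil X]] lY'[OF X Y] bspec[OF 3 Y]])
 thus ?thesis using Y' by blast
qed

lemma tb_A3:
 assumes X: "X : car PW" and X': "X' : car PW" and Y: "Y : car PV"
 shows "tb (X \<otimes>\<^bsub>BW\<^esub> X') Y = sw (comult BV Y) (%Y1 Y2. tb X Y1 * tb X' Y2)"
proof -
 have G: "bil PV PV scalars (%Y1 Y2. tb X Y1 * tb X' Y2)" if "X : car PW" "X' : car PW" for X X'
 by (rule bilI) (rule lin_mult_left lin_mult_right bil_right[OF tb_bil] that)+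
 have lY: "(%Y. sw (comult BV Y) (%Y1 Y2. tb X Y1 * tb X' Y2)) : lin PV scalars" if "X : car PW" "X' : car PW" for X X'
 by (rule lin_tsum_arg'[OF NV.BP_comult G[OF that] NV.RH.vs_tensor NV.RH.vs_tensor vsk])
 have cY: "comult BV Y : car (tensor PV PV)" if "Y : car PV" for Y by (rule lin_closed[OF NV.BP_comult that])
 note vP = NW.RH.vs_tensor NV.RH.vs_tensor vsk
 have lX: "(%X. sw (comult BV Y) (%Y1 Y2. tb X Y1 * tb X' Y2)) : lin PW scalars" if Y: "Y : car PV" and X': "X' : car PW" for Y X'
 by (rule lin_tsum_fun'[OF cY[OF Y] G[OF _ X']])
 (assumption | rule lin_mult_right bil_left[OF tb_bil] vP)+
 have lX': "(%X'. sw (comult BV Y) (%Y1 Y2. tb X Y1 * tb X' Y2)) : lin PW scalars" if Y: "Y : car PV" and X: "X : car PW" for Y X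
 by (rule lin_tsum_fun'[OF cY[OF Y] G[OF X]])
 (assumption | rule lin_mult_left bil_left[OF tb_bil] vP)+
 have 1: "tb (NW.e2 u k \<otimes>\<^bsub>BW\<^esub> NW.e2 u' k') (NV.e2 r h) =
 sw (comult BV (NV.e2 r h)) (%Y1 Y2. tb (NW.e2 u k) Y1 * tb (NW.e2 u' k') Y2)"
 if u: "u : LW" and k: "k : basis K" and u': "u' : LW" and k': "k' : basis K" and r: "r : LV" and h: "h : basis H"
 for u k u' k' r h
 proof -
 have "tb (NW.e2 u k \<otimes>\<^bsub>BW\<^esub> NW.e2 u' k') (NV.e2 r h) =
 ev2 (cD K k) (%k1 k2. ev (WY.Y.aT u' k1) (%x. ev (cmu K k2 k') (%m. tb (NW.e2 (u @ x) m) (NV.e2 r h))))"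
 by (rule NW.BP_mult_E[OF bil_left[OF tb_bil NV.e2_closed[OF r h]] u k u' k'])
 also have "... = ev2 (cD K k) (%k1 k2. ev (WY.Y.aT u' k1) (%x. ev (cmu K k2 k') (%m. TC.F (u @ x) m r h)))"
 by (rule WY.Hb.H_cong(1), rule WY.YT.A_cong, rule WY.Hb.H_cong(2)) (simp add: tb_E u r h)
 also have "... = ev2 (VY.Y.dT r) (%r1 r2. ev2 (VY.Y.cT r2) (%g r20. ev2 (cD H h) (%h1 h2. ev (cmu H g h1) (%p.
 TC.F u k r1 p * TC.F u' k' r20 h2))))"
 by (rule TC.F_A3[OF r h])
 also have "... = sw (comult BV (NV.e2 r h)) (%Y1 Y2. tb (NW.e2 u k) Y1 * tb (NW.e2 u' k') Y2)"
 unfolding NV.BP_comult_E[OF G[OF NW.e2_closed[OF u k] NW.e2_closed[OF u' k']] r h]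
 by (rule VY.YT.Dr_cong[OF r], rule VY.YT.C_cong, rule VY.Hb.H_cong(1), rule VY.Hb.H_cong(2))
 (simp only: tb_E u k u' k')
 finally show ?thesis .
 qed
 have 2: "ALL Y:car PV. tb (NW.e2 u k \<otimes>\<^bsub>BW\<^esub> NW.e2 u' k') Y = sw (comult BV Y) (%Y1 Y2. tb (NW.e2 u k) Y1 * tb (NW.e2 u' k') Y2)"
 if u: "u : LW" and k: "k : basis K" and u': "u' : LW" and k': "k' : basis K" for u k u' k'
 by (rule NV.P_ball[OF bil_right[OF tb_bil NW.BP_mult_closed[OF NW.e2_closed[OF u k] NW.e2_closed[OF u' k']]]
 lY[OF NW.e2_closed[OF u k] NW.e2_closed[OF u' k']] 1[OF u k u' k']])
 have 3: "ALL X:car PW. tb (X \<otimes>\<^bsub>BW\<^esub> NW.e2 u' k') Y = sw (comult BV Y) (%Y1 Y2. tb X Y1 * tb (NW.e2 u' k') Y2)"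
 if u': "u' : LW" and k': "k' : basis K" for u' k'
 by (rule NW.P_ball[OF lin_comp[OF NW.BP_mult1[OF NW.e2_closed[OF u' k']] bil_left[OF tb_bil Y]]
 lX[OF Y NW.e2_closed[OF u' k']] bspec[OF 2[OF _ _ u' k'] Y]])
 have "ALL X':car PW. tb (X \<otimes>\<^bsub>BW\<^esub> X') Y = sw (comult BV Y) (%Y1 Y2. tb X Y1 * tb X' Y2)"
 by (rule NW.P_ball[OF lin_comp[OF NW.BP_mult2[OF X] bil_left[OF tb_bil Y]] lX'[OF Y X] bspec[OF 3 X]])
 thus ?thesis using X' by blast
qed

lemma tb_A2: "Y : car PV ==> tb (one BW) Y = counit BV Y"
proof -
 have "ALL Y:car PV. tb (one BW) Y = counit BV Y"
 proof (rule NV.P_ball[OF bil_right[OF tb_bil NW.BP_one(2)] NV.BP_counit])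
 fix r h assume r: "r : LV" and h: "h : basis H"
 \<comment> \<open>The unit of K need not be a basis element, so it is expanded in coordinates
   before \<open>tb_E\<close> can be applied.\<close>
 have "tb (one BW) (NV.e2 r h) = ev (cun K) (%k. tb (NW.e2 [] k) (NV.e2 r h))" (is "?x = _")
 unfolding NW.BP_one
 by (rule WY.Hb.cun_lin[symmetric], rule lin_comp[OF _ bil_left[OF tb_bil NV.e2_closed[OF r h]]])
 (rule lin_pure2[OF NW.vs_R WY.Hb.vs_H NW.E_closed[OF lists.Nil] lin_id])
 also have "... = ev (cun K) (%k. TC.F [] k r h)"
 by (rule WY.Hb.H_cong(5)) (simp add: tb_E r h)
 also have "... = counit BV (NV.e2 r h)" (is "_ = ?y")
 unfolding NV.BP_counit_E[OF r h] by (rule TC.F_A2[OF r h])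
 finally show "?x = ?y" .
 qed
 thus "Y : car PV ==> tb (one BW) Y = counit BV Y" by blast
qed

lemma tb_A4: "X : car PW ==> tb X (one BV) = counit BW X"
proof -
 have "ALL X:car PW. tb X (one BV) = counit BW X"
 proof (rule NW.P_ball[OF bil_left[OF tb_bil NV.BP_one(2)] NW.BP_counit])
 fix u k assume u: "u : LW" and k: "k : basis K"
 have "tb (NW.e2 u k) (one BV) = ev (cun H) (%h. tb (NW.e2 u k) (NV.e2 [] h))" (is "?x = _")
 unfolding NV.BP_one
 by (rule VY.Hb.cun_lin[symmetric], rule lin_comp[OF _ bil_right[OF tb_bil NW.e2_closed[OF u k]]])
 (rule lin_pure2[OF NV.vs_R VY.Hb.vs_H NV.E_closed[OF lists.Nil] lin_id])
 also have "... = ev (cun H) (%h. TC.F u k [] h)"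
 by (rule VY.Hb.H_cong(5)) (simp add: tb_E u k)
 also have "... = counit BW (NW.e2 u k)" (is "_ = ?y")
 unfolding NW.BP_counit_E[OF u k] by (rule TC.F_A4)
 finally show "?x = ?y" .
 qed
 thus "X : car PW ==> tb X (one BV) = counit BW X" by blast
qed

lemma TF_A: "conditions_A BW BV TF"
 unfolding conditions_A_def Let_def BW_BV NW.BP_ops(5) NV.BP_ops(5)
 by (intro conjI ballI tb_A1 tb_A2 tb_A3 tb_A4)

end

theorem theorem8p3:
  fixes K :: "('k::field, 'g) hopf" and H :: "('k, 'h) hopf"
    and W :: "('k, 'w, 'g) yd" and V :: "('k, 'v, 'h) yd"
    and \<tau> :: "('g \<times> 'h \<Rightarrow>\<^sub>0 'k) set \<Rightarrow> 'k"
    and \<beta> :: "('w \<times> 'v \<Rightarrow>\<^sub>0 'k) set \<Rightarrow> 'k"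
  assumes "hopf_algebra K" and "bijective_antipode K"
    and "hopf_algebra H" and "bijective_antipode H"
    and "\<tau> \<in> linear_forms K H" and "conditions_A K H \<tau>"
    and "yd_module K W" and "yd_module H V"
    and "\<beta> \<in> linear_forms W V" and "conditions_C K H W V \<tau> \<beta>"
  shows "(\<exists>!\<gamma>. is_nichols_form K H W V \<beta> \<gamma>) \<and>
    twist_datum K H \<tau> (nichols_algebra K W) (nichols_algebra H V) (nichols_form K H W V \<beta>) \<and>
    twist_form K H \<tau> (nichols_algebra K W) (nichols_algebra H V) (nichols_form K H W V \<beta>)
      \<in> linear_forms (biproduct (nichols_algebra K W) K) (biproduct (nichols_algebra H V) H) \<and>
    conditions_A (biproduct (nichols_algebra K W) K) (biproduct (nichols_algebra H V) H)
      (twist_form K H \<tau> (nichols_algebra K W) (nichols_algebra H V) (nichols_form K H W V \<beta>))"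
proof -
  interpret nichols_pair K W H V \<tau> \<beta>
    by (intro nichols_pair.intro nichols_pair_axioms.intro yd_words.intro yd_bij.intro yd_bij_axioms.intro assms)
  \<comment> \<open>Existence and uniqueness give the definite description
    \<open>nichols_form\<close> its value, which is \<open>gamma\<close> by
    \<open>nichols_form_eq\<close>.\<close>
  have "\<exists>!\<gamma>. is_nichols_form K H W V \<beta> \<gamma>" using gamma_nichols gamma_unique by blast
  then show ?thesis
    unfolding nichols_form_eq linear_forms_def BW_BV by (intro conjI twist TF_linear TF_A)
qed

end
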